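(* Let $\overline H\in(\widehat\Lambda^\hbar_N)^{[\le0]}$ satisfy: (a) there exist $N$ independent solutions $G_\alpha(z)=\sum_{p\ge0}G_{\alpha,p-1}z^p\in(\widehat{\mathcal A}^\hbar_N)^{[\le0]}[[z]]$, $\alpha=1,\dots,N$, of $\mathcal D^\hbar_{\overline H}G_\alpha(z)=0$ with $G_\alpha(z=0)=\eta_{\alpha\mu}u^\mu$; (b) $\frac{\delta\overline H}{\delta u^1}=\frac12\eta_{\mu\nu}u^\mu u^\nu+\partial_xR+c(\varepsilon,\hbar)$ for some $R\in(\widehat{\mathcal A}^\hbar_N)^{[\le-1]}$ and $c(\varepsilon,\hbar)\in\mathbb C[[\varepsilon,\hbar]]$; (c) $\overline G_{1,1}=\overline H$, where $\overline G_{\alpha,p}:=\int G_{\alpha,p}dx$. Then, after replacing the solutions by $G_\alpha(z)\mapsto A^\mu_\alpha(z)G_\mu(z)+B_\alpha(z)$ for suitable $A^\mu_\alpha(z)=\delta^\mu_\alpha+\sum_{i>0}A^\mu_{\alpha,i}z^i\in\mathbb C[[z]]$ and $B_\alpha(z)=\sum_{i>0}B_{\alpha,i}(\varepsilon,\hbar)z^i\in\mathbb C[[\varepsilon,\hbar,z]]$, we have: (i) $\overline G_{1,0}=\int\frac12\eta_{\mu\nu}u^\mu u^\nu dx$; (ii) $[\overline G_{\alpha,p},\overline G_{\beta,q}]=0$ for all $\alpha,\beta$ and $p,q\ge-1$; (iii) $\frac1\hbar[G_{\alpha,p},\overline G_{\beta,0}]=\partial_x\frac{\partial G_{\alpha,p+1}}{\partial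 u^\beta}$ for all $\beta$ and $p\ge-1$; (iv) $\frac{\partial G_{\alpha,p}}{\partial u^1}=G_{\alpha,p-1}$ for all $\alpha$ and $p\ge-1$ (with $G_{\alpha,-2}:=0$); hence in particular $\overline H$ is part of a quantum integrable tau-symmetric hierarchy.
   Context: Quantum differential polynomials $\widehat{\mathcal A}^\hbar_N$: formal power series in $\varepsilon,\hbar$ whose coefficients are polynomials in $u^\alpha_k$ ($1\le\alpha\le N$, $k>0$) with coefficients in $\mathbb C[[u^1,\dots,u^N]]$ ($u^\alpha=u^\alpha_0$); grading $\deg u^\alpha_k=k$, $\deg\varepsilon=-1$, $\deg\hbar=-2$; superscripts $[\le d]$ mean sums of homogeneous terms of degree $\le d$. $\partial_x=\sum_ku^\alpha_{k+1}\partial/\partial u^\alpha_k$. Quantum local functionals $\widehat\Lambda^\hbar_N$: classes $\int f\,dx$ of $\widehat{\mathcal A}^\hbar_N$ modulo power series in $\varepsilon,\hbar$ and $\mathrm{Im}\,\partial_x$; $\frac{\delta\overline f}{\delta u^\mu}=\sum_i(-\partial_x)^i\frac{\partial f}{\partial u^\mu_i}$. $\eta=(\eta_{\alpha\beta})$ is a fixed nondegenerate symmetric matrix with inverse $(\eta^{\alpha\beta})$; repeated Greek indices are summed. Quantum commutator: via $u^\alpha_j=\sum_{k\in\mathbb Z}(ik)^jp^\alpha_ke^{ikx}$ a quantum differential polynomial becomes a Fourier series in $x$ with coefficients in $\mathbb C[p_{k>0}][[p_{k\le0},\hbar]][[\varepsilon]]$, a local functional corresponds to the constant Fourier coefficient;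 $f\star g=f\exp\big(\sum_{k>0}i\hbar k\eta^{\alpha\beta}\overleftarrow{\partial_{p^\alpha_k}}\overrightarrow{\partial_{p^\beta_{-k}}}\big)g$, $[f,g]=f\star g-g\star f$; the commutator of a differential polynomial with a local functional is again a differential polynomial. $D:=\varepsilon\frac{\partial}{\partial\varepsilon}+2\hbar\frac{\partial}{\partial\hbar}+\sum_{s\ge0}u^\alpha_s\frac{\partial}{\partial u^\alpha_s}$, and $\mathcal D^\hbar_{\overline H}\colon\widehat{\mathcal A}^\hbar_N[[z]]\to\widehat{\mathcal A}^\hbar_N[[z]]$ is $\mathcal D^\hbar_{\overline H}f(z)=\partial_x(D-1)f(z)-\frac z\hbar[f(z),\overline H]$.
   Formalization: Property (iv) is stated only for p ≥ 0, since for p = −1 with G_{α,−2} := 0 it would say η_{α1} = 0 for all α, contradicting nondegeneracy of η; the closing "hence" that H̄ is part of a tau-symmetric hierarchy is not stated separately. *)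

theory Defs
  imports Complex_Main
begin

text \<open>
Quantum differential polynomials are encoded by their coefficient functions.
A jet monomial is a map (alpha, k) to the exponent of u^alpha_k (finite support).
A quantum differential polynomial f is a map  e h m  to the coefficient of
eps^e hbar^h u^m.  Greek indices run over 1..N.
\<close>

type_synonym jmon = "nat \<times> nat \<Rightarrow> nat"
type_synonym qdp = "nat \<Rightarrow> nat \<Rightarrow> jmon \<Rightarrow> complex"

text \<open>Monomials in the Fourier variables p^alpha_k (alpha, k with k an integer),
and Fourier-side series: coefficient of  p^P hbar^h eps^e  (the x-frequency is
determined by P).\<close>

type_synonym pmon = "nat \<times> int \<Rightarrow> nat"
type_synonym fser = "pmon \<Rightarrow> nat \<Rightarrow> nat \<Rightarrow> complex"

definition msupp :: "('v \<Rightarrow> nat) \<Rightarrow> 'v set" where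
  "msupp m = {v. m v \<noteq> 0}"

definition mtotal :: "('v \<Rightarrow> nat) \<Rightarrow> nat" where
  "mtotal m = (\<Sum>v\<in>msupp m. m v)"

definition mdeg :: "jmon \<Rightarrow> nat" where
  "mdeg m = (\<Sum>v\<in>msupp m. snd v * m v)"

definition jet_part :: "jmon \<Rightarrow> jmon" where
  "jet_part m = (\<lambda>v. if 0 < snd v then m v else 0)"

text \<open>Well-formedness: monomials have finite support and only use u^1..u^N;
for fixed powers of eps and hbar only finitely many monomials in the u^alpha_k (k>0)
occur (polynomial in the jets, power series in u^alpha_0).\<close>

definition is_qdp :: "nat \<Rightarrow> qdp \<Rightarrow> bool" where
  "is_qdp N f \<longleftrightarrow>
     (\<forall>e h m. f e h m \<noteq> 0 \<longrightarrow> finite (msupp m) \<and> (\<forall>v\<in>msupp m. 1 \<le> fst v \<and> fst v \<le> N)) \<and>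
     (\<forall>e h. finite (jet_part ` {m. f e h m \<noteq> 0}))"

definition qdp_deg_le :: "nat \<Rightarrow> int \<Rightarrow> qdp \<Rightarrow> bool" where
  "qdp_deg_le N d f \<longleftrightarrow> is_qdp N f \<and>
     (\<forall>e h m. f e h m \<noteq> 0 \<longrightarrow> int (mdeg m) - int e - 2 * int h \<le> d)"

definition is_const :: "qdp \<Rightarrow> bool" where
  "is_const f \<longleftrightarrow> (\<forall>e h m. f e h m \<noteq> 0 \<longrightarrow> m = (\<lambda>_. 0))"

definition diff_u :: "nat \<Rightarrow> nat \<Rightarrow> qdp \<Rightarrow> qdp" where
  "diff_u \<alpha> k f = (\<lambda>e h m. of_nat (m (\<alpha>, k) + 1) * f e h (m((\<alpha>, k) := m (\<alpha>, k) + 1)))"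

text \<open>partial_x = sum u^alpha_(k+1) d/du^alpha_k.\<close>

definition dx :: "qdp \<Rightarrow> qdp" where
  "dx f = (\<lambda>e h m. \<Sum>v\<in>{v. m v \<noteq> 0 \<and> 0 < snd v}.
              diff_u (fst v) (snd v - 1) f e h (m(v := m v - 1)))"

text \<open>(D - 1) with D = eps d/deps + 2 hbar d/dhbar + sum u^alpha_s d/du^alpha_s.\<close>

definition Dm1 :: "qdp \<Rightarrow> qdp" where
  "Dm1 f = (\<lambda>e h m. (of_nat (e + 2 * h + mtotal m) - 1) * f e h m)"

definition hbar_mul :: "qdp \<Rightarrow> qdp" where
  "hbar_mul f = (\<lambda>e h m. if h = 0 then 0 else f e (h - 1) m)"

definition qmul :: "qdp \<Rightarrow> qdp \<Rightarrow> qdp" where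
  "qmul f g = (\<lambda>e h m. \<Sum>(e1, h1, m1)\<in>{(e1, h1, m1). e1 \<le> e \<and> h1 \<le> h \<and> m1 \<le> m}.
                 f e1 h1 m1 * g (e - e1) (h - h1) (\<lambda>v. m v - m1 v))"

definition uvar :: "nat \<Rightarrow> qdp" where
  "uvar \<alpha> = (\<lambda>e h m. if e = 0 \<and> h = 0 \<and> m = (\<lambda>_. 0)((\<alpha>, 0) := 1) then 1 else 0)"

definition half_eta_uu :: "nat \<Rightarrow> (nat \<Rightarrow> nat \<Rightarrow> complex) \<Rightarrow> qdp" where
  "half_eta_uu N \<eta> = (\<lambda>e h m. \<Sum>\<mu>\<in>{1..N}. \<Sum>\<nu>\<in>{1..N}. \<eta> \<mu> \<nu> / 2 * qmul (uvar \<mu>) (uvar \<nu>) e h m)"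

text \<open>Variational derivative  sum_i (-partial_x)^i df/du^alpha_i ; for fixed powers of
eps and hbar only i up to the maximal jet order occurring in that slice contribute.\<close>

definition var_deriv :: "nat \<Rightarrow> qdp \<Rightarrow> qdp" where
  "var_deriv \<alpha> f = (\<lambda>e h m.
     \<Sum>i\<le>Sup {k. \<exists>m' \<beta>. f e h m' \<noteq> 0 \<and> m' (\<beta>, k) \<noteq> 0}.
        (((\<lambda>g ee hh mm. - dx g ee hh mm) ^^ i) (diff_u \<alpha> i f)) e h m)"

text \<open>Equality of local functionals: int f dx = int g dx iff f - g lies in
C[[eps,hbar]] + Im partial_x.\<close>

definition lf_eq :: "nat \<Rightarrow> qdp \<Rightarrow> qdp \<Rightarrow> bool" where
  "lf_eq N f g \<longleftrightarrow> (\<exists>r c. is_qdp N r \<and> is_const c \<and>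
      (\<forall>e h m. f e h m - g e h m = dx r e h m + c e h m))"

definition pfreq :: "pmon \<Rightarrow> int" where
  "pfreq P = (\<Sum>v\<in>msupp P. snd v * int (P v))"

text \<open>Coefficient of p^P in the image of the monomial u^m under
u^alpha_j = sum_k (ik)^j p^alpha_k e^{ikx}  (multinomial expansion; n (alpha,j,k)
counts how many factors u^alpha_j contribute p^alpha_k).\<close>

definition fcoef :: "jmon \<Rightarrow> pmon \<Rightarrow> complex" where
  "fcoef m P = (\<Sum>n\<in>{n :: nat \<times> nat \<times> int \<Rightarrow> nat. finite (msupp n) \<and>
        (\<forall>\<alpha> j. (\<Sum>k\<in>{k. n (\<alpha>, j, k) \<noteq> 0}. n (\<alpha>, j, k)) = m (\<alpha>, j)) \<and>
        (\<forall>\<alpha> k. (\<Sum>j\<in>{j. n (\<alpha>, j, k) \<noteq> 0}. n (\<alpha>, j, k)) = P (\<alpha>, k))}.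
      (\<Prod>v\<in>msupp m. of_nat (fact (m v))) / (\<Prod>w\<in>msupp n. of_nat (fact (n w))) *
      (\<Prod>w\<in>msupp n. (\<i> * of_int (snd (snd w))) ^ (fst (snd w) * n w)))"

definition fourier :: "qdp \<Rightarrow> fser" where
  "fourier f = (\<lambda>P h e. \<Sum>m\<in>{m. f e h m \<noteq> 0 \<and> mtotal m = mtotal P}. f e h m * fcoef m P)"

text \<open>Constant Fourier coefficient (image of a local functional).\<close>

definition zero_mode :: "fser \<Rightarrow> fser" where
  "zero_mode F = (\<lambda>P h e. if pfreq P = 0 then F P h e else 0)"

text \<open>Contractions C (alpha, beta, k), k > 0: number of factors
i hbar k eta^{alpha beta} d/dp^alpha_k (left) d/dp^beta_{-k} (right).\<close>

definition lcon :: "(nat \<times> nat \<times> nat \<Rightarrow> nat) \<Rightarrow> pmon" where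
  "lcon C = (\<lambda>(\<alpha>, kk). if 0 < kk then (\<Sum>\<beta>\<in>{\<beta>. C (\<alpha>, \<beta>, nat kk) \<noteq> 0}. C (\<alpha>, \<beta>, nat kk)) else 0)"

definition rcon :: "(nat \<times> nat \<times> nat \<Rightarrow> nat) \<Rightarrow> pmon" where
  "rcon C = (\<lambda>(\<beta>, kk). if kk < 0 then (\<Sum>\<alpha>\<in>{\<alpha>. C (\<alpha>, \<beta>, nat (- kk)) \<noteq> 0}. C (\<alpha>, \<beta>, nat (- kk))) else 0)"

text \<open>Star product  f exp(sum_{k>0} i hbar k eta^{ab} <-d_{p^a_k} ->d_{p^b_{-k}}) g,
with etai the inverse matrix eta^{ab}.\<close>

definition star :: "(nat \<Rightarrow> nat \<Rightarrow> complex) \<Rightarrow> fser \<Rightarrow> fser \<Rightarrow> fser" where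
  "star etai F G = (\<lambda>P h e.
     \<Sum>(C, P1, h1, e1)\<in>{(C, P1, h1, e1). finite (msupp C) \<and> (\<forall>w\<in>msupp C. 0 < snd (snd w)) \<and>
          P1 \<le> P \<and> h1 + mtotal C \<le> h \<and> e1 \<le> e \<and>
          F (\<lambda>v. P1 v + lcon C v) h1 e1 \<noteq> 0 \<and>
          G (\<lambda>v. P v - P1 v + rcon C v) (h - h1 - mtotal C) (e - e1) \<noteq> 0}.
       F (\<lambda>v. P1 v + lcon C v) h1 e1 *
       G (\<lambda>v. P v - P1 v + rcon C v) (h - h1 - mtotal C) (e - e1) *
       (\<Prod>w\<in>msupp C. (\<i> * of_nat (snd (snd w)) * etai (fst w) (fst (snd w))) ^ C w
                         / of_nat (fact (C w))) *
       (\<Prod>v\<in>msupp (lcon C). of_nat (fact (P1 v + lcon C v)) / of_nat (fact (P1 v))) *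
       (\<Prod>v\<in>msupp (rcon C). of_nat (fact (P v - P1 v + rcon C v)) / of_nat (fact (P v - P1 v))))"

definition qcomm :: "(nat \<Rightarrow> nat \<Rightarrow> complex) \<Rightarrow> fser \<Rightarrow> fser \<Rightarrow> fser" where
  "qcomm etai F G = (\<lambda>P h e. star etai F G P h e - star etai G F P h e)"

end

theory Submission
  imports Defs "HOL-Computational_Algebra.Formal_Power_Series" "HOL-Computational_Algebra.Polynomial"
begin

text \<open>
Write \<open>M\<^sub>n(k)\<close> for the Fourier mode of frequency \<open>k\<close> of a solution \<open>G\<^sub>n\<close>. The recursion reads
\<open>i \<hbar> k (D - 1) M\<^sub>n\<^sub>+\<^sub>1(k) = [M\<^sub>n(k), H]\<close>. For two solutions \<open>A\<close>, \<open>B\<close> let \<open>S\<^sub>n\<close> be the sum over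
\<open>p + q = n\<close> of \<open>k\<^sup>p l\<^sup>q [A\<^sub>p(k), B\<^sub>q(l)]\<close>. By the Jacobi identity \<open>i \<hbar> (D - 2) S\<^sub>n\<^sub>+\<^sub>1 = [S\<^sub>n, H]\<close>;
since brackets are divisible by \<open>\<hbar>\<close>, \<open>D - 2\<close> is injective on their
nonconstant part, and by induction \<open>S\<^sub>n\<close> is constant for all nonzero \<open>k\<close>, \<open>l\<close>. Each
coefficient of these brackets is a polynomial in the frequencies, since sums of monomials over
compositions of \<open>k\<close> are polynomial in \<open>k\<close> and agree for positive and negative \<open>k\<close>. Comparing
powers of \<open>t\<close> along lines \<open>k = k\<^sub>0 + c t\<close>, \<open>l = t\<close> gives the vanishing of the brackets of the zero
modes and the formula for \<open>[A\<^sub>n(k), B\<^sub>1(0)]\<close>, which is tau symmetry. The string equation follows from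
the derivative of the recursion along \<open>u\<^sup>1\<close>, up to constants; these and the linear terms of
\<open>G\<^sub>\<alpha>\<^sub>,\<^sub>1\<close> are absorbed by \<open>A\<close> and \<open>B\<close>.
\<close>

text \<open>The claims involve modes of frequency 0, while the recursion carries the frequency as a
  factor and says nothing there; hence the detour through nonzero frequencies and polynomial
  continuation. A single star product is not polynomial in the frequency: contractions carry
  positive frequencies, so it lives on a half line. In the commutator the opposite order supplies
  the other half line, and Faulhaber reciprocity (the power sum polynomial at -n yields the sum over
  negative integers) glues both halves into one polynomial. The factor k of each contraction keeps
  all exponents at least 1, which makes the halves fit at 0. Constants need care:
  \<open>D - 2\<close> kills hbar itself, so a weighted sum of brackets may keep a constant term.
  Constants are central, so the induction on n is not disturbed. Series are handled as functions of
  lists of modes because the Leibniz rule is then a recursion on the list, and every sum over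
  contractions is finite mode by mode.\<close>

unbundle fps_syntax

section \<open>Sums over splittings of a list\<close>

text \<open>The Leibniz rule: the variables of a list are distributed over two factors in all
  possible ways. Distributing positions instead of values keeps the multiplicities of repeated
  variables right.\<close>

fun spl :: "('a list \<Rightarrow> 'a list \<Rightarrow> 'b::comm_monoid_add) \<Rightarrow> 'a list \<Rightarrow> 'b" where
  "spl \<phi> [] = \<phi> [] []"
| "spl \<phi> (x # xs) = spl (\<lambda>a b. \<phi> (x # a) b) xs + spl (\<lambda>a b. \<phi> a (x # b)) xs"

definition perm_inv :: "('a list \<Rightarrow> 'b) \<Rightarrow> bool" where
  "perm_inv F \<longleftrightarrow> (\<forall>xs ys. mset xs = mset ys \<longrightarrow> F xs = F ys)"

lemma perm_invD: "perm_inv F \<Longrightarrow> mset xs = mset ys \<Longrightarrow> F xs = F ys"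
  unfolding perm_inv_def by blast

lemma perm_invI: "(\<And>xs ys. mset xs = mset ys \<Longrightarrow> F xs = F ys) \<Longrightarrow> perm_inv F"
  unfolding perm_inv_def by blast

lemma perm_inv_Cons: "perm_inv F \<Longrightarrow> perm_inv (\<lambda>xs. F (x # xs))"
  by (rule perm_invI, erule perm_invD) simp

lemma spl_map: "spl \<phi> (map f xs) = spl (\<lambda>a b. \<phi> (map f a) (map f b)) xs"
  by (induction xs arbitrary: \<phi>) auto

lemma spl_cong:
  "(\<And>a b. mset a + mset b = mset xs \<Longrightarrow> \<phi> a b = \<psi> a b) \<Longrightarrow> spl \<phi> xs = spl \<psi> xs"
proof (induction xs arbitrary: \<phi> \<psi>)
  case (Cons x xs)
  have "spl (\<lambda>a b. \<phi> (x # a) b) xs = spl (\<lambda>a b. \<psi> (x # a) b) xs"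
    by (rule Cons.IH) (simp add: Cons.prems)
  moreover have "spl (\<lambda>a b. \<phi> a (x # b)) xs = spl (\<lambda>a b. \<psi> a (x # b)) xs"
    by (rule Cons.IH) (simp add: Cons.prems)
  ultimately show ?case by simp
qed simp

lemma spl_mult_left:
  fixes r :: "'b::semiring_0"
  shows "r * spl \<phi> xs = spl (\<lambda>a b. r * \<phi> a b) xs"
  by (induction xs arbitrary: \<phi>) (simp_all add: distrib_left)

lemma spl_mult_perm_inv:
  fixes \<psi> :: "'a list \<Rightarrow> 'b::semiring_0"
  assumes "perm_inv \<psi>"
  shows "\<psi> xs * spl \<phi> xs = spl (\<lambda>a b. \<psi> (a @ b) * \<phi> a b) xs"
proof -
  have "spl (\<lambda>a b. \<psi> (a @ b) * \<phi> a b) xs = spl (\<lambda>a b. \<psi> xs * \<phi> a b) xs"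
    by (rule spl_cong) (metis assms mset_append perm_invD)
  then show ?thesis by (simp add: spl_mult_left)
qed

section \<open>Words of fixed length over a finite alphabet\<close>

definition nlists :: "nat \<Rightarrow> 'a set \<Rightarrow> 'a list set" where
  "nlists n T = {cs. length cs = n \<and> set cs \<subseteq> T}"

lemma nlists_0 [simp]: "nlists 0 T = {[]}"
  by (auto simp: nlists_def)

lemma finite_nlists: "finite T \<Longrightarrow> finite (nlists n T)"
  unfolding nlists_def using finite_lists_length_eq[of T n] by (simp add: conj_commute)

lemma nlists_Suc: "nlists (Suc n) T = (\<lambda>(c, cs). c # cs) ` (T \<times> nlists n T)"
  by (auto simp: nlists_def length_Suc_conv image_iff)

lemma sum_nlists_Suc:
  "(\<Sum>cs\<in>nlists (Suc n) T. \<phi> cs) = (\<Sum>c\<in>T. \<Sum>cs\<in>nlists n T. \<phi> (c # cs))"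
proof -
  have "inj_on (\<lambda>(c, cs). c # cs) (T \<times> nlists n T)" by (auto simp: inj_on_def)
  then show ?thesis
    by (simp add: nlists_Suc sum.reindex o_def case_prod_unfold sum.cartesian_product)
qed

text \<open>A splitting of type j is a choice of j positions, and as the word varies its two parts
  range independently over all words of lengths j and n - j. The induction is Pascal's rule.\<close>

lemma sum_spl_nlists:
  fixes \<phi> :: "'a list \<Rightarrow> 'a list \<Rightarrow> 'b::comm_semiring_1"
  shows "(\<Sum>cs\<in>nlists n T. spl \<phi> cs) =
    (\<Sum>j\<le>n. of_nat (n choose j) * (\<Sum>a\<in>nlists j T. \<Sum>b\<in>nlists (n - j) T. \<phi> a b))"
proof (induction n arbitrary: \<phi>)
  case (Suc n)
  define b where "b j = (\<Sum>a\<in>nlists j T. \<Sum>b\<in>nlists (Suc n - j) T. \<phi> a b)" for j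
  have b1: "(\<Sum>c\<in>T. \<Sum>a\<in>nlists j T. \<Sum>b\<in>nlists (n - j) T. \<phi> (c # a) b) = b (Suc j)" for j
    by (simp add: b_def sum_nlists_Suc)
  have b2: "(\<Sum>c\<in>T. \<Sum>a\<in>nlists j T. \<Sum>b\<in>nlists (n - j) T. \<phi> a (c # b)) = b j" if "j \<le> n" for j
    using that by (subst sum.swap) (simp add: b_def sum_nlists_Suc Suc_diff_le)
  have "(\<Sum>cs\<in>nlists (Suc n) T. spl \<phi> cs)
      = (\<Sum>c\<in>T. \<Sum>j\<le>n. of_nat (n choose j) * (\<Sum>a\<in>nlists j T. \<Sum>b\<in>nlists (n - j) T. \<phi> (c # a) b))
      + (\<Sum>c\<in>T. \<Sum>j\<le>n. of_nat (n choose j) * (\<Sum>a\<in>nlists j T. \<Sum>b\<in>nlists (n - j) T. \<phi> a (c # b)))"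
    by (simp add: sum_nlists_Suc sum.distrib Suc.IH)
  also have "\<dots> = (\<Sum>j\<le>n. of_nat (n choose j) * b (Suc j)) + (\<Sum>j\<le>n. of_nat (n choose j) * b j)"
    unfolding sum.swap[where A = T and B = "{..n}"]
    by (simp add: sum_distrib_left[symmetric] b1 b2)
  also have "\<dots> = (\<Sum>j\<le>Suc n. of_nat (Suc n choose j) * b j)"
  proof -
    have "(\<Sum>j\<le>n. of_nat (n choose j) * b j) = (\<Sum>j\<le>Suc n. of_nat (n choose j) * b j)"
      by (simp add: binomial_eq_0)
    then have "(\<Sum>j\<le>n. of_nat (n choose j) * b j) = b 0 + (\<Sum>j\<le>n. of_nat (n choose Suc j) * b (Suc j))"
      by (simp only: sum.atMost_Suc_shift) simp
    then show ?thesis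
      by (simp only: sum.atMost_Suc_shift) (simp add: sum.distrib distrib_right add_ac)
  qed
  finally show ?case by (simp only: b_def)
qed simp

section \<open>Coefficients\<close>

text \<open>The outer series variable is \<open>\<hbar>\<close>, the inner one \<open>\<epsilon>\<close>.\<close>

type_synonym coeffs = "complex fps fps"

definition scal :: "complex \<Rightarrow> coeffs" where
  "scal c = fps_const (fps_const c)"

lemma scal_0 [simp]: "scal 0 = 0" and scal_1 [simp]: "scal 1 = 1"
  by (auto simp: scal_def)

lemma scal_add: "scal (a + b) = scal a + scal b"
  and scal_mult: "scal (a * b) = scal a * scal b"
  and scal_minus: "scal (- a) = - scal a"
  and scal_diff: "scal (a - b) = scal a - scal b"
  by (auto simp: scal_def)

lemma scal_of_nat: "scal (of_nat n) = of_nat n"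
  by (induction n) (auto simp: scal_add)

lemma scal_sum: "scal (sum f A) = (\<Sum>x\<in>A. scal (f x))"
  by (induction A rule: infinite_finite_induct) (auto simp: scal_add)

lemma scal_nth [simp]: "(scal c * r) $ h $ e = c * r $ h $ e"
  by (simp add: scal_def)

lemma coeffs_eqI: "(\<And>h e. (r :: coeffs) $ h $ e = s $ h $ e) \<Longrightarrow> r = s"
  by (simp add: fps_ext)

lemma hbar_nth: "(fps_X ^ n * r) $ h $ e = (if n \<le> h then (r :: coeffs) $ (h - n) $ e else 0)"
  by (simp add: fps_X_power_mult_nth)

lemma coeffs_mult_nth:
  "((r :: coeffs) * s) $ h $ e = (\<Sum>i\<le>h. \<Sum>j\<le>e. r $ i $ j * s $ (h - i) $ (e - j))"
  by (simp add: fps_mult_nth fps_sum_nth atLeast0AtMost)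

text \<open>The Euler operator eps d/deps + 2 hbar d/dhbar, that is, the part of D that acts on
  coefficients.\<close>

definition cdeg :: "coeffs \<Rightarrow> coeffs" where
  "cdeg r = Abs_fps (\<lambda>h. Abs_fps (\<lambda>e. of_nat (e + 2 * h) * r $ h $ e))"

lemma cdeg_nth [simp]: "cdeg r $ h $ e = of_nat (e + 2 * h) * r $ h $ e"
  by (simp add: cdeg_def)

lemma cdeg_mult: "cdeg (r * s) = cdeg r * s + r * cdeg s"
proof (rule coeffs_eqI)
  fix h e
  have "(cdeg r * s + r * cdeg s) $ h $ e
    = (\<Sum>i\<le>h. \<Sum>j\<le>e. of_nat (j + 2 * i) * (r $ i $ j * s $ (h - i) $ (e - j))
       + of_nat ((e - j) + 2 * (h - i)) * (r $ i $ j * s $ (h - i) $ (e - j)))"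
    by (simp only: fps_add_nth coeffs_mult_nth cdeg_nth sum.distrib mult.assoc mult.left_commute)
  also have "\<dots> = (\<Sum>i\<le>h. \<Sum>j\<le>e. of_nat (e + 2 * h) * (r $ i $ j * s $ (h - i) $ (e - j)))"
  proof (intro sum.cong refl)
    fix i j assume "i \<in> {..h}" "j \<in> {..e}"
    then have "e + 2 * h = (j + 2 * i) + ((e - j) + 2 * (h - i))" by auto
    then show "of_nat (j + 2 * i) * (r $ i $ j * s $ (h - i) $ (e - j))
       + of_nat ((e - j) + 2 * (h - i)) * (r $ i $ j * s $ (h - i) $ (e - j))
       = of_nat (e + 2 * h) * (r $ i $ j * s $ (h - i) $ (e - j))"
      by (simp only: distrib_right[symmetric] of_nat_add[symmetric])
  qed
  also have "\<dots> = cdeg (r * s) $ h $ e"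
    by (simp only: coeffs_mult_nth cdeg_nth sum_distrib_left)
  finally show "cdeg (r * s) $ h $ e = (cdeg r * s + r * cdeg s) $ h $ e" by (rule sym)
qed

lemma cdeg_add: "cdeg (r + s) = cdeg r + cdeg s"
  and cdeg_diff: "cdeg (r - s) = cdeg r - cdeg s"
  and cdeg_0 [simp]: "cdeg 0 = 0"
  by (auto intro!: coeffs_eqI simp: algebra_simps)

lemma cdeg_sum: "cdeg (sum f A) = (\<Sum>x\<in>A. cdeg (f x))"
  by (induction A rule: infinite_finite_induct) (auto simp: cdeg_add)

lemma cdeg_scal_mult: "cdeg (scal c * r) = scal c * cdeg r"
  by (rule coeffs_eqI) (simp only: cdeg_nth scal_nth mult.left_commute)

lemma cdeg_hbar: "cdeg (fps_X ^ n) = of_nat (2 * n) * fps_X ^ n"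
proof -
  have "cdeg (fps_X ^ n) = scal (of_nat (2 * n)) * fps_X ^ n"
    by (rule coeffs_eqI) (simp add: fps_X_power_nth)
  then show ?thesis by (simp only: scal_of_nat)
qed

section \<open>The star product on Taylor coefficients\<close>

type_synonym mode = "nat \<times> int"
text \<open>Fourier series are encoded by their partial derivatives at \<open>p = 0\<close>, listed by the modes
  differentiated along; prepending a mode to the argument is differentiation.\<close>

type_synonym lfun = "mode list \<Rightarrow> coeffs"

definition freq :: "mode list \<Rightarrow> int" where
  "freq xs = sum_list (map snd xs)"

lemma freq_simps [simp]: "freq [] = 0" "freq (x # xs) = snd x + freq xs" "freq (xs @ ys) = freq xs + freq ys"
  by (simp_all add: freq_def)

definition homog :: "int \<Rightarrow> lfun \<Rightarrow> bool" where
  "homog \<kappa> F \<longleftrightarrow> (\<forall>xs. F xs \<noteq> 0 \<longrightarrow> freq xs = \<kappa>)"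

lemma homogD: "homog \<kappa> F \<Longrightarrow> F xs \<noteq> 0 \<Longrightarrow> freq xs = \<kappa>"
  by (simp add: homog_def)

lemma homog_Cons: "homog \<kappa> F \<Longrightarrow> homog (\<kappa> - snd x) (\<lambda>xs. F (x # xs))"
  by (force simp: homog_def)

lemma homog_append: "homog \<kappa> F \<Longrightarrow> homog (\<kappa> - freq ys) (\<lambda>xs. F (ys @ xs))"
  by (force simp: homog_def)

lemma homog_add: "homog \<kappa> F \<Longrightarrow> homog \<kappa> G \<Longrightarrow> homog \<kappa> (\<lambda>xs. F xs + G xs)"
  and homog_diff: "homog \<kappa> F \<Longrightarrow> homog \<kappa> G \<Longrightarrow> homog \<kappa> (\<lambda>xs. F xs - G xs)"
  and homog_scale: "homog \<kappa> F \<Longrightarrow> homog \<kappa> (\<lambda>xs. r * F xs)"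
  and homog_zero: "homog \<kappa> (\<lambda>xs. 0)"
  unfolding homog_def by (metis add.right_neutral, metis diff_self, metis mult_zero_right, simp)

lemma homog_sum: "(\<And>i. i \<in> I \<Longrightarrow> homog \<kappa> (F i)) \<Longrightarrow> homog \<kappa> (\<lambda>xs. \<Sum>i\<in>I. F i xs)"
  by (induction I rule: infinite_finite_induct) (auto intro: homog_add homog_zero)

text \<open>A contraction \<open>(\<alpha>, \<beta>, k)\<close> removes \<open>p\<^sup>\<alpha>\<^sub>k\<close> from the left factor and
  \<open>p\<^sup>\<beta>\<^sub>-\<^sub>k\<close> from the right one.\<close>

type_synonym contr = "nat \<times> nat \<times> nat"

definition Lc :: "contr list \<Rightarrow> mode list" where
  "Lc = map (\<lambda>(\<alpha>, \<beta>, k). (\<alpha>, int k))"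

definition Rc :: "contr list \<Rightarrow> mode list" where
  "Rc = map (\<lambda>(\<alpha>, \<beta>, k). (\<beta>, - int k))"

definition csum :: "contr list \<Rightarrow> nat" where
  "csum cs = sum_list (map (\<lambda>(\<alpha>, \<beta>, k). k) cs)"

lemma Lc_simps [simp]: "Lc [] = []" "Lc (c # cs) = (fst c, int (snd (snd c))) # Lc cs" "Lc (as @ bs) = Lc as @ Lc bs"
  and Rc_simps [simp]: "Rc [] = []" "Rc (c # cs) = (fst (snd c), - int (snd (snd c))) # Rc cs" "Rc (as @ bs) = Rc as @ Rc bs"
  and csum_simps [simp]: "csum [] = 0" "csum (c # cs) = snd (snd c) + csum cs" "csum (as @ bs) = csum as + csum bs"
  by (auto simp: Lc_def Rc_def csum_def split: prod.splits)

lemma length_Lc [simp]: "length (Lc cs) = length cs" and length_Rc [simp]: "length (Rc cs) = length cs"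
  by (auto simp: Lc_def Rc_def)

lemma freq_Lc [simp]: "freq (Lc cs) = int (csum cs)" and freq_Rc [simp]: "freq (Rc cs) = - int (csum cs)"
  by (induction cs) auto

lemma perm_inv_Lc: "perm_inv F \<Longrightarrow> perm_inv (\<lambda>cs. F (Lc cs))"
  and perm_inv_Rc: "perm_inv F \<Longrightarrow> perm_inv (\<lambda>cs. F (Rc cs))"
  by (rule perm_invI, erule perm_invD, simp add: Lc_def Rc_def)+

lemma csum_ge_mem: "c \<in> set cs \<Longrightarrow> snd (snd c) \<le> csum cs"
  by (induction cs) auto

section \<open>Contraction lists, their weights, and the star product\<close>

locale weyl =
  fixes N :: nat and etai :: "nat \<Rightarrow> nat \<Rightarrow> complex"
begin

definition con :: "contr set" where
  "con = {1..N} \<times> {1..N} \<times> {0<..}"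

definition conB :: "nat \<Rightarrow> contr set" where
  "conB B = {1..N} \<times> {1..N} \<times> {1..B}"

lemma finite_conB [simp]: "finite (conB B)"
  by (simp add: conB_def)

definition CS :: "nat \<Rightarrow> contr list set" where
  "CS B = {cs. length cs \<le> B \<and> set cs \<subseteq> conB B}"

text \<open>Each contraction carries frequency at least 1. With indices confined to 1..N, a bound on
  the total frequency therefore leaves finitely many lists; this is the source of all finiteness in
  the star product.\<close>

lemma length_le_csum: "set cs \<subseteq> con \<Longrightarrow> length cs \<le> csum cs"
  by (induction cs) (auto simp: con_def)

lemma CS_con: "cs \<in> CS B \<Longrightarrow> set cs \<subseteq> con"
  by (auto simp: CS_def conB_def con_def)

lemma in_CS: "set cs \<subseteq> con \<Longrightarrow> csum cs \<le> B \<Longrightarrow> cs \<in> CS B"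
  using length_le_csum[of cs] csum_ge_mem[of _ cs]
  by (fastforce simp: CS_def con_def conB_def)

lemma finite_CS [simp]: "finite (CS B)"
  using finite_lists_length_le[of "conB B" B] by (simp add: CS_def conj_commute)

lemma sum_CS: "(\<Sum>cs\<in>CS B. \<phi> cs) = (\<Sum>n\<le>B. \<Sum>cs\<in>nlists n (conB B). \<phi> cs)"
proof -
  have "CS B = (\<Union>n\<in>{..B}. nlists n (conB B))" by (auto simp: CS_def nlists_def)
  then show ?thesis
    by (simp only:) (subst sum.UNION_disjoint; (simp add: finite_nlists)?; auto simp: nlists_def)
qed

definition w0 :: "contr list \<Rightarrow> complex" where
  "w0 cs = prod_list (map (\<lambda>(\<alpha>, \<beta>, k). \<i> * of_nat k * etai \<alpha> \<beta>) cs)"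

lemma w0_simps [simp]: "w0 [] = 1"
    "w0 (c # cs) = \<i> * of_nat (snd (snd c)) * etai (fst c) (fst (snd c)) * w0 cs"
    "w0 (as @ bs) = w0 as * w0 bs"
  by (simp_all add: w0_def case_prod_unfold)

lemma perm_inv_w0: "perm_inv (\<lambda>cs. scal (w0 cs))"
proof (rule perm_invI)
  fix xs ys :: "contr list" assume "mset xs = mset ys"
  then have "prod_mset (image_mset (\<lambda>(\<alpha>, \<beta>, k). \<i> * of_nat k * etai \<alpha> \<beta>) (mset xs))
    = prod_mset (image_mset (\<lambda>(\<alpha>, \<beta>, k). \<i> * of_nat k * etai \<alpha> \<beta>) (mset ys))" by simp
  then show "scal (w0 xs) = scal (w0 ys)"
    by (simp add: w0_def prod_mset_prod_list[symmetric])
qed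

text \<open>A term of the exponential series. The lists are ordered, so the full factorial of the
  length appears in place of factorials of multiplicities.\<close>

definition wt :: "contr list \<Rightarrow> coeffs" where
  "wt cs = scal (w0 cs / fact (length cs)) * fps_X ^ length cs"

lemma wt_Nil [simp]: "wt [] = 1"
  by (simp add: wt_def)

definition Sm :: "nat \<Rightarrow> (contr list \<Rightarrow> coeffs) \<Rightarrow> coeffs" where
  "Sm B \<phi> = (\<Sum>cs\<in>CS B. wt cs * \<phi> cs)"

lemma Sm_cong: "(\<And>cs. cs \<in> CS B \<Longrightarrow> \<phi> cs = \<psi> cs) \<Longrightarrow> Sm B \<phi> = Sm B \<psi>"
  by (simp add: Sm_def)

lemma Sm_add: "Sm B (\<lambda>cs. \<phi> cs + \<psi> cs) = Sm B \<phi> + Sm B \<psi>"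
  by (simp add: Sm_def distrib_left sum.distrib)

lemma Sm_mult: "r * Sm B \<phi> = Sm B (\<lambda>cs. r * \<phi> cs)"
  by (simp add: Sm_def sum_distrib_left mult.left_commute)

lemma Sm_swap: "Sm B (\<lambda>a. Sm B (\<lambda>b. \<phi> a b)) = Sm B (\<lambda>b. Sm B (\<lambda>a. \<phi> a b))"
  unfolding Sm_def sum_distrib_left
  by (subst sum.swap) (simp only: mult.left_commute)

text \<open>The law exp(x + y) = exp x exp y for contractions: \<open>w0\<close> is multiplicative,
  and the binomial coefficients of \<open>sum_spl_nlists\<close> turn 1/n! into the product of the
  two reciprocal factorials. \<open>CS B\<close> caps the length, so pairs of total length above
  \<open>B\<close> occur only in the double sum and have to vanish.\<close>

lemma Sm_spl:
  assumes "\<And>a b. a \<in> CS B \<Longrightarrow> b \<in> CS B \<Longrightarrow> B < length a + length b \<Longrightarrow> \<phi> a b = 0"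
  shows "Sm B (\<lambda>cs. spl \<phi> cs) = Sm B (\<lambda>a. Sm B (\<lambda>b. \<phi> a b))"
proof -
  define T where "T = conB B"
  define f where "f j m = (\<Sum>a\<in>nlists j T. \<Sum>b\<in>nlists m T. wt a * (wt b * \<phi> a b))" for j m
  have 1: "(\<Sum>cs\<in>nlists n T. wt cs * spl \<phi> cs) = (\<Sum>j\<le>n. f j (n - j))" for n
  proof -
    have "(\<Sum>cs\<in>nlists n T. wt cs * spl \<phi> cs)
        = (\<Sum>cs\<in>nlists n T. scal (1 / fact n) * fps_X ^ n * (scal (w0 cs) * spl \<phi> cs))"
    proof (intro sum.cong refl)
      fix cs assume "cs \<in> nlists n T"
      then have l: "length cs = n" by (simp add: nlists_def)
      have s: "scal (w0 cs / fact n) = scal (w0 cs) * scal (1 / fact n)"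
        by (simp add: scal_mult[symmetric])
      show "wt cs * spl \<phi> cs = scal (1 / fact n) * fps_X ^ n * (scal (w0 cs) * spl \<phi> cs)"
        unfolding wt_def l s by (simp only: mult_ac)
    qed
    also have "\<dots> = scal (1 / fact n) * fps_X ^ n * (\<Sum>cs\<in>nlists n T. spl (\<lambda>a b. scal (w0 (a @ b)) * \<phi> a b) cs)"
      by (simp only: spl_mult_perm_inv[OF perm_inv_w0] sum_distrib_left)
    also have "\<dots> = (\<Sum>j\<le>n. scal (1 / fact n) * fps_X ^ n * of_nat (n choose j) *
        (\<Sum>a\<in>nlists j T. \<Sum>b\<in>nlists (n - j) T. scal (w0 (a @ b)) * \<phi> a b))"
      by (simp only: sum_spl_nlists sum_distrib_left mult.assoc)
    also have "\<dots> = (\<Sum>j\<le>n. f j (n - j))"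
    proof (intro sum.cong refl)
      fix j assume "j \<in> {..n}"
      then have j: "j \<le> n" by simp
      have "1 / fact n * of_nat (n choose j) = 1 / (fact j * fact (n - j) :: complex)"
        using binomial_fact[OF j, where 'a = complex] by (simp add: field_simps)
      then have c: "scal (1 / fact n) * of_nat (n choose j) = scal (1 / fact j) * scal (1 / fact (n - j))"
        by (simp add: scal_of_nat[symmetric] scal_mult[symmetric])
      have "f j (n - j) = (\<Sum>a\<in>nlists j T. \<Sum>b\<in>nlists (n - j) T.
          scal (1 / fact n) * fps_X ^ n * of_nat (n choose j) * (scal (w0 (a @ b)) * \<phi> a b))"
        unfolding f_def
      proof (intro sum.cong refl)
        fix a b assume "a \<in> nlists j T" "b \<in> nlists (n - j) T"
        then have l: "length a = j" "length b = n - j" by (auto simp: nlists_def)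
        have p: "(fps_X :: coeffs) ^ n = fps_X ^ j * fps_X ^ (n - j)"
          using j by (simp add: power_add[symmetric])
        have s: "scal (w0 a / fact j) = scal (w0 a) * scal (1 / fact j)"
          "scal (w0 b / fact (n - j)) = scal (w0 b) * scal (1 / fact (n - j))"
          by (simp_all add: scal_mult[symmetric])
        have "wt a * (wt b * \<phi> a b) = (scal (1 / fact j) * scal (1 / fact (n - j))) * (fps_X ^ j * fps_X ^ (n - j)) * (scal (w0 a) * scal (w0 b) * \<phi> a b)"
          unfolding wt_def l s by (simp only: mult_ac)
        also have "\<dots> = (scal (1 / fact n) * of_nat (n choose j)) * fps_X ^ n * (scal (w0 (a @ b)) * \<phi> a b)"
          by (simp only: c p w0_simps scal_mult)
        finally show "wt a * (wt b * \<phi> a b) = scal (1 / fact n) * fps_X ^ n * of_nat (n choose j) * (scal (w0 (a @ b)) * \<phi> a b)"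
          by (simp only: mult_ac)
      qed
      then show "scal (1 / fact n) * fps_X ^ n * of_nat (n choose j) *
        (\<Sum>a\<in>nlists j T. \<Sum>b\<in>nlists (n - j) T. scal (w0 (a @ b)) * \<phi> a b) = f j (n - j)"
        by (simp only: sum_distrib_left)
    qed
    finally show ?thesis .
  qed
  have z: "f j m = 0" if "j \<le> B" "m \<le> B" "B < j + m" for j m
    unfolding f_def using that assms
    by (intro sum.neutral ballI) (auto simp: nlists_def CS_def T_def)
  have "Sm B (\<lambda>cs. spl \<phi> cs) = (\<Sum>n\<le>B. \<Sum>j\<le>n. f j (n - j))"
    by (simp add: Sm_def sum_CS 1 T_def[symmetric])
  also have "\<dots> = (\<Sum>(j, m)\<in>{(j, m). j + m \<le> B}. f j m)"
    by (rule sum.triangle_reindex_eq[symmetric])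
  also have "\<dots> = (\<Sum>(j, m)\<in>{..B} \<times> {..B}. f j m)"
    using z by (intro sum.mono_neutral_left) (auto, meson not_le)
  also have "\<dots> = (\<Sum>j\<le>B. \<Sum>m\<le>B. f j m)"
    by (simp add: sum.cartesian_product)
  also have "\<dots> = (\<Sum>j\<le>B. \<Sum>a\<in>nlists j T. \<Sum>m\<le>B. \<Sum>b\<in>nlists m T. wt a * (wt b * \<phi> a b))"
    unfolding f_def by (intro sum.cong refl) (rule sum.swap)
  also have "\<dots> = Sm B (\<lambda>a. Sm B (\<lambda>b. \<phi> a b))"
    by (simp add: Sm_def sum_CS T_def[symmetric] sum_distrib_left)
  finally show ?thesis .
qed

text \<open>The star product at p = 0: every mode of either factor is consumed by a contraction. A
  sum over an infinite set would default to 0; homogeneity of one factor bounds the total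
  contraction frequency and makes the set finite.\<close>

definition tpr :: "lfun \<Rightarrow> lfun \<Rightarrow> coeffs" where
  "tpr F G = (\<Sum>cs\<in>{cs. set cs \<subseteq> con \<and> F (Lc cs) \<noteq> 0 \<and> G (Rc cs) \<noteq> 0}. wt cs * (F (Lc cs) * G (Rc cs)))"

lemma tpr_eq_gen:
  assumes "\<And>cs. F (Lc cs) \<noteq> 0 \<Longrightarrow> G (Rc cs) \<noteq> 0 \<Longrightarrow> csum cs \<le> B"
  shows "tpr F G = Sm B (\<lambda>cs. F (Lc cs) * G (Rc cs))"
  unfolding tpr_def Sm_def
  using CS_con by (intro sum.mono_neutral_left) (auto intro: in_CS assms)

lemma tpr_eq: "homog \<kappa> F \<Longrightarrow> \<kappa> \<le> int B \<Longrightarrow> tpr F G = Sm B (\<lambda>cs. F (Lc cs) * G (Rc cs))"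
  by (rule tpr_eq_gen) (use homogD in fastforce)

lemma tpr_eq': "homog \<kappa> G \<Longrightarrow> - \<kappa> \<le> int B \<Longrightarrow> tpr F G = Sm B (\<lambda>cs. F (Lc cs) * G (Rc cs))"
  by (rule tpr_eq_gen) (use homogD in fastforce)

text \<open>The bidifferential operator of the star product has constant coefficients, so
  derivatives distribute by the Leibniz rule and the values at p = 0 determine the whole
  product.\<close>

fun tst :: "lfun \<Rightarrow> lfun \<Rightarrow> lfun" where
  "tst F G [] = tpr F G"
| "tst F G (x # xs) = tst (\<lambda>ys. F (x # ys)) G xs + tst F (\<lambda>ys. G (x # ys)) xs"

lemma tst_spl: "tst F G xs = spl (\<lambda>a b. tpr (\<lambda>ys. F (a @ ys)) (\<lambda>ys. G (b @ ys))) xs"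
  by (induction xs arbitrary: F G) auto

lemma tpr_nonzero:
  assumes "homog \<kappa> F" "homog \<mu> G" "tpr F G \<noteq> 0"
  shows "\<kappa> + \<mu> = 0"
proof -
  have "{cs. set cs \<subseteq> con \<and> F (Lc cs) \<noteq> 0 \<and> G (Rc cs) \<noteq> 0} \<noteq> {}"
  proof
    assume e: "{cs. set cs \<subseteq> con \<and> F (Lc cs) \<noteq> 0 \<and> G (Rc cs) \<noteq> 0} = {}"
    show False using assms(3) unfolding tpr_def e by simp
  qed
  then obtain cs where "F (Lc cs) \<noteq> 0" "G (Rc cs) \<noteq> 0" by blast
  then have "int (csum cs) = \<kappa>" "- int (csum cs) = \<mu>"
    using homogD[OF assms(1), of "Lc cs"] homogD[OF assms(2), of "Rc cs"] by simp_all
  then show ?thesis by simp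
qed

lemma homog_tst: "homog \<kappa> F \<Longrightarrow> homog \<mu> G \<Longrightarrow> homog (\<kappa> + \<mu>) (tst F G)"
proof -
  have "freq xs = \<kappa> + \<mu>" if "homog \<kappa> F" "homog \<mu> G" "tst F G xs \<noteq> 0" for xs \<kappa> \<mu> F G
    using that
  proof (induction xs arbitrary: F G \<kappa> \<mu>)
    case Nil
    then show ?case using tpr_nonzero[OF Nil.prems(1,2)] Nil.prems(3) by simp
  next
    case (Cons x xs)
    consider "tst (\<lambda>ys. F (x # ys)) G xs \<noteq> 0" | "tst F (\<lambda>ys. G (x # ys)) xs \<noteq> 0"
      using Cons.prems(3) unfolding tst.simps(2) by (cases "tst (\<lambda>ys. F (x # ys)) G xs = 0") simp_all
    then show ?case
    proof cases
      case 1
      show ?thesis using Cons.IH[OF homog_Cons[OF Cons.prems(1)] Cons.prems(2) 1] by simp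
    next
      case 2
      show ?thesis using Cons.IH[OF Cons.prems(1) homog_Cons[OF Cons.prems(2)] 2] by simp
    qed
  qed
  then show "homog \<kappa> F \<Longrightarrow> homog \<mu> G \<Longrightarrow> homog (\<kappa> + \<mu>) (tst F G)"
    unfolding homog_def[of "\<kappa> + \<mu>"] by blast
qed

text \<open>The common frequency lets one finite set of contractions serve both summands and their
  sum; this is why bilinearity is stated for homogeneous arguments only.\<close>

lemma tpr_add_left: "homog \<kappa> F \<Longrightarrow> homog \<kappa> F' \<Longrightarrow> tpr (\<lambda>xs. F xs + F' xs) G = tpr F G + tpr F' G"
  using tpr_eq[of \<kappa> _ "nat \<kappa>"] homog_add[of \<kappa> F F']
  by (simp add: Sm_add distrib_right)

lemma tpr_add_right: "homog \<kappa> G \<Longrightarrow> homog \<kappa> G' \<Longrightarrow> tpr F (\<lambda>xs. G xs + G' xs) = tpr F G + tpr F G'"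
  using tpr_eq'[of \<kappa> _ "nat (- \<kappa>)"] homog_add[of \<kappa> G G']
  by (simp add: Sm_add distrib_left)

lemma tpr_scale_left: "homog \<kappa> F \<Longrightarrow> tpr (\<lambda>xs. r * F xs) G = r * tpr F G"
  using tpr_eq[of \<kappa> _ "nat \<kappa>"] homog_scale[of \<kappa> F r]
  by (simp add: Sm_mult mult_ac)

lemma tpr_scale_right: "homog \<kappa> G \<Longrightarrow> tpr F (\<lambda>xs. r * G xs) = r * tpr F G"
  using tpr_eq'[of \<kappa> _ "nat (- \<kappa>)"] homog_scale[of \<kappa> G r]
  by (simp add: Sm_mult mult_ac)

lemma tpr_zero [simp]: "tpr (\<lambda>xs. 0) G = 0" "tpr F (\<lambda>xs. 0) = 0"
  by (simp_all add: tpr_def)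

lemma tst_zero [simp]: "tst (\<lambda>xs. 0) G xs = 0" "tst F (\<lambda>xs. 0) xs = 0"
  by (induction xs arbitrary: F G) auto

lemma tst_add_left: "homog \<kappa> F \<Longrightarrow> homog \<kappa> F' \<Longrightarrow> tst (\<lambda>xs. F xs + F' xs) G xs = tst F G xs + tst F' G xs"
proof (induction xs arbitrary: F F' G \<kappa>)
  case (Cons x xs)
  show ?case
    using Cons.IH[OF homog_Cons[OF Cons.prems(1)] homog_Cons[OF Cons.prems(2)]] Cons.IH[OF Cons.prems]
    by (simp add: add_ac)
qed (simp add: tpr_add_left)

lemma tst_add_right: "homog \<kappa> G \<Longrightarrow> homog \<kappa> G' \<Longrightarrow> tst F (\<lambda>xs. G xs + G' xs) xs = tst F G xs + tst F G' xs"
proof (induction xs arbitrary: F G' G \<kappa>)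
  case (Cons x xs)
  show ?case
    using Cons.IH[OF homog_Cons[OF Cons.prems(1)] homog_Cons[OF Cons.prems(2)]] Cons.IH[OF Cons.prems]
    by (simp add: add_ac)
qed (simp add: tpr_add_right)

lemma tst_scale_left: "homog \<kappa> F \<Longrightarrow> tst (\<lambda>xs. r * F xs) G xs = r * tst F G xs"
proof (induction xs arbitrary: F G \<kappa>)
  case (Cons x xs)
  show ?case
    using Cons.IH[OF homog_Cons[OF Cons.prems(1)]] Cons.IH[OF Cons.prems]
    by (simp add: distrib_left)
qed (simp add: tpr_scale_left)

lemma tst_scale_right: "homog \<kappa> G \<Longrightarrow> tst F (\<lambda>xs. r * G xs) xs = r * tst F G xs"
proof (induction xs arbitrary: F G \<kappa>)
  case (Cons x xs)
  show ?case
    using Cons.IH[OF homog_Cons[OF Cons.prems(1)]] Cons.IH[OF Cons.prems]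
    by (simp add: distrib_left)
qed (simp add: tpr_scale_right)

text \<open>Both sides are the same sum over triples: contractions \<open>a\<close> joining
  \<open>F\<close> to \<open>H\<close>, \<open>b\<close> joining \<open>G\<close> to
  \<open>H\<close>, and \<open>d\<close> joining \<open>F\<close> to \<open>G\<close>.
  \<open>Sm_spl\<close> sorts the contractions of the outer product by the inner factor they hit;
  permutation invariance brings the concatenated lists into a common order.\<close>

lemma tpr_assoc:
  assumes F: "homog f F" "perm_inv F" and G: "homog g G" "perm_inv G" and H: "homog h H" "perm_inv H"
  shows "tpr (tst F G) H = tpr F (tst G H)"
proof -
  define B where "B = nat (\<bar>f\<bar> + \<bar>g\<bar> + \<bar>h\<bar>)"
  define \<Phi> where "\<Phi> a b d = F (Lc a @ Lc d) * G (Lc b @ Rc d) * H (Rc a @ Rc b)" for a b d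
  have len: "length (a @ b) \<le> csum (a @ b)" if "a \<in> CS B" "b \<in> CS B" for a b
    by (rule length_le_csum) (use CS_con that in auto)
  have "tst F G (Lc cs) * H (Rc cs) = spl (\<lambda>a b. Sm B (\<lambda>d. \<Phi> a b d)) cs" for cs
  proof -
    have "tst F G (Lc cs) = spl (\<lambda>a b. tpr (\<lambda>ys. F (Lc a @ ys)) (\<lambda>ys. G (Lc b @ ys))) cs"
      unfolding tst_spl Lc_def spl_map by simp
    also have "\<dots> = spl (\<lambda>a b. Sm B (\<lambda>d. F (Lc a @ Lc d) * G (Lc b @ Rc d))) cs"
      by (intro spl_cong tpr_eq[OF homog_append[OF F(1)]]) (simp add: B_def)
    finally have "tst F G (Lc cs) * H (Rc cs) = H (Rc cs) * spl (\<lambda>a b. Sm B (\<lambda>d. F (Lc a @ Lc d) * G (Lc b @ Rc d))) cs"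
      by (simp add: mult.commute)
    then show ?thesis
      unfolding spl_mult_perm_inv[OF perm_inv_Rc[OF H(2)]] by (simp add: Sm_mult \<Phi>_def mult_ac)
  qed
  then have "tpr (tst F G) H = Sm B (\<lambda>cs. spl (\<lambda>a b. Sm B (\<lambda>d. \<Phi> a b d)) cs)"
    by (subst tpr_eq[OF homog_tst[OF F(1) G(1)]]) (simp_all add: B_def)
  also have "\<dots> = Sm B (\<lambda>a. Sm B (\<lambda>b. Sm B (\<lambda>d. \<Phi> a b d)))"
  proof (rule Sm_spl)
    \<comment> \<open>The frequency of \<open>H\<close> fixes the total frequency of the
      contractions ending in it, and thereby bounds their number by \<open>B\<close>.\<close>
    fix a b assume ab: "a \<in> CS B" "b \<in> CS B" "B < length a + length b"
    have "H (Rc a @ Rc b) = 0"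
    proof (rule ccontr)
      assume "H (Rc a @ Rc b) \<noteq> 0"
      then have "- int (csum (a @ b)) = h" using homogD[OF H(1)] by fastforce
      then show False using len[OF ab(1,2)] ab(3) by (simp add: B_def)
    qed
    then show "Sm B (\<lambda>d. \<Phi> a b d) = 0" by (simp add: \<Phi>_def Sm_def)
  qed
  finally have 1: "tpr (tst F G) H = Sm B (\<lambda>a. Sm B (\<lambda>b. Sm B (\<lambda>d. \<Phi> a b d)))" .
  have "F (Lc cs) * tst G H (Rc cs) = spl (\<lambda>d a. Sm B (\<lambda>b. \<Phi> a b d)) cs" for cs
  proof -
    have "tst G H (Rc cs) = spl (\<lambda>d a. tpr (\<lambda>ys. G (Rc d @ ys)) (\<lambda>ys. H (Rc a @ ys))) cs"
      unfolding tst_spl Rc_def spl_map by simp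
    also have "\<dots> = spl (\<lambda>d a. Sm B (\<lambda>b. G (Rc d @ Lc b) * H (Rc a @ Rc b))) cs"
      by (intro spl_cong tpr_eq'[OF homog_append[OF H(1)]]) (simp add: B_def)
    also have "\<dots> = spl (\<lambda>d a. Sm B (\<lambda>b. G (Lc b @ Rc d) * H (Rc a @ Rc b))) cs"
      by (intro spl_cong Sm_cong arg_cong2[where f = "(*)"] perm_invD[OF G(2)]) auto
    finally have "F (Lc cs) * tst G H (Rc cs) = spl (\<lambda>d a. F (Lc d @ Lc a) * Sm B (\<lambda>b. G (Lc b @ Rc d) * H (Rc a @ Rc b))) cs"
      using spl_mult_perm_inv[OF perm_inv_Lc[OF F(2)], of cs] by simp
    also have "\<dots> = spl (\<lambda>d a. F (Lc a @ Lc d) * Sm B (\<lambda>b. G (Lc b @ Rc d) * H (Rc a @ Rc b))) cs"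
      by (intro spl_cong arg_cong2[where f = "(*)"] perm_invD[OF F(2)]) auto
    finally show ?thesis by (simp add: Sm_mult \<Phi>_def mult_ac)
  qed
  then have "tpr F (tst G H) = Sm B (\<lambda>cs. spl (\<lambda>d a. Sm B (\<lambda>b. \<Phi> a b d)) cs)"
    by (subst tpr_eq[OF F(1)]) (simp_all add: B_def)
  also have "\<dots> = Sm B (\<lambda>d. Sm B (\<lambda>a. Sm B (\<lambda>b. \<Phi> a b d)))"
  proof (rule Sm_spl)
    fix d a assume ab: "d \<in> CS B" "a \<in> CS B" "B < length d + length a"
    have "F (Lc a @ Lc d) = 0"
    proof (rule ccontr)
      assume "F (Lc a @ Lc d) \<noteq> 0"
      then have "int (csum (d @ a)) = f" using homogD[OF F(1)] by fastforce
      then show False using len[OF ab(1,2)] ab(3) by (simp add: B_def)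
    qed
    then show "Sm B (\<lambda>b. \<Phi> a b d) = 0" by (simp add: \<Phi>_def Sm_def)
  qed
  also have "\<dots> = Sm B (\<lambda>a. Sm B (\<lambda>d. Sm B (\<lambda>b. \<Phi> a b d)))"
    by (rule Sm_swap)
  also have "\<dots> = Sm B (\<lambda>a. Sm B (\<lambda>b. Sm B (\<lambda>d. \<Phi> a b d)))"
    by (intro Sm_cong Sm_swap)
  finally show ?thesis using 1 by simp
qed

lemma tst_assoc:
  assumes "homog f F" "perm_inv F" "homog g G" "perm_inv G" "homog h H" "perm_inv H"
  shows "tst (tst F G) H xs = tst F (tst G H) xs"
  using assms
proof (induction xs arbitrary: F G H f g h)
  case (Cons x xs)
  note P = Cons.prems
  have "tst (\<lambda>ys. tst F G (x # ys)) H xs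
      = tst (tst (\<lambda>ys. F (x # ys)) G) H xs + tst (tst F (\<lambda>ys. G (x # ys))) H xs"
    using tst_add_left[of "f + g - snd x" "tst (\<lambda>ys. F (x # ys)) G" "tst F (\<lambda>ys. G (x # ys))" H xs]
      homog_tst[OF homog_Cons[OF P(1)] P(3)] homog_tst[OF P(1) homog_Cons[OF P(3)]]
    by (simp add: algebra_simps)
  moreover have "tst F (\<lambda>ys. tst G H (x # ys)) xs
      = tst F (tst (\<lambda>ys. G (x # ys)) H) xs + tst F (tst G (\<lambda>ys. H (x # ys))) xs"
    using tst_add_right[of "g + h - snd x" "tst (\<lambda>ys. G (x # ys)) H" "tst G (\<lambda>ys. H (x # ys))" F xs]
      homog_tst[OF homog_Cons[OF P(3)] P(5)] homog_tst[OF P(3) homog_Cons[OF P(5)]]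
    by (simp add: algebra_simps)
  ultimately show ?case
    using Cons.IH[OF homog_Cons[OF P(1)] perm_inv_Cons[OF P(2)] P(3-6)]
      Cons.IH[OF P(1,2) homog_Cons[OF P(3)] perm_inv_Cons[OF P(4)] P(5,6)]
      Cons.IH[OF P(1-4) homog_Cons[OF P(5)] perm_inv_Cons[OF P(6)]]
    by (simp only: tst.simps(2)[of "tst F G"] tst.simps(2)[of F] add.assoc)
qed (simp add: tpr_assoc)

end

text \<open>The operator D on Taylor coefficients: lists of length n see exactly the terms of degree
  n in p, so the jet part of D is multiplication by the length.\<close>

definition deg :: "lfun \<Rightarrow> lfun" where
  "deg F = (\<lambda>xs. cdeg (F xs) + of_nat (length xs) * F xs)"

lemma deg_Cons: "(\<lambda>ys. deg F (x # ys)) = (\<lambda>ys. deg (\<lambda>zs. F (x # zs)) ys + F (x # ys))"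
  by (auto simp: deg_def algebra_simps)

lemma homog_deg: "homog \<kappa> F \<Longrightarrow> homog \<kappa> (deg F)"
  unfolding homog_def deg_def by (metis add_0 cdeg_0 mult_zero_right)

lemma deg_add: "deg (\<lambda>xs. F xs + G xs) xs = deg F xs + deg G xs"
  and deg_diff: "deg (\<lambda>xs. F xs - G xs) xs = deg F xs - deg G xs"
  by (auto simp: deg_def cdeg_add cdeg_diff algebra_simps)

lemma deg_scale: "deg (\<lambda>xs. scal r * F xs) xs = scal r * deg F xs"
  by (simp add: deg_def cdeg_scal_mult distrib_left mult.left_commute)

lemma deg_sum: "deg (\<lambda>xs. \<Sum>i\<in>I. F i xs) xs = (\<Sum>i\<in>I. deg (F i) xs)"
  by (simp add: deg_def cdeg_sum sum.distrib sum_distrib_left)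

lemma deg_nth: "deg F xs $ h $ e = of_nat (e + 2 * h + length xs) * F xs $ h $ e"
proof -
  have "of_nat (length xs) * F xs = scal (of_nat (length xs)) * F xs"
    by (simp only: scal_of_nat)
  then show ?thesis unfolding deg_def
    by (simp only: fps_add_nth cdeg_nth scal_nth of_nat_add distrib_right)
qed

section \<open>D as a derivation of the star product, and the commutator\<close>

context weyl
begin

lemma cdeg_wt: "cdeg (wt cs) = of_nat (2 * length cs) * wt cs"
  unfolding wt_def cdeg_scal_mult cdeg_hbar by (simp only: mult_ac)

text \<open>A contraction removes one mode from each factor, which costs 2 in degree, and brings one
  hbar, which has weight 2. This balance is what the coefficient 2 of hbar in D provides.\<close>

lemma deg_tpr:
  assumes "homog \<kappa> F" "homog \<mu> G"
  shows "cdeg (tpr F G) = tpr (deg F) G + tpr F (deg G)"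
proof -
  define B where "B = nat \<kappa>"
  have e: "tpr F' G' = Sm B (\<lambda>cs. F' (Lc cs) * G' (Rc cs))" if "homog \<kappa> F'" for F' G'
    by (rule tpr_eq[OF that]) (simp add: B_def)
  have "cdeg (tpr F G) = (\<Sum>cs\<in>CS B. cdeg (wt cs) * (F (Lc cs) * G (Rc cs)) + wt cs * (cdeg (F (Lc cs)) * G (Rc cs) + F (Lc cs) * cdeg (G (Rc cs))))"
    unfolding e[OF assms(1)] Sm_def cdeg_sum by (simp only: cdeg_mult)
  also have "\<dots> = Sm B (\<lambda>cs. deg F (Lc cs) * G (Rc cs) + F (Lc cs) * deg G (Rc cs))"
    unfolding Sm_def cdeg_wt by (intro sum.cong refl) (simp add: deg_def algebra_simps)
  also have "\<dots> = tpr (deg F) G + tpr F (deg G)"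
    unfolding Sm_add e[OF assms(1)] e[OF homog_deg[OF assms(1)]] ..
  finally show ?thesis .
qed

lemma deg_tst:
  assumes "homog \<kappa> F" "homog \<mu> G"
  shows "deg (tst F G) xs = tst (deg F) G xs + tst F (deg G) xs"
  using assms
proof (induction xs arbitrary: F G \<kappa> \<mu>)
  case Nil
  then show ?case using deg_tpr by (simp add: deg_def)
next
  case (Cons x xs)
  note P = Cons.prems
  let ?F = "\<lambda>ys. F (x # ys)" and ?G = "\<lambda>ys. G (x # ys)"
  have "deg (tst F G) (x # xs) = deg (tst ?F G) xs + deg (tst F ?G) xs + tst ?F G xs + tst F ?G xs"
    by (simp add: deg_def cdeg_add algebra_simps)
  also have "\<dots> = (tst (deg ?F) G xs + tst ?F G xs) + tst ?F (deg G) xs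
      + tst (deg F) ?G xs + (tst F (deg ?G) xs + tst F ?G xs)"
    unfolding Cons.IH[OF homog_Cons[OF P(1)] P(2)] Cons.IH[OF P(1) homog_Cons[OF P(2)]]
    by (simp only: add_ac)
  also have "tst (deg ?F) G xs + tst ?F G xs = tst (\<lambda>ys. deg F (x # ys)) G xs"
    unfolding deg_Cons by (rule tst_add_left[OF homog_deg[OF homog_Cons[OF P(1)]] homog_Cons[OF P(1)], symmetric])
  also have "tst F (deg ?G) xs + tst F ?G xs = tst F (\<lambda>ys. deg G (x # ys)) xs"
    unfolding deg_Cons by (rule tst_add_right[OF homog_deg[OF homog_Cons[OF P(2)]] homog_Cons[OF P(2)], symmetric])
  finally show ?case by (simp only: tst.simps add_ac)
qed

lemma tst_diff_left: "homog \<kappa> F \<Longrightarrow> homog \<kappa> F' \<Longrightarrow> tst (\<lambda>xs. F xs - F' xs) G xs = tst F G xs - tst F' G xs"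
  using tst_add_left[of \<kappa> F "\<lambda>xs. - 1 * F' xs" G xs] homog_scale[of \<kappa> F' "- 1"] tst_scale_left[of \<kappa> F' "- 1" G xs]
  by simp

lemma tst_diff_right: "homog \<kappa> G \<Longrightarrow> homog \<kappa> G' \<Longrightarrow> tst F (\<lambda>xs. G xs - G' xs) xs = tst F G xs - tst F G' xs"
  using tst_add_right[of \<kappa> G "\<lambda>xs. - 1 * G' xs" F xs] homog_scale[of \<kappa> G' "- 1"] tst_scale_right[of \<kappa> G' F "- 1" xs]
  by simp

definition br :: "lfun \<Rightarrow> lfun \<Rightarrow> lfun" where
  "br F G = (\<lambda>xs. tst F G xs - tst G F xs)"

lemma br_Cons: "br F G (x # xs) = br (\<lambda>ys. F (x # ys)) G xs + br F (\<lambda>ys. G (x # ys)) xs"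
  by (simp add: br_def)

lemma br_Nil: "br F G [] = tpr F G - tpr G F"
  by (simp add: br_def)

lemma br_swap: "br G F xs = - br F G xs"
  by (simp add: br_def)

lemma homog_br: "homog \<kappa> F \<Longrightarrow> homog \<mu> G \<Longrightarrow> homog (\<kappa> + \<mu>) (br F G)"
  unfolding br_def using homog_tst[of \<kappa> F \<mu> G] homog_tst[of \<mu> G \<kappa> F]
  by (intro homog_diff) (simp_all add: add.commute)

lemma br_add_left: "homog \<kappa> F \<Longrightarrow> homog \<kappa> F' \<Longrightarrow> br (\<lambda>xs. F xs + F' xs) G xs = br F G xs + br F' G xs"
  by (simp add: br_def tst_add_left tst_add_right)

lemma br_add_right: "homog \<kappa> G \<Longrightarrow> homog \<kappa> G' \<Longrightarrow> br F (\<lambda>xs. G xs + G' xs) xs = br F G xs + br F G' xs"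
  by (simp add: br_def tst_add_left tst_add_right)

lemma br_diff_left: "homog \<kappa> F \<Longrightarrow> homog \<kappa> F' \<Longrightarrow> br (\<lambda>xs. F xs - F' xs) G xs = br F G xs - br F' G xs"
  by (simp add: br_def tst_diff_left tst_diff_right)

lemma br_diff_right: "homog \<kappa> G \<Longrightarrow> homog \<kappa> G' \<Longrightarrow> br F (\<lambda>xs. G xs - G' xs) xs = br F G xs - br F G' xs"
  by (simp add: br_def tst_diff_left tst_diff_right)

lemma br_scale_left: "homog \<kappa> F \<Longrightarrow> br (\<lambda>xs. r * F xs) G xs = r * br F G xs"
  by (simp add: br_def tst_scale_left tst_scale_right right_diff_distrib)

lemma br_scale_right: "homog \<kappa> G \<Longrightarrow> br F (\<lambda>xs. r * G xs) xs = r * br F G xs"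
  by (simp add: br_def tst_scale_left tst_scale_right right_diff_distrib)

lemma br_zero [simp]: "br (\<lambda>xs. 0) G xs = 0" "br F (\<lambda>xs. 0) xs = 0"
  by (simp_all add: br_def)

lemma br_sum_left:
  "(\<And>i. i \<in> I \<Longrightarrow> homog \<kappa> (F i)) \<Longrightarrow> br (\<lambda>xs. \<Sum>i\<in>I. F i xs) G xs = (\<Sum>i\<in>I. br (F i) G xs)"
proof (induction I rule: infinite_finite_induct)
  case (insert i I)
  then show ?case using br_add_left[of \<kappa> "F i" "\<lambda>xs. \<Sum>i\<in>I. F i xs" G xs] homog_sum[of I \<kappa> F] by simp
qed simp_all

lemma deg_br:
  assumes "homog \<kappa> F" "homog \<mu> G"
  shows "deg (br F G) xs = br (deg F) G xs + br F (deg G) xs"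
  unfolding br_def deg_diff deg_tst[OF assms] deg_tst[OF assms(2,1)] by simp

text \<open>Arranged as the derivation rule for bracketing with \<open>H\<close>, the form in which
  the recursions of two solutions combine. Associativity brings every double bracket to right-nested
  products, and these cancel.\<close>

lemma jacobi:
  assumes F: "homog f F" "perm_inv F" and G: "homog g G" "perm_inv G" and H: "homog h H" "perm_inv H"
  shows "br (br F H) G xs + br F (br G H) xs = br (br F G) H xs"
proof -
  have L: "br (br A C) E xs = tst A (tst C E) xs - tst C (tst A E) xs - tst E (tst A C) xs + tst E (tst C A) xs"
    if "homog a A" "perm_inv A" "homog c C" "perm_inv C" "homog e E" "perm_inv E" for A C E a c e
  proof -
    have h: "homog (a + c) (tst A C)" "homog (a + c) (tst C A)"
      using homog_tst that(1,3) by (metis add.commute)+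
    have "br (br A C) E xs = tst (tst A C) E xs - tst (tst C A) E xs - (tst E (tst A C) xs - tst E (tst C A) xs)"
      unfolding br_def tst_diff_left[OF h] tst_diff_right[OF h] ..
    then show ?thesis
      using tst_assoc[OF that] tst_assoc[OF that(3,4,1,2,5,6)] by simp
  qed
  have "br F (br G H) xs = - br (br G H) F xs" by (rule br_swap)
  then show ?thesis
    unfolding L[OF F H G] L[OF F G H] using L[OF G H F] by simp
qed

lemma wt_mult_nth_0: "cs \<noteq> [] \<Longrightarrow> (wt cs * r) $ 0 = 0"
  unfolding wt_def by (simp add: mult.assoc fps_mult_nth_0 zero_power)

text \<open>Each contraction brings a factor hbar, so at hbar = 0 only the empty list survives and
  the product is the ordinary commutative one.\<close>

lemma tpr_nth_0:
  assumes "homog \<kappa> F"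
  shows "tpr F G $ 0 = (F [] * G []) $ 0"
proof -
  have "tpr F G $ 0 = (\<Sum>cs\<in>CS (nat \<kappa>). (wt cs * (F (Lc cs) * G (Rc cs))) $ 0)"
    by (subst tpr_eq[OF assms, of "nat \<kappa>"]) (simp_all add: Sm_def fps_sum_nth)
  also have "\<dots> = (\<Sum>cs\<in>{[]}. (wt cs * (F (Lc cs) * G (Rc cs))) $ 0)"
  proof (rule sum.mono_neutral_right)
    show "{[]} \<subseteq> CS (nat \<kappa>)" by (simp add: CS_def)
    show "\<forall>cs\<in>CS (nat \<kappa>) - {[]}. (wt cs * (F (Lc cs) * G (Rc cs))) $ 0 = 0"
      using wt_mult_nth_0 by blast
  qed simp
  finally show ?thesis by simp
qed

lemma tst_comm_nth_0:
  assumes "homog \<kappa> F" "homog \<mu> G"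
  shows "tst F G xs $ 0 = tst G F xs $ 0"
  using assms
proof (induction xs arbitrary: F G \<kappa> \<mu>)
  case Nil
  then show ?case using tpr_nth_0[OF Nil(1), of G] tpr_nth_0[OF Nil(2), of F] by (simp add: mult.commute)
next
  case (Cons x xs)
  show ?case
    using Cons.IH[OF homog_Cons[OF Cons.prems(1)] Cons.prems(2)]
      Cons.IH[OF Cons.prems(1) homog_Cons[OF Cons.prems(2)]]
    by simp
qed

lemma br_nth_0: "homog \<kappa> F \<Longrightarrow> homog \<mu> G \<Longrightarrow> br F G xs $ 0 = 0"
  unfolding br_def using tst_comm_nth_0 by simp

text \<open>Constants are central: no contraction can hit them. Hence identities that hold only up
  to constants may still be inserted into brackets.\<close>

lemma br_const_left:
  assumes "\<And>xs. xs \<noteq> [] \<Longrightarrow> K xs = 0"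
  shows "br K F xs = 0"
proof -
  have K: "(\<lambda>ys. K (x # ys)) = (\<lambda>ys. 0)" for x using assms by auto
  have k: "K (Lc cs) = (if cs = [] then K [] else 0)" "K (Rc cs) = (if cs = [] then K [] else 0)" for cs
    using assms by (auto simp: Lc_def Rc_def)
  have s: "{cs. set cs \<subseteq> con \<and> K (Lc cs) \<noteq> 0 \<and> F (Rc cs) \<noteq> 0} = (if K [] \<noteq> 0 \<and> F [] \<noteq> 0 then {[]} else {})"
    "{cs. set cs \<subseteq> con \<and> F (Lc cs) \<noteq> 0 \<and> K (Rc cs) \<noteq> 0} = (if K [] \<noteq> 0 \<and> F [] \<noteq> 0 then {[]} else {})" for F
    unfolding k by auto
  have t: "tpr F K = F [] * K []" "tpr K F = K [] * F []" for F
    unfolding tpr_def s by auto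
  have "tst F K xs = F xs * K []" "tst K F xs = F xs * K []"
    by (induction xs arbitrary: F) (simp_all add: t K mult.commute)
  then show ?thesis by (simp add: br_def)
qed

section \<open>Brackets with linear and quadratic functionals\<close>

definition lin :: "(nat \<Rightarrow> complex) \<Rightarrow> int \<Rightarrow> lfun" where
  "lin u l = (\<lambda>zs. case zs of [(\<mu>, j)] \<Rightarrow> (if j = l \<and> \<mu> \<in> {1..N} then scal (u \<mu>) else 0) | _ \<Rightarrow> 0)"

lemma lin_simps [simp]: "lin u l [] = 0" "lin u l (x # y # zs) = 0"
  "lin u l [x] = (if snd x = l \<and> fst x \<in> {1..N} then scal (u (fst x)) else 0)"
  by (auto simp: lin_def split: prod.splits)

lemma tpr_single:
  assumes "\<And>cs. set cs \<subseteq> con \<Longrightarrow> F (Lc cs) \<noteq> 0 \<Longrightarrow> G (Rc cs) \<noteq> 0 \<Longrightarrow> \<exists>\<alpha> \<mu>. cs = [(\<alpha>, \<mu>, k)]" and "0 < k"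
  shows "tpr F G = (\<Sum>\<alpha>\<in>{1..N}. \<Sum>\<mu>\<in>{1..N}.
    fps_X * scal (\<i> * of_nat k) * (scal (etai \<alpha> \<mu>) * (F [(\<alpha>, int k)] * G [(\<mu>, - int k)])))"
proof -
  let ?t = "\<lambda>cs. wt cs * (F (Lc cs) * G (Rc cs))"
  let ?I = "(\<lambda>(\<alpha>, \<mu>). [(\<alpha>, \<mu>, k)]) ` ({1..N} \<times> {1..N})"
  have "tpr F G = (\<Sum>cs\<in>?I. ?t cs)"
    unfolding tpr_def
  proof (rule sum.mono_neutral_left)
    show "{cs. set cs \<subseteq> con \<and> F (Lc cs) \<noteq> 0 \<and> G (Rc cs) \<noteq> 0} \<subseteq> ?I"
    proof
      fix cs assume "cs \<in> {cs. set cs \<subseteq> con \<and> F (Lc cs) \<noteq> 0 \<and> G (Rc cs) \<noteq> 0}"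
      then have c: "set cs \<subseteq> con" "F (Lc cs) \<noteq> 0" "G (Rc cs) \<noteq> 0" by auto
      then obtain \<alpha> \<mu> where "cs = [(\<alpha>, \<mu>, k)]" using assms(1) by blast
      then show "cs \<in> ?I" using c(1) by (auto simp: con_def)
    qed
    show "\<forall>cs\<in>?I - {cs. set cs \<subseteq> con \<and> F (Lc cs) \<noteq> 0 \<and> G (Rc cs) \<noteq> 0}. ?t cs = 0"
    proof
      fix cs assume c: "cs \<in> ?I - {cs. set cs \<subseteq> con \<and> F (Lc cs) \<noteq> 0 \<and> G (Rc cs) \<noteq> 0}"
      then have "set cs \<subseteq> con" using assms(2) by (auto simp: con_def)
      then have "F (Lc cs) = 0 \<or> G (Rc cs) = 0" using c by blast
      then show "?t cs = 0" by auto
    qed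
  qed simp
  also have "\<dots> = (\<Sum>(\<alpha>, \<mu>)\<in>{1..N} \<times> {1..N}. ?t [(\<alpha>, \<mu>, k)])"
    by (subst sum.reindex) (auto simp: inj_on_def case_prod_unfold)
  also have "\<dots> = (\<Sum>\<alpha>\<in>{1..N}. \<Sum>\<mu>\<in>{1..N}. ?t [(\<alpha>, \<mu>, k)])"
    by (simp add: sum.cartesian_product)
  finally show ?thesis
    by (simp add: wt_def scal_mult mult_ac)
qed

text \<open>The canonical commutation relation. The hypotheses on \<open>u\<close> make it the row
  \<beta> of the matrix inverse to \<open>etai\<close>. Differentiating the linear form leaves a
  central constant, so in the induction all derivatives fall on \<open>F\<close>, and contractions
  are needed at p = 0 only.\<close>

lemma br_lin:
  assumes F: "homog \<kappa> F" "perm_inv F"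
    and \<beta>: "\<beta> \<in> {1..N}"
    and u1: "\<And>\<alpha>. \<alpha> \<in> {1..N} \<Longrightarrow> (\<Sum>\<mu>\<in>{1..N}. etai \<alpha> \<mu> * u \<mu>) = (if \<alpha> = \<beta> then 1 else 0)"
    and u2: "\<And>\<alpha>. \<alpha> \<in> {1..N} \<Longrightarrow> (\<Sum>\<mu>\<in>{1..N}. etai \<mu> \<alpha> * u \<mu>) = (if \<alpha> = \<beta> then 1 else 0)"
  shows "br F (lin u l) xs = - (fps_X * scal (\<i> * of_int l) * F ((\<beta>, - l) # xs))"
  using F
proof (induction xs arbitrary: F \<kappa>)
  case (Cons x xs)
  have 1: "br F (\<lambda>ys. lin u l (x # ys)) xs = 0"
    unfolding br_swap[of F] by (subst br_const_left) (auto simp: neq_Nil_conv)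
  have "br (\<lambda>ys. F (x # ys)) (lin u l) xs = - (fps_X * scal (\<i> * of_int l) * F (x # (\<beta>, - l) # xs))"
    by (rule Cons.IH[OF homog_Cons[OF Cons.prems(1)] perm_inv_Cons[OF Cons.prems(2)]])
  also have "F (x # (\<beta>, - l) # xs) = F ((\<beta>, - l) # x # xs)"
    by (rule perm_invD[OF Cons.prems(2)]) simp
  finally show ?case by (simp add: br_Cons 1)
next
  case Nil
  have len: "\<exists>x. zs = [x] \<and> snd x = l" if "lin u l zs \<noteq> 0" for zs
    using that by (auto simp: lin_def split: list.splits if_splits)
  \<comment> \<open>A right factor loses modes of negative frequency only, so this order contributes
    for l < 0; the opposite order takes l > 0, and the minus sign of the commutator merges both into
    one formula.\<close>
  have R: "tpr F (lin u l) = (if l < 0 then - (fps_X * scal (\<i> * of_int l) * F [(\<beta>, - l)]) else 0)"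
  proof (cases "l < 0")
    case True
    have l: "int (nat (- l)) = - l" using True by simp
    have "tpr F (lin u l) = (\<Sum>\<alpha>\<in>{1..N}. \<Sum>\<mu>\<in>{1..N}.
        fps_X * scal (\<i> * of_nat (nat (- l))) * (scal (etai \<alpha> \<mu>) * (F [(\<alpha>, int (nat (- l)))] * lin u l [(\<mu>, - int (nat (- l)))])))"
    proof (rule tpr_single)
      fix cs assume "lin u l (Rc cs) \<noteq> 0"
      from len[OF this] show "\<exists>\<alpha> \<mu>. cs = [(\<alpha>, \<mu>, nat (- l))]" by (auto simp: Rc_def)
    qed (use True in simp)
    also have "\<dots> = fps_X * scal (\<i> * of_nat (nat (- l))) * (\<Sum>\<alpha>\<in>{1..N}. F [(\<alpha>, - l)] * scal (\<Sum>\<mu>\<in>{1..N}. etai \<alpha> \<mu> * u \<mu>))"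
      unfolding l by (simp add: sum_distrib_left scal_sum scal_mult mult_ac)
    also have "(\<Sum>\<alpha>\<in>{1..N}. F [(\<alpha>, - l)] * scal (\<Sum>\<mu>\<in>{1..N}. etai \<alpha> \<mu> * u \<mu>)) = (\<Sum>\<alpha>\<in>{1..N}. if \<alpha> = \<beta> then F [(\<beta>, - l)] else 0)"
      by (rule sum.cong[OF refl], simp only: u1) auto
    also have "of_nat (nat (- l)) = - (of_int l :: complex)"
      using True by simp
    finally show ?thesis using True \<beta> by (simp add: scal_minus)
  next
    case False
    have e: "{cs. set cs \<subseteq> con \<and> F (Lc cs) \<noteq> 0 \<and> lin u l (Rc cs) \<noteq> 0} = {}"
      using len False by (fastforce simp: Rc_def con_def)
    show ?thesis using False unfolding tpr_def e by simp
  qed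
  have L: "tpr (lin u l) F = (if l > 0 then fps_X * scal (\<i> * of_int l) * F [(\<beta>, - l)] else 0)"
  proof (cases "l > 0")
    case True
    have l: "int (nat l) = l" using True by simp
    have "tpr (lin u l) F = (\<Sum>\<alpha>\<in>{1..N}. \<Sum>\<mu>\<in>{1..N}.
        fps_X * scal (\<i> * of_nat (nat l)) * (scal (etai \<alpha> \<mu>) * (lin u l [(\<alpha>, int (nat l))] * F [(\<mu>, - int (nat l))])))"
    proof (rule tpr_single)
      fix cs assume "lin u l (Lc cs) \<noteq> 0"
      from len[OF this] show "\<exists>\<alpha> \<mu>. cs = [(\<alpha>, \<mu>, nat l)]" by (auto simp: Lc_def)
    qed (use True in simp)
    also have "\<dots> = (\<Sum>\<mu>\<in>{1..N}. \<Sum>\<alpha>\<in>{1..N}.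
        fps_X * scal (\<i> * of_nat (nat l)) * (scal (etai \<alpha> \<mu>) * (lin u l [(\<alpha>, int (nat l))] * F [(\<mu>, - int (nat l))])))"
      by (rule sum.swap)
    also have "\<dots> = fps_X * scal (\<i> * of_nat (nat l)) * (\<Sum>\<mu>\<in>{1..N}. F [(\<mu>, - l)] * scal (\<Sum>\<alpha>\<in>{1..N}. etai \<alpha> \<mu> * u \<alpha>))"
      unfolding l by (simp add: sum_distrib_left scal_sum scal_mult mult_ac)
    also have "(\<Sum>\<mu>\<in>{1..N}. F [(\<mu>, - l)] * scal (\<Sum>\<alpha>\<in>{1..N}. etai \<alpha> \<mu> * u \<alpha>)) = (\<Sum>\<mu>\<in>{1..N}. if \<mu> = \<beta> then F [(\<beta>, - l)] else 0)"
      by (rule sum.cong[OF refl], simp only: u2) auto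
    also have "of_nat (nat l) = (of_int l :: complex)"
      using True by simp
    finally show ?thesis using True \<beta> by simp
  next
    case False
    have e: "{cs. set cs \<subseteq> con \<and> lin u l (Lc cs) \<noteq> 0 \<and> F (Rc cs) \<noteq> 0} = {}"
      using len False by (fastforce simp: Lc_def con_def)
    show ?thesis using False unfolding tpr_def e by simp
  qed
  show ?case
    unfolding br_Nil R L by (cases l "0::int" rule: linorder_cases) auto
qed

text \<open>The zero mode of the quadratic functional \<open>\<eta>(u, u) / 2\<close> generates translations in \<open>x\<close>.\<close>

lemma br_quad:
  assumes F: "homog \<kappa> F" "perm_inv F" "\<And>\<nu> l xs. \<nu> \<notin> {1..N} \<Longrightarrow> F ((\<nu>, l) # xs) = 0"
    and Q: "homog 0 Q" "Q [] = 0"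
    and dQ: "\<And>\<nu> l. \<nu> \<in> {1..N} \<Longrightarrow> (\<lambda>ys. Q ((\<nu>, l) # ys)) = lin (\<eta> \<nu>) (- l)"
    and dQ0: "\<And>\<nu> l ys. \<nu> \<notin> {1..N} \<Longrightarrow> Q ((\<nu>, l) # ys) = 0"
    and u1: "\<And>\<alpha> \<beta>. \<alpha> \<in> {1..N} \<Longrightarrow> \<beta> \<in> {1..N} \<Longrightarrow> (\<Sum>\<mu>\<in>{1..N}. etai \<alpha> \<mu> * \<eta> \<beta> \<mu>) = (if \<alpha> = \<beta> then 1 else 0)"
    and u2: "\<And>\<alpha> \<beta>. \<alpha> \<in> {1..N} \<Longrightarrow> \<beta> \<in> {1..N} \<Longrightarrow> (\<Sum>\<mu>\<in>{1..N}. etai \<mu> \<alpha> * \<eta> \<beta> \<mu>) = (if \<alpha> = \<beta> then 1 else 0)"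
  shows "br F Q xs = fps_X * scal (\<i> * of_int \<kappa>) * F xs"
  using F
proof (induction xs arbitrary: F \<kappa>)
  case Nil
  \<comment> \<open>A nonempty contraction list has nonzero frequency, whereas \<open>Q\<close> has
    frequency 0 and no constant term.\<close>
  have "Q (Rc cs) = 0" "Q (Lc cs) = 0" if "set cs \<subseteq> con" for cs
  proof -
    have "csum cs \<noteq> 0" if "cs \<noteq> []"
      using that \<open>set cs \<subseteq> con\<close> length_le_csum[of cs] by (metis le_zero_eq length_0_conv)
    then have "cs \<noteq> [] \<Longrightarrow> freq (Rc cs) \<noteq> 0" "cs \<noteq> [] \<Longrightarrow> freq (Lc cs) \<noteq> 0" by auto
    then show "Q (Rc cs) = 0" "Q (Lc cs) = 0" using homogD[OF Q(1)] Q(2) by (cases cs; force)+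
  qed
  then have e: "{cs. set cs \<subseteq> con \<and> F (Lc cs) \<noteq> 0 \<and> Q (Rc cs) \<noteq> 0} = {}"
    "{cs. set cs \<subseteq> con \<and> Q (Lc cs) \<noteq> 0 \<and> F (Rc cs) \<noteq> 0} = {}" by auto
  have "br F Q [] = 0" unfolding br_Nil tpr_def e by simp
  moreover have "F [] = 0 \<or> \<kappa> = 0" using homogD[OF Nil(1), of "[]"] by auto
  ultimately show ?case by auto
next
  case (Cons x xs)
  obtain \<nu> l where x: "x = (\<nu>, l)" by force
  have "F (y # x # xs) = 0" if "fst y \<notin> {1..N}" for y xs
    using Cons.prems(3)[of "fst y" "snd y"] that by simp
  then have s: "F (x # (\<nu>, l) # xs) = 0" if "\<nu> \<notin> {1..N}" for \<nu> l xs
    using perm_invD[OF Cons.prems(2), of "x # (\<nu>, l) # xs" "(\<nu>, l) # x # xs"] that by simp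
  have IH: "br (\<lambda>ys. F (x # ys)) Q xs = fps_X * scal (\<i> * of_int (\<kappa> - l)) * F (x # xs)"
    using Cons.IH[OF homog_Cons[OF Cons.prems(1)] perm_inv_Cons[OF Cons.prems(2)] s] x by simp
  have "br F (\<lambda>ys. Q (x # ys)) xs = fps_X * scal (\<i> * of_int l) * F (x # xs)"
  proof (cases "\<nu> \<in> {1..N}")
    case True
    have "br F (lin (\<eta> \<nu>) (- l)) xs = - (fps_X * scal (\<i> * of_int (- l)) * F ((\<nu>, - (- l)) # xs))"
      by (rule br_lin[OF Cons.prems(1,2) True]) ((rule u1[OF _ True] u2[OF _ True]), assumption)+
    then show ?thesis
      unfolding x dQ[OF True] by (simp add: scal_minus)
  next
    case False
    then have "(\<lambda>ys. Q (x # ys)) = (\<lambda>ys. 0)" using dQ0 x by auto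
    then show ?thesis using Cons.prems(3)[OF False] x by simp
  qed
  with IH show ?case
    unfolding br_Cons by (simp add: scal_diff right_diff_distrib left_diff_distrib)
qed

text \<open>Since \<open>l [[A p, H], B q] + k [A p, [B q, H]]\<close> telescopes along \<open>k\<^sup>p l\<^sup>q\<close>, the Jacobi identity
  turns the recursions for \<open>A\<close> and \<open>B\<close> into one for the weighted sum of their brackets.\<close>

lemma bracket_modes_vanish:
  assumes A: "\<And>p. homog k (A p)" "\<And>p. perm_inv (A p)"
    and B: "\<And>p. homog l (B p)" "\<And>p. perm_inv (B p)"
    and H: "homog 0 H" "perm_inv H"
    and A0: "\<And>xs. deg (A 0) xs = A 0 xs" and B0: "\<And>xs. deg (B 0) xs = B 0 xs"
    and AS: "\<And>p xs. fps_X * scal (\<i> * of_int k) * (deg (A (Suc p)) xs - A (Suc p) xs) = br (A p) H xs"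
    and BS: "\<And>p xs. fps_X * scal (\<i> * of_int l) * (deg (B (Suc p)) xs - B (Suc p) xs) = br (B p) H xs"
    and kl: "k \<noteq> 0" "l \<noteq> 0" and xs: "xs \<noteq> []"
  shows "(\<Sum>p\<le>n. scal (of_int (k ^ p * l ^ (n - p))) * br (A p) (B (n - p)) xs) = 0"
  using xs
proof (induction n arbitrary: xs)
  define M where "M n = (\<lambda>xs. \<Sum>p\<le>n. scal (of_int (k ^ p * l ^ (n - p))) * br (A p) (B (n - p)) xs)" for n
  define KA where "KA p = (\<lambda>xs. deg (A p) xs - A p xs)" for p
  define KB where "KB p = (\<lambda>xs. deg (B p) xs - B p xs)" for p
  define c where "c = fps_X * scal (\<i> * of_int (k * l))"
  have KA: "homog k (KA p)" and KB: "homog l (KB p)" for p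
    unfolding KA_def KB_def by (intro homog_diff homog_deg A B)+
  have KA0: "KA 0 = (\<lambda>xs. 0)" and KB0: "KB 0 = (\<lambda>xs. 0)"
    by (auto simp: KA_def KB_def A0 B0)
  have hbr: "homog (k + l) (br (A p) (B q))" for p q
    by (rule homog_br[OF A(1) B(1)])
  have dbr: "deg (br (A p) (B q)) xs - 2 * br (A p) (B q) xs = br (KA p) (B q) xs + br (A p) (KB q) xs" for p q xs
    unfolding deg_br[OF A(1) B(1)] KA_def KB_def br_diff_left[OF homog_deg[OF A(1)] A(1)]
      br_diff_right[OF homog_deg[OF B(1)] B(1)] by simp
  have "deg (M n) xs = (\<Sum>p\<le>n. scal (of_int (k ^ p * l ^ (n - p))) * deg (br (A p) (B (n - p))) xs)" for n xs
    unfolding M_def deg_sum deg_scale ..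
  then have dM: "deg (M n) xs - 2 * M n xs = (\<Sum>p\<le>n. scal (of_int (k ^ p * l ^ (n - p))) *
      (br (KA p) (B (n - p)) xs + br (A p) (KB (n - p)) xs))" for n xs
    unfolding dbr[symmetric] M_def by (simp add: sum_distrib_left sum_subtractf right_diff_distrib mult.left_commute)
  have fin: "M n xs = 0" if c0: "c * (deg (M n) xs - 2 * M n xs) = 0" and ne: "xs \<noteq> []" for n xs
  proof (rule coeffs_eqI)
    fix h e
    have "c \<noteq> 0"
    proof
      assume "c = 0"
      then have "c $ 1 $ 0 = 0" by simp
      then show False using kl by (simp add: c_def scal_def)
    qed
    then have "deg (M n) xs = 2 * M n xs" using c0 by simp
    then have "deg (M n) xs $ h $ e = 2 * M n xs $ h $ e"
      using scal_nth[of 2 "M n xs" h e] scal_of_nat[of 2] by (metis of_nat_numeral)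
    then have *: "(of_nat (e + 2 * h + length xs) - 2) * M n xs $ h $ e = 0"
      unfolding deg_nth by (simp add: left_diff_distrib)
    \<comment> \<open>The order h = 0 vanishes because brackets are divisible by hbar. For h >= 1
      and a nonempty list the eigenvalue e + 2h + length - 2 is positive; on the empty list it would
      be 0 at e = 0, h = 1.\<close>
    show "M n xs $ h $ e = 0 $ h $ e"
    proof (cases "h = 0")
      case True
      then show ?thesis using br_nth_0[OF A(1) B(1)] by (simp add: M_def fps_sum_nth scal_def)
    next
      case False
      then obtain h' l' where "h = Suc h'" "length xs = Suc l'" using ne by (metis length_0_conv not0_implies_Suc)
      then have "of_nat (e + 2 * h + length xs) - 2 = (of_nat (e + 2 * h' + Suc l') :: complex)" by simp
      then have "of_nat (e + 2 * h + length xs) - 2 \<noteq> (0 :: complex)"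
        by (metis add_Suc_right nat.simps(3) of_nat_eq_0_iff)
      then show ?thesis using * by simp
    qed
  qed
  {
    case 0
    show ?case using fin[of 0 xs] dM[of 0 xs] 0 by (simp add: M_def KA0 KB0)
  next
    case (Suc n)
    have l1: "br (br (A p) H) (B q) xs = fps_X * scal (\<i> * of_int k) * br (KA (Suc p)) (B q) xs" for p q
      unfolding AS[symmetric] KA_def[symmetric] br_scale_left[OF KA, symmetric]
      by (rule arg_cong2[where f = "\<lambda>f x. br f (B q) x"]) (auto simp: KA_def AS)
    have l2: "br (A p) (br (B q) H) xs = fps_X * scal (\<i> * of_int l) * br (A p) (KB (Suc q)) xs" for p q
      unfolding br_scale_right[OF KB, symmetric]
      by (rule arg_cong2[where f = "\<lambda>f x. br (A p) f x"]) (auto simp: KB_def BS)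
    have "c * (deg (M (Suc n)) xs - 2 * M (Suc n) xs)
      = c * (\<Sum>p\<le>Suc n. scal (of_int (k ^ p * l ^ (Suc n - p))) * br (KA p) (B (Suc n - p)) xs)
      + c * (\<Sum>p\<le>Suc n. scal (of_int (k ^ p * l ^ (Suc n - p))) * br (A p) (KB (Suc n - p)) xs)"
      by (simp only: dM distrib_left sum.distrib)
    \<comment> \<open>The initial values are killed by D - 1, so the first term of this sum and the
      last term of the next one drop out. After the shift both sums carry the same weights times k
      l.\<close>
    also have "(\<Sum>p\<le>Suc n. scal (of_int (k ^ p * l ^ (Suc n - p))) * br (KA p) (B (Suc n - p)) xs)
      = (\<Sum>p\<le>n. scal (of_int (k ^ Suc p * l ^ (n - p))) * br (KA (Suc p)) (B (n - p)) xs)"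
      by (subst sum.atMost_Suc_shift) (simp add: KA0)
    also have "(\<Sum>p\<le>Suc n. scal (of_int (k ^ p * l ^ (Suc n - p))) * br (A p) (KB (Suc n - p)) xs)
      = (\<Sum>p\<le>n. scal (of_int (k ^ p * l ^ Suc (n - p))) * br (A p) (KB (Suc (n - p))) xs)"
      by (subst sum.atMost_Suc) (simp add: KB0 Suc_diff_le)
    also have "c * (\<Sum>p\<le>n. scal (of_int (k ^ Suc p * l ^ (n - p))) * br (KA (Suc p)) (B (n - p)) xs)
      = (\<Sum>p\<le>n. scal (of_int (k * l)) * scal (of_int (k ^ p * l ^ (n - p))) * br (br (A p) H) (B (n - p)) xs)"
      unfolding sum_distrib_left l1 c_def by (intro sum.cong refl) (simp add: scal_mult mult_ac)
    also have "c * (\<Sum>p\<le>n. scal (of_int (k ^ p * l ^ Suc (n - p))) * br (A p) (KB (Suc (n - p))) xs)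
      = (\<Sum>p\<le>n. scal (of_int (k * l)) * scal (of_int (k ^ p * l ^ (n - p))) * br (A p) (br (B (n - p)) H) xs)"
      unfolding sum_distrib_left l2 c_def by (intro sum.cong refl) (simp add: scal_mult mult_ac)
    finally have "c * (deg (M (Suc n)) xs - 2 * M (Suc n) xs)
      = (\<Sum>p\<le>n. scal (of_int (k * l)) * (scal (of_int (k ^ p * l ^ (n - p))) * br (br (A p) (B (n - p))) H xs))"
      unfolding sum.distrib[symmetric] distrib_left[symmetric] jacobi[OF A B H] by (simp only: mult.assoc)
    also have "\<dots> = scal (of_int (k * l)) * br (M n) H xs"
      unfolding M_def br_sum_left[OF homog_scale[OF hbr]] br_scale_left[OF hbr] sum_distrib_left ..
    \<comment> \<open>By induction \<open>M n\<close> is constant, hence central.\<close>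
    also have "br (M n) H xs = 0"
      unfolding M_def by (rule br_const_left) (rule Suc.IH)
    finally show ?case
      using fin[of "Suc n" xs] Suc.prems by (simp add: M_def)
  }
qed

end

section \<open>Polynomial dependence on the frequencies\<close>

definition polyf :: "(int \<Rightarrow> complex) \<Rightarrow> bool" where
  "polyf f \<longleftrightarrow> (\<exists>p. \<forall>t. f t = poly p (of_int t))"

lemma polyfI: "(\<And>t. f t = poly p (of_int t)) \<Longrightarrow> polyf f"
  unfolding polyf_def by blast

lemma polyf_const [simp]: "polyf (\<lambda>t. c)"
  by (rule polyfI[of _ "[:c:]"]) simp

lemma polyf_add: "polyf f \<Longrightarrow> polyf g \<Longrightarrow> polyf (\<lambda>t. f t + g t)"
  unfolding polyf_def by (metis poly_add)

lemma polyf_mult: "polyf f \<Longrightarrow> polyf g \<Longrightarrow> polyf (\<lambda>t. f t * g t)"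
  unfolding polyf_def by (metis poly_mult)

lemma polyf_power: "polyf f \<Longrightarrow> polyf (\<lambda>t. f t ^ n)"
  by (induction n) (simp_all add: polyf_mult)

lemma polyf_sum: "(\<And>i. i \<in> I \<Longrightarrow> polyf (f i)) \<Longrightarrow> polyf (\<lambda>t. \<Sum>i\<in>I. f i t)"
  by (induction I rule: infinite_finite_induct) (simp_all add: polyf_add)

definition linf :: "(int \<Rightarrow> int) \<Rightarrow> bool" where
  "linf k \<longleftrightarrow> (\<exists>a b. k = (\<lambda>t. a + b * t))"

lemma linfI: "linf (\<lambda>t. a + b * t)"
  unfolding linf_def by blast

lemma linf_diff: "linf k \<Longrightarrow> linf l \<Longrightarrow> linf (\<lambda>t. k t - l t)"
proof -
  assume "linf k" "linf l"
  then obtain a b c d where "k = (\<lambda>t. a + b * t)" "l = (\<lambda>t. c + d * t)" unfolding linf_def by blast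
  then have "(\<lambda>t. k t - l t) = (\<lambda>t. (a - c) + (b - d) * t)" by (auto simp: algebra_simps)
  then show ?thesis using linfI by simp
qed

lemma polyf_linf: "polyf f \<Longrightarrow> linf k \<Longrightarrow> polyf (\<lambda>t. f (k t))"
proof -
  assume "polyf f" "linf k"
  then obtain p a b where p: "\<And>t. f t = poly p (of_int t)" and k: "k = (\<lambda>t. a + b * t)"
    unfolding linf_def polyf_def by blast
  show ?thesis
    by (rule polyfI[of _ "pcompose p [:of_int a, of_int b:]"]) (simp add: p k poly_pcompose mult.commute)
qed

lemma polyf_of_int: "polyf (\<lambda>t. of_int t)"
  by (rule polyfI[of _ "[:0, 1:]"]) simp

lemma polyf_of_linf: "linf k \<Longrightarrow> polyf (\<lambda>t. of_int (k t))"
  by (rule polyf_linf[OF polyf_of_int])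

lemma polyf_eq_0:
  assumes "polyf f" "infinite {t. f t = 0}"
  shows "f t = 0"
proof -
  obtain p where p: "\<And>t. f t = poly p (of_int t)" using assms(1) unfolding polyf_def by blast
  have "p = 0"
  proof (rule ccontr)
    assume "p \<noteq> 0"
    then have "finite {x. poly p x = 0}" by (rule poly_roots_finite)
    then have "finite ((of_int :: int \<Rightarrow> complex) -` {x. poly p x = 0})"
      by (rule finite_vimageI) (simp add: inj_on_def)
    then show False using assms(2) by (simp add: p vimage_def)
  qed
  then show ?thesis by (simp add: p)
qed

text \<open>The device that carries identities from generic frequencies over to the finitely many
  excluded ones.\<close>

lemma polyf_eq_0_cofinite:
  assumes "polyf f" "finite S" "\<And>t. t \<notin> S \<Longrightarrow> f t = 0"
  shows "f t = 0"
proof (rule polyf_eq_0[OF assms(1)])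
  have "UNIV - S \<subseteq> {t. f t = 0}" using assms(3) by auto
  then show "infinite {t. f t = 0}"
    using assms(2) infinite_UNIV_int by (meson Diff_infinite_finite infinite_super)
qed

text \<open>The difference of x^(m+1) is (m + 1) x^m plus lower powers, and the lower powers have
  antidifferences by induction.\<close>

lemma poly_antidifference: "\<exists>p :: complex poly. \<forall>x. poly p (x + 1) - poly p x = x ^ m"
proof (induction m rule: less_induct)
  case (less m)
  have "\<forall>j\<in>{..<m}. \<exists>p :: complex poly. \<forall>x. poly p (x + 1) - poly p x = x ^ j"
    using less.IH by blast
  from bchoice[OF this] obtain P where
    P: "\<forall>j\<in>{..<m}. \<forall>x :: complex. poly (P j) (x + 1) - poly (P j) x = x ^ j" ..
  define q where "q = monom 1 (Suc m) - (\<Sum>j<m. smult (of_nat (Suc m choose j)) (P j))"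
  define n :: complex where "n = of_nat (Suc m)"
  have "poly q (x + 1) - poly q x = n * x ^ m" for x
  proof -
    have "(x + 1) ^ Suc m = (\<Sum>j\<le>Suc m. of_nat (Suc m choose j) * x ^ j)"
      by (subst binomial_ring) simp
    also have "\<dots> = (\<Sum>j<m. of_nat (Suc m choose j) * x ^ j) + n * x ^ m + x ^ Suc m"
      by (simp add: lessThan_Suc_atMost[symmetric] n_def)
    finally have b: "(x + 1) ^ Suc m = (\<Sum>j<m. of_nat (Suc m choose j) * x ^ j) + n * x ^ m + x ^ Suc m" .
    have "(\<Sum>j<m. of_nat (Suc m choose j) * poly (P j) (x + 1)) - (\<Sum>j<m. of_nat (Suc m choose j) * poly (P j) x)
        = (\<Sum>j<m. of_nat (Suc m choose j) * x ^ j)"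
      unfolding sum_subtractf[symmetric] right_diff_distrib[symmetric]
      by (intro sum.cong refl arg_cong2[where f = "(*)"]) (use P in blast)
    then show ?thesis
      unfolding q_def poly_smult poly_diff poly_sum poly_monom mult_1 b by (simp only: algebra_simps)
  qed
  then have "poly (smult (1 / n) q) (x + 1) - poly (smult (1 / n) q) x = x ^ m" for x
    unfolding poly_smult right_diff_distrib[symmetric] by (simp add: n_def del: of_nat_Suc)
  then show ?case by blast
qed

text \<open>Both sums telescope one antidifference \<open>p\<close>. As a >= 1, the summand at 0
  vanishes, so \<open>p\<close> takes equal values at 0 and 1; summing over -1, ..., -(n - 1) then
  gives minus the same polynomial at -n. The second range stops at n - 1, which is what reciprocity
  requires.\<close>

lemma power_sum_poly:
  assumes "1 \<le> a"
  shows "\<exists>P :: complex poly. (\<forall>n. (\<Sum>m=1..n. of_nat m ^ a) = poly P (of_nat n)) \<and>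
    (\<forall>n. (\<Sum>m=1..<n. (- of_nat m) ^ a) = - poly P (- of_nat n))"
proof -
  obtain p :: "complex poly" where p: "\<And>x. poly p (x + 1) - poly p x = x ^ a"
    using poly_antidifference by blast
  define P where "P = pcompose p [:1, 1:] - [:poly p 1:]"
  have P: "poly P x = poly p (x + 1) - poly p 1" for x
    by (simp add: P_def poly_pcompose add.commute)
  have p0: "poly p 1 = poly p 0" using p[of 0] assms by (simp add: zero_power)
  have "(\<Sum>m=1..n. of_nat m ^ a) = poly P (of_nat n)" for n
  proof (induction n)
    case (Suc n)
    then show ?case using p[of "of_nat n + 1"] by (simp add: P algebra_simps)
  qed (simp add: P)
  moreover have "(\<Sum>m=1..<n. (- of_nat m) ^ a) = - poly P (- of_nat n)" for n
  proof (induction n)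
    case 0
    then show ?case by (simp add: P)
  next
    case (Suc n)
    have "poly P (- of_nat (Suc n)) = poly P (- of_nat n) - (- of_nat n) ^ a"
      using p[of "- of_nat n"] by (simp add: P algebra_simps)
    moreover have "(\<Sum>m=1..<Suc n. (- of_nat m :: complex) ^ a) = (\<Sum>m=1..<n. (- of_nat m) ^ a) + (- of_nat n) ^ a"
      using assms by (cases n) (simp_all add: zero_power)
    ultimately show ?case using Suc by simp
  qed
  ultimately show ?thesis by blast
qed

text \<open>Write the polynomial at k - x as c + (k - x) q(k - x): the factor k leaves the sum and
  the factor x raises the exponent, so the induction on q runs over all a at once.\<close>

lemma convolution_poly:
  assumes "1 \<le> a"
  shows "\<exists>Q :: complex poly. (\<forall>n. (\<Sum>m=1..n. of_nat m ^ a * poly q (of_nat n - of_nat m)) = poly Q (of_nat n)) \<and>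
    (\<forall>n. (\<Sum>m=1..<n. (- of_nat m) ^ a * poly q (of_nat m - of_nat n)) = - poly Q (- of_nat n))"
  using assms
proof (induction q arbitrary: a)
  case 0
  show ?case by (rule exI[of _ 0]) simp
next
  case (pCons c q)
  obtain P :: "complex poly" where P: "\<And>n. (\<Sum>m=1..n. of_nat m ^ a) = poly P (of_nat n)"
    "\<And>n. (\<Sum>m=1..<n. (- of_nat m) ^ a) = - poly P (- of_nat n)"
    using power_sum_poly[OF pCons.prems] by blast
  obtain Q1 where Q1: "\<And>n. (\<Sum>m=1..n. of_nat m ^ a * poly q (of_nat n - of_nat m)) = poly Q1 (of_nat n)"
    "\<And>n. (\<Sum>m=1..<n. (- of_nat m) ^ a * poly q (of_nat m - of_nat n)) = - poly Q1 (- of_nat n)"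
    using pCons.IH[OF pCons.prems] by blast
  have "1 \<le> Suc a" by simp
  then obtain Q2 where Q2: "\<And>n. (\<Sum>m=1..n. of_nat m ^ Suc a * poly q (of_nat n - of_nat m)) = poly Q2 (of_nat n)"
    "\<And>n. (\<Sum>m=1..<n. (- of_nat m) ^ Suc a * poly q (of_nat m - of_nat n)) = - poly Q2 (- of_nat n)"
    using pCons.IH by blast
  have e: "x ^ a * poly (pCons c q) (k - x) = c * x ^ a + k * (x ^ a * poly q (k - x)) - x ^ Suc a * poly q (k - x)" for x k
    by (simp add: algebra_simps)
  have e': "(- x) ^ a * poly (pCons c q) (x - k) = c * (- x) ^ a + (- k) * ((- x) ^ a * poly q (x - k)) - (- x) ^ Suc a * poly q (x - k)" for x k
    using e[of "- x" "- k"] by simp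
  show ?case
  proof (intro exI[of _ "smult c P + [:0, 1:] * Q1 - Q2"] conjI allI)
    fix n
    show "(\<Sum>m=1..n. of_nat m ^ a * poly (pCons c q) (of_nat n - of_nat m)) = poly (smult c P + [:0, 1:] * Q1 - Q2) (of_nat n)"
      unfolding e sum.distrib sum_subtractf sum_distrib_left[symmetric] P Q1 Q2 by simp
    show "(\<Sum>m=1..<n. (- of_nat m) ^ a * poly (pCons c q) (of_nat m - of_nat n)) = - poly (smult c P + [:0, 1:] * Q1 - Q2) (- of_nat n)"
      unfolding e' sum.distrib sum_subtractf sum_distrib_left[symmetric] P Q1 Q2 by simp
  qed
qed

text \<open>For a sign \<open>\<sigma>\<close>, the sum of \<open>\<Prod>\<kappa>\<^sub>i ^ a\<^sub>i\<close> over the \<open>\<kappa>\<close> of sign \<open>\<sigma>\<close> with sum \<open>k\<close>. The sums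
  over positive and over negative \<open>\<kappa>\<close> are given by one polynomial, up to sign.\<close>

fun csm :: "int \<Rightarrow> nat list \<Rightarrow> int \<Rightarrow> complex" where
  "csm \<sigma> [] k = (if k = 0 then 1 else 0)"
| "csm \<sigma> (a # as) k = (\<Sum>m=1..nat (\<sigma> * k). of_int (\<sigma> * int m) ^ a * csm \<sigma> as (k - \<sigma> * int m))"

text \<open>Each further entry is a convolution with one more power. On the negative side every
  convolution costs a sign by reciprocity, whence the power of -1.\<close>

lemma csm_poly:
  assumes "as \<noteq> []" "\<And>a. a \<in> set as \<Longrightarrow> 1 \<le> a"
  shows "\<exists>q. poly q 0 = 0 \<and> (\<forall>k. csm 1 as k = (if 0 < k then poly q (of_int k) else 0)) \<and>
    (\<forall>k. csm (- 1) as k = (if k < 0 then (- 1) ^ (length as - 1) * poly q (of_int k) else 0))"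
  using assms
proof (induction as)
  case (Cons a as)
  have a: "1 \<le> a" using Cons.prems by simp
  show ?case
  proof (cases "as = []")
    case True
    have 1: "csm 1 [a] k = (if 0 < k then of_int k ^ a else 0)" for k
    proof (cases "0 < k")
      case True
      have "csm 1 [a] k = (\<Sum>m\<in>{1..nat k}. if m = nat k then of_int k ^ a else 0)"
        unfolding csm.simps by (intro sum.cong) (use True in auto)
      then show ?thesis using True by simp
    qed simp
    have 2: "csm (- 1) [a] k = (if k < 0 then of_int k ^ a else 0)" for k
    proof (cases "k < 0")
      case True
      have "csm (- 1) [a] k = (\<Sum>m\<in>{1..nat (- k)}. if m = nat (- k) then of_int k ^ a else 0)"
        unfolding csm.simps by (intro sum.cong) (use True in auto)
      then show ?thesis using True by simp
    qed simp
    show ?thesis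
      unfolding True 1 2 using a by (intro exI[of _ "monom 1 a"]) (simp add: poly_monom zero_power)
  next
    case False
    have "\<exists>q. poly q 0 = 0 \<and> (\<forall>k. csm 1 as k = (if 0 < k then poly q (of_int k) else 0)) \<and>
      (\<forall>k. csm (- 1) as k = (if k < 0 then (- 1) ^ (length as - 1) * poly q (of_int k) else 0))"
      by (rule Cons.IH[OF False]) (rule Cons.prems(2), simp)
    then obtain q where q: "poly q 0 = 0" "\<And>k. csm 1 as k = (if 0 < k then poly q (of_int k) else 0)"
      "\<And>k. csm (- 1) as k = (if k < 0 then (- 1) ^ (length as - 1) * poly q (of_int k) else 0)"
      by blast
    obtain Q where Q: "\<And>n. (\<Sum>m=1..n. of_nat m ^ a * poly q (of_nat n - of_nat m)) = poly Q (of_nat n)"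
      "\<And>n. (\<Sum>m=1..<n. (- of_nat m) ^ a * poly q (of_nat m - of_nat n)) = - poly Q (- of_nat n)"
      using convolution_poly[OF a] by blast
    have Q0: "poly Q 0 = 0" using Q(1)[of 0] by simp
    have Q1: "csm 1 (a # as) k = (if 0 < k then poly Q (of_int k) else 0)" for k
    proof (cases "0 < k")
      case True
      then have n: "of_nat (nat k) = (of_int k :: complex)" by simp
      have "csm 1 (a # as) k = (\<Sum>m=1..nat k. of_nat m ^ a * poly q (of_nat (nat k) - of_nat m))"
        unfolding csm.simps
      proof (intro sum.cong)
        fix m assume "m \<in> {1..nat k}"
        then have m: "int m \<le> k" by auto
        \<comment> \<open>At m = k the remaining sum is empty, while the formula gives the value of
          q at 0. Carrying \<open>poly q 0 = 0\<close> through the induction makes the two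
          agree.\<close>
        show "of_int (1 * int m) ^ a * csm 1 as (k - 1 * int m) = of_nat m ^ a * poly q (of_nat (nat k) - of_nat m)"
          unfolding q(2) n by (cases "k = int m") (use m q(1) in simp_all)
      qed simp
      also have "\<dots> = poly Q (of_int k)"
        unfolding Q(1) unfolding n ..
      finally show ?thesis using True by (simp only: if_True)
    qed simp
    have Q2: "csm (- 1) (a # as) k = (if k < 0 then (- 1) ^ (length (a # as) - 1) * poly Q (of_int k) else 0)" for k
    proof (cases "k < 0")
      case True
      then have n: "of_nat (nat (- k)) = (- of_int k :: complex)" by simp
      have "csm (- 1) (a # as) k = (\<Sum>m=1..nat (- k). if m < nat (- k) then (- 1) ^ (length as - 1) * ((- of_nat m) ^ a * poly q (of_nat m - of_nat (nat (- k)))) else 0)"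
        unfolding csm.simps q(3) n by (intro sum.cong) (auto simp: add.commute)
      also have "\<dots> = (\<Sum>m=1..<nat (- k). (- 1) ^ (length as - 1) * ((- of_nat m) ^ a * poly q (of_nat m - of_nat (nat (- k)))))"
        by (rule sum.mono_neutral_cong_right) auto
      also have "\<dots> = (- 1) ^ (length as - 1) * - poly Q (of_int k)"
        unfolding sum_distrib_left[symmetric] Q(2) unfolding n minus_minus ..
      also have "\<dots> = (- 1) ^ (length (a # as) - 1) * poly Q (of_int k)"
        using False by (cases as) simp_all
      finally show ?thesis using True by (simp only: if_True)
    qed simp
    show ?thesis by (intro exI[of _ Q] conjI allI Q0 Q1 Q2)
  qed
qed simp

text \<open>Each of the two sums is polynomial on a half line only; this signed combination glues
  them. For the empty list two Kronecker deltas cancel. Exactly this combination arises in a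
  commutator.\<close>

lemma polyf_csm:
  assumes "\<And>a. a \<in> set as \<Longrightarrow> 1 \<le> a"
  shows "polyf (\<lambda>k. csm 1 as k - (- 1) ^ length as * csm (- 1) as k)"
proof (cases "as = []")
  case False
  then obtain q where q: "poly q 0 = 0" "\<And>k. csm 1 as k = (if 0 < k then poly q (of_int k) else 0)"
      "\<And>k. csm (- 1) as k = (if k < 0 then (- 1) ^ (length as - 1) * poly q (of_int k) else 0)"
    using csm_poly[OF False assms] by blast
  obtain n where n: "length as = Suc n" using False by (cases as) auto
  show ?thesis
  proof (rule polyfI)
    fix k
    show "csm 1 as k - (- 1) ^ length as * csm (- 1) as k = poly q (of_int k)"
      unfolding q(2,3) n using q(1) by (cases k "0::int" rule: linorder_cases) (simp_all flip: power_add mult_2)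
  qed
qed simp

text \<open>Taylor coefficients in the modes, computed from the Taylor coefficients \<open>c\<close>
  in the jets: by u^\<alpha>_j = sum (ik)^j p^\<alpha>_k e^{ikx}, a mode of frequency k meets the
  jet of order j with the factor (ik)^j. The jet order is at most \<open>J\<close>.\<close>

fun sy :: "nat \<Rightarrow> ((nat \<times> nat) list \<Rightarrow> complex) \<Rightarrow> mode list \<Rightarrow> complex" where
  "sy J c [] = c []"
| "sy J c (x # xs) = (\<Sum>j\<le>J. (\<i> * of_int (snd x)) ^ j * sy J (\<lambda>ws. c ((fst x, j) # ws)) xs)"

lemma sy_lincomb: "sy J (\<lambda>ws. \<Sum>i\<in>I. r i * c i ws) xs = (\<Sum>i\<in>I. r i * sy J (c i) xs)"
proof (induction xs arbitrary: c)
  case (Cons x xs)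
  show ?case
    unfolding sy.simps Cons.IH sum_distrib_left by (subst sum.swap) (simp only: mult.left_commute)
qed simp

text \<open>Families whose dependence on t is polynomial once the frequencies of the list are fixed.
  One \<open>J\<close> serves all orders up to (h, e), since a star product coefficient mixes all
  lower orders. The class is closed under differentiation along a mode whose frequency is linear in
  t.\<close>

definition pfam :: "nat \<Rightarrow> nat \<Rightarrow> nat \<Rightarrow> (int \<Rightarrow> lfun) \<Rightarrow> bool" where
  "pfam J h e F \<longleftrightarrow> (\<exists>c. (\<forall>t h' e' xs. h' \<le> h \<longrightarrow> e' \<le> e \<longrightarrow> F t xs $ h' $ e' = sy J (c t h' e') xs) \<and>
     (\<forall>h' e' ws. polyf (\<lambda>t. c t h' e' ws)))"

lemma pfam_Cons:
  assumes "pfam J h e F" "linf k"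
  shows "pfam J h e (\<lambda>t ys. F t ((\<alpha>, k t) # ys))"
proof -
  obtain c where c: "\<And>t h' e' xs. h' \<le> h \<Longrightarrow> e' \<le> e \<Longrightarrow> F t xs $ h' $ e' = sy J (c t h' e') xs"
    "\<And>h' e' ws. polyf (\<lambda>t. c t h' e' ws)"
    using assms(1) unfolding pfam_def by blast
  define c' where "c' t h' e' ws = (\<Sum>j\<le>J. (\<i> * of_int (k t)) ^ j * c t h' e' ((\<alpha>, j) # ws))" for t h' e' ws
  have "F t ((\<alpha>, k t) # xs) $ h' $ e' = sy J (c' t h' e') xs" if "h' \<le> h" "e' \<le> e" for t h' e' xs
    unfolding c(1)[OF that] c'_def sy_lincomb by simp
  moreover have "polyf (\<lambda>t. c' t h' e' ws)" for h' e' ws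
    unfolding c'_def by (intro polyf_sum polyf_mult polyf_power polyf_const polyf_of_linf assms(2) c(2))
  ultimately show ?thesis unfolding pfam_def by blast
qed

definition md :: "int \<Rightarrow> lfun \<Rightarrow> lfun" where
  "md k F = (\<lambda>xs. if freq xs = k then F xs else 0)"

lemma homog_md: "homog k (md k F)"
  by (simp add: homog_def md_def)

lemma md_Cons: "(\<lambda>ys. md k F (x # ys)) = md (k - snd x) (\<lambda>ys. F (x # ys))"
  by (auto simp: md_def)

lemma perm_inv_md: "perm_inv F \<Longrightarrow> perm_inv (md k F)"
proof (rule perm_invI)
  fix xs ys :: "mode list" assume F: "perm_inv F" and m: "mset xs = mset ys"
  have "freq xs = freq ys" unfolding freq_def using m by (metis mset_map sum_mset_sum_list)
  then show "md k F xs = md k F ys" using perm_invD[OF F m] by (simp add: md_def)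
qed

section \<open>Contraction sums of fixed total frequency, and polynomiality of commutators\<close>

context weyl
begin

definition CK :: "nat \<Rightarrow> int \<Rightarrow> contr list set" where
  "CK n k = {cs. length cs = n \<and> set cs \<subseteq> con \<and> int (csum cs) = k}"

lemma CK_0: "CK 0 k = (if k = 0 then {[]} else {})"
  by (auto simp: CK_def)

lemma finite_CK: "finite (CK n k)"
  by (rule finite_subset[OF _ finite_CS[of "nat k"]]) (auto simp: CK_def intro: in_CS)

lemma sum_CK_Suc:
  "(\<Sum>cs\<in>CK (Suc n) k. \<phi> cs) = (\<Sum>\<alpha>\<in>{1..N}. \<Sum>\<beta>\<in>{1..N}. \<Sum>m=1..nat k. \<Sum>cs\<in>CK n (k - int m). \<phi> ((\<alpha>, \<beta>, m) # cs))"
proof -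
  have "(\<Sum>cs\<in>CK (Suc n) k. \<phi> cs) = (\<Sum>(c, cs)\<in>Sigma ({1..N} \<times> {1..N} \<times> {1..nat k}) (\<lambda>(\<alpha>, \<beta>, m). CK n (k - int m)). \<phi> (c # cs))"
  proof (rule sum.reindex_bij_witness[of _ "\<lambda>(c, cs). c # cs" "\<lambda>cs. (hd cs, tl cs)"])
    fix cs assume "cs \<in> CK (Suc n) k"
    then show "(hd cs, tl cs) \<in> Sigma ({1..N} \<times> {1..N} \<times> {1..nat k}) (\<lambda>(\<alpha>, \<beta>, m). CK n (k - int m))"
      by (cases cs) (auto simp: CK_def con_def)
  qed (auto simp: CK_def con_def length_Suc_conv)
  also have "\<dots> = (\<Sum>c\<in>{1..N} \<times> {1..N} \<times> {1..nat k}. \<Sum>cs\<in>(case c of (\<alpha>, \<beta>, m) \<Rightarrow> CK n (k - int m)). \<phi> (c # cs))"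
    by (subst sum.Sigma) (auto simp: finite_CK)
  finally show ?thesis by (simp add: sum.cartesian_product case_prod_unfold)
qed

text \<open>Besides its two indices, such a tuple records the jet orders at which a contraction
  meets its two factors.\<close>

definition exps :: "nat \<Rightarrow> (nat \<times> nat \<times> nat \<times> nat) set" where
  "exps J = {1..N} \<times> {1..N} \<times> {..J} \<times> {..J}"

lemma sum_exps: "(\<Sum>e\<in>exps J. \<phi> e) = (\<Sum>\<alpha>\<in>{1..N}. \<Sum>\<beta>\<in>{1..N}. \<Sum>i\<le>J. \<Sum>j\<le>J. \<phi> (\<alpha>, \<beta>, i, j))"
  unfolding exps_def by (simp add: sum.cartesian_product case_prod_unfold)

definition ew :: "nat \<times> nat \<times> nat \<times> nat \<Rightarrow> complex" where
  "ew = (\<lambda>(\<alpha>, \<beta>, i, j). \<i> * etai \<alpha> \<beta> * \<i> ^ i * (- \<i>) ^ j)"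

definition ecoef :: "((nat \<times> nat) list \<Rightarrow> complex) \<Rightarrow> ((nat \<times> nat) list \<Rightarrow> complex) \<Rightarrow> (nat \<times> nat \<times> nat \<times> nat) list \<Rightarrow> complex" where
  "ecoef c d es = prod_list (map ew es) * c (map (\<lambda>(\<alpha>, \<beta>, i, j). (\<alpha>, i)) es) * d (map (\<lambda>(\<alpha>, \<beta>, i, j). (\<beta>, j)) es)"

text \<open>A contraction of frequency m contributes m from the star product and m^i, m^j from the
  jets. The extra 1 is what guarantees the positive exponents that \<open>csm_poly\<close>
  requires.\<close>

definition eexp :: "(nat \<times> nat \<times> nat \<times> nat) list \<Rightarrow> nat list" where
  "eexp = map (\<lambda>(\<alpha>, \<beta>, i, j). Suc (i + j))"

lemma ecoef_Cons: "ecoef c d ((\<alpha>, \<beta>, i, j) # es) =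
    ew (\<alpha>, \<beta>, i, j) * ecoef (\<lambda>ws. c ((\<alpha>, i) # ws)) (\<lambda>ws. d ((\<beta>, j) # ws)) es"
  by (simp add: ecoef_def)

text \<open>Expanding the jets turns each contraction into a constant times a power of its
  frequency; what remains is a sum over compositions of k.\<close>

lemma contraction_sum_left:
  "(\<Sum>cs\<in>CK n k. w0 cs * (sy J c (Lc cs) * sy J d (Rc cs))) = (\<Sum>es\<in>nlists n (exps J). ecoef c d es * csm 1 (eexp es) k)"
proof (induction n arbitrary: c d k)
  case 0
  then show ?case by (simp add: CK_0 ecoef_def eexp_def)
next
  case (Suc n)
  define t where "t \<alpha> \<beta> m i j = \<i> * of_nat m * etai \<alpha> \<beta> * (\<i> * of_int (int m)) ^ i * (\<i> * of_int (- int m)) ^ j" for \<alpha> \<beta> m i j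
  define S where "S \<alpha> \<beta> m i j = (\<Sum>es\<in>nlists n (exps J). ecoef (\<lambda>ws. c ((\<alpha>, i) # ws)) (\<lambda>ws. d ((\<beta>, j) # ws)) es * csm 1 (eexp es) (k - int m))" for \<alpha> \<beta> m i j
  have t: "t \<alpha> \<beta> m i j = ew (\<alpha>, \<beta>, i, j) * of_int (1 * int m) ^ Suc (i + j)" for \<alpha> \<beta> m i j
  proof -
    define M where "M = (of_int (1 * int m) :: complex)"
    have M: "of_nat m = M" "of_int (int m) = M" "\<i> * of_int (- int m) = (- \<i>) * M" by (simp_all add: M_def)
    show ?thesis
      unfolding t_def ew_def case_prod_conv M M_def[symmetric] power_mult_distrib power_add power_Suc by (simp only: mult_ac)
  qed
  have "(\<Sum>cs\<in>CK n (k - int m). w0 ((\<alpha>, \<beta>, m) # cs) * (sy J c (Lc ((\<alpha>, \<beta>, m) # cs)) * sy J d (Rc ((\<alpha>, \<beta>, m) # cs))))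
      = (\<Sum>i\<le>J. \<Sum>j\<le>J. t \<alpha> \<beta> m i j * S \<alpha> \<beta> m i j)" for \<alpha> \<beta> m
  proof -
    have "w0 ((\<alpha>, \<beta>, m) # cs) * (sy J c (Lc ((\<alpha>, \<beta>, m) # cs)) * sy J d (Rc ((\<alpha>, \<beta>, m) # cs)))
      = (\<Sum>i\<le>J. \<Sum>j\<le>J. t \<alpha> \<beta> m i j * (w0 cs * (sy J (\<lambda>ws. c ((\<alpha>, i) # ws)) (Lc cs) * sy J (\<lambda>ws. d ((\<beta>, j) # ws)) (Rc cs))))" for cs
      unfolding Lc_simps Rc_simps sy.simps w0_simps fst_conv snd_conv sum_product
      unfolding sum_distrib_left
      by (intro sum.cong refl) (simp only: t_def mult_ac)
    then have "(\<Sum>cs\<in>CK n (k - int m). w0 ((\<alpha>, \<beta>, m) # cs) * (sy J c (Lc ((\<alpha>, \<beta>, m) # cs)) * sy J d (Rc ((\<alpha>, \<beta>, m) # cs))))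
      = (\<Sum>cs\<in>CK n (k - int m). \<Sum>i\<le>J. \<Sum>j\<le>J. t \<alpha> \<beta> m i j * (w0 cs * (sy J (\<lambda>ws. c ((\<alpha>, i) # ws)) (Lc cs) * sy J (\<lambda>ws. d ((\<beta>, j) # ws)) (Rc cs))))"
      by (simp only:)
    also have "\<dots> = (\<Sum>i\<le>J. \<Sum>j\<le>J. \<Sum>cs\<in>CK n (k - int m). t \<alpha> \<beta> m i j * (w0 cs * (sy J (\<lambda>ws. c ((\<alpha>, i) # ws)) (Lc cs) * sy J (\<lambda>ws. d ((\<beta>, j) # ws)) (Rc cs))))"
      by (subst sum.swap) (intro sum.cong refl sum.swap)
    finally show ?thesis unfolding sum_distrib_left[symmetric] Suc.IH S_def .
  qed
  then have "(\<Sum>cs\<in>CK (Suc n) k. w0 cs * (sy J c (Lc cs) * sy J d (Rc cs)))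
      = (\<Sum>\<alpha>\<in>{1..N}. \<Sum>\<beta>\<in>{1..N}. \<Sum>m=1..nat k. \<Sum>i\<le>J. \<Sum>j\<le>J. t \<alpha> \<beta> m i j * S \<alpha> \<beta> m i j)"
    unfolding sum_CK_Suc by (simp only:)
  also have "\<dots> = (\<Sum>\<alpha>\<in>{1..N}. \<Sum>\<beta>\<in>{1..N}. \<Sum>i\<le>J. \<Sum>j\<le>J. \<Sum>m=1..nat k. t \<alpha> \<beta> m i j * S \<alpha> \<beta> m i j)"
    by (rule sum.cong[OF refl], rule sum.cong[OF refl], subst sum.swap, rule sum.cong[OF refl], rule sum.swap)
  also have "(\<lambda>\<alpha> \<beta> i j. \<Sum>m=1..nat k. t \<alpha> \<beta> m i j * S \<alpha> \<beta> m i j)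
      = (\<lambda>\<alpha> \<beta> i j. \<Sum>es\<in>nlists n (exps J). ecoef c d ((\<alpha>, \<beta>, i, j) # es) * csm 1 (eexp ((\<alpha>, \<beta>, i, j) # es)) k)"
  proof (intro ext)
    fix \<alpha> \<beta> i j
    show "(\<Sum>m=1..nat k. t \<alpha> \<beta> m i j * S \<alpha> \<beta> m i j)
      = (\<Sum>es\<in>nlists n (exps J). ecoef c d ((\<alpha>, \<beta>, i, j) # es) * csm 1 (eexp ((\<alpha>, \<beta>, i, j) # es)) k)"
      unfolding S_def t sum_distrib_left
      by (subst sum.swap) (simp only: ecoef_Cons eexp_def list.map csm.simps case_prod_conv sum_distrib_left mult_1 mult_ac)
  qed
  finally show ?case unfolding sum_nlists_Suc sum_exps .
qed

text \<open>In the variable -m the jet factors coincide with those of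
  \<open>contraction_sum_left\<close>; only the factor m of the star product changes sign, once per
  contraction. Symmetry of \<open>etai\<close> accounts for the exchanged indices.\<close>

lemma contraction_sum_right:
  assumes sym: "\<And>\<alpha> \<beta>. \<alpha> \<in> {1..N} \<Longrightarrow> \<beta> \<in> {1..N} \<Longrightarrow> etai \<alpha> \<beta> = etai \<beta> \<alpha>"
  shows "(\<Sum>cs\<in>CK n (- k). w0 cs * (sy J c (Rc cs) * sy J d (Lc cs)))
    = (- 1) ^ n * (\<Sum>es\<in>nlists n (exps J). ecoef c d es * csm (- 1) (eexp es) k)"
proof (induction n arbitrary: c d k)
  case 0
  then show ?case by (simp add: CK_0 ecoef_def eexp_def)
next
  case (Suc n)
  define t where "t \<alpha> \<beta> m i j = \<i> * of_nat m * etai \<beta> \<alpha> * (\<i> * of_int (- int m)) ^ i * (\<i> * of_int (int m)) ^ j" for \<alpha> \<beta> m i j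
  define S where "S \<alpha> \<beta> m i j = (- 1) ^ n * (\<Sum>es\<in>nlists n (exps J). ecoef (\<lambda>ws. c ((\<alpha>, i) # ws)) (\<lambda>ws. d ((\<beta>, j) # ws)) es * csm (- 1) (eexp es) (k + int m))" for \<alpha> \<beta> m i j
  have t: "t \<alpha> \<beta> m i j = - (ew (\<alpha>, \<beta>, i, j) * of_int (- 1 * int m) ^ Suc (i + j))" if "\<alpha> \<in> {1..N}" "\<beta> \<in> {1..N}" for \<alpha> \<beta> m i j
  proof -
    define M where "M = (of_int (- 1 * int m) :: complex)"
    have M: "of_nat m = - M" "of_int (- int m) = M" "\<i> * of_int (int m) = (- \<i>) * M" by (simp_all add: M_def)
    show ?thesis
      unfolding t_def ew_def case_prod_conv M M_def[symmetric] power_mult_distrib power_add power_Suc sym[OF that]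
      by (simp only: mult_minus_left mult_minus_right mult_ac)
  qed
  have IH: "(\<Sum>cs\<in>CK n (- k - int m). w0 cs * (sy J c (Rc cs) * sy J d (Lc cs)))
    = (- 1) ^ n * (\<Sum>es\<in>nlists n (exps J). ecoef c d es * csm (- 1) (eexp es) (k + int m))" for c d m
    using Suc.IH[of c d "k + int m"] by simp
  have "(\<Sum>cs\<in>CK n (- k - int m). w0 ((\<beta>, \<alpha>, m) # cs) * (sy J c (Rc ((\<beta>, \<alpha>, m) # cs)) * sy J d (Lc ((\<beta>, \<alpha>, m) # cs))))
      = (\<Sum>i\<le>J. \<Sum>j\<le>J. t \<alpha> \<beta> m i j * S \<alpha> \<beta> m i j)" for \<alpha> \<beta> m
  proof -
    have "w0 ((\<beta>, \<alpha>, m) # cs) * (sy J c (Rc ((\<beta>, \<alpha>, m) # cs)) * sy J d (Lc ((\<beta>, \<alpha>, m) # cs)))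
      = (\<Sum>i\<le>J. \<Sum>j\<le>J. t \<alpha> \<beta> m i j * (w0 cs * (sy J (\<lambda>ws. c ((\<alpha>, i) # ws)) (Rc cs) * sy J (\<lambda>ws. d ((\<beta>, j) # ws)) (Lc cs))))" for cs
      unfolding Lc_simps Rc_simps sy.simps w0_simps fst_conv snd_conv sum_product
      unfolding sum_distrib_left
      by (intro sum.cong refl) (simp only: t_def mult_ac)
    then have "(\<Sum>cs\<in>CK n (- k - int m). w0 ((\<beta>, \<alpha>, m) # cs) * (sy J c (Rc ((\<beta>, \<alpha>, m) # cs)) * sy J d (Lc ((\<beta>, \<alpha>, m) # cs))))
      = (\<Sum>cs\<in>CK n (- k - int m). \<Sum>i\<le>J. \<Sum>j\<le>J. t \<alpha> \<beta> m i j * (w0 cs * (sy J (\<lambda>ws. c ((\<alpha>, i) # ws)) (Rc cs) * sy J (\<lambda>ws. d ((\<beta>, j) # ws)) (Lc cs))))"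
      by (simp only:)
    also have "\<dots> = (\<Sum>i\<le>J. \<Sum>j\<le>J. \<Sum>cs\<in>CK n (- k - int m). t \<alpha> \<beta> m i j * (w0 cs * (sy J (\<lambda>ws. c ((\<alpha>, i) # ws)) (Rc cs) * sy J (\<lambda>ws. d ((\<beta>, j) # ws)) (Lc cs))))"
      by (subst sum.swap) (intro sum.cong refl sum.swap)
    finally show ?thesis unfolding sum_distrib_left[symmetric] IH S_def .
  qed
  then have "(\<Sum>cs\<in>CK (Suc n) (- k). w0 cs * (sy J c (Rc cs) * sy J d (Lc cs)))
      = (\<Sum>\<beta>\<in>{1..N}. \<Sum>\<alpha>\<in>{1..N}. \<Sum>m=1..nat (- k). \<Sum>i\<le>J. \<Sum>j\<le>J. t \<alpha> \<beta> m i j * S \<alpha> \<beta> m i j)"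
    unfolding sum_CK_Suc by (simp only:)
  also have "\<dots> = (\<Sum>\<alpha>\<in>{1..N}. \<Sum>\<beta>\<in>{1..N}. \<Sum>m=1..nat (- k). \<Sum>i\<le>J. \<Sum>j\<le>J. t \<alpha> \<beta> m i j * S \<alpha> \<beta> m i j)"
    by (rule sum.swap)
  also have "\<dots> = (\<Sum>\<alpha>\<in>{1..N}. \<Sum>\<beta>\<in>{1..N}. \<Sum>i\<le>J. \<Sum>j\<le>J. \<Sum>m=1..nat (- k). t \<alpha> \<beta> m i j * S \<alpha> \<beta> m i j)"
    by (rule sum.cong[OF refl], rule sum.cong[OF refl], subst sum.swap, rule sum.cong[OF refl], rule sum.swap)
  also have "\<dots> = (\<Sum>\<alpha>\<in>{1..N}. \<Sum>\<beta>\<in>{1..N}. \<Sum>i\<le>J. \<Sum>j\<le>J. (- 1) ^ Suc n *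
      (\<Sum>es\<in>nlists n (exps J). ecoef c d ((\<alpha>, \<beta>, i, j) # es) * csm (- 1) (eexp ((\<alpha>, \<beta>, i, j) # es)) k))"
  proof (intro sum.cong refl)
    fix \<alpha> \<beta> i j assume ab: "\<alpha> \<in> {1..N}" "\<beta> \<in> {1..N}"
    have k: "k - - 1 * int m = k + int m" "- 1 * k = - k" for m by simp_all
    have "(\<Sum>m=1..nat (- k). t \<alpha> \<beta> m i j * S \<alpha> \<beta> m i j) = (\<Sum>m=1..nat (- k). \<Sum>es\<in>nlists n (exps J). (- 1) ^ Suc n *
      (ecoef c d ((\<alpha>, \<beta>, i, j) # es) * (of_int (- 1 * int m) ^ Suc (i + j) * csm (- 1) (eexp es) (k + int m))))"
      unfolding S_def t[OF ab] sum_distrib_left ecoef_Cons power_Suc[of "- 1 :: complex" n]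
      by (intro sum.cong refl) (simp only: mult_minus_left mult_minus_right mult_1 mult_ac)
    also have "\<dots> = (- 1) ^ Suc n * (\<Sum>es\<in>nlists n (exps J). ecoef c d ((\<alpha>, \<beta>, i, j) # es) * csm (- 1) (eexp ((\<alpha>, \<beta>, i, j) # es)) k)"
      by (subst sum.swap) (simp only: eexp_def list.map csm.simps case_prod_conv sum_distrib_left k)
    finally show "(\<Sum>m=1..nat (- k). t \<alpha> \<beta> m i j * S \<alpha> \<beta> m i j) = (- 1) ^ Suc n *
      (\<Sum>es\<in>nlists n (exps J). ecoef c d ((\<alpha>, \<beta>, i, j) # es) * csm (- 1) (eexp ((\<alpha>, \<beta>, i, j) # es)) k)" .
  qed
  finally show ?case unfolding sum_nlists_Suc sum_exps sum_distrib_left[of "(- 1) ^ Suc n"] .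
qed

lemma tpr_md_nth:
  "tpr (md k F) (md (- k) G) $ h $ e =
    (\<Sum>n\<le>h. \<Sum>i\<le>h - n. \<Sum>j\<le>e. (\<Sum>cs\<in>CK n k. w0 cs * (F (Lc cs) $ i $ j * G (Rc cs) $ (h - n - i) $ (e - j))) / fact n)"
proof -
  define T where "T cs = wt cs * (F (Lc cs) * G (Rc cs))" for cs
  define B where "B = nat k + h"
  have T: "T cs $ h $ e = (if n \<le> h then \<Sum>i\<le>h - n. \<Sum>j\<le>e. w0 cs * (F (Lc cs) $ i $ j * G (Rc cs) $ (h - n - i) $ (e - j)) / fact n else 0)"
    if "cs \<in> CK n k" for cs n
  proof -
    have n: "length cs = n" using that by (simp add: CK_def)
    show ?thesis
      unfolding T_def wt_def n mult.assoc scal_nth hbar_nth coeffs_mult_nth[of "F (Lc cs)" "G (Rc cs)"]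
      by (simp add: sum_distrib_left sum_divide_distrib)
  qed
  have "tpr (md k F) (md (- k) G) = (\<Sum>cs\<in>(\<Union>n\<in>{..B}. CK n k). wt cs * (md k F (Lc cs) * md (- k) G (Rc cs)))"
    unfolding tpr_def
  proof (rule sum.mono_neutral_left)
    show "{cs. set cs \<subseteq> con \<and> md k F (Lc cs) \<noteq> 0 \<and> md (- k) G (Rc cs) \<noteq> 0} \<subseteq> (\<Union>n\<in>{..B}. CK n k)"
    proof
      fix cs assume "cs \<in> {cs. set cs \<subseteq> con \<and> md k F (Lc cs) \<noteq> 0 \<and> md (- k) G (Rc cs) \<noteq> 0}"
      then have c: "set cs \<subseteq> con" "int (csum cs) = k" by (auto simp: md_def split: if_splits)
      then show "cs \<in> (\<Union>n\<in>{..B}. CK n k)" using length_le_csum[OF c(1)] by (auto simp: CK_def B_def)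
    qed
    show "\<forall>cs\<in>(\<Union>n\<in>{..B}. CK n k) - {cs. set cs \<subseteq> con \<and> md k F (Lc cs) \<noteq> 0 \<and> md (- k) G (Rc cs) \<noteq> 0}.
      wt cs * (md k F (Lc cs) * md (- k) G (Rc cs)) = 0"
      by (auto simp: CK_def)
  qed (auto simp: finite_CK)
  also have "\<dots> = (\<Sum>cs\<in>(\<Union>n\<in>{..B}. CK n k). T cs)"
    by (rule sum.cong) (auto simp: CK_def md_def T_def)
  also have "\<dots> = (\<Sum>n\<le>B. \<Sum>cs\<in>CK n k. T cs)"
    by (rule sum.UNION_disjoint) (auto simp: finite_CK, auto simp: CK_def)
  finally have "tpr (md k F) (md (- k) G) $ h $ e = (\<Sum>n\<le>B. \<Sum>cs\<in>CK n k. T cs $ h $ e)"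
    by (simp add: fps_sum_nth)
  also have "\<dots> = (\<Sum>n\<le>h. \<Sum>cs\<in>CK n k. T cs $ h $ e)"
    by (rule sum.mono_neutral_right) (auto simp: B_def T intro!: sum.neutral)
  also have "\<dots> = (\<Sum>n\<le>h. \<Sum>cs\<in>CK n k. \<Sum>i\<le>h - n. \<Sum>j\<le>e. w0 cs * (F (Lc cs) $ i $ j * G (Rc cs) $ (h - n - i) $ (e - j)) / fact n)"
    by (intro sum.cong refl) (simp add: T)
  also have "\<dots> = (\<Sum>n\<le>h. \<Sum>i\<le>h - n. \<Sum>j\<le>e. \<Sum>cs\<in>CK n k. w0 cs * (F (Lc cs) $ i $ j * G (Rc cs) $ (h - n - i) $ (e - j)) / fact n)"
    by (intro sum.cong refl, subst sum.swap, intro sum.cong refl sum.swap)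
  finally show ?thesis by (simp only: sum_divide_distrib)
qed

text \<open>The order reversal of \<open>tpr_md_nth\<close>, reindexed so that \<open>F\<close>
  again carries the orders i and j; the two expansions can then be subtracted term by term.\<close>

lemma tpr_md_nth':
  "tpr (md (- k) G) (md k F) $ h $ e =
    (\<Sum>n\<le>h. \<Sum>i\<le>h - n. \<Sum>j\<le>e. (\<Sum>cs\<in>CK n (- k). w0 cs * (F (Rc cs) $ i $ j * G (Lc cs) $ (h - n - i) $ (e - j))) / fact n)"
proof -
  have r1: "(\<Sum>i\<le>a. f i) = (\<Sum>i\<le>a. f (a - i))" for a :: nat and f :: "nat \<Rightarrow> complex"
    by (rule sum.reindex_bij_witness[of _ "\<lambda>i. a - i" "\<lambda>i. a - i"]) auto
  have r: "(\<Sum>i\<le>a. \<Sum>j\<le>b. f i j) = (\<Sum>i\<le>a. \<Sum>j\<le>b. f (a - i) (b - j))" for a b :: nat and f :: "nat \<Rightarrow> nat \<Rightarrow> complex"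
    by (subst r1) (intro sum.cong refl r1)
  have "tpr (md (- k) G) (md k F) $ h $ e =
    (\<Sum>n\<le>h. \<Sum>i\<le>h - n. \<Sum>j\<le>e. (\<Sum>cs\<in>CK n (- k). w0 cs * (G (Lc cs) $ i $ j * F (Rc cs) $ (h - n - i) $ (e - j))) / fact n)"
    using tpr_md_nth[of "- k" G F h e] unfolding minus_minus .
  also have "\<dots> = (\<Sum>n\<le>h. \<Sum>i\<le>h - n. \<Sum>j\<le>e. (\<Sum>cs\<in>CK n (- k). w0 cs * (F (Rc cs) $ i $ j * G (Lc cs) $ (h - n - i) $ (e - j))) / fact n)"
  proof (rule sum.cong[OF refl], subst r, intro sum.cong refl)
    fix n i j assume "n \<in> {..h}" "i \<in> {..h - n}" "j \<in> {..e}"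
    then have "h - n - (h - n - i) = i" "e - (e - j) = j" by auto
    then show "(\<Sum>cs\<in>CK n (- k). w0 cs * (G (Lc cs) $ (h - n - i) $ (e - j) * F (Rc cs) $ (h - n - (h - n - i)) $ (e - (e - j)))) / fact n
      = (\<Sum>cs\<in>CK n (- k). w0 cs * (F (Rc cs) $ i $ j * G (Lc cs) $ (h - n - i) $ (e - j))) / fact n"
      by (simp only: mult.commute[of "F _ $ _ $ _"])
  qed
  finally show ?thesis .
qed

text \<open>The two orders of the product give the sums over positive and over negative contraction
  frequencies, with relative sign (-1)^n. Their difference is the combination of
  \<open>polyf_csm\<close>, with coefficients polynomial in t by \<open>pfam\<close>.\<close>

lemma br_Nil_polyf:
  assumes sym: "\<And>\<alpha> \<beta>. \<alpha> \<in> {1..N} \<Longrightarrow> \<beta> \<in> {1..N} \<Longrightarrow> etai \<alpha> \<beta> = etai \<beta> \<alpha>"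
    and F: "pfam J h e F" and G: "pfam J h e G" and k: "linf k"
  shows "polyf (\<lambda>t. br (md (k t) (F t)) (md (- k t) (G t)) [] $ h $ e)"
proof -
  obtain c where c: "\<And>t h' e' xs. h' \<le> h \<Longrightarrow> e' \<le> e \<Longrightarrow> F t xs $ h' $ e' = sy J (c t h' e') xs"
    "\<And>h' e' ws. polyf (\<lambda>t. c t h' e' ws)"
    using F unfolding pfam_def by blast
  obtain d where d: "\<And>t h' e' xs. h' \<le> h \<Longrightarrow> e' \<le> e \<Longrightarrow> G t xs $ h' $ e' = sy J (d t h' e') xs"
    "\<And>h' e' ws. polyf (\<lambda>t. d t h' e' ws)"
    using G unfolding pfam_def by blast
  define Z where "Z t n i j = (\<Sum>es\<in>nlists n (exps J). ecoef (c t i j) (d t (h - n - i) (e - j)) es *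
      (csm 1 (eexp es) (k t) - (- 1) ^ length (eexp es) * csm (- 1) (eexp es) (k t)))" for t n i j
  have eq: "br (md (k t) (F t)) (md (- k t) (G t)) [] $ h $ e = (\<Sum>n\<le>h. \<Sum>i\<le>h - n. \<Sum>j\<le>e. Z t n i j / fact n)" for t
    unfolding br_Nil fps_sub_nth tpr_md_nth tpr_md_nth' sum_subtractf[symmetric] diff_divide_distrib[symmetric]
  proof (intro sum.cong refl arg_cong2[where f = "(/)"])
    fix n i j assume "n \<in> {..h}" "i \<in> {..h - n}" "j \<in> {..e}"
    then have l: "i \<le> h" "h - n - i \<le> h" "j \<le> e" "e - j \<le> e" by auto
    have R: "(\<Sum>cs\<in>CK n (- k t). w0 cs * (sy J (c t i j) (Rc cs) * sy J (d t (h - n - i) (e - j)) (Lc cs)))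
      = (- 1) ^ n * (\<Sum>es\<in>nlists n (exps J). ecoef (c t i j) (d t (h - n - i) (e - j)) es * csm (- 1) (eexp es) (k t))"
      by (rule contraction_sum_right[OF sym])
    show "(\<Sum>cs\<in>CK n (k t). w0 cs * (F t (Lc cs) $ i $ j * G t (Rc cs) $ (h - n - i) $ (e - j)))
      - (\<Sum>cs\<in>CK n (- k t). w0 cs * (F t (Rc cs) $ i $ j * G t (Lc cs) $ (h - n - i) $ (e - j))) = Z t n i j"
      unfolding c(1)[OF l(1,3)] d(1)[OF l(2,4)] contraction_sum_left R Z_def
        sum_distrib_left sum_subtractf[symmetric]
      by (intro sum.cong refl) (auto simp: nlists_def eexp_def right_diff_distrib)
  qed
  have "polyf (\<lambda>t. Z t n i j)" for n i j
    unfolding Z_def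
  proof (intro polyf_sum polyf_mult)
    fix es
    show "polyf (\<lambda>t. ecoef (c t i j) (d t (h - n - i) (e - j)) es)"
      unfolding ecoef_def by (intro polyf_mult polyf_const c(2) d(2))
    show "polyf (\<lambda>t. csm 1 (eexp es) (k t) - (- 1) ^ length (eexp es) * csm (- 1) (eexp es) (k t))"
      by (rule polyf_linf[OF polyf_csm k]) (auto simp: eexp_def)
  qed
  then show ?thesis
    unfolding eq divide_inverse by (intro polyf_sum polyf_mult polyf_const)
qed

text \<open>The Leibniz rule reduces the list to the empty one and lowers the frequencies k or l by
  linear functions of t. The condition on the total frequency ensures that l = -k at the
  end.\<close>

lemma br_polyf:
  assumes sym: "\<And>\<alpha> \<beta>. \<alpha> \<in> {1..N} \<Longrightarrow> \<beta> \<in> {1..N} \<Longrightarrow> etai \<alpha> \<beta> = etai \<beta> \<alpha>"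
    and "pfam J h e F" "pfam J h e G" "linf k" "linf l"
    and "\<And>x. x \<in> set zs \<Longrightarrow> linf (snd x)"
    and "\<And>t. k t + l t = freq (map (\<lambda>(\<alpha>, f). (\<alpha>, f t)) zs)"
  shows "polyf (\<lambda>t. br (md (k t) (F t)) (md (l t) (G t)) (map (\<lambda>(\<alpha>, f). (\<alpha>, f t)) zs) $ h $ e)"
  using assms(2-)
proof (induction zs arbitrary: F G k l)
  case Nil
  then have "l = (\<lambda>t. - k t)" by (intro ext) (simp add: add_eq_0_iff)
  then show ?case using br_Nil_polyf[OF sym Nil(1-3)] by simp
next
  case (Cons x zs)
  obtain \<alpha> f where x: "x = (\<alpha>, f)" by force
  have f: "linf f" using Cons.prems(5)[of x] x by simp
  have lz: "linf (snd y)" if "y \<in> set zs" for y using Cons.prems(5) that by simp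
  have fr: "k t - f t + l t = freq (map (\<lambda>(\<alpha>, f). (\<alpha>, f t)) zs)" "k t + (l t - f t) = freq (map (\<lambda>(\<alpha>, f). (\<alpha>, f t)) zs)" for t
    using Cons.prems(6)[of t] x by simp_all
  have "polyf (\<lambda>t. br (md (k t - f t) (\<lambda>ys. F t ((\<alpha>, f t) # ys))) (md (l t) (G t)) (map (\<lambda>(\<alpha>, f). (\<alpha>, f t)) zs) $ h $ e)"
    by (rule Cons.IH[OF pfam_Cons[OF Cons.prems(1) f] Cons.prems(2) linf_diff[OF Cons.prems(3) f] Cons.prems(4) lz fr(1)])
  moreover have "polyf (\<lambda>t. br (md (k t) (F t)) (md (l t - f t) (\<lambda>ys. G t ((\<alpha>, f t) # ys))) (map (\<lambda>(\<alpha>, f). (\<alpha>, f t)) zs) $ h $ e)"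
    by (rule Cons.IH[OF Cons.prems(1) pfam_Cons[OF Cons.prems(2) f] Cons.prems(3) linf_diff[OF Cons.prems(4) f] lz fr(2)])
  ultimately show ?case
    unfolding x list.map case_prod_conv br_Cons md_Cons fps_add_nth snd_conv by (rule polyf_add)
qed

end

section \<open>Monomials and lists of variables\<close>

text \<open>The passage from lists, on which the proof computes, to exponent functions, by which
  \<open>fcoef\<close>, \<open>fourier\<close> and \<open>star\<close> are indexed.\<close>

definition mon :: "'v list \<Rightarrow> 'v \<Rightarrow> nat" where
  "mon xs = (\<lambda>v. count_list xs v)"

definition inc :: "'v \<Rightarrow> ('v \<Rightarrow> nat) \<Rightarrow> 'v \<Rightarrow> nat" where
  "inc v m = m(v := m v + 1)"

definition dec :: "'v \<Rightarrow> ('v \<Rightarrow> nat) \<Rightarrow> 'v \<Rightarrow> nat" where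
  "dec v m = m(v := m v - 1)"

definition mfact :: "('v \<Rightarrow> nat) \<Rightarrow> nat" where
  "mfact m = (\<Prod>v\<in>msupp m. fact (m v))"

lemma inc_dec: "m v \<noteq> 0 \<Longrightarrow> inc v (dec v m) = m" and dec_inc [simp]: "dec v (inc v m) = m"
  by (auto simp: inc_def dec_def)

lemma inc_self [simp]: "inc v m v = Suc (m v)"
  by (simp add: inc_def)

lemma msupp_inc: "msupp (inc v m) = insert v (msupp m)"
  by (auto simp: msupp_def inc_def)

lemma msupp_dec: "msupp (dec v m) \<subseteq> msupp m"
  by (auto simp: msupp_def dec_def split: if_splits)

lemma msupp_zero [simp]: "msupp (\<lambda>_. 0) = {}"
  by (simp add: msupp_def)

lemma msupp_empty: "msupp m = {} \<Longrightarrow> m = (\<lambda>_. 0)"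
  by (auto simp: msupp_def)

lemma mon_Nil [simp]: "mon [] = (\<lambda>_. 0)"
  by (simp add: mon_def)

lemma mon_Cons: "mon (x # xs) = inc x (mon xs)"
  by (auto simp: mon_def inc_def)

lemma msupp_mon [simp]: "msupp (mon xs) = set xs"
  by (induction xs) (auto simp: mon_Cons msupp_inc)

lemma mfact_superset: "finite A \<Longrightarrow> msupp m \<subseteq> A \<Longrightarrow> mfact m = (\<Prod>v\<in>A. fact (m v))"
  unfolding mfact_def by (rule prod.mono_neutral_left) (auto simp: msupp_def)

lemma mtotal_superset: "finite A \<Longrightarrow> msupp m \<subseteq> A \<Longrightarrow> mtotal m = (\<Sum>v\<in>A. m v)"
  unfolding mtotal_def by (rule sum.mono_neutral_left) (auto simp: msupp_def)

lemma mfact_inc: "finite (msupp m) \<Longrightarrow> mfact (inc v m) = Suc (m v) * mfact m"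
proof -
  assume f: "finite (msupp m)"
  let ?A = "insert v (msupp m)"
  have "mfact (inc v m) = (\<Prod>w\<in>?A. fact (inc v m w))"
    using f by (intro mfact_superset) (auto simp: msupp_inc)
  also have "\<dots> = fact (Suc (m v)) * (\<Prod>w\<in>?A - {v}. fact (inc v m w))"
    using f by (subst prod.remove[of _ v]) auto
  also have "(\<Prod>w\<in>?A - {v}. fact (inc v m w)) = (\<Prod>w\<in>?A - {v}. fact (m w))"
    by (rule prod.cong) (auto simp: inc_def)
  also have "fact (Suc (m v)) * (\<Prod>w\<in>?A - {v}. fact (m w)) = Suc (m v) * (\<Prod>w\<in>?A. fact (m w))"
    using f by (subst prod.remove[of ?A v]) (auto simp: algebra_simps)
  also have "(\<Prod>w\<in>?A. fact (m w)) = mfact m"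
    using f by (intro mfact_superset[symmetric]) auto
  finally show ?thesis .
qed

lemma mtotal_inc: "finite (msupp m) \<Longrightarrow> mtotal (inc v m) = Suc (mtotal m)"
proof -
  assume f: "finite (msupp m)"
  let ?A = "insert v (msupp m)"
  have "mtotal (inc v m) = (\<Sum>w\<in>?A. inc v m w)"
    using f by (intro mtotal_superset) (auto simp: msupp_inc)
  also have "\<dots> = (\<Sum>w\<in>?A. m w + (if w = v then 1 else 0))"
    by (rule sum.cong) (auto simp: inc_def)
  also have "\<dots> = (\<Sum>w\<in>?A. m w) + 1"
    using f by (simp add: sum.distrib)
  also have "(\<Sum>w\<in>?A. m w) = mtotal m"
    using f by (intro mtotal_superset[symmetric]) auto
  finally show ?thesis by simp
qed

lemma mfact_pos: "mfact m \<noteq> 0"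
proof (cases "finite (msupp m)")
  case True
  then show ?thesis by (simp add: mfact_def prod_zero_iff)
qed (simp add: mfact_def)

lemma mfact_zero [simp]: "mfact (\<lambda>_. 0) = 1" and mtotal_zero [simp]: "mtotal (\<lambda>_. 0) = 0"
  by (simp_all add: mfact_def mtotal_def)

lemma mtotal_mon [simp]: "mtotal (mon xs) = length xs"
  by (induction xs) (simp_all add: mon_Cons mtotal_inc)

lemma mtotal_eq_0: "finite (msupp m) \<Longrightarrow> mtotal m = 0 \<Longrightarrow> m = (\<lambda>_. 0)"
  by (auto simp: mtotal_def msupp_def)

lemma mtotal_pos: "finite (msupp m) \<Longrightarrow> m \<noteq> (\<lambda>_. 0) \<Longrightarrow> 0 < mtotal m"
  using mtotal_eq_0 by blast

lemma mon_eq_mset: "mset xs = mset ys \<Longrightarrow> mon xs = mon ys"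
  by (simp add: mon_def flip: count_mset)

lemma ex_mon: "finite (msupp P) \<Longrightarrow> \<exists>xs. P = mon xs"
proof -
  assume "finite (msupp P)"
  then have c: "count (Abs_multiset P) = P" by (simp add: count_Abs_multiset msupp_def)
  obtain xs where "mset xs = Abs_multiset P" using ex_mset by blast
  then have "P = mon xs" using c by (simp add: fun_eq_iff mon_def flip: count_mset)
  then show ?thesis by blast
qed

lemma pfreq_mon: "pfreq (mon xs) = freq xs"
proof (induction xs)
  case Nil
  then show ?case by (simp add: pfreq_def)
next
  case (Cons x xs)
  have f: "finite (insert x (set xs))" by simp
  have sup: "pfreq (mon ys) = (\<Sum>v\<in>A. snd v * int (mon ys v))" if "finite A" "set ys \<subseteq> A" for ys A
    unfolding pfreq_def msupp_mon using that(2) by (intro sum.mono_neutral_left that(1)) (auto simp: mon_def count_list_0_iff)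
  have "pfreq (mon (x # xs)) = (\<Sum>v\<in>insert x (set xs). snd v * int (mon xs v) + (if v = x then snd x else 0))"
    by (subst sup[OF f]) (auto simp: mon_Cons inc_def algebra_simps intro!: sum.cong)
  also have "\<dots> = pfreq (mon xs) + snd x"
    by (subst sup[OF f, of xs]) (auto simp: sum.distrib)
  finally show ?case using Cons by simp
qed

section \<open>The Fourier transform of a monomial\<close>

definition fsum :: "('a \<Rightarrow> nat) \<Rightarrow> nat" where
  "fsum g = (\<Sum>k\<in>{k. g k \<noteq> 0}. g k)"

lemma fsum_inc: "finite {k. g k \<noteq> 0} \<Longrightarrow> fsum (inc x g) = Suc (fsum g)"
  using mtotal_inc[of g x] by (simp add: fsum_def mtotal_def msupp_def)

lemma fsum_ge: "finite {k. g k \<noteq> 0} \<Longrightarrow> g k \<le> fsum g"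
  unfolding fsum_def by (cases "g k = 0") (auto intro: member_le_sum)

type_synonym tab = "nat \<times> nat \<times> int \<Rightarrow> nat"

text \<open>The index set of \<open>fcoef\<close>: tables with row sums \<open>m\<close> and column
  sums \<open>P\<close> for each \<alpha>.\<close>

definition Tab :: "jmon \<Rightarrow> pmon \<Rightarrow> tab set" where
  "Tab m P = {n. finite (msupp n) \<and> (\<forall>\<alpha> j. fsum (\<lambda>k. n (\<alpha>, j, k)) = m (\<alpha>, j)) \<and>
    (\<forall>\<alpha> k. fsum (\<lambda>j. n (\<alpha>, j, k)) = P (\<alpha>, k))}"

lemma finite_row: "finite (msupp (n :: tab)) \<Longrightarrow> finite {k. n (\<alpha>, j, k) \<noteq> 0}"
  and finite_col: "finite (msupp (n :: tab)) \<Longrightarrow> finite {j. n (\<alpha>, j, k) \<noteq> 0}"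
proof -
  assume f: "finite (msupp n)"
  have "{k. n (\<alpha>, j, k) \<noteq> 0} \<subseteq> (\<lambda>w. snd (snd w)) ` msupp n"
    "{j. n (\<alpha>, j, k) \<noteq> 0} \<subseteq> (\<lambda>w. fst (snd w)) ` msupp n"
    by (force simp: msupp_def image_iff)+
  then show "finite {k. n (\<alpha>, j, k) \<noteq> 0}" "finite {j. n (\<alpha>, j, k) \<noteq> 0}"
    using finite_subset finite_imageI[OF f] by blast+
qed

lemma Tab_inc:
  "n \<in> Tab m P \<longleftrightarrow> inc (\<alpha>, j, \<kappa>) n \<in> Tab (inc (\<alpha>, j) m) (inc (\<alpha>, \<kappa>) P)"
proof (cases "finite (msupp n)")
  case True
  have r: "(\<lambda>k. inc (\<alpha>, j, \<kappa>) n (\<alpha>', j', k)) = (if \<alpha>' = \<alpha> \<and> j' = j then inc \<kappa> (\<lambda>k. n (\<alpha>', j', k)) else (\<lambda>k. n (\<alpha>', j', k)))" for \<alpha>' j'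
    by (auto simp: inc_def)
  have c: "(\<lambda>j'. inc (\<alpha>, j, \<kappa>) n (\<alpha>', j', k)) = (if \<alpha>' = \<alpha> \<and> k = \<kappa> then inc j (\<lambda>j'. n (\<alpha>', j', k)) else (\<lambda>j'. n (\<alpha>', j', k)))" for \<alpha>' k
    by (auto simp: inc_def)
  have 1: "(fsum (\<lambda>k. inc (\<alpha>, j, \<kappa>) n (\<alpha>', j', k)) = inc (\<alpha>, j) m (\<alpha>', j')) \<longleftrightarrow> (fsum (\<lambda>k. n (\<alpha>', j', k)) = m (\<alpha>', j'))" for \<alpha>' j'
    unfolding r using fsum_inc[OF finite_row[OF True, of \<alpha>' j'], of \<kappa>] by (auto simp: inc_def)
  have 2: "(fsum (\<lambda>j'. inc (\<alpha>, j, \<kappa>) n (\<alpha>', j', k)) = inc (\<alpha>, \<kappa>) P (\<alpha>', k)) \<longleftrightarrow> (fsum (\<lambda>j'. n (\<alpha>', j', k)) = P (\<alpha>', k))" for \<alpha>' k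
    unfolding c using fsum_inc[OF finite_col[OF True, of \<alpha>' k], of j] by (auto simp: inc_def)
  show ?thesis unfolding Tab_def mem_Collect_eq 1 2 by (simp add: msupp_inc True)
qed (simp add: Tab_def msupp_inc)

lemma finite_Tab:
  assumes "finite (msupp m)" "finite (msupp P)"
  shows "finite (Tab m P)"
proof -
  define K where "K = (\<lambda>((\<alpha>, j), (\<beta>, k)). (\<alpha>, j, k)) ` (msupp m \<times> msupp P)"
  define b where "b = (\<Sum>v\<in>msupp m. m v)"
  have "Tab m P \<subseteq> {n. \<forall>w. (w \<in> K \<longrightarrow> n w \<in> {..b}) \<and> (w \<notin> K \<longrightarrow> n w = 0)}"
  proof (clarify)
    fix n \<alpha> j k assume n: "n \<in> Tab m P"
    then have f: "finite (msupp n)" by (simp add: Tab_def)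
    have le: "n (\<alpha>, j, k) \<le> m (\<alpha>, j)" "n (\<alpha>, j, k) \<le> P (\<alpha>, k)"
      using fsum_ge[OF finite_row[OF f, of \<alpha> j], of k] fsum_ge[OF finite_col[OF f, of \<alpha> k], of j] n by (auto simp: Tab_def)
    have "m (\<alpha>, j) \<le> b" using assms(1) unfolding b_def by (cases "m (\<alpha>, j) = 0") (auto intro: member_le_sum simp: msupp_def)
    moreover have "(\<alpha>, j, k) \<in> K" if "n (\<alpha>, j, k) \<noteq> 0"
    proof -
      have "((\<alpha>, j), (\<alpha>, k)) \<in> msupp m \<times> msupp P" using that le by (auto simp: msupp_def)
      then show ?thesis unfolding K_def by force
    qed
    ultimately show "((\<alpha>, j, k) \<in> K \<longrightarrow> n (\<alpha>, j, k) \<in> {..b}) \<and> ((\<alpha>, j, k) \<notin> K \<longrightarrow> n (\<alpha>, j, k) = 0)"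
      using le by auto
  qed
  moreover have "finite K" unfolding K_def using assms by simp
  ultimately show ?thesis using finite_set_of_finite_funs[of K "{..b}" 0] by (simp add: finite_subset)
qed

definition tabw :: "tab \<Rightarrow> complex" where
  "tabw n = (\<Prod>w\<in>msupp n. (\<i> * of_int (snd (snd w))) ^ (fst (snd w) * n w))"

lemma tabw_inc: "finite (msupp n) \<Longrightarrow> tabw (inc (\<alpha>, j, \<kappa>) n) = (\<i> * of_int \<kappa>) ^ j * tabw n"
proof -
  assume f: "finite (msupp n)"
  let ?v = "(\<alpha>, j, \<kappa>)"
  let ?A = "insert ?v (msupp n)"
  let ?g = "\<lambda>n w. (\<i> * of_int (snd (snd w))) ^ (fst (snd w) * n w) :: complex"
  have s: "tabw n' = (\<Prod>w\<in>?A. ?g n' w)" if "msupp n' \<subseteq> ?A" for n'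
    unfolding tabw_def using f that by (intro prod.mono_neutral_left) (auto simp: msupp_def)
  have "tabw (inc ?v n) = (\<Prod>w\<in>?A. ?g n w * (if w = ?v then (\<i> * of_int \<kappa>) ^ j else 1))"
  proof -
    have "msupp (inc ?v n) \<subseteq> ?A" by (simp add: msupp_inc)
    then show ?thesis
      unfolding s[OF \<open>msupp (inc ?v n) \<subseteq> ?A\<close>] by (intro prod.cong) (auto simp: inc_def power_add mult.commute)
  qed
  also have "\<dots> = (\<Prod>w\<in>?A. ?g n w) * (\<i> * of_int \<kappa>) ^ j"
    using f by (simp only: prod.distrib) simp
  also have "(\<Prod>w\<in>?A. ?g n w) = tabw n" by (rule s[symmetric]) auto
  finally show ?thesis by (simp add: mult.commute)
qed

text \<open>The P-th derivative at p = 0 of u^m / m!, with the exponentials stripped. In this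
  normalization the chain rule has no combinatorial factors.\<close>

definition tcoef :: "jmon \<Rightarrow> pmon \<Rightarrow> complex" where
  "tcoef m P = (\<Sum>n\<in>Tab m P. of_nat (mfact P) / of_nat (mfact n) * tabw n)"

lemma fcoef_tcoef: "fcoef m P * of_nat (mfact P) = of_nat (mfact m) * tcoef m P"
proof -
  have "fcoef m P = (\<Sum>n\<in>Tab m P. of_nat (mfact m) / of_nat (mfact n) * tabw n)"
    unfolding fcoef_def Tab_def fsum_def mfact_def tabw_def of_nat_prod ..
  then show ?thesis by (simp add: tcoef_def sum_distrib_left sum_distrib_right mult_ac)
qed

lemma tcoef_Nil: "tcoef m (\<lambda>_. 0) = (if m = (\<lambda>_. 0) then 1 else 0)"
proof -
  have 1: "n = (\<lambda>_. 0) \<and> m = (\<lambda>_. 0)" if n: "n \<in> Tab m (\<lambda>_. 0)" for n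
  proof -
    have f: "finite (msupp n)" using n by (simp add: Tab_def)
    have "n (\<alpha>, j, k) = 0" for \<alpha> j k
      using n fsum_ge[OF finite_col[OF f, of \<alpha> k], of j] by (simp add: Tab_def)
    then have z: "n = (\<lambda>_. 0)" by (intro ext) (metis prod_cases3)
    then have "m (\<alpha>, j) = 0" for \<alpha> j using n by (simp add: Tab_def fsum_def)
    then have "m = (\<lambda>_. 0)" by (intro ext) (metis surj_pair)
    with z show ?thesis by blast
  qed
  have 2: "(\<lambda>_. 0) \<in> Tab (\<lambda>_. 0) (\<lambda>_. 0)" by (simp add: Tab_def fsum_def)
  show ?thesis
  proof (cases "m = (\<lambda>_. 0)")
    case True
    have "Tab m (\<lambda>_. 0) = {\<lambda>_. 0}" using 1 2 True by blast
    then show ?thesis using True by (simp add: tcoef_def tabw_def)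
  next
    case False
    then have "Tab m (\<lambda>_. 0) = {}" using 1 by blast
    then show ?thesis using False by (simp add: tcoef_def)
  qed
qed

text \<open>The chain rule for d/dp^\<alpha>_\<kappa>. The factor gained by the factorial of
  \<open>P\<close> is a column sum of the table; distributing it over the column selects one factor
  u^\<alpha>_j, and removing that unit leaves a table for the smaller margins.\<close>

lemma tcoef_inc:
  assumes m: "finite (msupp m)" and P: "finite (msupp P)" and J: "\<And>j. m (\<alpha>, j) \<noteq> 0 \<Longrightarrow> j \<le> J"
  shows "tcoef m (inc (\<alpha>, \<kappa>) P) = (\<Sum>j\<in>{j. j \<le> J \<and> m (\<alpha>, j) \<noteq> 0}. (\<i> * of_int \<kappa>) ^ j * tcoef (dec (\<alpha>, j) m) P)"
proof -
  let ?P = "inc (\<alpha>, \<kappa>) P"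
  let ?J = "{j. j \<le> J \<and> m (\<alpha>, j) \<noteq> 0}"
  have finP: "finite (msupp ?P)" using P by (simp add: msupp_inc)
  have row: "of_nat (mfact ?P) / of_nat (mfact n) * tabw n
    = (\<Sum>j\<in>{j\<in>?J. n (\<alpha>, j, \<kappa>) \<noteq> 0}. of_nat (mfact P) * of_nat (n (\<alpha>, j, \<kappa>)) / of_nat (mfact n) * tabw n)"
    if n: "n \<in> Tab m ?P" for n
  proof -
    have f: "finite (msupp n)" using n by (simp add: Tab_def)
    have "j \<in> ?J" if "n (\<alpha>, j, \<kappa>) \<noteq> 0" for j
    proof -
      have "m (\<alpha>, j) \<noteq> 0" using fsum_ge[OF finite_row[OF f, of \<alpha> j], of \<kappa>] n that by (auto simp: Tab_def)
      then show ?thesis using J by simp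
    qed
    then have "{j\<in>?J. n (\<alpha>, j, \<kappa>) \<noteq> 0} = {j. n (\<alpha>, j, \<kappa>) \<noteq> 0}" by auto
    \<comment> \<open>The column sum equals the new exponent of p^\<alpha>_\<kappa>; it replaces the
      quotient of the two factorials.\<close>
    then have s: "(\<Sum>j\<in>{j\<in>?J. n (\<alpha>, j, \<kappa>) \<noteq> 0}. n (\<alpha>, j, \<kappa>)) = Suc (P (\<alpha>, \<kappa>))"
      using n by (simp add: Tab_def fsum_def)
    have "of_nat (mfact ?P) = of_nat (mfact P) * (\<Sum>j\<in>{j\<in>?J. n (\<alpha>, j, \<kappa>) \<noteq> 0}. of_nat (n (\<alpha>, j, \<kappa>)) :: complex)"
      unfolding mfact_inc[OF P] s[symmetric] by (simp add: mult.commute)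
    then show ?thesis by (simp add: sum_distrib_left sum_distrib_right sum_divide_distrib)
  qed
  have "tcoef m ?P = (\<Sum>n\<in>Tab m ?P. \<Sum>j\<in>{j\<in>?J. n (\<alpha>, j, \<kappa>) \<noteq> 0}. of_nat (mfact P) * of_nat (n (\<alpha>, j, \<kappa>)) / of_nat (mfact n) * tabw n)"
    unfolding tcoef_def by (rule sum.cong[OF refl row])
  also have "\<dots> = (\<Sum>j\<in>?J. \<Sum>n\<in>{n\<in>Tab m ?P. n (\<alpha>, j, \<kappa>) \<noteq> 0}. of_nat (mfact P) * of_nat (n (\<alpha>, j, \<kappa>)) / of_nat (mfact n) * tabw n)"
    by (rule sum.swap_restrict) (auto simp: finite_Tab[OF m finP])
  also have "\<dots> = (\<Sum>j\<in>?J. \<Sum>n\<in>Tab (dec (\<alpha>, j) m) P. (\<i> * of_int \<kappa>) ^ j * (of_nat (mfact P) / of_nat (mfact n) * tabw n))"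
  proof (rule sum.cong[OF refl])
    fix j assume j: "j \<in> ?J"
    then have dm: "inc (\<alpha>, j) (dec (\<alpha>, j) m) = m" by (simp add: inc_dec)
    let ?w = "(\<alpha>, j, \<kappa>)"
    show "(\<Sum>n\<in>{n\<in>Tab m ?P. n ?w \<noteq> 0}. of_nat (mfact P) * of_nat (n ?w) / of_nat (mfact n) * tabw n)
      = (\<Sum>n\<in>Tab (dec (\<alpha>, j) m) P. (\<i> * of_int \<kappa>) ^ j * (of_nat (mfact P) / of_nat (mfact n) * tabw n))"
    proof (rule sum.reindex_bij_witness[of _ "inc ?w" "dec ?w"])
      fix n assume n: "n \<in> {n\<in>Tab m ?P. n ?w \<noteq> 0}"
      then have id: "inc ?w (dec ?w n) = n" by (simp add: inc_dec)
      show "inc ?w (dec ?w n) = n" by (rule id)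
      have t: "dec ?w n \<in> Tab (dec (\<alpha>, j) m) P"
        using n Tab_inc[of "dec ?w n" "dec (\<alpha>, j) m" P \<alpha> j \<kappa>] unfolding id dm by simp
      then show "dec ?w n \<in> Tab (dec (\<alpha>, j) m) P" .
      have f: "finite (msupp (dec ?w n))" using t by (simp add: Tab_def)
      define q where "q = dec ?w n"
      have nq: "n = inc ?w q" by (simp add: q_def id)
      have fq: "finite (msupp q)" using f by (simp add: q_def)
      show "(\<i> * of_int \<kappa>) ^ j * (of_nat (mfact P) / of_nat (mfact (dec ?w n)) * tabw (dec ?w n)) = of_nat (mfact P) * of_nat (n ?w) / of_nat (mfact n) * tabw n"
      proof -
        have e: "c * (p / M * t) = p * s / (s * M) * (c * t)" if "s \<noteq> 0" "M \<noteq> 0" for c p M t s :: complex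
          using that by (simp add: field_simps)
        show ?thesis
          unfolding nq dec_inc mfact_inc[OF fq] tabw_inc[OF fq] inc_self of_nat_mult
          by (rule e) (use mfact_pos[of q] in \<open>simp_all del: of_nat_Suc\<close>)
      qed
    next
      fix n assume n: "n \<in> Tab (dec (\<alpha>, j) m) P"
      show "dec ?w (inc ?w n) = n" by simp
      show "inc ?w n \<in> {n\<in>Tab m ?P. n ?w \<noteq> 0}"
        using n Tab_inc[of n "dec (\<alpha>, j) m" P \<alpha> j \<kappa>] unfolding dm by simp
    qed
  qed
  finally show ?thesis unfolding tcoef_def sum_distrib_left .
qed

section \<open>The Fourier transform of a differential polynomial\<close>

definition slice :: "nat \<Rightarrow> (jmon \<Rightarrow> complex) \<Rightarrow> bool" where
  "slice N g \<longleftrightarrow> (\<forall>m. g m \<noteq> 0 \<longrightarrow> finite (msupp m) \<and> (\<forall>v\<in>msupp m. 1 \<le> fst v \<and> fst v \<le> N)) \<and>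
    finite (jet_part ` {m. g m \<noteq> 0})"

lemma is_qdp_slice: "is_qdp N f \<longleftrightarrow> (\<forall>e h. slice N (f e h))"
  unfolding is_qdp_def slice_def by blast

lemma slice_finite: "slice N g \<Longrightarrow> g m \<noteq> 0 \<Longrightarrow> finite (msupp m)"
  unfolding slice_def by blast

lemma slice_index: "slice N g \<Longrightarrow> g m \<noteq> 0 \<Longrightarrow> m (\<alpha>, j) \<noteq> 0 \<Longrightarrow> \<alpha> \<in> {1..N}"
  unfolding slice_def msupp_def by force

lemma slice_jets: "slice N g \<Longrightarrow> finite (jet_part ` {m. g m \<noteq> 0})"
  unfolding slice_def by blast

lemma slice_mono: "slice N f \<Longrightarrow> (\<And>m. g m \<noteq> 0 \<Longrightarrow> f m \<noteq> 0) \<Longrightarrow> slice N g"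
proof -
  assume f: "slice N f" and i: "\<And>m. g m \<noteq> 0 \<Longrightarrow> f m \<noteq> 0"
  have "{m. g m \<noteq> 0} \<subseteq> {m. f m \<noteq> 0}" using i by blast
  then have "finite (jet_part ` {m. g m \<noteq> 0})" using slice_jets[OF f] by (meson finite_subset image_mono)
  then show ?thesis using f i unfolding slice_def by blast
qed

lemma slice_zero [simp]: "slice N (\<lambda>m. 0)"
  by (simp add: slice_def)

lemma slice_add: "slice N f \<Longrightarrow> slice N g \<Longrightarrow> slice N (\<lambda>m. f m + g m)"
proof -
  assume f: "slice N f" and g: "slice N g"
  have "{m. f m + g m \<noteq> 0} \<subseteq> {m. f m \<noteq> 0} \<union> {m. g m \<noteq> 0}" by auto
  then have "jet_part ` {m. f m + g m \<noteq> 0} \<subseteq> jet_part ` {m. f m \<noteq> 0} \<union> jet_part ` {m. g m \<noteq> 0}" by blast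
  then have "finite (jet_part ` {m. f m + g m \<noteq> 0})"
    using slice_jets[OF f] slice_jets[OF g] by (meson finite_UnI finite_subset)
  moreover have "f m + g m \<noteq> 0 \<Longrightarrow> f m \<noteq> 0 \<or> g m \<noteq> 0" for m by auto
  ultimately show ?thesis using f g unfolding slice_def by blast
qed

lemma slice_scale: "slice N f \<Longrightarrow> slice N (\<lambda>m. c * f m)"
  by (rule slice_mono) auto

lemma slice_sum: "(\<And>i. i \<in> I \<Longrightarrow> slice N (f i)) \<Longrightarrow> slice N (\<lambda>m. \<Sum>i\<in>I. f i m)"
  by (induction I rule: infinite_finite_induct) (simp_all add: slice_add)

text \<open>Only finitely many jet parts occur, and the exponents of the N variables u^\<alpha>_0
  are bounded by the total degree. The Fourier substitution is homogeneous, so this makes each of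
  its coefficients a finite sum.\<close>

lemma finite_slice:
  assumes "slice N g"
  shows "finite {m. g m \<noteq> 0 \<and> mtotal m = n}"
proof -
  let ?S = "{m. g m \<noteq> 0 \<and> mtotal m = n}"
  let ?\<phi> = "\<lambda>m :: jmon. (jet_part m, \<lambda>\<alpha>. m (\<alpha>, 0 :: nat))"
  let ?Z = "{q :: nat \<Rightarrow> nat. \<forall>\<alpha>. (\<alpha> \<in> {1..N} \<longrightarrow> q \<alpha> \<in> {..n}) \<and> (\<alpha> \<notin> {1..N} \<longrightarrow> q \<alpha> = 0)}"
  have "inj_on ?\<phi> ?S"
  proof (rule inj_onI)
    fix m m' assume e: "?\<phi> m = ?\<phi> m'"
    have "m (\<alpha>, j) = m' (\<alpha>, j)" for \<alpha> j
    proof (cases j)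
      case 0
      then show ?thesis using e by (auto dest: fun_cong[of _ _ \<alpha>])
    next
      case (Suc i)
      have "jet_part m (\<alpha>, j) = jet_part m' (\<alpha>, j)" using e by simp
      then show ?thesis using Suc by (simp add: jet_part_def)
    qed
    then show "m = m'" by (intro ext) (metis surj_pair)
  qed
  moreover have "?\<phi> ` ?S \<subseteq> (jet_part ` {m. g m \<noteq> 0}) \<times> ?Z"
  proof (rule image_subsetI)
    fix m assume m: "m \<in> ?S"
    have "m (\<alpha>, 0) \<le> n" for \<alpha>
    proof (cases "m (\<alpha>, 0) = 0")
      case False
      then have "m (\<alpha>, 0) \<le> mtotal m"
        unfolding mtotal_def using m slice_finite[OF assms, of m] by (intro member_le_sum) (auto simp: msupp_def)
      then show ?thesis using m by simp
    qed simp
    moreover have "m (\<alpha>, 0) = 0" if "\<alpha> \<notin> {1..N}" for \<alpha>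
      using slice_index[OF assms, of m \<alpha> 0] m that by blast
    ultimately show "?\<phi> m \<in> (jet_part ` {m. g m \<noteq> 0}) \<times> ?Z" using m by auto
  qed
  moreover have "finite ((jet_part ` {m. g m \<noteq> 0}) \<times> ?Z)"
    using slice_jets[OF assms] finite_set_of_finite_funs[of "{1..N}" "{..n}" 0] by simp
  ultimately show ?thesis by (meson finite_subset inj_on_finite)
qed

definition jb :: "nat \<Rightarrow> (jmon \<Rightarrow> complex) \<Rightarrow> bool" where
  "jb J g \<longleftrightarrow> (\<forall>m \<alpha> j. g m \<noteq> 0 \<longrightarrow> m (\<alpha>, j) \<noteq> 0 \<longrightarrow> j \<le> J)"

lemma jbD: "jb J g \<Longrightarrow> g m \<noteq> 0 \<Longrightarrow> m (\<alpha>, j) \<noteq> 0 \<Longrightarrow> j \<le> J"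
  unfolding jb_def by blast

lemma jb_mono: "jb J g \<Longrightarrow> J \<le> J' \<Longrightarrow> jb J' g"
  unfolding jb_def using le_trans by blast

lemma msupp_jet_part: "msupp (jet_part m) \<subseteq> msupp m"
  by (auto simp: jet_part_def msupp_def)

lemma ex_jb: "slice N g \<Longrightarrow> \<exists>J. jb J g"
proof -
  assume g: "slice N g"
  let ?K = "\<Union>q\<in>jet_part ` {m. g m \<noteq> 0}. snd ` msupp q"
  have "finite (msupp (jet_part m))" if "g m \<noteq> 0" for m
    using slice_finite[OF g that] msupp_jet_part finite_subset by blast
  then have fin: "finite ?K"
    by (intro finite_UN_I slice_jets[OF g] finite_imageI) blast
  have "j \<le> Max (insert 0 ?K)" if "g m \<noteq> 0" "m (\<alpha>, j) \<noteq> 0" for m \<alpha> j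
  proof (cases "j = 0")
    case False
    then have "(\<alpha>, j) \<in> msupp (jet_part m)" using that by (simp add: jet_part_def msupp_def)
    then have "j \<in> ?K" using that(1) by force
    then show ?thesis using fin by (intro Max_ge) auto
  qed simp
  then show ?thesis unfolding jb_def by blast
qed

definition du :: "nat \<Rightarrow> nat \<Rightarrow> (jmon \<Rightarrow> complex) \<Rightarrow> jmon \<Rightarrow> complex" where
  "du \<alpha> k g = (\<lambda>m. of_nat (Suc (m (\<alpha>, k))) * g (inc (\<alpha>, k) m))"

lemma diff_u_du: "diff_u \<alpha> k f e h = du \<alpha> k (f e h)"
  unfolding diff_u_def du_def inc_def by simp

lemma du_nonzero: "du \<alpha> k g m \<noteq> 0 \<longleftrightarrow> g (inc (\<alpha>, k) m) \<noteq> 0"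
  unfolding du_def by (simp del: of_nat_Suc)

lemma slice_du:
  assumes "slice N g"
  shows "slice N (du \<alpha> k g)"
proof -
  let ?r = "\<lambda>q. if 0 < k then dec (\<alpha>, k) q else q"
  have j: "jet_part m = ?r (jet_part (inc (\<alpha>, k) m))" for m
    by (auto simp: jet_part_def inc_def dec_def fun_eq_iff)
  have "jet_part ` {m. du \<alpha> k g m \<noteq> 0} \<subseteq> ?r ` jet_part ` {m. g m \<noteq> 0}"
  proof (rule image_subsetI)
    fix m assume "m \<in> {m. du \<alpha> k g m \<noteq> 0}"
    then have "inc (\<alpha>, k) m \<in> {m. g m \<noteq> 0}" by (simp add: du_nonzero)
    then show "jet_part m \<in> ?r ` jet_part ` {m. g m \<noteq> 0}" using j[of m] by blast
  qed
  then have "finite (jet_part ` {m. du \<alpha> k g m \<noteq> 0})"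
    using slice_jets[OF assms] by (meson finite_imageI finite_subset)
  moreover have "finite (msupp m) \<and> (\<forall>v\<in>msupp m. 1 \<le> fst v \<and> fst v \<le> N)" if "du \<alpha> k g m \<noteq> 0" for m
  proof -
    have "g (inc (\<alpha>, k) m) \<noteq> 0" using that by (simp add: du_nonzero)
    then have "finite (msupp (inc (\<alpha>, k) m)) \<and> (\<forall>v\<in>msupp (inc (\<alpha>, k) m). 1 \<le> fst v \<and> fst v \<le> N)"
      using assms unfolding slice_def by blast
    then show ?thesis by (simp add: msupp_inc)
  qed
  ultimately show ?thesis unfolding slice_def by blast
qed

lemma jb_du: "jb J g \<Longrightarrow> jb J (du \<alpha> k g)"
proof -
  assume g: "jb J g"
  have "j \<le> J" if "du \<alpha> k g m \<noteq> 0" "m (\<beta>, j) \<noteq> 0" for m \<beta> j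
    by (rule jbD[OF g, of "inc (\<alpha>, k) m" \<beta>]) (use that in \<open>simp_all add: du_nonzero inc_def\<close>)
  then show ?thesis unfolding jb_def by blast
qed

lemma du_zero [simp]: "du \<alpha> k (\<lambda>m. 0) = (\<lambda>m. 0)"
  by (simp add: du_def)

lemma du_add: "du \<alpha> k (\<lambda>m. f m + g m) = (\<lambda>m. du \<alpha> k f m + du \<alpha> k g m)"
  by (simp add: du_def distrib_left)

lemma du_scale: "du \<alpha> k (\<lambda>m. c * f m) = (\<lambda>m. c * du \<alpha> k f m)"
  by (simp add: du_def mult.left_commute)

lemma du_sum: "du \<alpha> k (\<lambda>m. \<Sum>i\<in>I. f i m) = (\<lambda>m. \<Sum>i\<in>I. du \<alpha> k (f i) m)"
  by (simp add: du_def sum_distrib_left)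

lemma du_outside: "slice N g \<Longrightarrow> \<alpha> \<notin> {1..N} \<Longrightarrow> du \<alpha> k g = (\<lambda>m. 0)"
proof
  fix m assume g: "slice N g" and a: "\<alpha> \<notin> {1..N}"
  have "g (inc (\<alpha>, k) m) = 0" using slice_index[OF g, of "inc (\<alpha>, k) m" \<alpha> k] a by (metis inc_self nat.simps(3))
  then show "du \<alpha> k g m = 0" by (simp add: du_def)
qed

lemma du_above: "jb J g \<Longrightarrow> J < k \<Longrightarrow> du \<alpha> k g = (\<lambda>m. 0)"
proof
  fix m assume g: "jb J g" and a: "J < k"
  have "g (inc (\<alpha>, k) m) = 0" using jbD[OF g, of "inc (\<alpha>, k) m" \<alpha> k] a by (metis inc_self nat.simps(3) not_le)
  then show "du \<alpha> k g m = 0" by (simp add: du_def)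
qed

text \<open>The derivative at p = 0 along the modes \<open>xs\<close> of one eps-hbar slice. The
  substitution is linear in p, so only monomials of total degree \<open>length xs\<close>
  contribute.\<close>

definition Fx :: "(jmon \<Rightarrow> complex) \<Rightarrow> mode list \<Rightarrow> complex" where
  "Fx g xs = (\<Sum>m\<in>{m. g m \<noteq> 0 \<and> mtotal m = length xs}. g m * of_nat (mfact m) * tcoef m (mon xs))"

definition hat :: "fser \<Rightarrow> lfun" where
  "hat F xs = Abs_fps (\<lambda>h. Abs_fps (\<lambda>e. F (mon xs) h e * of_nat (mfact (mon xs))))"

lemma hat_nth [simp]: "hat F xs $ h $ e = F (mon xs) h e * of_nat (mfact (mon xs))"
  by (simp add: hat_def)

lemma perm_inv_hat: "perm_inv (hat F)"
  by (rule perm_invI, drule mon_eq_mset) (simp add: hat_def)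

lemma hat_fourier: "hat (fourier f) xs $ h $ e = Fx (f e h) xs"
  unfolding hat_nth fourier_def Fx_def sum_distrib_right mtotal_mon mult.assoc fcoef_tcoef ..

lemma Fx_superset:
  assumes "finite A" "\<And>m. g m \<noteq> 0 \<Longrightarrow> mtotal m = length xs \<Longrightarrow> m \<in> A" "\<And>m. m \<in> A \<Longrightarrow> g m \<noteq> 0 \<Longrightarrow> mtotal m = length xs"
  shows "Fx g xs = (\<Sum>m\<in>A. g m * of_nat (mfact m) * tcoef m (mon xs))"
  unfolding Fx_def
proof (rule sum.mono_neutral_left[OF assms(1)])
  show "{m. g m \<noteq> 0 \<and> mtotal m = length xs} \<subseteq> A" using assms(2) by blast
  show "\<forall>m\<in>A - {m. g m \<noteq> 0 \<and> mtotal m = length xs}. g m * of_nat (mfact m) * tcoef m (mon xs) = 0"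
    using assms(3) by force
qed

lemma Fx_zero [simp]: "Fx (\<lambda>m. 0) xs = 0"
  by (simp add: Fx_def)

lemma Fx_add: "slice N f \<Longrightarrow> slice N g \<Longrightarrow> Fx (\<lambda>m. f m + g m) xs = Fx f xs + Fx g xs"
proof -
  assume f: "slice N f" and g: "slice N g"
  let ?A = "{m. f m \<noteq> 0 \<and> mtotal m = length xs} \<union> {m. g m \<noteq> 0 \<and> mtotal m = length xs}"
  have A: "finite ?A" using finite_slice[OF f] finite_slice[OF g] by simp
  have "Fx f xs = (\<Sum>m\<in>?A. f m * of_nat (mfact m) * tcoef m (mon xs))"
    "Fx g xs = (\<Sum>m\<in>?A. g m * of_nat (mfact m) * tcoef m (mon xs))"
    "Fx (\<lambda>m. f m + g m) xs = (\<Sum>m\<in>?A. (f m + g m) * of_nat (mfact m) * tcoef m (mon xs))"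
    by (rule Fx_superset[OF A]; force)+
  then show ?thesis by (simp only: sum.distrib distrib_right)
qed

lemma Fx_weight: "slice N g \<Longrightarrow> Fx (\<lambda>m. w (mtotal m) * g m) xs = w (length xs) * Fx g xs"
proof -
  assume g: "slice N g"
  let ?A = "{m. g m \<noteq> 0 \<and> mtotal m = length xs}"
  have "Fx (\<lambda>m. w (mtotal m) * g m) xs = (\<Sum>m\<in>?A. w (mtotal m) * g m * of_nat (mfact m) * tcoef m (mon xs))"
    by (rule Fx_superset[OF finite_slice[OF g]]) auto
  also have "\<dots> = (\<Sum>m\<in>?A. w (length xs) * (g m * of_nat (mfact m) * tcoef m (mon xs)))"
    by (rule sum.cong) auto
  finally show ?thesis by (simp add: Fx_def sum_distrib_left)
qed

lemma Fx_scale: "slice N g \<Longrightarrow> Fx (\<lambda>m. c * g m) xs = c * Fx g xs"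
  using Fx_weight[of N g "\<lambda>_. c" xs] by simp

lemma Fx_sum: "(\<And>i. i \<in> I \<Longrightarrow> slice N (f i)) \<Longrightarrow> Fx (\<lambda>m. \<Sum>i\<in>I. f i m) xs = (\<Sum>i\<in>I. Fx (f i) xs)"
proof (induction I rule: infinite_finite_induct)
  case (insert i I)
  then show ?case using Fx_add[of N "f i" "\<lambda>m. \<Sum>i\<in>I. f i m" xs] slice_sum[of I N f] by simp
qed simp_all

lemma Fx_Nil: "slice N g \<Longrightarrow> Fx g [] = g (\<lambda>_. 0)"
proof -
  assume g: "slice N g"
  have "Fx g [] = (\<Sum>m\<in>{\<lambda>_. 0}. g m * of_nat (mfact m) * tcoef m (mon ([] :: mode list)))"
  proof (rule Fx_superset)
    fix m assume "g m \<noteq> 0" "mtotal m = length ([] :: mode list)"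
    then show "m \<in> {\<lambda>_. 0}" using mtotal_eq_0[OF slice_finite[OF g]] by simp
  qed auto
  then show ?thesis by (simp add: tcoef_Nil)
qed

text \<open>The chain rule for the substitution of Fourier series: after exchanging the sums,
  removing one u^\<alpha>_j from each monomial is a bijection onto the monomials of the jet
  derivative.\<close>

lemma Fx_Cons:
  assumes g: "slice N g" "jb J g"
  shows "Fx g ((\<alpha>, \<kappa>) # xs) = (\<Sum>j\<le>J. (\<i> * of_int \<kappa>) ^ j * Fx (du \<alpha> j g) xs)"
proof -
  let ?A = "{m. g m \<noteq> 0 \<and> mtotal m = Suc (length xs)}"
  have fin: "finite ?A" by (rule finite_slice[OF g(1)])
  let ?t = "\<lambda>m j. g m * of_nat (mfact m) * ((\<i> * of_int \<kappa>) ^ j * tcoef (dec (\<alpha>, j) m) (mon xs))"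
  have "Fx g ((\<alpha>, \<kappa>) # xs) = (\<Sum>m\<in>?A. \<Sum>j\<in>{j\<in>{..J}. m (\<alpha>, j) \<noteq> 0}. ?t m j)"
    unfolding Fx_def length_Cons
  proof (rule sum.cong[OF refl])
    fix m assume m: "m \<in> ?A"
    have "tcoef m (mon ((\<alpha>, \<kappa>) # xs)) = (\<Sum>j\<in>{j. j \<le> J \<and> m (\<alpha>, j) \<noteq> 0}. (\<i> * of_int \<kappa>) ^ j * tcoef (dec (\<alpha>, j) m) (mon xs))"
      unfolding mon_Cons by (rule tcoef_inc) (use m slice_finite[OF g(1)] jbD[OF g(2)] in auto)
    then show "g m * of_nat (mfact m) * tcoef m (mon ((\<alpha>, \<kappa>) # xs)) = (\<Sum>j\<in>{j\<in>{..J}. m (\<alpha>, j) \<noteq> 0}. ?t m j)"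
      by (simp add: sum_distrib_left)
  qed
  also have "\<dots> = (\<Sum>j\<le>J. \<Sum>m\<in>{m\<in>?A. m (\<alpha>, j) \<noteq> 0}. ?t m j)"
    by (rule sum.swap_restrict[OF fin]) simp
  also have "\<dots> = (\<Sum>j\<le>J. (\<i> * of_int \<kappa>) ^ j * Fx (du \<alpha> j g) xs)"
  proof (rule sum.cong[OF refl])
    fix j :: nat
    let ?v = "(\<alpha>, j)"
    have "(\<Sum>m\<in>{m\<in>?A. m ?v \<noteq> 0}. ?t m j)
      = (\<Sum>m\<in>{m. du \<alpha> j g m \<noteq> 0 \<and> mtotal m = length xs}. (\<i> * of_int \<kappa>) ^ j * (du \<alpha> j g m * of_nat (mfact m) * tcoef m (mon xs)))"
    proof (rule sum.reindex_bij_witness[of _ "inc ?v" "dec ?v"])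
      fix m assume m: "m \<in> {m\<in>?A. m ?v \<noteq> 0}"
      then have id: "inc ?v (dec ?v m) = m" by (simp add: inc_dec)
      show "inc ?v (dec ?v m) = m" by (rule id)
      define q where "q = dec ?v m"
      have mq: "m = inc ?v q" by (simp add: q_def id)
      have fq: "finite (msupp q)"
        using m slice_finite[OF g(1), of m] msupp_dec[of ?v m] finite_subset unfolding q_def by blast
      show "dec ?v m \<in> {m. du \<alpha> j g m \<noteq> 0 \<and> mtotal m = length xs}"
        using m fq unfolding mq by (simp add: du_nonzero mtotal_inc)
      show "(\<i> * of_int \<kappa>) ^ j * (du \<alpha> j g (dec ?v m) * of_nat (mfact (dec ?v m)) * tcoef (dec ?v m) (mon xs)) = ?t m j"
        unfolding mq dec_inc du_def mfact_inc[OF fq] of_nat_mult by (simp only: mult_ac)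
    next
      fix m assume m: "m \<in> {m. du \<alpha> j g m \<noteq> 0 \<and> mtotal m = length xs}"
      then have "finite (msupp m)" using slice_finite[OF slice_du[OF g(1)]] by blast
      then show "inc ?v m \<in> {m\<in>?A. m ?v \<noteq> 0}" using m by (simp add: du_nonzero mtotal_inc)
    qed simp
    then show "(\<Sum>m\<in>{m\<in>?A. m ?v \<noteq> 0}. ?t m j) = (\<i> * of_int \<kappa>) ^ j * Fx (du \<alpha> j g) xs"
      by (simp add: Fx_def sum_distrib_left)
  qed
  finally show ?thesis .
qed

lemma Fx_Cons_0: "slice N g \<Longrightarrow> Fx g ((\<alpha>, 0) # xs) = Fx (du \<alpha> 0 g) xs"
proof -
  assume g: "slice N g"
  obtain J where J: "jb J g" using ex_jb[OF g] by blast
  have "Fx g ((\<alpha>, 0) # xs) = (\<Sum>j\<le>J. if j = 0 then Fx (du \<alpha> 0 g) xs else 0)"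
    unfolding Fx_Cons[OF g J] by (rule sum.cong) (auto simp: zero_power)
  then show ?thesis by simp
qed

lemma Fx_outside: "slice N g \<Longrightarrow> \<alpha> \<notin> {1..N} \<Longrightarrow> Fx g ((\<alpha>, \<kappa>) # xs) = 0"
proof -
  assume g: "slice N g" and a: "\<alpha> \<notin> {1..N}"
  obtain J where J: "jb J g" using ex_jb[OF g] by blast
  show ?thesis unfolding Fx_Cons[OF g J] du_outside[OF g a] by simp
qed

text \<open>Taylor coefficients at 0 in the jet variables: the symbol that \<open>sy\<close>
  evaluates.\<close>

fun tc :: "(jmon \<Rightarrow> complex) \<Rightarrow> (nat \<times> nat) list \<Rightarrow> complex" where
  "tc g [] = g (\<lambda>_. 0)"
| "tc g (w # ws) = tc (du (fst w) (snd w) g) ws"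

lemma Fx_sy: "slice N g \<Longrightarrow> jb J g \<Longrightarrow> Fx g xs = sy J (tc g) xs"
proof (induction xs arbitrary: g)
  case Nil
  then show ?case by (simp add: Fx_Nil)
next
  case (Cons x xs)
  obtain \<alpha> \<kappa> where x: "x = (\<alpha>, \<kappa>)" by force
  show ?case
    unfolding x Fx_Cons[OF Cons.prems] using Cons.IH[OF slice_du[OF Cons.prems(1)] jb_du[OF Cons.prems(2)]] by simp
qed

lemma power_sum_zero:
  fixes c :: "nat \<Rightarrow> complex"
  assumes "\<And>t :: int. (\<Sum>j\<le>J. (\<i> * of_int t) ^ j * c j) = 0" "j \<le> J"
  shows "c j = 0"
proof -
  define p where "p = (\<Sum>j\<le>J. monom (\<i> ^ j * c j) j)"
  have "poly p (of_int t) = 0" for t :: int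
    using assms(1)[of t] by (simp add: p_def poly_sum poly_monom power_mult_distrib mult_ac)
  then have r: "range (of_int :: int \<Rightarrow> complex) \<subseteq> {x. poly p x = 0}" by auto
  have "p = 0"
  proof (rule ccontr)
    assume "p \<noteq> 0"
    then have "finite (range (of_int :: int \<Rightarrow> complex))" using poly_roots_finite r finite_subset by blast
    moreover have "inj (of_int :: int \<Rightarrow> complex)" by (simp add: inj_on_def)
    ultimately show False using finite_imageD infinite_UNIV_int by blast
  qed
  then have "coeff p j = 0" by simp
  then have "\<i> ^ j * c j = 0" using assms(2) by (simp add: p_def coeff_sum)
  then show ?thesis by simp
qed

text \<open>The frequencies in the list are free, and each coefficient is polynomial in the first of
  them. Its vanishing separates the jet orders, and every jet derivative falls under the
  induction.\<close>

lemma Fx_inject: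
  assumes "slice N g" "\<And>xs. length xs = n \<Longrightarrow> Fx g xs = 0" "finite (msupp m)" "mtotal m = n"
  shows "g m = 0"
  using assms
proof (induction n arbitrary: g m)
  case 0
  then show ?case using Fx_Nil[OF 0(1)] mtotal_eq_0[of m] by simp
next
  case (Suc n)
  obtain J where J: "jb J g" using ex_jb[OF Suc.prems(1)] by blast
  have "msupp m \<noteq> {}" using Suc.prems(4) msupp_empty[of m] by force
  then obtain \<alpha> j where v: "m (\<alpha>, j) \<noteq> 0" by (auto simp: msupp_def)
  let ?v = "(\<alpha>, j)"
  have id: "inc ?v (dec ?v m) = m" by (rule inc_dec[of m ?v, OF v])
  have fq: "finite (msupp (dec ?v m))" using msupp_dec[of ?v m] Suc.prems(3) finite_subset by blast
  show ?case
  proof (cases "j \<le> J")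
    case True
    have "du \<alpha> j g (dec ?v m) = 0"
    proof (rule Suc.IH[OF slice_du[OF Suc.prems(1)] _ fq])
      fix xs :: "mode list" assume l: "length xs = n"
      have "(\<Sum>j\<le>J. (\<i> * of_int t) ^ j * Fx (du \<alpha> j g) xs) = 0" for t
        using Suc.prems(2)[of "(\<alpha>, t) # xs"] l unfolding Fx_Cons[OF Suc.prems(1) J] by simp
      then show "Fx (du \<alpha> j g) xs = 0" by (rule power_sum_zero[OF _ True])
    next
      show "mtotal (dec ?v m) = n" using mtotal_inc[OF fq, of ?v] Suc.prems(4) unfolding id by simp
    qed
    then show ?thesis using du_nonzero[of \<alpha> j g "dec ?v m"] unfolding id by blast
  next
    case False
    then show ?thesis using jbD[OF J, of m \<alpha> j] v by blast
  qed
qed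

lemma polyf_Fx_hd: "slice N g \<Longrightarrow> linf f \<Longrightarrow> polyf (\<lambda>t. Fx g ((\<alpha>, f t) # xs))"
proof -
  assume g: "slice N g" and f: "linf f"
  obtain J where J: "jb J g" using ex_jb[OF g] by blast
  show ?thesis
    unfolding Fx_Cons[OF g J] by (intro polyf_sum polyf_mult polyf_power polyf_const polyf_of_linf f)
qed

text \<open>Equations carrying the factor \<open>freq xs\<close> give no information at total
  frequency 0. As a polynomial in the first frequency, the coefficient also vanishes at the one
  value that is excluded.\<close>

lemma Fx_inject_nonzero_freq:
  assumes g: "slice N g" and z: "\<And>xs. xs \<noteq> [] \<Longrightarrow> freq xs \<noteq> 0 \<Longrightarrow> Fx g xs = 0" and m: "m \<noteq> (\<lambda>_. 0)"
  shows "g m = 0"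
proof (rule ccontr)
  assume "g m \<noteq> 0"
  then have f: "finite (msupp m)" by (rule slice_finite[OF g])
  obtain n where n: "mtotal m = Suc n" using mtotal_pos[OF f m] gr0_conv_Suc by blast
  have "Fx g xs = 0" if l: "length xs = Suc n" for xs
  proof -
    obtain \<alpha> \<kappa> ys where xs: "xs = (\<alpha>, \<kappa>) # ys" using l by (metis length_Suc_conv surj_pair)
    have "linf (\<lambda>t. t)" using linfI[of 0 1] by simp
    then have "polyf (\<lambda>t. Fx g ((\<alpha>, t) # ys))" by (rule polyf_Fx_hd[OF g])
    then show ?thesis
      unfolding xs by (rule polyf_eq_0_cofinite[of _ "{- freq ys}"]) (auto intro!: z)
  qed
  then show False using Fx_inject[OF g _ f n] \<open>g m \<noteq> 0\<close> by blast
qed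

section \<open>The total derivative and the variational derivative\<close>

definition low :: "nat \<times> nat \<Rightarrow> nat \<times> nat" where
  "low v = (fst v, snd v - 1)"

definition dxs :: "(jmon \<Rightarrow> complex) \<Rightarrow> jmon \<Rightarrow> complex" where
  "dxs g = (\<lambda>m. \<Sum>v\<in>{v. m v \<noteq> 0 \<and> 0 < snd v}. of_nat (Suc (dec v m (low v))) * g (inc (low v) (dec v m)))"

lemma dx_dxs: "dx f e h = dxs (f e h)"
  unfolding dx_def dxs_def diff_u_du du_def low_def dec_def by simp

lemma low_neq: "0 < snd v \<Longrightarrow> low v \<noteq> v"
  by (auto simp: low_def prod_eq_iff)

lemma dxs_nonzero: "dxs g m \<noteq> 0 \<Longrightarrow> \<exists>v. m v \<noteq> 0 \<and> 0 < snd v \<and> g (inc (low v) (dec v m)) \<noteq> 0"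
proof (rule ccontr)
  assume a: "dxs g m \<noteq> 0" and n: "\<not> (\<exists>v. m v \<noteq> 0 \<and> 0 < snd v \<and> g (inc (low v) (dec v m)) \<noteq> 0)"
  have "dxs g m = 0" unfolding dxs_def
  proof (rule sum.neutral, rule ballI)
    fix v assume "v \<in> {v. m v \<noteq> 0 \<and> 0 < snd v}"
    then have "g (inc (low v) (dec v m)) = 0" using n by blast
    then show "of_nat (Suc (dec v m (low v))) * g (inc (low v) (dec v m)) = 0" by simp
  qed
  with a show False by simp
qed

lemma slice_dxs:
  assumes "slice N g"
  shows "slice N (dxs g)"
proof -
  let ?Q = "jet_part ` {m. g m \<noteq> 0}"
  \<comment> \<open>Every monomial of the derivative is obtained by raising one variable
    \<open>w\<close> of a monomial of \<open>g\<close>. A variable of order 0 is invisible in the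
    jet part, so then nothing is removed there, and \<open>w\<close> ranges over the N
    indices.\<close>
  let ?f = "\<lambda>q w. inc (fst w, Suc (snd w)) (if 0 < snd w then dec w q else q)"
  let ?B = "\<Union>q\<in>?Q. ?f q ` (msupp q \<union> {1..N} \<times> {0})"
  have fq: "finite (msupp q)" if q: "q \<in> ?Q" for q
  proof -
    obtain m where m: "g m \<noteq> 0" "q = jet_part m" using q by blast
    show ?thesis unfolding m(2) by (rule finite_subset[OF msupp_jet_part slice_finite[OF assms m(1)]])
  qed
  have fB: "finite ?B"
  proof (rule finite_UN_I[OF slice_jets[OF assms]])
    fix q assume "q \<in> ?Q"
    from fq[OF this] show "finite (?f q ` (msupp q \<union> {1..N} \<times> {0}))" by simp
  qed
  have main: "finite (msupp m) \<and> (\<forall>v\<in>msupp m. 1 \<le> fst v \<and> fst v \<le> N) \<and> jet_part m \<in> ?B" if nz: "dxs g m \<noteq> 0" for m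
  proof -
    obtain v where v: "m v \<noteq> 0" "0 < snd v" "g (inc (low v) (dec v m)) \<noteq> 0"
      using dxs_nonzero[OF nz] by blast
    define m' where "m' = inc (low v) (dec v m)"
    have sl: "finite (msupp m')" "\<And>w. w \<in> msupp m' \<Longrightarrow> 1 \<le> fst w \<and> fst w \<le> N"
      using assms[unfolded slice_def, THEN conjunct1, rule_format, OF v(3)] unfolding m'_def by simp_all
    have sub: "msupp m \<subseteq> insert v (msupp m')"
      unfolding m'_def msupp_inc by (auto simp: msupp_def dec_def)
    have lw: "low v \<in> msupp m'" unfolding m'_def msupp_inc by simp
    have idx: "1 \<le> fst v \<and> fst v \<le> N" using sl(2)[OF lw] by (simp add: low_def)
    have "jet_part m = ?f (jet_part m') (low v)"
    proof
      fix x :: "nat \<times> nat"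
      obtain a b where ab: "v = (a, Suc b)" using v(2) by (metis gr0_conv_Suc prod.collapse)
      obtain c d where x: "x = (c, d)" by (rule prod.exhaust)
      have l: "low v = (a, b)" by (simp add: ab low_def)
      show "jet_part m x = ?f (jet_part m') (low v) x"
        using v(1) unfolding m'_def l unfolding ab x jet_part_def inc_def dec_def
        by (cases "c = a"; cases "d = Suc b"; cases "d = b"; cases b) simp_all
    qed
    moreover have jq: "jet_part m' \<in> ?Q" by (rule imageI) (use v(3) m'_def in simp)
    moreover have "low v \<in> msupp (jet_part m') \<union> {1..N} \<times> {0}"
    proof (cases "snd (low v) = 0")
      case True
      then have "low v = (fst v, 0)" by (simp add: low_def prod_eq_iff)
      then show ?thesis using idx by simp
    next
      case False
      then show ?thesis using lw by (simp add: msupp_def jet_part_def)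
    qed
    ultimately have "jet_part m \<in> ?B" by (simp only:) (rule UN_I[OF jq], rule imageI)
    moreover have "finite (msupp m)" by (rule finite_subset[OF sub]) (simp add: sl(1))
    moreover have "1 \<le> fst w \<and> fst w \<le> N" if w: "w \<in> msupp m" for w
    proof (cases "w = v")
      case True
      then show ?thesis using idx by simp
    next
      case False
      then show ?thesis using w sub sl(2)[of w] by blast
    qed
    ultimately show ?thesis by simp
  qed
  have "jet_part ` {m. dxs g m \<noteq> 0} \<subseteq> ?B"
    by (rule image_subsetI) (rule main[THEN conjunct2, THEN conjunct2], simp)
  then have "finite (jet_part ` {m. dxs g m \<noteq> 0})" using fB by (rule finite_subset)
  moreover have "\<forall>m. dxs g m \<noteq> 0 \<longrightarrow> finite (msupp m) \<and> (\<forall>v\<in>msupp m. 1 \<le> fst v \<and> fst v \<le> N)"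
    using main by simp
  ultimately show ?thesis unfolding slice_def by simp
qed

lemma jb_dxs: "jb J g \<Longrightarrow> jb (Suc J) (dxs g)"
proof -
  assume g: "jb J g"
  have "j \<le> Suc J" if nz: "dxs g m \<noteq> 0" and mj: "m (\<beta>, j) \<noteq> 0" for m \<beta> j
  proof -
    obtain v where v: "m v \<noteq> 0" "0 < snd v" "g (inc (low v) (dec v m)) \<noteq> 0"
      using dxs_nonzero[OF nz] by blast
    have l: "snd (low v) \<le> J"
      using jbD[OF g v(3), of "fst (low v)" "snd (low v)"] by simp
    show ?thesis
    proof (cases "v = (\<beta>, j)")
      case True
      then show ?thesis using l v(2) by (simp add: low_def)
    next
      case False
      then have "inc (low v) (dec v m) (\<beta>, j) \<noteq> 0" using mj by (auto simp: inc_def dec_def)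
      then show ?thesis using jbD[OF g v(3)] by fastforce
    qed
  qed
  then show ?thesis unfolding jb_def by blast
qed

text \<open>The two sides are compared term by term over a common finite set of variables. All terms
  agree except the one of u^\<alpha>_k itself, where the exponent m + 1 faces m; the surplus 1 is
  the commutator term.\<close>

lemma du_dxs:
  assumes g: "slice N g"
  shows "du \<alpha> k (dxs g) m = dxs (du \<alpha> k g) m + (if 0 < k then du \<alpha> (k - 1) g m else 0)"
proof (cases "finite (msupp m)")
  case False
  have "du \<alpha> k (dxs g) m = 0" "dxs (du \<alpha> k g) m = 0" "du \<alpha> (k - 1) g m = 0"
    using False slice_finite[OF slice_du[OF slice_dxs[OF g]], of \<alpha> k m]
      slice_finite[OF slice_dxs[OF slice_du[OF g]], of \<alpha> k m] slice_finite[OF slice_du[OF g], of \<alpha> "k - 1" m]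
    by blast+
  then show ?thesis by simp
next
  case True
  let ?w = "(\<alpha>, k)"
  define A where "A = {v\<in>insert ?w (msupp m). 0 < snd v}"
  have fA: "finite A" using True by (simp add: A_def)
  have sup: "dxs f q = (\<Sum>v\<in>A. if q v = 0 then 0 else of_nat (Suc (dec v q (low v))) * f (inc (low v) (dec v q)))"
    if "msupp q \<subseteq> insert ?w (msupp m)" for f q
    unfolding dxs_def using that by (intro sum.mono_neutral_cong_left fA) (auto simp: A_def msupp_def)
  have "du \<alpha> k (dxs g) m = (\<Sum>v\<in>A. of_nat (Suc (m ?w)) *
      (if inc ?w m v = 0 then 0 else of_nat (Suc (dec v (inc ?w m) (low v))) * g (inc (low v) (dec v (inc ?w m)))))"
    unfolding du_def sup[of "inc ?w m", unfolded msupp_inc, OF subset_refl] sum_distrib_left ..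
  also have "\<dots> = (\<Sum>v\<in>A. (if m v = 0 then 0 else of_nat (Suc (dec v m (low v))) * du \<alpha> k g (inc (low v) (dec v m)))
      + (if v = ?w then du \<alpha> (k - 1) g m else 0))"
  proof (rule sum.cong[OF refl])
    fix v assume "v \<in> A"
    then have v: "0 < snd v" by (simp add: A_def)
    have lv: "low v \<noteq> v" by (rule low_neq[OF v])
    show "of_nat (Suc (m ?w)) *
      (if inc ?w m v = 0 then 0 else of_nat (Suc (dec v (inc ?w m) (low v))) * g (inc (low v) (dec v (inc ?w m))))
      = (if m v = 0 then 0 else of_nat (Suc (dec v m (low v))) * du \<alpha> k g (inc (low v) (dec v m)))
      + (if v = ?w then du \<alpha> (k - 1) g m else 0)"
    proof (cases "v = ?w")
      case vw: True
      have lw: "low v = (\<alpha>, k - 1)" by (simp add: vw low_def)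
      show ?thesis
      proof (cases "m v = 0")
        case True
        then show ?thesis unfolding vw[symmetric] using lv by (simp add: lw du_def)
      next
        case False
        have id: "inc v (inc (low v) (dec v m)) = inc (low v) m"
          using False lv by (auto simp: inc_def dec_def fun_eq_iff)
        have c: "inc (low v) (dec v m) v = m v - 1" "dec v m (low v) = m (low v)"
          using lv by (auto simp: inc_def dec_def)
        obtain n where n: "m v = Suc n" using False not0_implies_Suc by blast
        show ?thesis
          unfolding du_def vw[symmetric] id c dec_inc inc_self lw[symmetric]
          by (simp add: n algebra_simps)
      qed
    next
      case False
      have iv: "inc ?w m v = m v" using False by (simp add: inc_def)
      show ?thesis
      proof (cases "m v = 0")
        case True
        then show ?thesis using False iv by simp
      next
        case mv: False
        have cm: "dec v (inc ?w m) = inc ?w (dec v m)" "inc (low v) (inc ?w q) = inc ?w (inc (low v) q)" for q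
          using False by (auto simp: inc_def dec_def fun_eq_iff)
        have "Suc (m ?w) * Suc (inc ?w (dec v m) (low v)) = Suc (dec v m (low v)) * Suc (inc (low v) (dec v m) ?w)"
          using False lv by (cases "low v = ?w") (auto simp: inc_def dec_def)
        then have "of_nat (Suc (m ?w)) * of_nat (Suc (inc ?w (dec v m) (low v)))
          = (of_nat (Suc (dec v m (low v))) * of_nat (Suc (inc (low v) (dec v m) ?w)) :: complex)"
          by (simp only: of_nat_mult[symmetric])
        then show ?thesis
          using False mv iv unfolding du_def cm by (simp only: if_False mult.assoc[symmetric] add_0_right)
      qed
    qed
  qed
  also have "\<dots> = dxs (du \<alpha> k g) m + (if 0 < k then du \<alpha> (k - 1) g m else 0)"
  proof -
    have "?w \<in> A \<longleftrightarrow> 0 < k" by (simp add: A_def)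
    then show ?thesis using fA by (simp add: sum.distrib sup[of m] subset_insertI)
  qed
  finally show ?thesis .
qed

text \<open>In the induction the commutator term of \<open>du_dxs\<close> shifts the sum over jet
  orders by one, which contributes the frequency of the new mode.\<close>

lemma Fx_dxs: "slice N g \<Longrightarrow> Fx (dxs g) xs = \<i> * of_int (freq xs) * Fx g xs"
proof (induction xs arbitrary: g)
  case Nil
  then show ?case unfolding Fx_Nil[OF slice_dxs[OF Nil]] by (simp add: dxs_def)
next
  case (Cons x xs)
  note g = Cons.prems
  obtain \<alpha> \<kappa> where x: "x = (\<alpha>, \<kappa>)" by force
  obtain J where J: "jb J g" using ex_jb[OF g] by blast
  let ?z = "\<i> * of_int \<kappa> :: complex"
  have st: "Fx (du \<alpha> j (dxs g)) xs = \<i> * of_int (freq xs) * Fx (du \<alpha> j g) xs + (if 0 < j then Fx (du \<alpha> (j - 1) g) xs else 0)" for j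
  proof -
    have "Fx (du \<alpha> j (dxs g)) xs = Fx (\<lambda>m. dxs (du \<alpha> j g) m + (if 0 < j then du \<alpha> (j - 1) g m else 0)) xs"
      using du_dxs[OF g] by presburger
    also have "\<dots> = Fx (dxs (du \<alpha> j g)) xs + Fx (\<lambda>m. if 0 < j then du \<alpha> (j - 1) g m else 0) xs"
      by (rule Fx_add[OF slice_dxs[OF slice_du[OF g]]]) (cases "0 < j", simp_all add: slice_du[OF g])
    finally show ?thesis using Cons.IH[OF slice_du[OF g]] by simp
  qed
  have "Fx (dxs g) (x # xs) = \<i> * of_int (freq xs) * (\<Sum>j\<le>Suc J. ?z ^ j * Fx (du \<alpha> j g) xs)
      + (\<Sum>j\<le>Suc J. ?z ^ j * (if 0 < j then Fx (du \<alpha> (j - 1) g) xs else 0))"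
    unfolding x Fx_Cons[OF slice_dxs[OF g] jb_dxs[OF J]] st
    by (simp only: distrib_left sum.distrib sum_distrib_left mult.left_commute)
  also have "(\<Sum>j\<le>Suc J. ?z ^ j * (if 0 < j then Fx (du \<alpha> (j - 1) g) xs else 0)) = ?z * (\<Sum>j\<le>J. ?z ^ j * Fx (du \<alpha> j g) xs)"
    by (subst sum.atMost_Suc_shift) (simp add: sum_distrib_left mult_ac)
  also have "(\<Sum>j\<le>Suc J. ?z ^ j * Fx (du \<alpha> j g) xs) = (\<Sum>j\<le>J. ?z ^ j * Fx (du \<alpha> j g) xs)"
    by (simp add: du_above[OF J])
  finally show ?case unfolding x Fx_Cons[OF g J] by (simp add: algebra_simps)
qed

lemma Fx_dxs_power: "slice N g \<Longrightarrow> slice N (((\<lambda>g m. - dxs g m) ^^ i) g) \<and>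
  Fx (((\<lambda>g m. - dxs g m) ^^ i) g) xs = (- (\<i> * of_int (freq xs))) ^ i * Fx g xs"
proof (induction i)
  case (Suc i)
  let ?g = "((\<lambda>g m. - dxs g m) ^^ i) g"
  have sl: "slice N ?g" and IH: "Fx ?g xs = (- (\<i> * of_int (freq xs))) ^ i * Fx g xs" using Suc by simp_all
  have s: "((\<lambda>g m. - dxs g m) ^^ Suc i) g = (\<lambda>m. (- 1) * dxs ?g m)" by simp
  show ?case
    unfolding s Fx_scale[OF slice_dxs[OF sl]] Fx_dxs[OF sl] IH using slice_scale[OF slice_dxs[OF sl], of "- 1"] by simp
qed simp

text \<open>Total differentiation is multiplication by i times the frequency, so the powers of -dx
  supply exactly the factors of the chain rule for the opposite frequency. Thus variational
  derivatives are mode derivatives of the local functional.\<close>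

lemma slice_var_deriv_Fx:
  assumes f: "is_qdp N f"
  shows "slice N (var_deriv \<alpha> f e h) \<and> Fx (var_deriv \<alpha> f e h) xs = Fx (f e h) ((\<alpha>, - freq xs) # xs)"
proof -
  let ?g = "f e h"
  have g: "slice N ?g" using f is_qdp_slice by blast
  let ?K = "{k. \<exists>m' \<beta>. ?g m' \<noteq> 0 \<and> m' (\<beta>, k) \<noteq> 0}"
  obtain J0 where J0: "jb J0 ?g" using ex_jb[OF g] by blast
  \<comment> \<open>Boundedness makes \<open>Sup\<close> a genuine upper bound of the occurring jet
    orders, so the cutoff in \<open>var_deriv\<close> loses no term.\<close>
  have bdd: "bdd_above ?K" using jbD[OF J0] by (intro bdd_aboveI[of _ J0]) blast
  have J: "jb (Sup ?K) ?g" unfolding jb_def using cSup_upper[OF _ bdd] by blast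
  have p: "((\<lambda>g ee hh mm. - dx g ee hh mm) ^^ i) q e h = ((\<lambda>g m. - dxs g m) ^^ i) (q e h)" for i q
  proof (induction i)
    case (Suc i)
    show ?case
      unfolding funpow.simps o_apply dx_dxs[of "((\<lambda>g ee hh mm. - dx g ee hh mm) ^^ i) q"] Suc.IH ..
  qed simp
  have v: "var_deriv \<alpha> f e h = (\<lambda>m. \<Sum>i\<le>Sup ?K. ((\<lambda>g m. - dxs g m) ^^ i) (du \<alpha> i ?g) m)"
    unfolding var_deriv_def by (simp only: p diff_u_du)
  have s: "slice N (((\<lambda>g m. - dxs g m) ^^ i) (du \<alpha> i ?g))" for i
    by (rule Fx_dxs_power[OF slice_du[OF g], THEN conjunct1])
  have "Fx (var_deriv \<alpha> f e h) xs = (\<Sum>i\<le>Sup ?K. (- (\<i> * of_int (freq xs))) ^ i * Fx (du \<alpha> i ?g) xs)"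
    unfolding v Fx_sum[OF s] Fx_dxs_power[OF slice_du[OF g], THEN conjunct2] ..
  then have "Fx (var_deriv \<alpha> f e h) xs = Fx ?g ((\<alpha>, - freq xs) # xs)"
    unfolding Fx_Cons[OF g J] by simp
  moreover have "slice N (var_deriv \<alpha> f e h)" unfolding v by (rule slice_sum[OF s])
  ultimately show ?thesis by blast
qed

section \<open>The star product of Fourier series\<close>

lemma mon_append: "mon (a @ b) = (\<lambda>v. mon a v + mon b v)"
  by (simp add: mon_def)

definition mchoose :: "('v \<Rightarrow> nat) \<Rightarrow> ('v \<Rightarrow> nat) \<Rightarrow> nat" where
  "mchoose M P = (\<Prod>v\<in>msupp M. M v choose P v)"

lemma mchoose_superset: "finite A \<Longrightarrow> msupp M \<subseteq> A \<Longrightarrow> P \<le> M \<Longrightarrow> mchoose M P = (\<Prod>v\<in>A. M v choose P v)"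
  unfolding mchoose_def
proof (rule prod.mono_neutral_left, assumption, assumption, rule ballI)
  fix v assume le: "P \<le> M" and v: "v \<in> A - msupp M"
  have "P v \<le> M v" by (rule le_funD[OF le])
  moreover have "M v = 0" using v by (simp add: msupp_def)
  ultimately show "M v choose P v = 1" by simp
qed

lemma msupp_mono: "(\<And>v. P v \<le> M v) \<Longrightarrow> msupp P \<subseteq> msupp M"
proof
  fix v assume le: "\<And>v. P v \<le> M v" and v: "v \<in> msupp P"
  have "0 < P v" using v by (simp add: msupp_def)
  from less_le_trans[OF this le] show "v \<in> msupp M" by (simp add: msupp_def)
qed

lemma mchoose_mfact:
  assumes "finite (msupp M)" "P \<le> M"
  shows "mchoose M P * mfact P * mfact (\<lambda>v. M v - P v) = mfact M"
proof -
  have le: "P v \<le> M v" for v using assms(2) by (simp add: le_fun_def)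
  have "msupp P \<subseteq> msupp M" by (rule msupp_mono[OF le])
  then have P: "mfact P = (\<Prod>v\<in>msupp M. fact (P v))" by (rule mfact_superset[OF assms(1)])
  have "msupp (\<lambda>v. M v - P v) \<subseteq> msupp M" by (auto simp: msupp_def)
  then have D: "mfact (\<lambda>v. M v - P v) = (\<Prod>v\<in>msupp M. fact (M v - P v))" by (rule mfact_superset[OF assms(1)])
  show ?thesis
    unfolding P D mchoose_def prod.distrib[symmetric] mfact_def[of M]
    by (rule prod.cong[OF refl]) (use binomial_fact_lemma[OF le] in \<open>simp add: mult_ac\<close>)
qed

lemma mchoose_inc:
  assumes f: "finite (msupp M)" and P: "P \<le> inc x M"
  shows "mchoose (inc x M) P = (if P x \<noteq> 0 then mchoose M (dec x P) else 0) + (if P \<le> M then mchoose M P else 0)"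
proof -
  let ?A = "insert x (msupp M)"
  have fA: "finite ?A" using f by simp
  have Pv: "P v \<le> M v" if "v \<noteq> x" for v using le_funD[OF P, of v] that by (simp add: inc_def)
  have Px: "P x \<le> Suc (M x)" using le_funD[OF P, of x] by simp
  define R where "R = (\<Prod>v\<in>?A - {x}. M v choose P v)"
  have split: "(\<Prod>v\<in>?A. h v) = h x * (\<Prod>v\<in>?A - {x}. h v)" for h :: "'a \<Rightarrow> nat"
    using fA by (rule prod.remove) simp
  have 1: "mchoose (inc x M) P = (Suc (M x) choose P x) * R"
  proof -
    have "mchoose (inc x M) P = (\<Prod>v\<in>?A. inc x M v choose P v)"
      by (rule mchoose_superset[OF fA _ P]) (simp add: msupp_inc)
    also have "\<dots> = (Suc (M x) choose P x) * (\<Prod>v\<in>?A - {x}. inc x M v choose P v)" unfolding split by simp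
    also have "(\<Prod>v\<in>?A - {x}. inc x M v choose P v) = R"
      unfolding R_def by (rule prod.cong) (auto simp: inc_def)
    finally show ?thesis .
  qed
  have 2: "mchoose M (dec x P) = (M x choose (P x - 1)) * R"
  proof -
    have "dec x P \<le> M" unfolding le_fun_def
    proof
      fix v show "dec x P v \<le> M v" using Pv[of v] Px by (cases "v = x") (simp_all add: dec_def)
    qed
    then have "mchoose M (dec x P) = (\<Prod>v\<in>?A. M v choose dec x P v)"
      by (intro mchoose_superset fA) auto
    also have "\<dots> = (M x choose (P x - 1)) * (\<Prod>v\<in>?A - {x}. M v choose dec x P v)" unfolding split by (simp add: dec_def)
    also have "(\<Prod>v\<in>?A - {x}. M v choose dec x P v) = R"
      unfolding R_def by (rule prod.cong) (auto simp: dec_def)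
    finally show ?thesis .
  qed
  have 3: "(if P \<le> M then mchoose M P else 0) = (M x choose P x) * R"
  proof (cases "P \<le> M")
    case True
    have "mchoose M P = (\<Prod>v\<in>?A. M v choose P v)" by (rule mchoose_superset[OF fA _ True]) blast
    then show ?thesis using True unfolding split R_def by simp
  next
    case False
    then obtain v where "\<not> P v \<le> M v" by (auto simp: le_fun_def)
    then have "\<not> P x \<le> M x" using Pv[of v] by (cases "v = x") auto
    then show ?thesis using False by (simp add: binomial_eq_0)
  qed
  show ?thesis unfolding 1 2 3 by (cases "P x") (simp_all add: distrib_right)
qed

lemma finite_below: "finite (msupp M) \<Longrightarrow> finite {P :: 'v \<Rightarrow> nat. P \<le> M}"
proof -
  assume f: "finite (msupp M)"
  let ?b = "\<Sum>v\<in>msupp M. M v"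
  have "{P. P \<le> M} \<subseteq> {P. \<forall>v. (v \<in> msupp M \<longrightarrow> P v \<in> {..?b}) \<and> (v \<notin> msupp M \<longrightarrow> P v = 0)}"
  proof (intro subsetI CollectI allI conjI impI)
    fix P v assume "P \<in> {P. P \<le> M}"
    then have le: "P v \<le> M v" by (simp add: le_fun_def)
    show "P v \<in> {..?b}" if "v \<in> msupp M"
      using le member_le_sum[of v "msupp M" M] f that by simp
    show "P v = 0" if "v \<notin> msupp M" using le that by (simp add: msupp_def)
  qed
  moreover have "finite {P. \<forall>v. (v \<in> msupp M \<longrightarrow> P v \<in> {..?b}) \<and> (v \<notin> msupp M \<longrightarrow> P v = 0)}"
    by (rule finite_set_of_finite_funs[OF f]) simp
  ultimately show ?thesis by (rule finite_subset)
qed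

text \<open>Counts the splittings of a list by the exponents of the left part; the induction is
  Pascal's rule in the form \<open>mchoose_inc\<close>. This links the Leibniz rule for lists to the
  sum over \<open>P1\<close> in \<open>star\<close>.\<close>

lemma spl_mon:
  fixes \<phi> :: "('v \<Rightarrow> nat) \<Rightarrow> ('v \<Rightarrow> nat) \<Rightarrow> 'b::comm_semiring_1"
  shows "spl (\<lambda>a b. \<phi> (mon a) (mon b)) xs = (\<Sum>P\<in>{P. P \<le> mon xs}. of_nat (mchoose (mon xs) P) * \<phi> P (\<lambda>v. mon xs v - P v))"
proof (induction xs arbitrary: \<phi>)
  case Nil
  have "{P. P \<le> (\<lambda>_ :: 'v. 0 :: nat)} = {\<lambda>_. 0}" by (auto simp: le_fun_def)
  then show ?case by (simp add: mchoose_def)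
next
  case (Cons x xs)
  let ?M = "mon xs"
  have fM: "finite (msupp ?M)" by simp
  have fB: "finite {P. P \<le> inc x ?M}" by (rule finite_below) (simp add: msupp_inc)
  have "(\<Sum>P\<in>{P. P \<le> inc x ?M}. of_nat (mchoose (inc x ?M) P) * \<phi> P (\<lambda>v. inc x ?M v - P v))
    = (\<Sum>P\<in>{P. P \<le> inc x ?M}. (if P x \<noteq> 0 then of_nat (mchoose ?M (dec x P)) * \<phi> P (\<lambda>v. inc x ?M v - P v) else 0))
    + (\<Sum>P\<in>{P. P \<le> inc x ?M}. (if P \<le> ?M then of_nat (mchoose ?M P) * \<phi> P (\<lambda>v. inc x ?M v - P v) else 0))"
    unfolding sum.distrib[symmetric]
  proof (rule sum.cong[OF refl])
    fix P assume "P \<in> {P. P \<le> inc x ?M}"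
    then have P: "P \<le> inc x ?M" by simp
    show "of_nat (mchoose (inc x ?M) P) * \<phi> P (\<lambda>v. inc x ?M v - P v)
      = (if P x \<noteq> 0 then of_nat (mchoose ?M (dec x P)) * \<phi> P (\<lambda>v. inc x ?M v - P v) else 0)
      + (if P \<le> ?M then of_nat (mchoose ?M P) * \<phi> P (\<lambda>v. inc x ?M v - P v) else 0)"
      unfolding mchoose_inc[OF fM P] by (simp add: distrib_right)
  qed
  also have "(\<Sum>P\<in>{P. P \<le> inc x ?M}. (if P x \<noteq> 0 then of_nat (mchoose ?M (dec x P)) * \<phi> P (\<lambda>v. inc x ?M v - P v) else 0))
    = (\<Sum>Q\<in>{Q. Q \<le> ?M}. of_nat (mchoose ?M Q) * \<phi> (inc x Q) (\<lambda>v. ?M v - Q v))"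
  proof -
    have "(\<Sum>P\<in>{P. P \<le> inc x ?M}. (if P x \<noteq> 0 then of_nat (mchoose ?M (dec x P)) * \<phi> P (\<lambda>v. inc x ?M v - P v) else 0))
      = (\<Sum>P\<in>{P\<in>{P. P \<le> inc x ?M}. P x \<noteq> 0}. of_nat (mchoose ?M (dec x P)) * \<phi> P (\<lambda>v. inc x ?M v - P v))"
      by (rule sum.inter_filter[OF fB, symmetric])
    also have "\<dots> = (\<Sum>Q\<in>{Q. Q \<le> ?M}. of_nat (mchoose ?M Q) * \<phi> (inc x Q) (\<lambda>v. ?M v - Q v))"
    proof (rule sum.reindex_bij_witness[of _ "inc x" "dec x"])
      fix P assume "P \<in> {P\<in>{P. P \<le> inc x ?M}. P x \<noteq> 0}"
      then have P: "P \<le> inc x ?M" "P x \<noteq> 0" by simp_all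
      have id: "inc x (dec x P) = P" by (rule inc_dec[of P x, OF P(2)])
      show "inc x (dec x P) = P" by (rule id)
      have "dec x P v \<le> ?M v" for v using le_funD[OF P(1), of v] by (auto simp: inc_def dec_def split: if_splits)
      then show "dec x P \<in> {Q. Q \<le> ?M}" by (simp add: le_fun_def)
      have "(\<lambda>v. ?M v - dec x P v) = (\<lambda>v. inc x ?M v - P v)"
        using P(2) by (intro ext) (auto simp: inc_def dec_def)
      then show "of_nat (mchoose ?M (dec x P)) * \<phi> (inc x (dec x P)) (\<lambda>v. ?M v - dec x P v)
        = of_nat (mchoose ?M (dec x P)) * \<phi> P (\<lambda>v. inc x ?M v - P v)" unfolding id by simp
    next
      fix Q assume Q: "Q \<in> {Q. Q \<le> ?M}"
      have "inc x Q v \<le> inc x ?M v" for v using Q by (auto simp: inc_def le_fun_def)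
      then show "inc x Q \<in> {P\<in>{P. P \<le> inc x ?M}. P x \<noteq> 0}" by (simp add: le_fun_def)
    qed simp
    finally show ?thesis .
  qed
  also have "(\<Sum>P\<in>{P. P \<le> inc x ?M}. (if P \<le> ?M then of_nat (mchoose ?M P) * \<phi> P (\<lambda>v. inc x ?M v - P v) else 0))
    = (\<Sum>Q\<in>{Q. Q \<le> ?M}. of_nat (mchoose ?M Q) * \<phi> Q (inc x (\<lambda>v. ?M v - Q v)))"
  proof (rule sum.mono_neutral_cong_right[OF fB])
    have "?M \<le> inc x ?M" by (simp add: le_fun_def inc_def)
    then show "{Q. Q \<le> ?M} \<subseteq> {P. P \<le> inc x ?M}" using order_trans by blast
    fix Q assume "Q \<in> {Q. Q \<le> ?M}"
    then have Q: "Q v \<le> ?M v" for v by (simp add: le_fun_def)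
    have "(\<lambda>v. inc x ?M v - Q v) = inc x (\<lambda>v. ?M v - Q v)"
      using Q[of x] by (intro ext) (auto simp: inc_def)
    then show "(if Q \<le> ?M then of_nat (mchoose ?M Q) * \<phi> Q (\<lambda>v. inc x ?M v - Q v) else 0)
      = of_nat (mchoose ?M Q) * \<phi> Q (inc x (\<lambda>v. ?M v - Q v))" using Q by (simp add: le_fun_def)
  qed simp
  finally show ?case
    unfolding mon_Cons spl.simps Cons.IH[of "\<lambda>P Q. \<phi> (inc x P) Q"] Cons.IH[of "\<lambda>P Q. \<phi> P (inc x Q)"] by simp
qed

section \<open>Contraction lists versus contraction tables\<close>

definition tabs :: "nat \<Rightarrow> 'a set \<Rightarrow> ('a \<Rightarrow> nat) set" where
  "tabs n T = {C. msupp C \<subseteq> T \<and> mtotal C = n}"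

lemma msupp_tabs: "finite T \<Longrightarrow> C \<in> tabs n T \<Longrightarrow> finite (msupp C)"
  unfolding tabs_def using finite_subset by blast

lemma finite_tabs: "finite T \<Longrightarrow> finite (tabs n T)"
proof -
  assume T: "finite T"
  have "tabs n T \<subseteq> {C. \<forall>v. (v \<in> T \<longrightarrow> C v \<in> {..n}) \<and> (v \<notin> T \<longrightarrow> C v = 0)}"
  proof (intro subsetI CollectI allI conjI impI)
    fix C v assume C: "C \<in> tabs n T"
    have f: "finite (msupp C)" by (rule msupp_tabs[OF T C])
    show "C v \<in> {..n}"
    proof (cases "C v = 0")
      case False
      then have "C v \<le> mtotal C" unfolding mtotal_def using f by (intro member_le_sum) (auto simp: msupp_def)
      then show ?thesis using C by (simp add: tabs_def)
    qed simp
    show "C v = 0" if "v \<notin> T" using C that by (auto simp: tabs_def msupp_def)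
  qed
  moreover have "finite {C. \<forall>v. (v \<in> T \<longrightarrow> C v \<in> {..n}) \<and> (v \<notin> T \<longrightarrow> C v = (0::nat))}"
    by (rule finite_set_of_finite_funs[OF T]) simp
  ultimately show ?thesis by (rule finite_subset)
qed

text \<open>A table C of total n has n!/C! orderings. Stripping the first letter, the factor n + 1
  is regained as the sum of the entries of C.\<close>

lemma sum_nlists_mon:
  fixes \<phi> :: "('a \<Rightarrow> nat) \<Rightarrow> complex"
  assumes T: "finite T"
  shows "(\<Sum>cs\<in>nlists n T. \<phi> (mon cs)) = (\<Sum>C\<in>tabs n T. fact n / of_nat (mfact C) * \<phi> C)"
proof (induction n arbitrary: \<phi>)
  case 0
  have "C = (\<lambda>_. 0)" if C: "C \<in> tabs 0 T" for C
    by (rule mtotal_eq_0[OF msupp_tabs[OF T C]]) (use C in \<open>simp add: tabs_def\<close>)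
  moreover have "(\<lambda>_. 0) \<in> tabs 0 T" by (simp add: tabs_def)
  ultimately have "tabs 0 T = {\<lambda>_. 0}" by blast
  then show ?case by simp
next
  case (Suc n)
  have "(\<Sum>cs\<in>nlists (Suc n) T. \<phi> (mon cs)) = (\<Sum>c\<in>T. \<Sum>C\<in>tabs n T. fact n / of_nat (mfact C) * \<phi> (inc c C))"
    unfolding sum_nlists_Suc mon_Cons by (rule sum.cong[OF refl]) (rule Suc.IH)
  also have "\<dots> = (\<Sum>c\<in>T. \<Sum>C\<in>{C\<in>tabs (Suc n) T. C c \<noteq> 0}. fact n * of_nat (C c) / of_nat (mfact C) * \<phi> C)"
  proof (rule sum.cong[OF refl])
    fix c assume c: "c \<in> T"
    show "(\<Sum>C\<in>tabs n T. fact n / of_nat (mfact C) * \<phi> (inc c C)) = (\<Sum>C\<in>{C\<in>tabs (Suc n) T. C c \<noteq> 0}. fact n * of_nat (C c) / of_nat (mfact C) * \<phi> C)"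
    proof (rule sum.reindex_bij_witness[of _ "dec c" "inc c"])
      fix C assume C: "C \<in> tabs n T"
      have f: "finite (msupp C)" by (rule msupp_tabs[OF T C])
      show "dec c (inc c C) = C" by simp
      show "inc c C \<in> {C\<in>tabs (Suc n) T. C c \<noteq> 0}" using C c by (simp add: tabs_def msupp_inc mtotal_inc[OF f])
      have e: "a * s / (s * M) = a / M" if "s \<noteq> 0" for a s M :: complex using that by simp
      show "fact n * of_nat (inc c C c) / of_nat (mfact (inc c C)) * \<phi> (inc c C) = fact n / of_nat (mfact C) * \<phi> (inc c C)"
        unfolding mfact_inc[OF f] inc_self of_nat_mult by (subst e) (simp_all del: of_nat_Suc)
    next
      fix C assume C: "C \<in> {C\<in>tabs (Suc n) T. C c \<noteq> 0}"
      then have id: "inc c (dec c C) = C" by (simp add: inc_dec)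
      show "inc c (dec c C) = C" by (rule id)
      have "finite (msupp C)" using C msupp_tabs[OF T] by blast
      then have f': "finite (msupp (dec c C))" by (rule finite_subset[OF msupp_dec])
      have "Suc (mtotal (dec c C)) = Suc n" using mtotal_inc[OF f', of c] C unfolding id by (simp add: tabs_def)
      moreover have "msupp (dec c C) \<subseteq> T" using msupp_dec[of c C] C by (auto simp: tabs_def)
      ultimately show "dec c C \<in> tabs n T" by (simp add: tabs_def)
    qed
  qed
  also have "\<dots> = (\<Sum>C\<in>tabs (Suc n) T. \<Sum>c\<in>{c\<in>T. C c \<noteq> 0}. fact n * of_nat (C c) / of_nat (mfact C) * \<phi> C)"
    by (rule sum.swap_restrict[OF T finite_tabs[OF T]])
  also have "\<dots> = (\<Sum>C\<in>tabs (Suc n) T. fact (Suc n) / of_nat (mfact C) * \<phi> C)"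
  proof (rule sum.cong[OF refl])
    fix C assume C: "C \<in> tabs (Suc n) T"
    then have s: "{c\<in>T. C c \<noteq> 0} = msupp C" by (auto simp: tabs_def msupp_def)
    have t: "(\<Sum>c\<in>msupp C. of_nat (C c)) = (of_nat (Suc n) :: complex)"
      unfolding of_nat_sum[symmetric] mtotal_def[symmetric] using C by (simp add: tabs_def)
    have "(\<Sum>c\<in>msupp C. fact n * of_nat (C c) / of_nat (mfact C) * \<phi> C) = (fact n / of_nat (mfact C) * \<phi> C) * (\<Sum>c\<in>msupp C. of_nat (C c))"
      by (simp add: sum_distrib_left sum_divide_distrib mult_ac)
    also have "\<dots> = fact (Suc n) / of_nat (mfact C) * \<phi> C" unfolding t fact_Suc by simp
    finally show "(\<Sum>c\<in>{c\<in>T. C c \<noteq> 0}. fact n * of_nat (C c) / of_nat (mfact C) * \<phi> C) = fact (Suc n) / of_nat (mfact C) * \<phi> C" unfolding s .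
  qed
  finally show ?case .
qed

lemma lcon_fsum: "lcon C (\<alpha>, k) = (if 0 < k then fsum (\<lambda>\<beta>. C (\<alpha>, \<beta>, nat k)) else 0)"
  and rcon_fsum: "rcon C (\<beta>, k) = (if k < 0 then fsum (\<lambda>\<alpha>. C (\<alpha>, \<beta>, nat (- k))) else 0)"
  unfolding lcon_def rcon_def fsum_def by simp_all

lemma finite_contr_rows:
  fixes C :: "contr \<Rightarrow> nat"
  assumes "finite (msupp C)"
  shows "finite {\<beta>. C (\<alpha>, \<beta>, k) \<noteq> 0}" "finite {\<alpha>. C (\<alpha>, \<beta>, k) \<noteq> 0}"
proof -
  have "{\<beta>. C (\<alpha>, \<beta>, k) \<noteq> 0} \<subseteq> (\<lambda>c. fst (snd c)) ` msupp C" "{\<alpha>. C (\<alpha>, \<beta>, k) \<noteq> 0} \<subseteq> fst ` msupp C"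
    by (force simp: msupp_def image_iff)+
  then show "finite {\<beta>. C (\<alpha>, \<beta>, k) \<noteq> 0}" "finite {\<alpha>. C (\<alpha>, \<beta>, k) \<noteq> 0}"
    using finite_subset finite_imageI[OF assms] by blast+
qed

lemma lcon_mon: "(\<And>c. c \<in> set cs \<Longrightarrow> 0 < snd (snd c)) \<Longrightarrow> lcon (mon cs) = mon (Lc cs)"
  and rcon_mon: "(\<And>c. c \<in> set cs \<Longrightarrow> 0 < snd (snd c)) \<Longrightarrow> rcon (mon cs) = mon (Rc cs)"
proof (induction cs)
  case Nil
  { case 1 show ?case by (auto simp: fun_eq_iff lcon_fsum fsum_def) }
  { case 2 show ?case by (auto simp: fun_eq_iff rcon_fsum fsum_def) }
next
  case (Cons c cs)
  obtain a b m where c: "c = (a, b, m)" by (metis prod_cases3)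
  have f: "finite (msupp (mon cs))" by simp
  { case 1
    then have m: "0 < m" using c by force
    have IH: "lcon (mon cs) = mon (Lc cs)" by (rule Cons.IH(1)) (use 1 in simp)
    have row: "(\<lambda>\<beta>. inc c (mon cs) (\<alpha>, \<beta>, k)) = (if \<alpha> = a \<and> k = m then inc b (\<lambda>\<beta>. mon cs (\<alpha>, \<beta>, k)) else (\<lambda>\<beta>. mon cs (\<alpha>, \<beta>, k)))" for \<alpha> k
      by (auto simp: inc_def c)
    have "lcon (inc c (mon cs)) (\<alpha>, k) = inc (a, int m) (lcon (mon cs)) (\<alpha>, k)" for \<alpha> k
      unfolding lcon_fsum row inc_def[of "(a, int m)"] fun_upd_def
      using m fsum_inc[OF finite_contr_rows(1)[OF f]] by (auto simp: lcon_fsum)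
    then have "lcon (inc c (mon cs)) = inc (a, int m) (lcon (mon cs))" by (intro ext) (metis surj_pair)
    then show ?case unfolding mon_Cons IH by (simp add: c mon_Cons) }
  { case 2
    then have m: "0 < m" using c by force
    have IH: "rcon (mon cs) = mon (Rc cs)" by (rule Cons.IH(2)) (use 2 in simp)
    have row: "(\<lambda>\<alpha>. inc c (mon cs) (\<alpha>, \<beta>, k)) = (if \<beta> = b \<and> k = m then inc a (\<lambda>\<alpha>. mon cs (\<alpha>, \<beta>, k)) else (\<lambda>\<alpha>. mon cs (\<alpha>, \<beta>, k)))" for \<beta> k
      by (auto simp: inc_def c)
    have "rcon (inc c (mon cs)) (\<beta>, k) = inc (b, - int m) (rcon (mon cs)) (\<beta>, k)" for \<beta> k
      unfolding rcon_fsum row inc_def[of "(b, - int m)"] fun_upd_def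
      using m fsum_inc[OF finite_contr_rows(2)[OF f]] by (auto simp: rcon_fsum)
    then have "rcon (inc c (mon cs)) = inc (b, - int m) (rcon (mon cs))" by (intro ext) (metis surj_pair)
    then show ?case unfolding mon_Cons IH by (simp add: c mon_Cons) }
qed

definition mdf :: "int \<Rightarrow> fser \<Rightarrow> fser" where
  "mdf k F = (\<lambda>P h e. if pfreq P = k then F P h e else 0)"

lemma zero_mode_mdf: "zero_mode F = mdf 0 F"
  by (simp add: zero_mode_def mdf_def)

lemma hat_mdf: "hat (mdf k F) = md k (hat F)"
  by (intro ext coeffs_eqI) (simp add: md_def mdf_def pfreq_mon)

text \<open>\<open>star\<close> ranges over all tables, \<open>con\<close> only over indices in
  1..N, and lists reach finite monomials only; this support condition closes both gaps.\<close>

definition fsupp :: "nat \<Rightarrow> fser \<Rightarrow> bool" where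
  "fsupp N F \<longleftrightarrow> (\<forall>P h e. F P h e \<noteq> 0 \<longrightarrow> finite (msupp P) \<and> (\<forall>v\<in>msupp P. fst v \<in> {1..N}))"

lemma fsuppD: "fsupp N F \<Longrightarrow> F P h e \<noteq> 0 \<Longrightarrow> finite (msupp P)"
    "fsupp N F \<Longrightarrow> F P h e \<noteq> 0 \<Longrightarrow> P (\<alpha>, k) \<noteq> 0 \<Longrightarrow> \<alpha> \<in> {1..N}"
proof -
  show "fsupp N F \<Longrightarrow> F P h e \<noteq> 0 \<Longrightarrow> finite (msupp P)" unfolding fsupp_def by blast
  show "fsupp N F \<Longrightarrow> F P h e \<noteq> 0 \<Longrightarrow> P (\<alpha>, k) \<noteq> 0 \<Longrightarrow> \<alpha> \<in> {1..N}" unfolding fsupp_def msupp_def by force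
qed

lemma fsupp_mdf: "fsupp N F \<Longrightarrow> fsupp N (mdf k F)"
proof -
  assume F: "fsupp N F"
  have "F P h e \<noteq> 0" if "mdf k F P h e \<noteq> 0" for P h e
    using that unfolding mdf_def by (cases "pfreq P = k") simp_all
  then show ?thesis using F unfolding fsupp_def by blast
qed

lemma tcoef_finite: "tcoef m P \<noteq> 0 \<Longrightarrow> finite (msupp P)"
proof -
  assume "tcoef m P \<noteq> 0"
  then have "Tab m P \<noteq> {}" by (auto simp: tcoef_def)
  then obtain n where n: "n \<in> Tab m P" by blast
  then have f: "finite (msupp n)" by (simp add: Tab_def)
  have "msupp P \<subseteq> (\<lambda>w. (fst w, snd (snd w))) ` msupp n"
  proof
    fix v assume "v \<in> msupp P"
    obtain \<alpha> k where v: "v = (\<alpha>, k)" by force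
    have "fsum (\<lambda>j. n (\<alpha>, j, k)) = P (\<alpha>, k)" using n by (simp add: Tab_def)
    then have "fsum (\<lambda>j. n (\<alpha>, j, k)) \<noteq> 0" using \<open>v \<in> msupp P\<close> v by (simp add: msupp_def)
    then obtain j where "n (\<alpha>, j, k) \<noteq> 0" unfolding fsum_def by (metis (mono_tags, lifting) mem_Collect_eq sum.neutral)
    then show "v \<in> (\<lambda>w. (fst w, snd (snd w))) ` msupp n" unfolding v by (force simp: msupp_def image_iff)
  qed
  then show ?thesis by (rule finite_subset) (simp add: f)
qed

lemma fsupp_fourier: "is_qdp N f \<Longrightarrow> fsupp N (fourier f)"
  unfolding fsupp_def
proof (intro allI impI conjI ballI)
  fix P h e assume f: "is_qdp N f" and nz: "fourier f P h e \<noteq> 0"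
  have g: "slice N (f e h)" using f is_qdp_slice by blast
  show fin: "finite (msupp P)"
  proof (rule ccontr)
    assume inf: "\<not> finite (msupp P)"
    have "fcoef m P = 0" for m
    proof -
      have "tcoef m P = 0" using tcoef_finite[of m P] inf by blast
      then have "fcoef m P * of_nat (mfact P) = 0" using fcoef_tcoef[of m P] by simp
      then show ?thesis using mfact_pos[of P] by simp
    qed
    then show False using nz by (simp add: fourier_def)
  qed
  fix v assume v: "v \<in> msupp P"
  obtain \<alpha> k where vk: "v = (\<alpha>, k)" by force
  have id: "inc v (dec v P) = P" by (rule inc_dec[of P v]) (use v in \<open>simp add: msupp_def\<close>)
  have "finite (msupp (dec v P))" using msupp_dec fin by (rule finite_subset)
  then obtain ys where "dec v P = mon ys" using ex_mon by blast
  then have P: "P = mon ((\<alpha>, k) # ys)" using id by (simp add: mon_Cons vk)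
  have "Fx (f e h) ((\<alpha>, k) # ys) \<noteq> 0"
    unfolding hat_fourier[symmetric] hat_nth P[symmetric] using nz mfact_pos by simp
  then show "fst v \<in> {1..N}" using Fx_outside[OF g, of \<alpha> k ys] vk by force
qed

section \<open>Comparison of \<open>star\<close> with the product on Taylor coefficients\<close>

context weyl
begin

definition wtab :: "(contr \<Rightarrow> nat) \<Rightarrow> complex" where
  "wtab C = (\<Prod>w\<in>msupp C. (\<i> * of_nat (snd (snd w)) * etai (fst w) (fst (snd w))) ^ C w)"

lemma wtab_mon: "wtab (mon cs) = w0 cs"
proof (induction cs)
  case (Cons c cs)
  let ?g = "\<lambda>w. \<i> * of_nat (snd (snd w)) * etai (fst w) (fst (snd w))"
  let ?A = "insert c (set cs)"
  have s: "wtab C = (\<Prod>w\<in>?A. ?g w ^ C w)" if "msupp C \<subseteq> ?A" for C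
    unfolding wtab_def using that by (intro prod.mono_neutral_left) (auto simp: msupp_def)
  have "msupp (inc c (mon cs)) \<subseteq> ?A" by (simp add: msupp_inc)
  then have "wtab (mon (c # cs)) = (\<Prod>w\<in>?A. ?g w ^ mon cs w * (if w = c then ?g c else 1))"
    unfolding mon_Cons s[OF \<open>msupp (inc c (mon cs)) \<subseteq> ?A\<close>] by (intro prod.cong) (auto simp: inc_def)
  also have "\<dots> = (\<Prod>w\<in>?A. ?g w ^ mon cs w) * ?g c"
    by (simp only: prod.distrib) simp
  also have "(\<Prod>w\<in>?A. ?g w ^ mon cs w) = wtab (mon cs)" by (rule s[symmetric]) (simp add: subset_insertI)
  finally show ?case using Cons by (simp add: mult_ac)
qed (simp add: wtab_def)

text \<open>Off the support of \<open>L\<close> the factorials agree, so the falling factorials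
  produced by differentiation form a quotient of complete factorials.\<close>

lemma star_ratio:
  assumes "finite (msupp P)" "finite (msupp L)"
  shows "(\<Prod>v\<in>msupp L. of_nat (fact (P v + L v)) / of_nat (fact (P v))) = (of_nat (mfact (\<lambda>v. P v + L v)) / of_nat (mfact P) :: complex)"
proof -
  let ?A = "msupp P \<union> msupp L"
  have fA: "finite ?A" using assms by simp
  have "(\<Prod>v\<in>msupp L. of_nat (fact (P v + L v)) / of_nat (fact (P v)) :: complex) = (\<Prod>v\<in>?A. of_nat (fact (P v + L v)) / of_nat (fact (P v)))"
    by (rule prod.mono_neutral_left[OF fA]) (auto simp: msupp_def)
  also have "\<dots> = (\<Prod>v\<in>?A. of_nat (fact (P v + L v))) / (\<Prod>v\<in>?A. of_nat (fact (P v)))"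
    by (rule prod_dividef)
  also have "(\<Prod>v\<in>?A. of_nat (fact (P v + L v))) = (of_nat (mfact (\<lambda>v. P v + L v)) :: complex)"
    by (subst mfact_superset[OF fA]) (auto simp: msupp_def)
  also have "(\<Prod>v\<in>?A. of_nat (fact (P v))) = (of_nat (mfact P) :: complex)"
    by (subst mfact_superset[OF fA]) (auto simp: msupp_def)
  finally show ?thesis .
qed

lemma star_infinite:
  assumes F: "fsupp N F" and G: "fsupp N G" and P: "infinite (msupp P)"
  shows "star etai F G P h e = 0"
proof -
  have "\<not> (F (\<lambda>v. P1 v + lcon C v) h1 e1 \<noteq> 0 \<and> G (\<lambda>v. P v - P1 v + rcon C v) h2 e2 \<noteq> 0)" for C P1 h1 e1 h2 e2
  proof
    assume a: "F (\<lambda>v. P1 v + lcon C v) h1 e1 \<noteq> 0 \<and> G (\<lambda>v. P v - P1 v + rcon C v) h2 e2 \<noteq> 0"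
    have "finite (msupp (\<lambda>v. P1 v + lcon C v) \<union> msupp (\<lambda>v. P v - P1 v + rcon C v))"
      using fsuppD(1)[OF F conjunct1[OF a]] fsuppD(1)[OF G conjunct2[OF a]] by simp
    moreover have "msupp P \<subseteq> msupp (\<lambda>v. P1 v + lcon C v) \<union> msupp (\<lambda>v. P v - P1 v + rcon C v)"
      by (auto simp: msupp_def)
    ultimately show False using P finite_subset by blast
  qed
  then show ?thesis unfolding star_def by (intro sum.neutral) blast
qed

definition hm :: "fser \<Rightarrow> pmon \<Rightarrow> coeffs" where
  "hm F P = Abs_fps (\<lambda>h. Abs_fps (\<lambda>e. F P h e * of_nat (mfact P)))"

lemma hat_hm: "hat F xs = hm F (mon xs)"
  by (simp add: hat_def hm_def)

lemma hm_nth [simp]: "hm F P $ h $ e = F P h e * of_nat (mfact P)"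
  by (simp add: hm_def)

text \<open>Multiplication by P! turns coefficients into derivatives. The sum over \<open>P1\<close>
  becomes the Leibniz rule through \<open>spl_mon\<close>, and the sum over tables becomes the
  weighted sum over lists through \<open>sum_nlists_mon\<close>.\<close>

lemma star_tst:
  assumes F: "fsupp N F" "\<And>P h e. F P h e \<noteq> 0 \<Longrightarrow> pfreq P = \<kappa>" and G: "fsupp N G"
  shows "star etai F G (mon xs) h e * of_nat (mfact (mon xs)) = tst (hat F) (hat G) xs $ h $ e"
proof -
  define P where "P = mon xs"
  define D where "D = {P1. P1 \<le> P}"
  have fP: "finite (msupp P)" by (simp add: P_def)
  have fD: "finite D" unfolding D_def by (rule finite_below[OF fP])
  have fP1: "finite (msupp P1)" if "P1 \<in> D" for P1
  proof (rule finite_subset[OF _ fP])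
    have "P1 v \<le> P v" for v using that unfolding D_def mem_Collect_eq by (rule le_funD)
    then show "msupp P1 \<subseteq> msupp P" by (rule msupp_mono)
  qed
  have fP2: "finite (msupp (\<lambda>v. P v - P1 v))" for P1
    by (rule finite_subset[OF _ fP]) (auto simp: msupp_def)
  \<comment> \<open>The left factor has frequency \<kappa>, so the contractions meeting the part
    \<open>P1\<close> carry frequency \<kappa> - \<open>pfreq P1\<close>; this \<open>B\<close>
    bounds all these values at once.\<close>
  define B where "B = nat \<bar>\<kappa>\<bar> + (\<Sum>P1\<in>D. nat \<bar>pfreq P1\<bar>)"
  define T where "T = conB B"
  define K where "K = (\<Union>n\<in>{..B}. tabs n T)"
  have fT: "finite T" by (simp add: T_def)
  have fK: "finite K" unfolding K_def using finite_tabs[OF fT] by simp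
  have Kf: "finite (msupp C)" if "C \<in> K" for C using that msupp_tabs[OF fT] unfolding K_def by blast
  have Kmon: "\<exists>cs. C = mon cs \<and> set cs \<subseteq> conB B" if C: "C \<in> K" for C
  proof -
    obtain cs where cs: "C = mon cs" using ex_mon[OF Kf[OF C]] by blast
    have "msupp C \<subseteq> conB B" using C unfolding K_def tabs_def T_def by blast
    then have "set cs \<subseteq> conB B" unfolding cs by simp
    then show ?thesis using cs by blast
  qed
  have pos: "0 < snd (snd c)" if "set cs \<subseteq> conB B \<or> set cs \<subseteq> con" "c \<in> set cs" for c cs B
    using that by (auto simp: conB_def con_def)
  have bound: "csum cs \<le> B" if P1: "P1 \<in> D" and nz: "F (\<lambda>v. P1 v + mon (Lc cs) v) h1 e1 \<noteq> 0" for P1 cs h1 e1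
  proof -
    obtain a where a: "P1 = mon a" using ex_mon[OF fP1[OF P1]] by blast
    have "pfreq (mon (a @ Lc cs)) = \<kappa>" using F(2)[OF nz] by (simp add: a mon_append)
    then have "int (csum cs) = \<kappa> - pfreq P1" by (simp add: pfreq_mon a)
    moreover have "nat \<bar>pfreq P1\<bar> \<le> (\<Sum>P1\<in>D. nat \<bar>pfreq P1\<bar>)" by (rule member_le_sum[OF P1 _ fD]) simp
    ultimately show ?thesis unfolding B_def by linarith
  qed
  define t where "t P1 C h1 e1 = F (\<lambda>v. P1 v + lcon C v) h1 e1 *
       G (\<lambda>v. P v - P1 v + rcon C v) (h - h1 - mtotal C) (e - e1) *
       (\<Prod>w\<in>msupp C. (\<i> * of_nat (snd (snd w)) * etai (fst w) (fst (snd w))) ^ C w / of_nat (fact (C w))) *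
       (\<Prod>v\<in>msupp (lcon C). of_nat (fact (P1 v + lcon C v)) / of_nat (fact (P1 v))) *
       (\<Prod>v\<in>msupp (rcon C). of_nat (fact (P v - P1 v + rcon C v)) / of_nat (fact (P v - P1 v)))" for P1 C h1 e1
  define S where "S = {(C, P1, h1, e1). finite (msupp C) \<and> (\<forall>w\<in>msupp C. 0 < snd (snd w)) \<and>
          P1 \<le> P \<and> h1 + mtotal C \<le> h \<and> e1 \<le> e \<and> F (\<lambda>v. P1 v + lcon C v) h1 e1 \<noteq> 0 \<and>
          G (\<lambda>v. P v - P1 v + rcon C v) (h - h1 - mtotal C) (e - e1) \<noteq> 0}"
  define \<Omega> where "\<Omega> = Sigma K (\<lambda>C. Sigma D (\<lambda>P1. {h1. h1 + mtotal C \<le> h} \<times> {..e}))"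
  have fh: "finite {h1. h1 + n \<le> h}" for n by (rule finite_subset[of _ "{..h}"]) auto
  have f\<Omega>: "finite \<Omega>" unfolding \<Omega>_def by (intro finite_SigmaI fK fD fh finite_cartesian_product) simp
  have S\<Omega>: "S \<subseteq> \<Omega>"
  proof
    fix z assume "z \<in> S"
    then obtain C P1 h1 e1 where z: "z = (C, P1, h1, e1)" and c: "finite (msupp C)" "\<And>w. w \<in> msupp C \<Longrightarrow> 0 < snd (snd w)"
      "P1 \<le> P" "h1 + mtotal C \<le> h" "e1 \<le> e" and nF: "F (\<lambda>v. P1 v + lcon C v) h1 e1 \<noteq> 0"
      and nG: "G (\<lambda>v. P v - P1 v + rcon C v) (h - h1 - mtotal C) (e - e1) \<noteq> 0"
      unfolding S_def by blast
    obtain cs where cs: "C = mon cs" using ex_mon[OF c(1)] by blast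
    have ps: "0 < snd (snd w)" if "w \<in> set cs" for w using c(2)[of w] that by (simp add: cs)
    have L: "lcon C = mon (Lc cs)" "rcon C = mon (Rc cs)" unfolding cs using lcon_mon rcon_mon ps by blast+
    \<comment> \<open>A contraction occurring with nonzero factors differentiates \<open>F\<close>
      and \<open>G\<close> along its indices, and their supports confine these to 1..N.\<close>
    have val: "set cs \<subseteq> con"
    proof
      fix w assume w: "w \<in> set cs"
      obtain \<alpha> \<beta> k where wk: "w = (\<alpha>, \<beta>, k)" by (metis prod_cases3)
      have "(\<alpha>, int k) \<in> set (Lc cs)" "(\<beta>, - int k) \<in> set (Rc cs)" using w unfolding wk Lc_def Rc_def by force+
      then have "mon (Lc cs) (\<alpha>, int k) \<noteq> 0" "mon (Rc cs) (\<beta>, - int k) \<noteq> 0"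
        by (simp_all add: mon_def count_list_0_iff)
      then have "\<alpha> \<in> {1..N}" "\<beta> \<in> {1..N}"
        using fsuppD(2)[OF F(1) nF, of \<alpha> "int k"] fsuppD(2)[OF G nG, of \<beta> "- int k"] by (simp_all add: L)
      then show "w \<in> con" using ps[OF w] by (simp add: con_def wk)
    qed
    have P1D: "P1 \<in> D" using c(3) by (simp add: D_def)
    have "csum cs \<le> B" by (rule bound[OF P1D]) (use nF L in simp)
    then have "cs \<in> CS B" by (rule in_CS[OF val])
    then have "C \<in> K" unfolding K_def tabs_def T_def by (simp add: cs CS_def)
    then show "z \<in> \<Omega>" unfolding \<Omega>_def z using P1D c(4,5) by simp
  qed
  have out: "t P1 C h1 e1 = 0" if "(C, P1, h1, e1) \<in> \<Omega> - S" for C P1 h1 e1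
  proof -
    have "C \<in> K" "P1 \<in> D" "h1 + mtotal C \<le> h" "e1 \<le> e" "(C, P1, h1, e1) \<notin> S" using that by (auto simp: \<Omega>_def)
    moreover obtain cs where "C = mon cs" "set cs \<subseteq> conB B" using Kmon[OF \<open>C \<in> K\<close>] by blast
    moreover have "\<forall>w\<in>msupp C. 0 < snd (snd w)" using \<open>C = mon cs\<close> \<open>set cs \<subseteq> conB B\<close> pos[of cs B] by simp
    ultimately have "F (\<lambda>v. P1 v + lcon C v) h1 e1 = 0 \<or> G (\<lambda>v. P v - P1 v + rcon C v) (h - h1 - mtotal C) (e - e1) = 0"
      using Kf unfolding S_def D_def by blast
    then show ?thesis unfolding t_def by auto
  qed
  have "star etai F G P h e = (\<Sum>(C, P1, h1, e1)\<in>S. t P1 C h1 e1)"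
    unfolding star_def S_def t_def ..
  also have "\<dots> = (\<Sum>(C, P1, h1, e1)\<in>\<Omega>. t P1 C h1 e1)"
  proof (rule sum.mono_neutral_left[OF f\<Omega> S\<Omega>], rule ballI)
    fix z assume z: "z \<in> \<Omega> - S"
    obtain C P1 h1 e1 where e: "z = (C, P1, h1, e1)" by (rule prod_cases4)
    show "(case z of (C, P1, h1, e1) \<Rightarrow> t P1 C h1 e1) = 0"
      unfolding e prod.case by (rule out) (use z e in simp)
  qed
  also have "\<dots> = (\<Sum>C\<in>K. \<Sum>P1\<in>D. \<Sum>h1\<in>{h1. h1 + mtotal C \<le> h}. \<Sum>e1\<le>e. t P1 C h1 e1)"
  proof -
    have fz: "finite ({h1. h1 + mtotal C \<le> h} \<times> {..e})" for C :: "contr \<Rightarrow> nat"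
      by (rule finite_cartesian_product[OF fh]) simp
    have "(\<Sum>C\<in>K. \<Sum>P1\<in>D. \<Sum>h1\<in>{h1. h1 + mtotal C \<le> h}. \<Sum>e1\<le>e. t P1 C h1 e1)
      = (\<Sum>C\<in>K. \<Sum>P1\<in>D. \<Sum>(h1, e1)\<in>{h1. h1 + mtotal C \<le> h} \<times> {..e}. t P1 C h1 e1)"
      by (simp only: sum.cartesian_product)
    also have "\<dots> = (\<Sum>C\<in>K. \<Sum>(P1, h1, e1)\<in>Sigma D (\<lambda>P1. {h1. h1 + mtotal C \<le> h} \<times> {..e}). t P1 C h1 e1)"
      by (rule sum.cong[OF refl], rule sum.Sigma[OF fD]) (simp add: fz)
    also have "\<dots> = (\<Sum>(C, P1, h1, e1)\<in>\<Omega>. t P1 C h1 e1)"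
      unfolding \<Omega>_def by (rule sum.Sigma[OF fK]) (simp add: fz fD)
    finally show ?thesis by (rule sym)
  qed
  also have "\<dots> = (\<Sum>P1\<in>D. \<Sum>C\<in>K. \<Sum>h1\<in>{h1. h1 + mtotal C \<le> h}. \<Sum>e1\<le>e. t P1 C h1 e1)"
    by (rule sum.swap)
  finally have star: "star etai F G P h e * of_nat (mfact P)
    = (\<Sum>P1\<in>D. (\<Sum>C\<in>K. \<Sum>h1\<in>{h1. h1 + mtotal C \<le> h}. \<Sum>e1\<le>e. t P1 C h1 e1) * of_nat (mfact P))"
    by (simp add: sum_distrib_right)
  define A1 where "A1 P1 C = hm F (\<lambda>v. P1 v + lcon C v)" for P1 C
  define A2 where "A2 P1 C = hm G (\<lambda>v. P v - P1 v + rcon C v)" for P1 C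
  \<comment> \<open>By \<open>mchoose_mfact\<close>, P! is a binomial coefficient times the
    factorials of \<open>P1\<close> and of its complement. These two cancel the denominators of the
    star ratios, whose numerators turn the coefficients of \<open>F\<close> and \<open>G\<close>
    into derivatives.\<close>
  have trm: "t P1 C h1 e1 * of_nat (mfact P) = of_nat (mchoose P P1) *
      (wtab C / of_nat (mfact C) * (A1 P1 C $ h1 $ e1 * A2 P1 C $ (h - h1 - mtotal C) $ (e - e1)))"
    if P1: "P1 \<in> D" and C: "C \<in> K" for P1 C h1 e1
  proof -
    obtain cs where cs: "C = mon cs" "set cs \<subseteq> conB B" using Kmon[OF C] by blast
    have L: "lcon C = mon (Lc cs)" "rcon C = mon (Rc cs)" unfolding cs(1) using lcon_mon rcon_mon pos cs(2) by blast+
    have fl: "finite (msupp (lcon C))" "finite (msupp (rcon C))" by (simp_all add: L)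
    define p1 p2 q1 q2 :: complex where "p1 = of_nat (mfact P1)" and "p2 = of_nat (mfact (\<lambda>v. P v - P1 v))"
      and "q1 = of_nat (mfact (\<lambda>v. P1 v + lcon C v))" and "q2 = of_nat (mfact (\<lambda>v. P v - P1 v + rcon C v))"
    have nz: "p1 \<noteq> 0" "p2 \<noteq> 0" unfolding p1_def p2_def using mfact_pos by simp_all
    have mP: "of_nat (mfact P) = of_nat (mchoose P P1) * p1 * p2"
      unfolding p1_def p2_def of_nat_mult[symmetric] by (subst mchoose_mfact[OF fP]) (use P1 D_def in simp_all)
    have w: "(\<Prod>w\<in>msupp C. (\<i> * of_nat (snd (snd w)) * etai (fst w) (fst (snd w))) ^ C w / of_nat (fact (C w))) = wtab C / of_nat (mfact C)"
      unfolding wtab_def mfact_def of_nat_prod by (rule prod_dividef)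
    show ?thesis
      unfolding t_def w star_ratio[OF fP1[OF P1] fl(1)] star_ratio[OF fP2 fl(2)] A1_def A2_def hm_nth mP
        p1_def[symmetric] p2_def[symmetric] q1_def[symmetric] q2_def[symmetric]
      using nz by (simp add: field_simps)
  qed
  have tp: "tpr (\<lambda>ys. hm F (\<lambda>v. P1 v + mon ys v)) (\<lambda>ys. hm G (\<lambda>v. P v - P1 v + mon ys v)) $ h $ e
    = (\<Sum>C\<in>K. \<Sum>h1\<in>{h1. h1 + mtotal C \<le> h}. \<Sum>e1\<le>e. wtab C / of_nat (mfact C) * (A1 P1 C $ h1 $ e1 * A2 P1 C $ (h - h1 - mtotal C) $ (e - e1)))"
    if P1: "P1 \<in> D" for P1
  proof -
    define R where "R C = (\<Sum>h1\<in>{h1. h1 + mtotal C \<le> h}. \<Sum>e1\<le>e. A1 P1 C $ h1 $ e1 * A2 P1 C $ (h - h1 - mtotal C) $ (e - e1))" for C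
    have "tpr (\<lambda>ys. hm F (\<lambda>v. P1 v + mon ys v)) (\<lambda>ys. hm G (\<lambda>v. P v - P1 v + mon ys v))
      = Sm B (\<lambda>cs. hm F (\<lambda>v. P1 v + mon (Lc cs) v) * hm G (\<lambda>v. P v - P1 v + mon (Rc cs) v))"
    proof (rule tpr_eq_gen)
      fix cs assume "hm F (\<lambda>v. P1 v + mon (Lc cs) v) \<noteq> 0"
      then obtain h1 e1 where "hm F (\<lambda>v. P1 v + mon (Lc cs) v) $ h1 $ e1 \<noteq> 0"
        using coeffs_eqI[of "hm F (\<lambda>v. P1 v + mon (Lc cs) v)" 0] by auto
      then have "F (\<lambda>v. P1 v + mon (Lc cs) v) h1 e1 \<noteq> 0" by auto
      then show "csum cs \<le> B" by (rule bound[OF P1])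
    qed
    then have "tpr (\<lambda>ys. hm F (\<lambda>v. P1 v + mon ys v)) (\<lambda>ys. hm G (\<lambda>v. P v - P1 v + mon ys v)) $ h $ e
      = (\<Sum>n\<le>B. \<Sum>cs\<in>nlists n T. (wt cs * (hm F (\<lambda>v. P1 v + mon (Lc cs) v) * hm G (\<lambda>v. P v - P1 v + mon (Rc cs) v))) $ h $ e)"
      by (simp only: Sm_def sum_CS T_def fps_sum_nth)
    also have "\<dots> = (\<Sum>n\<le>B. \<Sum>cs\<in>nlists n T. wtab (mon cs) / fact n * R (mon cs))"
    proof (intro sum.cong refl)
      fix n cs assume "cs \<in> nlists n T"
      then have l: "length cs = n" "set cs \<subseteq> conB B" by (auto simp: nlists_def T_def)
      have ps: "0 < snd (snd c)" if "c \<in> set cs" for c using pos[of cs B c] l(2) that by blast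
      have L: "mon (Lc cs) = lcon (mon cs)" "mon (Rc cs) = rcon (mon cs)"
        by (rule lcon_mon[OF ps, symmetric], assumption) (rule rcon_mon[OF ps, symmetric], assumption)
      have m: "mtotal (mon cs) = n" by (simp add: l)
      have "(wt cs * (A1 P1 (mon cs) * A2 P1 (mon cs))) $ h $ e = wtab (mon cs) / fact n * R (mon cs)"
      proof (cases "n \<le> h")
        case True
        have s: "{h1. h1 + n \<le> h} = {..h - n}" using True by auto
        have "h - n - i = h - i - n" for i by simp
        then show ?thesis
          unfolding wt_def l mult.assoc scal_nth hbar_nth coeffs_mult_nth[of "A1 P1 (mon cs)"] R_def m s wtab_mon using True by simp
      next
        case False
        then have s: "{h1. h1 + n \<le> h} = {}" by auto
        show ?thesis unfolding wt_def l mult.assoc scal_nth hbar_nth R_def m s using False by simp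
      qed
      then show "(wt cs * (hm F (\<lambda>v. P1 v + mon (Lc cs) v) * hm G (\<lambda>v. P v - P1 v + mon (Rc cs) v))) $ h $ e = wtab (mon cs) / fact n * R (mon cs)"
        unfolding L A1_def A2_def .
    qed
    also have "\<dots> = (\<Sum>n\<le>B. \<Sum>C\<in>tabs n T. wtab C / of_nat (mfact C) * R C)"
    proof (rule sum.cong[OF refl])
      fix n
      show "(\<Sum>cs\<in>nlists n T. wtab (mon cs) / fact n * R (mon cs)) = (\<Sum>C\<in>tabs n T. wtab C / of_nat (mfact C) * R C)"
        unfolding sum_nlists_mon[OF fT, of "\<lambda>C. wtab C / fact n * R C"] by (rule sum.cong[OF refl]) simp
    qed
    also have "\<dots> = (\<Sum>C\<in>K. wtab C / of_nat (mfact C) * R C)"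
      unfolding K_def by (rule sum.UNION_disjoint[symmetric]) (simp_all add: finite_tabs[OF fT], auto simp: tabs_def)
    finally show ?thesis unfolding R_def sum_distrib_left .
  qed
  have "tst (hat F) (hat G) xs = spl (\<lambda>a b. tpr (\<lambda>ys. hm F (\<lambda>v. mon a v + mon ys v)) (\<lambda>ys. hm G (\<lambda>v. mon b v + mon ys v))) xs"
    unfolding tst_spl hat_hm mon_append ..
  also have "\<dots> = (\<Sum>P1\<in>D. of_nat (mchoose P P1) * tpr (\<lambda>ys. hm F (\<lambda>v. P1 v + mon ys v)) (\<lambda>ys. hm G (\<lambda>v. P v - P1 v + mon ys v)))"
    unfolding P_def D_def using spl_mon[of "\<lambda>P1 P2. tpr (\<lambda>ys. hm F (\<lambda>v. P1 v + mon ys v)) (\<lambda>ys. hm G (\<lambda>v. P2 v + mon ys v))" xs] .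
  finally have "tst (hat F) (hat G) xs $ h $ e = (\<Sum>P1\<in>D. of_nat (mchoose P P1) * tpr (\<lambda>ys. hm F (\<lambda>v. P1 v + mon ys v)) (\<lambda>ys. hm G (\<lambda>v. P v - P1 v + mon ys v)) $ h $ e)"
    by (simp only: fps_sum_nth scal_of_nat[symmetric] scal_nth)
  also have "\<dots> = (\<Sum>P1\<in>D. (\<Sum>C\<in>K. \<Sum>h1\<in>{h1. h1 + mtotal C \<le> h}. \<Sum>e1\<le>e. t P1 C h1 e1) * of_nat (mfact P))"
  proof (rule sum.cong[OF refl])
    fix P1 assume P1: "P1 \<in> D"
    show "of_nat (mchoose P P1) * tpr (\<lambda>ys. hm F (\<lambda>v. P1 v + mon ys v)) (\<lambda>ys. hm G (\<lambda>v. P v - P1 v + mon ys v)) $ h $ e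
      = (\<Sum>C\<in>K. \<Sum>h1\<in>{h1. h1 + mtotal C \<le> h}. \<Sum>e1\<le>e. t P1 C h1 e1) * of_nat (mfact P)"
      unfolding tp[OF P1] sum_distrib_left sum_distrib_right
      by (intro sum.cong refl) (simp only: trm[OF P1])
  qed
  finally show ?thesis unfolding star[symmetric] unfolding P_def by (rule sym)
qed

text \<open>Where one factor vanishes, the other may be altered. The index set itself depends on
  both supports, which is why each hypothesis is restricted by the nonvanishing of the other
  factor.\<close>

lemma star_cong:
  assumes 1: "\<And>C P1 h1 e1 h2 e2. finite (msupp C) \<Longrightarrow> \<forall>w\<in>msupp C. 0 < snd (snd w) \<Longrightarrow> P1 \<le> P \<Longrightarrow>
      G (\<lambda>v. P v - P1 v + rcon C v) h2 e2 \<noteq> 0 \<Longrightarrow> F (\<lambda>v. P1 v + lcon C v) h1 e1 = F' (\<lambda>v. P1 v + lcon C v) h1 e1"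
    and 2: "\<And>C P1 h1 e1 h2 e2. finite (msupp C) \<Longrightarrow> \<forall>w\<in>msupp C. 0 < snd (snd w) \<Longrightarrow> P1 \<le> P \<Longrightarrow>
      F' (\<lambda>v. P1 v + lcon C v) h1 e1 \<noteq> 0 \<Longrightarrow> G (\<lambda>v. P v - P1 v + rcon C v) h2 e2 = G' (\<lambda>v. P v - P1 v + rcon C v) h2 e2"
  shows "star etai F G P h e = star etai F' G' P h e"
  unfolding star_def
proof (rule sum.cong, goal_cases)
  case 1
  show ?case
  proof (rule Collect_cong, goal_cases)
    case (1 z)
    obtain C P1 h1 e1 where z: "z = (C, P1, h1, e1)" by (rule prod_cases4)
    let ?f = "\<lambda>v. P1 v + lcon C v" and ?g = "\<lambda>v. P v - P1 v + rcon C v"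
    have f: "(F ?f h1 e1 \<noteq> 0) = (F' ?f h1 e1 \<noteq> 0)" if "finite (msupp C)" "\<forall>w\<in>msupp C. 0 < snd (snd w)" "P1 \<le> P"
      "G ?g (h - h1 - mtotal C) (e - e1) \<noteq> 0" using assms(1)[OF that] by simp
    have g: "(G ?g (h - h1 - mtotal C) (e - e1) \<noteq> 0) = (G' ?g (h - h1 - mtotal C) (e - e1) \<noteq> 0)"
      if "finite (msupp C)" "\<forall>w\<in>msupp C. 0 < snd (snd w)" "P1 \<le> P" "F' ?f h1 e1 \<noteq> 0" using assms(2)[OF that] by simp
    show ?case unfolding z prod.case using f g by blast
  qed
next
  case (2 z)
  obtain C P1 h1 e1 where z: "z = (C, P1, h1, e1)" by (rule prod_cases4)
  have c: "finite (msupp C)" "\<forall>w\<in>msupp C. 0 < snd (snd w)" "P1 \<le> P" "F' (\<lambda>v. P1 v + lcon C v) h1 e1 \<noteq> 0"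
    "G' (\<lambda>v. P v - P1 v + rcon C v) (h - h1 - mtotal C) (e - e1) \<noteq> 0"
    using 2 unfolding z by simp_all
  have g: "G (\<lambda>v. P v - P1 v + rcon C v) (h - h1 - mtotal C) (e - e1) = G' (\<lambda>v. P v - P1 v + rcon C v) (h - h1 - mtotal C) (e - e1)"
    by (rule assms(2)[OF c(1-4)])
  have gn: "G (\<lambda>v. P v - P1 v + rcon C v) (h - h1 - mtotal C) (e - e1) \<noteq> 0"
    unfolding g by (rule c(5))
  have f: "F (\<lambda>v. P1 v + lcon C v) h1 e1 = F' (\<lambda>v. P1 v + lcon C v) h1 e1"
    by (rule assms(1)[OF c(1-3) gn])
  show ?case unfolding z prod.case f g ..
qed

text \<open>A contraction removes opposite frequencies from the two factors, so their frequencies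
  add up to that of the result, and a homogeneous \<open>G\<close> meets a single mode of
  \<open>F\<close>. This reduces products with a local functional to the homogeneous case of
  \<open>star_tst\<close>.\<close>

lemma star_project:
  assumes F: "fsupp N F" and G: "fsupp N G" "\<And>P h e. G P h e \<noteq> 0 \<Longrightarrow> pfreq P = \<mu>"
  shows "star etai F G (mon xs) h e = star etai (mdf (freq xs - \<mu>) F) G (mon xs) h e"
    and "star etai G F (mon xs) h e = star etai G (mdf (freq xs - \<mu>) F) (mon xs) h e"
proof -
  let ?P = "mon xs"
  have fr: "pfreq (\<lambda>v. P1 v + lcon C v) + pfreq (\<lambda>v. ?P v - P1 v + rcon C v) = freq xs"
    if C: "finite (msupp C)" "\<forall>w\<in>msupp C. 0 < snd (snd w)" and le: "P1 \<le> ?P" for C P1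
  proof -
    have le': "P1 v \<le> ?P v" for v by (rule le_funD[OF le])
    have "msupp P1 \<subseteq> msupp ?P" "msupp (\<lambda>v. ?P v - P1 v) \<subseteq> msupp ?P"
      by (rule msupp_mono[OF le'], rule msupp_mono, simp)
    moreover have "finite (msupp ?P)" by simp
    ultimately have "finite (msupp P1)" "finite (msupp (\<lambda>v. ?P v - P1 v))"
      using finite_subset by blast+
    then obtain a b where ab: "P1 = mon a" "(\<lambda>v. ?P v - P1 v) = mon b" using ex_mon by blast
    obtain cs where cs: "C = mon cs" using ex_mon[OF C(1)] by blast
    have ps: "0 < snd (snd w)" if "w \<in> set cs" for w using C(2) that by (simp add: cs)
    have L: "lcon C = mon (Lc cs)" "rcon C = mon (Rc cs)" unfolding cs using lcon_mon rcon_mon ps by blast+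
    have b: "?P v - P1 v = mon b v" for v using fun_cong[OF ab(2), of v] .
    have "?P = mon (a @ b)"
    proof
      fix v
      show "?P v = mon (a @ b) v" unfolding mon_append b[symmetric] ab(1)[symmetric] using le'[of v] by simp
    qed
    then have "freq xs = freq a + freq b" by (metis freq_simps(3) pfreq_mon)
    moreover have "pfreq (\<lambda>v. P1 v + lcon C v) = freq (a @ Lc cs)"
      unfolding pfreq_mon[symmetric] mon_append ab(1) L ..
    moreover have "pfreq (\<lambda>v. ?P v - P1 v + rcon C v) = freq (b @ Rc cs)"
      unfolding pfreq_mon[symmetric] mon_append b L ..
    ultimately show ?thesis by simp
  qed
  have m1: "mdf (freq xs - \<mu>) F (\<lambda>v. P1 v + lcon C v) h1 e1 = F (\<lambda>v. P1 v + lcon C v) h1 e1"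
    if "finite (msupp C)" "\<forall>w\<in>msupp C. 0 < snd (snd w)" "P1 \<le> ?P" "G (\<lambda>v. ?P v - P1 v + rcon C v) h2 e2 \<noteq> 0" for C P1 h1 e1 h2 e2
    using fr[OF that(1-3)] G(2)[OF that(4)] by (simp add: mdf_def)
  have m2: "mdf (freq xs - \<mu>) F (\<lambda>v. ?P v - P1 v + rcon C v) h1 e1 = F (\<lambda>v. ?P v - P1 v + rcon C v) h1 e1"
    if "finite (msupp C)" "\<forall>w\<in>msupp C. 0 < snd (snd w)" "P1 \<le> ?P" "G (\<lambda>v. P1 v + lcon C v) h2 e2 \<noteq> 0" for C P1 h1 e1 h2 e2
    using fr[OF that(1-3)] G(2)[OF that(4)] by (simp add: mdf_def)
  show "star etai F G ?P h e = star etai (mdf (freq xs - \<mu>) F) G ?P h e"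
    by (rule star_cong, rule m1[symmetric], assumption+, rule refl)
  show "star etai G F ?P h e = star etai G (mdf (freq xs - \<mu>) F) ?P h e"
    by (rule star_cong, rule refl, rule m2[symmetric], assumption+)
qed

lemma hat_qcomm:
  assumes F: "fsupp N F" and G: "fsupp N G"
  shows "hat (qcomm etai F (zero_mode G)) xs = br (md (freq xs) (hat F)) (md 0 (hat G)) xs"
proof (rule coeffs_eqI)
  fix h e
  let ?F = "mdf (freq xs) F" and ?G = "mdf 0 G"
  have s: "fsupp N ?F" "fsupp N ?G" using fsupp_mdf F G by blast+
  have f: "\<And>P h e. ?F P h e \<noteq> 0 \<Longrightarrow> pfreq P = freq xs" "\<And>P h e. ?G P h e \<noteq> 0 \<Longrightarrow> pfreq P = 0"
    by (auto simp: mdf_def split: if_splits)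
  have p: "star etai F ?G (mon xs) h e = star etai ?F ?G (mon xs) h e" "star etai ?G F (mon xs) h e = star etai ?G ?F (mon xs) h e"
    by (simp_all only: star_project(1)[OF F s(2) f(2)] star_project(2)[OF F s(2) f(2)] diff_zero)
  have "hat (qcomm etai F (zero_mode G)) xs $ h $ e
    = star etai ?F ?G (mon xs) h e * of_nat (mfact (mon xs)) - star etai ?G ?F (mon xs) h e * of_nat (mfact (mon xs))"
    unfolding hat_nth qcomm_def zero_mode_mdf p by (simp add: left_diff_distrib)
  also have "\<dots> = tst (hat ?F) (hat ?G) xs $ h $ e - tst (hat ?G) (hat ?F) xs $ h $ e"
    by (rule arg_cong2[where f = "(-)"]; rule star_tst) (rule s f; assumption?)+
  finally show "hat (qcomm etai F (zero_mode G)) xs $ h $ e = br (md (freq xs) (hat F)) (md 0 (hat G)) xs $ h $ e"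
    unfolding br_def hat_mdf by simp
qed

lemma qcomm_infinite:
  "fsupp N F \<Longrightarrow> fsupp N G \<Longrightarrow> infinite (msupp P) \<Longrightarrow> qcomm etai F (zero_mode G) P h e = 0"
  unfolding qcomm_def zero_mode_mdf using star_infinite fsupp_mdf by simp

end

section \<open>Linear and quadratic densities\<close>

definition ind :: "jmon \<Rightarrow> jmon \<Rightarrow> complex" where
  "ind m0 = (\<lambda>m. if m = m0 then 1 else 0)"

lemma du_ind: "du \<alpha> k (ind m0) = (\<lambda>m. of_nat (m0 (\<alpha>, k)) * ind (dec (\<alpha>, k) m0) m)"
proof
  fix m
  show "du \<alpha> k (ind m0) m = of_nat (m0 (\<alpha>, k)) * ind (dec (\<alpha>, k) m0) m"
  proof (cases "inc (\<alpha>, k) m = m0")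
    case True
    then show ?thesis by (auto simp: du_def ind_def)
  next
    case False
    then have "m0 (\<alpha>, k) = 0 \<or> m \<noteq> dec (\<alpha>, k) m0" using inc_dec[of m0 "(\<alpha>, k)"] by auto
    then show ?thesis using False by (auto simp: du_def ind_def)
  qed
qed

lemma slice_ind: "finite (msupp m0) \<Longrightarrow> (\<And>v. v \<in> msupp m0 \<Longrightarrow> fst v \<in> {1..N}) \<Longrightarrow> slice N (ind m0)"
proof -
  assume f: "finite (msupp m0)" and i: "\<And>v. v \<in> msupp m0 \<Longrightarrow> fst v \<in> {1..N}"
  have "{m. ind m0 m \<noteq> 0} = {m0}" by (auto simp: ind_def)
  then show ?thesis unfolding slice_def using f i by (auto simp: ind_def split: if_splits)
qed

definition dvar :: "nat \<Rightarrow> jmon" where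
  "dvar \<mu> = inc (\<mu>, 0) (\<lambda>_. 0)"

lemma msupp_dvar [simp]: "msupp (dvar \<mu>) = {(\<mu>, 0)}"
  by (simp add: dvar_def msupp_inc)

lemma slice_ind_zero: "slice N (ind (\<lambda>_. 0))"
  by (rule slice_ind) simp_all

lemma slice_ind_dvar: "\<mu> \<in> {1..N} \<Longrightarrow> slice N (ind (dvar \<mu>))"
  by (rule slice_ind) simp_all

lemma dvar_apply: "dvar \<mu> (\<alpha>, k) = (if \<alpha> = \<mu> \<and> k = 0 then 1 else 0)"
  by (simp add: dvar_def inc_def)

lemma du_dvar: "du \<alpha> k (ind (dvar \<mu>)) = (if \<alpha> = \<mu> \<and> k = 0 then ind (\<lambda>_. 0) else (\<lambda>m. 0))"
  unfolding du_ind dvar_apply by (auto simp: dvar_def)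

lemma Fx_ind_zero: "Fx (ind (\<lambda>_. 0)) xs = (if xs = [] then 1 else 0)"
proof (cases xs)
  case Nil
  then show ?thesis using Fx_Nil[OF slice_ind_zero] by (simp add: ind_def)
next
  case (Cons x ys)
  obtain \<alpha> \<kappa> where x: "x = (\<alpha>, \<kappa>)" by force
  have "jb 0 (ind (\<lambda>_. 0))" by (simp add: jb_def ind_def)
  then show ?thesis unfolding Cons x Fx_Cons[OF slice_ind_zero \<open>jb 0 (ind (\<lambda>_. 0))\<close>] du_ind by simp
qed

lemma Fx_ind_dvar:
  assumes "\<mu> \<in> {1..N}"
  shows "Fx (ind (dvar \<mu>)) xs = (if \<exists>\<kappa>. xs = [(\<mu>, \<kappa>)] then 1 else 0)"
proof (cases xs)
  case Nil
  then show ?thesis using Fx_Nil[OF slice_ind_dvar[OF assms]] by (simp add: ind_def dvar_def inc_def fun_eq_iff) 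
next
  case (Cons x ys)
  obtain \<alpha> \<kappa> where x: "x = (\<alpha>, \<kappa>)" by force
  have j: "jb 0 (ind (dvar \<mu>))" by (auto simp: jb_def ind_def dvar_apply)
  show ?thesis unfolding Cons x Fx_Cons[OF slice_ind_dvar[OF assms] j] du_dvar by (auto simp: Fx_ind_zero)
qed

lemma uvar_ind: "uvar \<mu> e h = (if e = 0 \<and> h = 0 then ind (dvar \<mu>) else (\<lambda>m. 0))"
  by (auto simp: uvar_def ind_def dvar_def inc_def)

lemma qmul_uvar: "qmul (uvar \<mu>) (uvar \<nu>) e h m = (if e = 0 \<and> h = 0 then ind (inc (\<mu>, 0) (dvar \<nu>)) m else 0)"
proof -
  let ?S = "{(e1, h1, m1). e1 \<le> e \<and> h1 \<le> h \<and> m1 \<le> m}"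
  let ?t = "\<lambda>(e1, h1, m1). uvar \<mu> e1 h1 m1 * uvar \<nu> (e - e1) (h - h1) (\<lambda>v. m v - m1 v)"
  show ?thesis
  proof (cases "e = 0 \<and> h = 0 \<and> m = inc (\<mu>, 0) (dvar \<nu>)")
    case True
    have d: "(\<lambda>v. m v - dvar \<mu> v) = dvar \<nu>" unfolding conjunct2[OF conjunct2[OF True]] by (auto simp: dvar_def inc_def)
    have z: "(0, 0, dvar \<mu>) \<in> ?S" using True by (auto simp: le_fun_def dvar_def inc_def)
    have "finite (msupp m)" using True by (simp add: msupp_inc)
    have fS: "finite ?S"
      by (rule finite_subset[of _ "{..e} \<times> {..h} \<times> {m1. m1 \<le> m}"]) (auto intro: finite_below[OF \<open>finite (msupp m)\<close>])
    have "(\<Sum>z\<in>?S. ?t z) = (\<Sum>z\<in>{(0, 0, dvar \<mu>)}. ?t z)"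
    proof (rule sum.mono_neutral_right[OF fS], use z in simp, rule ballI)
      fix y assume y: "y \<in> ?S - {(0, 0, dvar \<mu>)}"
      obtain e1 h1 m1 where y': "y = (e1, h1, m1)" by (rule prod_cases3)
      have "e1 = 0" "h1 = 0" "m1 \<noteq> dvar \<mu>" using y True unfolding y' by auto
      then have "uvar \<mu> e1 h1 m1 = 0" by (simp add: uvar_ind ind_def)
      then show "?t y = 0" unfolding y' by simp
    qed
    then show ?thesis using True d by (simp add: qmul_def uvar_ind ind_def)
  next
    case False
    have "?t z = 0" if "z \<in> ?S" for z
    proof -
      obtain e1 h1 m1 where z: "z = (e1, h1, m1)" by (rule prod_cases3)
      have le: "e1 \<le> e" "h1 \<le> h" "m1 \<le> m" using that z by auto
      show ?thesis
      proof (rule ccontr)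
        assume "?t z \<noteq> 0"
        then have nz: "e1 = 0" "h1 = 0" "m1 = dvar \<mu>" "e - e1 = 0" "h - h1 = 0" "(\<lambda>v. m v - m1 v) = dvar \<nu>"
          by (auto simp: z uvar_ind ind_def split: if_splits)
        have "m v = inc (\<mu>, 0) (dvar \<nu>) v" for v
          using le_funD[OF le(3), of v] fun_cong[OF nz(6), of v] unfolding nz(3) by (auto simp: dvar_def inc_def split: if_splits)
        then show False using False nz by auto
      qed
    qed
    then have "qmul (uvar \<mu>) (uvar \<nu>) e h m = 0" unfolding qmul_def by (intro sum.neutral) blast
    then show ?thesis using False by (auto simp: ind_def)
  qed
qed

definition quad :: "nat \<Rightarrow> (nat \<Rightarrow> nat \<Rightarrow> complex) \<Rightarrow> jmon \<Rightarrow> complex" where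
  "quad N \<eta> = (\<lambda>m. \<Sum>\<mu>\<in>{1..N}. \<Sum>\<nu>\<in>{1..N}. \<eta> \<mu> \<nu> / 2 * ind (inc (\<mu>, 0) (dvar \<nu>)) m)"

lemma half_eta_quad: "half_eta_uu N \<eta> e h = (if e = 0 \<and> h = 0 then quad N \<eta> else (\<lambda>m. 0))"
  by (auto simp: half_eta_uu_def qmul_uvar quad_def fun_eq_iff)

lemma slice_quad: "slice N (quad N \<eta>)"
  unfolding quad_def by (intro slice_sum slice_scale slice_ind) (auto simp: msupp_inc)

lemma jb_quad: "jb 0 (quad N \<eta>)"
proof -
  have "j = 0" if nz: "quad N \<eta> m \<noteq> 0" and mj: "m (\<alpha>, j) \<noteq> 0" for m \<alpha> j
  proof -
    obtain \<mu> where "(\<Sum>\<nu>\<in>{1..N}. \<eta> \<mu> \<nu> / 2 * ind (inc (\<mu>, 0) (dvar \<nu>)) m) \<noteq> 0"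
      using nz unfolding quad_def by (rule sum.not_neutral_contains_not_neutral)
    then obtain \<nu> where "\<eta> \<mu> \<nu> / 2 * ind (inc (\<mu>, 0) (dvar \<nu>)) m \<noteq> 0"
      by (rule sum.not_neutral_contains_not_neutral)
    then have m: "m = inc (\<mu>, 0) (dvar \<nu>)" by (auto simp: ind_def split: if_splits)
    have "(\<alpha>, j) \<in> msupp m" using mj by (simp add: msupp_def)
    then show ?thesis unfolding m msupp_inc by auto
  qed
  then show ?thesis unfolding jb_def by blast
qed

lemma quad_mtotal: "quad N \<eta> m \<noteq> 0 \<Longrightarrow> mtotal m = 2"
proof -
  assume nz: "quad N \<eta> m \<noteq> 0"
  obtain \<mu> where "(\<Sum>\<nu>\<in>{1..N}. \<eta> \<mu> \<nu> / 2 * ind (inc (\<mu>, 0) (dvar \<nu>)) m) \<noteq> 0"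
    using nz unfolding quad_def by (rule sum.not_neutral_contains_not_neutral)
  then obtain \<nu> where "\<eta> \<mu> \<nu> / 2 * ind (inc (\<mu>, 0) (dvar \<nu>)) m \<noteq> 0"
    by (rule sum.not_neutral_contains_not_neutral)
  then have m: "m = inc (\<mu>, 0) (dvar \<nu>)" by (auto simp: ind_def split: if_splits)
  show ?thesis unfolding m by (simp add: mtotal_inc dvar_def msupp_inc)
qed

lemma du_quad:
  assumes sym: "\<And>\<alpha> \<beta>. \<alpha> \<in> {1..N} \<Longrightarrow> \<beta> \<in> {1..N} \<Longrightarrow> \<eta> \<alpha> \<beta> = \<eta> \<beta> \<alpha>" and \<alpha>: "\<alpha> \<in> {1..N}"
  shows "du \<alpha> 0 (quad N \<eta>) = (\<lambda>m. \<Sum>\<nu>\<in>{1..N}. \<eta> \<alpha> \<nu> * ind (dvar \<nu>) m)"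
proof
  fix m
  have d: "du \<alpha> 0 (ind (inc (\<mu>, 0) (dvar \<nu>))) m = (if \<mu> = \<alpha> then ind (dvar \<nu>) m else 0) + (if \<nu> = \<alpha> then ind (dvar \<mu>) m else 0)" for \<mu> \<nu>
  proof (cases "\<mu> = \<alpha>")
    case True
    then show ?thesis unfolding du_ind by (auto simp: dvar_apply)
  next
    case False
    have e: "dec (\<alpha>, 0) (inc (\<mu>, 0) (dvar \<alpha>)) = dvar \<mu>"
      using False by (auto simp: dec_def inc_def dvar_def fun_eq_iff)
    have c: "inc (\<mu>, 0) (dvar \<nu>) (\<alpha>, 0) = (if \<nu> = \<alpha> then 1 else 0)" using False by (auto simp: inc_def dvar_def)
    show ?thesis unfolding du_ind c using False e by auto
  qed
  have "du \<alpha> 0 (quad N \<eta>) m = (\<Sum>\<mu>\<in>{1..N}. \<Sum>\<nu>\<in>{1..N}. \<eta> \<mu> \<nu> / 2 * du \<alpha> 0 (ind (inc (\<mu>, 0) (dvar \<nu>))) m)"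
    unfolding quad_def du_sum du_scale ..
  also have "\<dots> = (\<Sum>\<mu>\<in>{1..N}. \<Sum>\<nu>\<in>{1..N}. if \<mu> = \<alpha> then \<eta> \<mu> \<nu> / 2 * ind (dvar \<nu>) m else 0)
      + (\<Sum>\<mu>\<in>{1..N}. \<Sum>\<nu>\<in>{1..N}. if \<nu> = \<alpha> then \<eta> \<mu> \<nu> / 2 * ind (dvar \<mu>) m else 0)"
    unfolding sum.distrib[symmetric] d by (intro sum.cong refl) (auto simp: distrib_left)
  also have "(\<Sum>\<mu>\<in>{1..N}. \<Sum>\<nu>\<in>{1..N}. if \<mu> = \<alpha> then \<eta> \<mu> \<nu> / 2 * ind (dvar \<nu>) m else 0)
      = (\<Sum>\<nu>\<in>{1..N}. \<eta> \<alpha> \<nu> / 2 * ind (dvar \<nu>) m)"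
    by (subst sum.swap) (use \<alpha> in \<open>simp add: sum.delta\<close>)
  also have "(\<Sum>\<mu>\<in>{1..N}. \<Sum>\<nu>\<in>{1..N}. if \<nu> = \<alpha> then \<eta> \<mu> \<nu> / 2 * ind (dvar \<mu>) m else 0)
      = (\<Sum>\<mu>\<in>{1..N}. \<eta> \<mu> \<alpha> / 2 * ind (dvar \<mu>) m)"
    using \<alpha> by (simp add: sum.delta)
  also have "\<dots> = (\<Sum>\<nu>\<in>{1..N}. \<eta> \<alpha> \<nu> / 2 * ind (dvar \<nu>) m)"
    by (intro sum.cong refl) (simp only: sym[OF _ \<alpha>])
  finally show "du \<alpha> 0 (quad N \<eta>) m = (\<Sum>\<nu>\<in>{1..N}. \<eta> \<alpha> \<nu> * ind (dvar \<nu>) m)"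
    by (simp add: sum.distrib[symmetric])
qed

lemma Fx_linear:
  "Fx (\<lambda>m. \<Sum>\<nu>\<in>{1..N}. c \<nu> * ind (dvar \<nu>) m) xs = (case xs of [(\<mu>, \<kappa>)] \<Rightarrow> if \<mu> \<in> {1..N} then c \<mu> else 0 | _ \<Rightarrow> 0)"
proof -
  have s: "Fx (\<lambda>m. \<Sum>\<nu>\<in>{1..N}. c \<nu> * ind (dvar \<nu>) m) xs = (\<Sum>\<nu>\<in>{1..N}. if \<exists>\<kappa>. xs = [(\<nu>, \<kappa>)] then c \<nu> else 0)"
  proof -
    have "Fx (\<lambda>m. \<Sum>\<nu>\<in>{1..N}. c \<nu> * ind (dvar \<nu>) m) xs = (\<Sum>\<nu>\<in>{1..N}. Fx (\<lambda>m. c \<nu> * ind (dvar \<nu>) m) xs)"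
      by (rule Fx_sum[where N = N]) (rule slice_scale[OF slice_ind_dvar])
    also have "\<dots> = (\<Sum>\<nu>\<in>{1..N}. if \<exists>\<kappa>. xs = [(\<nu>, \<kappa>)] then c \<nu> else 0)"
    proof (rule sum.cong[OF refl])
      fix \<nu> assume n: "\<nu> \<in> {1..N}"
      show "Fx (\<lambda>m. c \<nu> * ind (dvar \<nu>) m) xs = (if \<exists>\<kappa>. xs = [(\<nu>, \<kappa>)] then c \<nu> else 0)"
        unfolding Fx_scale[OF slice_ind_dvar[OF n]] Fx_ind_dvar[OF n] by simp
    qed
    finally show ?thesis .
  qed
  show ?thesis
  proof (cases "\<exists>\<mu> \<kappa>. xs = [(\<mu>, \<kappa>)]")
    case True
    then obtain \<mu> \<kappa> where x: "xs = [(\<mu>, \<kappa>)]" by blast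
    have "(\<Sum>\<nu>\<in>{1..N}. if \<exists>\<kappa>. xs = [(\<nu>, \<kappa>)] then c \<nu> else 0) = (\<Sum>\<nu>\<in>{1..N}. if \<nu> = \<mu> then c \<mu> else 0)"
      unfolding x by (rule sum.cong) auto
    then show ?thesis unfolding s unfolding x by simp
  next
    case False
    then have "(\<Sum>\<nu>\<in>{1..N}. if \<exists>\<kappa>. xs = [(\<nu>, \<kappa>)] then c \<nu> else 0) = 0" by (intro sum.neutral) auto
    then show ?thesis unfolding s using False by (auto split: list.splits)
  qed
qed

section \<open>Fourier transforms of differential operators\<close>

lemma hat_hbar_mul: "hat (fourier (hbar_mul f)) xs = fps_X * hat (fourier f) xs"
proof (rule coeffs_eqI)
  fix h e
  have "hbar_mul f e h = (if h = 0 then (\<lambda>m. 0) else f e (h - 1))" by (auto simp: hbar_mul_def)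
  then show "hat (fourier (hbar_mul f)) xs $ h $ e = (fps_X * hat (fourier f) xs) $ h $ e"
    unfolding hat_fourier using hbar_nth[of 1 "hat (fourier f) xs" h e] by (cases h) (simp_all add: hat_fourier del: hat_nth)
qed

lemma hat_dx: "is_qdp N f \<Longrightarrow> hat (fourier (dx f)) xs = scal (\<i> * of_int (freq xs)) * hat (fourier f) xs"
proof (rule coeffs_eqI)
  fix h e assume "is_qdp N f"
  then have s: "slice N (f e h)" unfolding is_qdp_slice by blast
  show "hat (fourier (dx f)) xs $ h $ e = (scal (\<i> * of_int (freq xs)) * hat (fourier f) xs) $ h $ e"
    unfolding hat_fourier scal_nth dx_dxs Fx_dxs[OF s] ..
qed

lemma is_qdp_Dm1: "is_qdp N f \<Longrightarrow> is_qdp N (Dm1 f)"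
  unfolding is_qdp_slice
proof (intro allI)
  fix e h assume "\<forall>e h. slice N (f e h)"
  then have "slice N (f e h)" by blast
  then show "slice N (Dm1 f e h)" by (rule slice_mono) (auto simp: Dm1_def)
qed

lemma is_qdp_dx: "is_qdp N f \<Longrightarrow> is_qdp N (dx f)"
  unfolding is_qdp_slice dx_dxs using slice_dxs by blast

lemma is_qdp_diff_u: "is_qdp N f \<Longrightarrow> is_qdp N (diff_u \<alpha> k f)"
  unfolding is_qdp_slice diff_u_du using slice_du by blast

lemma is_qdp_hbar_mul: "is_qdp N f \<Longrightarrow> is_qdp N (hbar_mul f)"
  unfolding is_qdp_slice
proof (intro allI)
  fix e h assume f: "\<forall>e h. slice N (f e h)"
  have "hbar_mul f e h = (if h = 0 then (\<lambda>m. 0) else f e (h - 1))" by (auto simp: hbar_mul_def)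
  then show "slice N (hbar_mul f e h)" using f by simp
qed

lemma hat_Dm1: "is_qdp N f \<Longrightarrow> hat (fourier (Dm1 f)) xs = deg (hat (fourier f)) xs - hat (fourier f) xs"
proof (rule coeffs_eqI)
  fix h e assume "is_qdp N f"
  then have s: "slice N (f e h)" unfolding is_qdp_slice by blast
  have "Dm1 f e h = (\<lambda>m. (\<lambda>n. of_nat (e + 2 * h + n) - 1) (mtotal m) * f e h m)" by (simp add: Dm1_def)
  then have "Fx (Dm1 f e h) xs = (of_nat (e + 2 * h + length xs) - 1) * Fx (f e h) xs"
    using Fx_weight[OF s, of "\<lambda>n. of_nat (e + 2 * h + n) - 1" xs] by simp
  then show "hat (fourier (Dm1 f)) xs $ h $ e = (deg (hat (fourier f)) xs - hat (fourier f) xs) $ h $ e"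
    unfolding fps_sub_nth deg_nth hat_fourier by (simp add: left_diff_distrib)
qed

lemma hat_diff_u: "is_qdp N f \<Longrightarrow> hat (fourier (diff_u \<alpha> 0 f)) xs = hat (fourier f) ((\<alpha>, 0) # xs)"
proof (rule coeffs_eqI)
  fix h e assume "is_qdp N f"
  then have s: "slice N (f e h)" unfolding is_qdp_slice by blast
  show "hat (fourier (diff_u \<alpha> 0 f)) xs $ h $ e = hat (fourier f) ((\<alpha>, 0) # xs) $ h $ e"
    unfolding hat_fourier diff_u_du Fx_Cons_0[OF s] ..
qed

lemma hat_outside: "is_qdp N f \<Longrightarrow> \<nu> \<notin> {1..N} \<Longrightarrow> hat (fourier f) ((\<nu>, l) # xs) = 0"
proof (rule coeffs_eqI)
  fix h e assume f: "is_qdp N f" and n: "\<nu> \<notin> {1..N}"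
  have s: "slice N (f e h)" using f unfolding is_qdp_slice by blast
  show "hat (fourier f) ((\<nu>, l) # xs) $ h $ e = 0 $ h $ e"
    unfolding hat_fourier Fx_outside[OF s n] by simp
qed

lemma hat_const: "is_const c \<Longrightarrow> is_qdp N c \<Longrightarrow> xs \<noteq> [] \<Longrightarrow> hat (fourier c) xs = 0"
proof (rule coeffs_eqI)
  fix h e assume c: "is_const c" and xs: "xs \<noteq> []"
  have z: "{m. c e h m \<noteq> 0 \<and> mtotal m = length xs} = {}"
  proof -
    have "mtotal m \<noteq> length xs" if "c e h m \<noteq> 0" for m
    proof -
      have "m = (\<lambda>_. 0)" using c that unfolding is_const_def by blast
      then show ?thesis using xs by simp
    qed
    then show ?thesis by blast
  qed
  show "hat (fourier c) xs $ h $ e = 0 $ h $ e" unfolding hat_fourier Fx_def z by simp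
qed

lemma is_qdp_const: "is_const c \<Longrightarrow> is_qdp N c"
  unfolding is_qdp_slice
proof (intro allI)
  fix e h assume c: "is_const c"
  have i: "m = (\<lambda>_. 0)" if "c e h m \<noteq> 0" for m using c that unfolding is_const_def by blast
  show "slice N (c e h)" by (rule slice_mono[OF slice_ind_zero]) (simp add: ind_def i)
qed

lemma is_qdp_half_eta: "is_qdp N (half_eta_uu N \<eta>)"
  unfolding is_qdp_slice half_eta_quad by (simp add: slice_quad)

text \<open>The jet order may grow with the powers of eps and hbar; up to fixed orders it is
  bounded, crudely by the sum of the finitely many bounds. Every larger \<open>J\<close> works too,
  so that two polynomials can share one.\<close>

lemma ex_pfam:
  assumes f: "is_qdp N f"
  shows "\<exists>J0. \<forall>J\<ge>J0. pfam J h e (\<lambda>t. hat (fourier f))"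
proof -
  have s: "slice N (f e' h')" for e' h' using f unfolding is_qdp_slice by blast
  have "\<forall>e' h'. \<exists>J. jb J (f e' h')" using ex_jb[OF s] by blast
  then obtain Jf where Jf: "\<And>e' h'. jb (Jf e' h') (f e' h')" by metis
  define J0 where "J0 = (\<Sum>h'\<le>h. \<Sum>e'\<le>e. Jf e' h')"
  have le: "Jf e' h' \<le> J0" if "h' \<le> h" "e' \<le> e" for e' h'
  proof -
    have "Jf e' h' \<le> (\<Sum>e'\<le>e. Jf e' h')" by (rule member_le_sum) (use that in auto)
    also have "\<dots> \<le> J0" unfolding J0_def by (rule member_le_sum) (use that in auto)
    finally show ?thesis .
  qed
  have "pfam J h e (\<lambda>t. hat (fourier f))" if "J0 \<le> J" for J
  proof -
    have "hat (fourier f) xs $ h' $ e' = sy J (tc (f e' h')) xs" if "h' \<le> h" "e' \<le> e" for h' e' xs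
      unfolding hat_fourier
      by (rule Fx_sy[OF s jb_mono[OF Jf order_trans[OF le[OF that] \<open>J0 \<le> J\<close>]]])
    then show ?thesis unfolding pfam_def by (intro exI[of _ "\<lambda>t h' e'. tc (f e' h')"]) simp
  qed
  then show ?thesis by blast
qed

section \<open>Solutions of the recursion\<close>

text \<open>The index n stands for the subscript n - 1 of the solutions. The recursion is multiplied
  by hbar, which avoids dividing a commutator.\<close>

locale recursion_solutions = weyl N etai for N etai +
  fixes \<eta> :: "nat \<Rightarrow> nat \<Rightarrow> complex" and H :: qdp and G :: "nat \<Rightarrow> nat \<Rightarrow> qdp"
  assumes eta_sym: "\<And>\<alpha> \<beta>. \<alpha> \<in> {1..N} \<Longrightarrow> \<beta> \<in> {1..N} \<Longrightarrow> \<eta> \<alpha> \<beta> = \<eta> \<beta> \<alpha>"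
    and eta_inv: "\<And>\<alpha> \<beta>. \<alpha> \<in> {1..N} \<Longrightarrow> \<beta> \<in> {1..N} \<Longrightarrow> (\<Sum>\<mu>\<in>{1..N}. \<eta> \<alpha> \<mu> * etai \<mu> \<beta>) = (if \<alpha> = \<beta> then 1 else 0)"
    and H_qdp: "is_qdp N H"
    and G_qdp: "\<And>\<alpha> n. \<alpha> \<in> {1..N} \<Longrightarrow> is_qdp N (G \<alpha> n)"
    and G_init: "\<And>\<alpha>. \<alpha> \<in> {1..N} \<Longrightarrow> G \<alpha> 0 = (\<lambda>e h m. \<Sum>\<mu>\<in>{1..N}. \<eta> \<alpha> \<mu> * uvar \<mu> e h m)"
    and G_rec: "\<And>\<alpha> n. \<alpha> \<in> {1..N} \<Longrightarrow> fourier (hbar_mul (dx (Dm1 (G \<alpha> (Suc n)))))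
      = qcomm etai (fourier (G \<alpha> n)) (zero_mode (fourier H))"
begin

text \<open>The hypothesis gives an inverse on one side. With T the transpose of
  \<open>etai\<close>, evaluating the product T \<eta> \<open>etai\<close> in both bracketings
  yields \<open>etai\<close> and T.\<close>

lemma etai_sym:
  assumes a: "\<alpha> \<in> {1..N}" and b: "\<beta> \<in> {1..N}"
  shows "etai \<alpha> \<beta> = etai \<beta> \<alpha>"
proof -
  let ?S = "\<Sum>\<gamma>\<in>{1..N}. \<Sum>\<mu>\<in>{1..N}. etai \<mu> \<alpha> * \<eta> \<mu> \<gamma> * etai \<gamma> \<beta>"
  have "?S = (\<Sum>\<gamma>\<in>{1..N}. (if \<gamma> = \<alpha> then 1 else 0) * etai \<gamma> \<beta>)"
  proof (rule sum.cong[OF refl])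
    fix \<gamma> assume c: "\<gamma> \<in> {1..N}"
    have "(\<Sum>\<mu>\<in>{1..N}. etai \<mu> \<alpha> * \<eta> \<mu> \<gamma> * etai \<gamma> \<beta>) = (\<Sum>\<mu>\<in>{1..N}. \<eta> \<gamma> \<mu> * etai \<mu> \<alpha>) * etai \<gamma> \<beta>"
      unfolding sum_distrib_right by (intro sum.cong refl) (simp only: eta_sym[OF _ c] mult_ac)
    then show "(\<Sum>\<mu>\<in>{1..N}. etai \<mu> \<alpha> * \<eta> \<mu> \<gamma> * etai \<gamma> \<beta>) = (if \<gamma> = \<alpha> then 1 else 0) * etai \<gamma> \<beta>"
      unfolding eta_inv[OF c a] .
  qed
  also have "\<dots> = (\<Sum>\<gamma>\<in>{1..N}. if \<gamma> = \<alpha> then etai \<alpha> \<beta> else 0)" by (rule sum.cong) auto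
  also have "\<dots> = etai \<alpha> \<beta>" using a by simp
  finally have 1: "?S = etai \<alpha> \<beta>" .
  have "?S = (\<Sum>\<mu>\<in>{1..N}. \<Sum>\<gamma>\<in>{1..N}. etai \<mu> \<alpha> * \<eta> \<mu> \<gamma> * etai \<gamma> \<beta>)" by (rule sum.swap)
  also have "\<dots> = (\<Sum>\<mu>\<in>{1..N}. etai \<mu> \<alpha> * (if \<mu> = \<beta> then 1 else 0))"
  proof (rule sum.cong[OF refl])
    fix \<mu> assume c: "\<mu> \<in> {1..N}"
    show "(\<Sum>\<gamma>\<in>{1..N}. etai \<mu> \<alpha> * \<eta> \<mu> \<gamma> * etai \<gamma> \<beta>) = etai \<mu> \<alpha> * (if \<mu> = \<beta> then 1 else 0)"
      unfolding mult.assoc sum_distrib_left[symmetric] eta_inv[OF c b] ..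
  qed
  also have "\<dots> = (\<Sum>\<mu>\<in>{1..N}. if \<mu> = \<beta> then etai \<beta> \<alpha> else 0)" by (rule sum.cong) auto
  also have "\<dots> = etai \<beta> \<alpha>" using b by simp
  finally show ?thesis using 1 by simp
qed

lemma etai_eta: "\<alpha> \<in> {1..N} \<Longrightarrow> \<beta> \<in> {1..N} \<Longrightarrow> (\<Sum>\<mu>\<in>{1..N}. etai \<alpha> \<mu> * \<eta> \<beta> \<mu>) = (if \<alpha> = \<beta> then 1 else 0)"
proof -
  assume a: "\<alpha> \<in> {1..N}" and b: "\<beta> \<in> {1..N}"
  have "(\<Sum>\<mu>\<in>{1..N}. etai \<alpha> \<mu> * \<eta> \<beta> \<mu>) = (\<Sum>\<mu>\<in>{1..N}. \<eta> \<beta> \<mu> * etai \<mu> \<alpha>)"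
    by (intro sum.cong refl) (simp only: etai_sym[OF a] mult.commute)
  then show ?thesis unfolding eta_inv[OF b a] by auto
qed

lemma etai_eta': "\<alpha> \<in> {1..N} \<Longrightarrow> \<beta> \<in> {1..N} \<Longrightarrow> (\<Sum>\<mu>\<in>{1..N}. etai \<mu> \<alpha> * \<eta> \<beta> \<mu>) = (if \<alpha> = \<beta> then 1 else 0)"
proof -
  assume a: "\<alpha> \<in> {1..N}" and b: "\<beta> \<in> {1..N}"
  have "(\<Sum>\<mu>\<in>{1..N}. etai \<mu> \<alpha> * \<eta> \<beta> \<mu>) = (\<Sum>\<mu>\<in>{1..N}. \<eta> \<beta> \<mu> * etai \<mu> \<alpha>)"
    by (intro sum.cong refl) (simp only: mult.commute)
  then show ?thesis unfolding eta_inv[OF b a] by auto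
qed

definition gh :: "nat \<Rightarrow> nat \<Rightarrow> lfun" where "gh \<alpha> n = hat (fourier (G \<alpha> n))"
definition hh :: lfun where "hh = hat (fourier H)"

lemma perm_gh: "perm_inv (md k (gh \<alpha> n))" and perm_hh: "perm_inv (md k hh)"
  unfolding gh_def hh_def by (rule perm_inv_md[OF perm_inv_hat])+

lemma slice_G: "\<alpha> \<in> {1..N} \<Longrightarrow> slice N (G \<alpha> n e h)"
  using G_qdp is_qdp_slice by blast

lemma md_eq_lin:
  assumes F: "\<And>xs h e. K xs $ h $ e = (if e = 0 \<and> h = 0 then (case xs of [(\<mu>, \<kappa>)] \<Rightarrow> if \<mu> \<in> {1..N} then u \<mu> else 0 | _ \<Rightarrow> 0) else 0)"
  shows "md k K = lin u k"
proof (intro ext coeffs_eqI)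
  fix xs h e
  have s: "scal c $ h $ e = (if e = 0 \<and> h = 0 then c else 0)" for c by (simp add: scal_def)
  show "md k K xs $ h $ e = lin u k xs $ h $ e"
  proof (cases "\<exists>\<mu> \<kappa>. xs = [(\<mu>, \<kappa>)]")
    case True
    then obtain \<mu> \<kappa> where x: "xs = [(\<mu>, \<kappa>)]" by blast
    have "K [(\<mu>, \<kappa>)] $ h $ e = (if e = 0 \<and> h = 0 then if \<mu> \<in> {1..N} then u \<mu> else 0 else 0)"
      unfolding F by (simp only: list.case prod.case)
    then show ?thesis unfolding x md_def lin_simps
      by (cases "\<kappa> = k"; cases "\<mu> \<in> {1..N}") (simp_all add: s del: atLeastAtMost_iff One_nat_def)
  next
    case False
    then have "lin u k xs = 0" by (auto simp: lin_def split: list.splits)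
    moreover have "K xs $ h $ e = 0" unfolding F using False by (auto split: list.splits)
    ultimately show ?thesis by (simp add: md_def)
  qed
qed

lemma gh_0: "\<alpha> \<in> {1..N} \<Longrightarrow> md k (gh \<alpha> 0) = lin (\<eta> \<alpha>) k"
proof (rule md_eq_lin)
  fix xs h e assume a: "\<alpha> \<in> {1..N}"
  have g: "G \<alpha> 0 e h = (if e = 0 \<and> h = 0 then (\<lambda>m. \<Sum>\<mu>\<in>{1..N}. \<eta> \<alpha> \<mu> * ind (dvar \<mu>) m) else (\<lambda>m. 0))"
    unfolding G_init[OF a] uvar_ind by auto
  show "gh \<alpha> 0 xs $ h $ e = (if e = 0 \<and> h = 0 then (case xs of [(\<mu>, \<kappa>)] \<Rightarrow> if \<mu> \<in> {1..N} then \<eta> \<alpha> \<mu> else 0 | _ \<Rightarrow> 0) else 0)"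
    unfolding gh_def hat_fourier g by (simp only: Fx_linear Fx_zero split: if_split) simp
qed

lemma deg_gh_0: "\<alpha> \<in> {1..N} \<Longrightarrow> deg (md k (gh \<alpha> 0)) xs = md k (gh \<alpha> 0) xs"
proof -
  assume a: "\<alpha> \<in> {1..N}"
  have c: "cdeg (scal z) = 0" for z by (rule coeffs_eqI) (simp add: scal_def)
  show ?thesis
  proof (cases "\<exists>x. xs = [x]")
    case True
    then show ?thesis unfolding gh_0[OF a] deg_def by (auto simp: c)
  next
    case False
    then have "lin (\<eta> \<alpha>) k xs = 0" by (auto simp: lin_def split: list.splits)
    then show ?thesis unfolding gh_0[OF a] deg_def by simp
  qed
qed

lemma gh_rec:
  assumes a: "\<alpha> \<in> {1..N}"
  shows "fps_X * scal (\<i> * of_int k) * (deg (md k (gh \<alpha> (Suc n))) xs - md k (gh \<alpha> (Suc n)) xs) = br (md k (gh \<alpha> n)) (md 0 hh) xs"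
proof (cases "freq xs = k")
  case True
  have "hat (fourier (hbar_mul (dx (Dm1 (G \<alpha> (Suc n)))))) xs = fps_X * (scal (\<i> * of_int (freq xs)) * (deg (gh \<alpha> (Suc n)) xs - gh \<alpha> (Suc n) xs))"
    unfolding hat_hbar_mul hat_dx[OF is_qdp_Dm1[OF G_qdp[OF a]]] hat_Dm1[OF G_qdp[OF a]] gh_def ..
  moreover have "hat (fourier (hbar_mul (dx (Dm1 (G \<alpha> (Suc n)))))) xs = br (md (freq xs) (gh \<alpha> n)) (md 0 hh) xs"
    unfolding G_rec[OF a] hat_qcomm[OF fsupp_fourier[OF G_qdp[OF a]] fsupp_fourier[OF H_qdp]] gh_def hh_def ..
  moreover have "deg (md k (gh \<alpha> (Suc n))) xs = deg (gh \<alpha> (Suc n)) xs" "md k (gh \<alpha> (Suc n)) xs = gh \<alpha> (Suc n) xs"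
    using True by (simp_all add: deg_def md_def)
  ultimately show ?thesis using True by (simp add: mult.assoc)
next
  case False
  have "br (md k (gh \<alpha> n)) (md 0 hh) xs = 0"
    using homogD[OF homog_br[OF homog_md homog_md], of k "gh \<alpha> n" 0 hh xs] False by auto
  moreover have "md k (gh \<alpha> (Suc n)) xs = 0" "deg (md k (gh \<alpha> (Suc n))) xs = 0"
    using False by (simp_all add: deg_def md_def)
  ultimately show ?thesis by simp
qed

lemma weighted_bracket_zero:
  assumes a: "\<alpha> \<in> {1..N}" and b: "\<beta> \<in> {1..N}" and kl: "k \<noteq> 0" "l \<noteq> 0" and xs: "xs \<noteq> []"
  shows "(\<Sum>p\<le>n. of_int (k ^ p * l ^ (n - p)) * br (md k (gh \<alpha> p)) (md l (gh \<beta> (n - p))) xs $ h $ e) = 0"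
proof -
  have "(\<Sum>p\<le>n. scal (of_int (k ^ p * l ^ (n - p))) * br (md k (gh \<alpha> p)) (md l (gh \<beta> (n - p))) xs) = 0"
    by (rule bracket_modes_vanish[where A = "\<lambda>p. md k (gh \<alpha> p)" and B = "\<lambda>p. md l (gh \<beta> p)" and H = "md 0 hh"])
      (rule homog_md perm_gh perm_hh deg_gh_0[OF a] deg_gh_0[OF b] gh_rec[OF a] gh_rec[OF b] kl xs)+
  then have "(\<Sum>p\<le>n. scal (of_int (k ^ p * l ^ (n - p))) * br (md k (gh \<alpha> p)) (md l (gh \<beta> (n - p))) xs) $ h $ e = 0" by simp
  then show ?thesis by (simp only: fps_sum_nth scal_nth)
qed

lemma polyf_gh_bracket:
  assumes a: "\<alpha> \<in> {1..N}" and b: "\<beta> \<in> {1..N}" and k: "linf k" "linf l"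
    and zs: "\<And>x. x \<in> set zs \<Longrightarrow> linf (snd x)" "\<And>t. k t + l t = freq (map (\<lambda>(\<alpha>, f). (\<alpha>, f t)) zs)"
  shows "polyf (\<lambda>t. br (md (k t) (gh \<alpha> p)) (md (l t) (gh \<beta> q)) (map (\<lambda>(\<alpha>, f). (\<alpha>, f t)) zs) $ h $ e)"
proof -
  obtain J1 where J1: "\<And>J. J1 \<le> J \<Longrightarrow> pfam J h e (\<lambda>t. gh \<alpha> p)"
    using ex_pfam[OF G_qdp[OF a, of p], of h e] unfolding gh_def by blast
  obtain J2 where J2: "\<And>J. J2 \<le> J \<Longrightarrow> pfam J h e (\<lambda>t. gh \<beta> q)"
    using ex_pfam[OF G_qdp[OF b, of q], of h e] unfolding gh_def by blast
  show ?thesis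
    by (rule br_polyf[OF etai_sym J1[of "max J1 J2"] J2[of "max J1 J2"] k zs]) simp_all
qed

text \<open>At fixed order \<open>n\<close>, put \<open>k = c t\<close>, \<open>l = t\<close>, shifting one frequency of \<open>xs\<close> accordingly: the
  weighted sum of the brackets is \<open>t ^ n\<close> times a polynomial in \<open>t\<close>, which therefore vanishes at 0.\<close>

lemma gh_commute:
  assumes a: "\<alpha> \<in> {1..N}" and b: "\<beta> \<in> {1..N}" and xs: "xs \<noteq> []"
  shows "br (md 0 (gh \<alpha> p)) (md 0 (gh \<beta> q)) xs = 0"
proof (cases "freq xs = 0")
  case False
  then show ?thesis using homogD[OF homog_br[OF homog_md homog_md], of 0 "gh \<alpha> p" 0 "gh \<beta> q" xs] by auto
next
  case True
  obtain \<gamma> \<kappa> ys where x: "xs = (\<gamma>, \<kappa>) # ys" using xs by (metis list.exhaust surj_pair)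
  define n where "n = p + q"
  have const: "linf (\<lambda>t. z)" for z using linfI[of z 0] by simp
  show ?thesis
  proof (rule coeffs_eqI)
    fix h e
    define b0 where "b0 i = br (md 0 (gh \<alpha> i)) (md 0 (gh \<beta> (n - i))) xs $ h $ e" for i
    have z: "(\<Sum>i\<le>n. of_int (c ^ i) * b0 i) = 0" if c: "c \<noteq> 0" for c
    proof -
      define zs where "zs = (\<gamma>, \<lambda>t. \<kappa> + (c + 1) * t) # map (\<lambda>(\<gamma>, \<kappa>). (\<gamma>, \<lambda>t :: int. \<kappa>)) ys"
      define X where "X t = map (\<lambda>(\<alpha>, f). (\<alpha>, f t)) zs" for t
      have X: "X t = (\<gamma>, \<kappa> + (c + 1) * t) # ys" for t
        unfolding X_def zs_def by (simp add: case_prod_unfold comp_def)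
      have lz: "linf (snd y)" if "y \<in> set zs" for y
        using that linfI[of \<kappa> "c + 1"] const unfolding zs_def by auto
      have lk: "linf (\<lambda>t. c * t)" "linf (\<lambda>t. t)" using linfI[of 0 c] linfI[of 0 1] by simp_all
      have fr: "c * t + t = freq (map (\<lambda>(\<alpha>, f). (\<alpha>, f t)) zs)" for t
        using True unfolding X_def[symmetric] X x by (simp add: algebra_simps)
      define f where "f t = (\<Sum>i\<le>n. of_int (c ^ i) * br (md (c * t) (gh \<alpha> i)) (md t (gh \<beta> (n - i))) (X t) $ h $ e)" for t
      have pf: "polyf f"
        unfolding f_def X_def by (intro polyf_sum polyf_mult polyf_const polyf_gh_bracket[OF a b lk lz fr])
      have fz: "f t = 0" if t: "t \<notin> {0}" for t
      proof -
        have "(\<Sum>i\<le>n. of_int ((c * t) ^ i * t ^ (n - i)) * br (md (c * t) (gh \<alpha> i)) (md t (gh \<beta> (n - i))) (X t) $ h $ e) = 0"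
          by (rule weighted_bracket_zero[OF a b]) (use c t in \<open>simp_all add: X\<close>)
        moreover have "(c * t) ^ i * t ^ (n - i) = t ^ n * c ^ i" if "i \<le> n" for i
        proof -
          have "t ^ n = t ^ i * t ^ (n - i)" using that by (simp add: power_add[symmetric])
          then show ?thesis unfolding power_mult_distrib by (simp only: mult_ac)
        qed
        ultimately have "of_int (t ^ n) * f t = 0"
          unfolding f_def sum_distrib_left by (simp add: mult.assoc)
        then show ?thesis using t by simp
      qed
      have "f 0 = 0" by (rule polyf_eq_0_cofinite[OF pf, of "{0}"]) (simp, rule fz)
      moreover have "X 0 = xs" unfolding X x by simp
      ultimately show ?thesis unfolding f_def b0_def by simp
    qed
    \<comment> \<open>Letting the slope c vary as well separates the summands: a polynomial in c
      vanishing for all c other than 0 has zero coefficients, and these are the individual brackets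
      of zero modes.\<close>
    have pf: "polyf (\<lambda>c. \<Sum>i\<le>n. of_int (c ^ i) * b0 i)"
      unfolding of_int_power by (intro polyf_sum polyf_mult polyf_power polyf_const polyf_of_int)
    have "(\<Sum>i\<le>n. of_int (c ^ i) * b0 i) = 0" for c
      by (rule polyf_eq_0_cofinite[OF pf, of "{0}"]) (use z in auto)
    then have "(\<Sum>i\<le>n. (\<i> * of_int c) ^ i * (b0 i / \<i> ^ i)) = 0" for c
      by (simp add: power_mult_distrib)
    then have "b0 p / \<i> ^ p = 0" by (rule power_sum_zero) (simp add: n_def)
    then show "br (md 0 (gh \<alpha> p)) (md 0 (gh \<beta> q)) xs $ h $ e = 0 $ h $ e"
      by (simp add: b0_def n_def)
  qed
qed

lemma br_gh_lin:
  assumes b: "\<beta> \<in> {1..N}"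
  shows "br (md k (gh \<alpha> p)) (md l (gh \<beta> 0)) xs = - (fps_X * scal (\<i> * of_int l) * md k (gh \<alpha> p) ((\<beta>, - l) # xs))"
  unfolding gh_0[OF b] by (rule br_lin[OF homog_md perm_gh b]) (rule etai_eta[OF _ b] etai_eta'[OF _ b], assumption)+

text \<open>Here \<open>k = s - t\<close> and \<open>l = t\<close>; only the terms with \<open>q \<le> 1\<close> survive division by \<open>t\<close> at \<open>t = 0\<close>.\<close>

lemma gh_bracket_1:
  assumes a: "\<alpha> \<in> {1..N}" and b: "\<beta> \<in> {1..N}" and s: "freq xs \<noteq> 0"
  shows "br (md (freq xs) (gh \<alpha> n)) (md 0 (gh \<beta> 1)) xs = fps_X * scal (\<i> * of_int (freq xs)) * gh \<alpha> (Suc n) ((\<beta>, 0) # xs)"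
proof (rule coeffs_eqI)
  fix h e
  let ?s = "freq xs"
  have xs: "xs \<noteq> []" using s by auto
  have const: "linf (\<lambda>t. z)" for z using linfI[of z 0] by simp
  define zs where "zs = map (\<lambda>(\<gamma>, \<kappa>). (\<gamma>, \<lambda>t :: int. \<kappa>)) xs"
  have X: "map (\<lambda>(\<alpha>, f). (\<alpha>, f t)) zs = xs" for t
    unfolding zs_def by (simp add: case_prod_unfold comp_def)
  have lz: "linf (snd y)" if "y \<in> set zs" for y using that const unfolding zs_def by auto
  have lk: "linf (\<lambda>t. ?s - t)" "linf (\<lambda>t. t)" "linf (\<lambda>t. - t)"
    using linfI[of ?s "- 1"] linfI[of 0 1] linfI[of 0 "- 1"] by simp_all
  have fr: "?s - t + t = freq (map (\<lambda>(\<alpha>, f). (\<alpha>, f t)) zs)" for t unfolding X by simp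
  define L where "L p t = br (md (?s - t) (gh \<alpha> p)) (md t (gh \<beta> (Suc n - p))) xs $ h $ e" for p t
  \<comment> \<open>By \<open>br_gh_lin\<close> the bracket with the linear mode in the term p = n +
    1 is -t times a derivative along a mode of frequency -t; \<open>T\<close> is that derivative,
    with the factor hbar read as an index shift.\<close>
  define T where "T t = \<i> * (if h = 0 then 0 else Fx (G \<alpha> (Suc n) e (h - 1)) ((\<beta>, - t) # xs))" for t
  have pL: "polyf (L p)" for p
    using polyf_gh_bracket[OF a b lk(1,2) lz fr, of p "Suc n - p" h e] unfolding L_def X .
  have pT: "polyf T"
    unfolding T_def by (cases "h = 0") (simp_all add: polyf_mult polyf_Fx_hd[OF slice_G[OF a] lk(3)])
  have LT: "L (Suc n) t = - (of_int t * T t)" for t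
  proof -
    have "md (?s - t) (gh \<alpha> (Suc n)) ((\<beta>, - t) # xs) = gh \<alpha> (Suc n) ((\<beta>, - t) # xs)" by (simp add: md_def)
    then have "br (md (?s - t) (gh \<alpha> (Suc n))) (md t (gh \<beta> 0)) xs = - (scal (\<i> * of_int t) * (fps_X ^ 1 * gh \<alpha> (Suc n) ((\<beta>, - t) # xs)))"
      unfolding br_gh_lin[OF b] by (simp add: mult_ac)
    then show ?thesis
      unfolding L_def diff_self_eq_0 fps_neg_nth scal_nth hbar_nth T_def gh_def hat_fourier[symmetric] by (cases h) simp_all
  qed
  define f where "f t = - (of_int (?s - t) ^ Suc n * T t) + of_int (?s - t) ^ n * L n t
    + (\<Sum>p<n. of_int (?s - t) ^ p * of_int t ^ (n - p) * L p t)" for t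
  have pf: "polyf f"
  proof -
    have "polyf (\<lambda>t. (- 1) * (of_int (?s - t) ^ Suc n * T t) + of_int (?s - t) ^ n * L n t
      + (\<Sum>p<n. of_int (?s - t) ^ p * of_int t ^ (n - p) * L p t))"
      by (intro polyf_add polyf_mult polyf_sum polyf_power polyf_const polyf_of_linf lk pL pT)
    then show ?thesis unfolding f_def by simp
  qed
  have fz: "f t = 0" if t: "t \<notin> {0, ?s}" for t
  proof -
    have nz: "?s - t \<noteq> 0" "t \<noteq> 0" using t by auto
    have "0 = (\<Sum>p\<le>Suc n. of_int ((?s - t) ^ p * t ^ (Suc n - p)) * L p t)"
      unfolding L_def by (rule weighted_bracket_zero[OF a b nz xs, symmetric])
    also have "\<dots> = (\<Sum>p<n. of_int ((?s - t) ^ p * t ^ (Suc n - p)) * L p t) + of_int ((?s - t) ^ n * t) * L n t + of_int ((?s - t) ^ Suc n) * L (Suc n) t"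
      by (simp add: lessThan_Suc_atMost[symmetric])
    also have "(\<Sum>p<n. of_int ((?s - t) ^ p * t ^ (Suc n - p)) * L p t) = of_int t * (\<Sum>p<n. of_int (?s - t) ^ p * of_int t ^ (n - p) * L p t)"
      unfolding sum_distrib_left by (rule sum.cong) (simp_all add: Suc_diff_le)
    finally have "of_int t * f t = 0" unfolding f_def LT by (simp add: algebra_simps)
    then show ?thesis using nz(2) by simp
  qed
  have "f 0 = 0" by (rule polyf_eq_0_cofinite[OF pf, of "{0, ?s}"]) (simp, rule fz)
  moreover have "(\<Sum>p<n. of_int (?s - 0) ^ p * of_int 0 ^ (n - p) * L p 0) = 0"
    by (rule sum.neutral) (simp add: zero_power)
  ultimately have "of_int ?s ^ n * (L n 0 - of_int ?s * T 0) = 0" unfolding f_def by (simp add: algebra_simps)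
  then have "L n 0 = of_int ?s * T 0" using s by simp
  then show "br (md (freq xs) (gh \<alpha> n)) (md 0 (gh \<beta> 1)) xs $ h $ e
    = (fps_X * scal (\<i> * of_int (freq xs)) * gh \<alpha> (Suc n) ((\<beta>, 0) # xs)) $ h $ e"
  proof -
    have r: "fps_X * scal (\<i> * of_int (freq xs)) * gh \<alpha> (Suc n) ((\<beta>, 0) # xs) = scal (\<i> * of_int (freq xs)) * (fps_X ^ 1 * gh \<alpha> (Suc n) ((\<beta>, 0) # xs))"
      by (simp add: mult_ac)
    show ?thesis
      unfolding r scal_nth hbar_nth
      unfolding gh_def[of \<alpha> "Suc n"] hat_fourier
      using \<open>L n 0 = of_int ?s * T 0\<close> unfolding L_def T_def by (cases h) simp_all
  qed
qed

text \<open>Contractions have positive frequency, so two zero modes admit none at p = 0, and the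
  product there is commutative.\<close>

lemma br_Nil_zero_modes: "br (md 0 F) (md 0 G') [] = 0"
proof -
  have "tpr (md 0 F) (md 0 G') = F [] * G' []" for F G'
  proof -
    have "tpr (md 0 F) (md 0 G') = (\<Sum>cs\<in>{[]}. wt cs * (md 0 F (Lc cs) * md 0 G' (Rc cs)))"
      unfolding tpr_def
    proof (rule sum.mono_neutral_left)
      show "{cs. set cs \<subseteq> con \<and> md 0 F (Lc cs) \<noteq> 0 \<and> md 0 G' (Rc cs) \<noteq> 0} \<subseteq> {[]}"
      proof
        fix cs assume "cs \<in> {cs. set cs \<subseteq> con \<and> md 0 F (Lc cs) \<noteq> 0 \<and> md 0 G' (Rc cs) \<noteq> 0}"
        then have c: "set cs \<subseteq> con" "csum cs = 0" by (auto simp: md_def split: if_splits)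
        then show "cs \<in> {[]}" using length_le_csum[OF c(1)] by simp
      qed
    qed auto
    then show ?thesis by (simp add: md_def)
  qed
  then show ?thesis by (simp add: br_Nil mult.commute)
qed

theorem functionals_commute:
  assumes a: "\<alpha> \<in> {1..N}" and b: "\<beta> \<in> {1..N}" and P: "P \<noteq> (\<lambda>_. 0)"
  shows "qcomm etai (zero_mode (fourier (G \<alpha> p))) (zero_mode (fourier (G \<beta> q))) P h e = 0"
proof -
  have s: "fsupp N (fourier (G \<alpha> p))" "fsupp N (fourier (G \<beta> q))"
    by (rule fsupp_fourier[OF G_qdp[OF a]], rule fsupp_fourier[OF G_qdp[OF b]])
  have s0: "fsupp N (zero_mode (fourier (G \<alpha> p)))" unfolding zero_mode_mdf by (rule fsupp_mdf[OF s(1)])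
  show ?thesis
  proof (cases "finite (msupp P)")
    case False
    then show ?thesis using qcomm_infinite[OF s0 s(2)] by blast
  next
    case True
    then obtain xs where x: "P = mon xs" using ex_mon by blast
    then have xs: "xs \<noteq> []" using P by auto
    have "md (freq xs) (md 0 (gh \<alpha> p)) = (if freq xs = 0 then md 0 (gh \<alpha> p) else (\<lambda>xs. 0))"
      by (auto simp: md_def fun_eq_iff)
    then have "br (md (freq xs) (md 0 (gh \<alpha> p))) (md 0 (gh \<beta> q)) xs = 0"
      using gh_commute[OF a b xs] by (cases "freq xs = 0") simp_all
    then have "hat (qcomm etai (zero_mode (fourier (G \<alpha> p))) (zero_mode (fourier (G \<beta> q)))) xs = 0"
      unfolding hat_qcomm[OF s0 s(2)] unfolding zero_mode_mdf hat_mdf gh_def .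
    then have "hat (qcomm etai (zero_mode (fourier (G \<alpha> p))) (zero_mode (fourier (G \<beta> q)))) xs $ h $ e = 0" by simp
    then show ?thesis unfolding hat_nth x[symmetric] using mfact_pos[of P] by simp
  qed
qed

text \<open>Nonzero frequencies are covered by \<open>gh_bracket_1\<close>. At frequency 0 a total
  derivative has no mode, and the bracket of the two zero modes vanishes.\<close>

theorem tau_symmetry:
  assumes a: "\<alpha> \<in> {1..N}" and b: "\<beta> \<in> {1..N}"
  shows "qcomm etai (fourier (G \<alpha> n)) (zero_mode (fourier (G \<beta> 1))) = fourier (hbar_mul (dx (diff_u \<beta> 0 (G \<alpha> (Suc n)))))"
proof (intro ext)
  fix P h e
  let ?r = "hbar_mul (dx (diff_u \<beta> 0 (G \<alpha> (Suc n))))"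
  have s: "fsupp N (fourier (G \<alpha> n))" "fsupp N (fourier (G \<beta> 1))"
    by (rule fsupp_fourier[OF G_qdp[OF a]], rule fsupp_fourier[OF G_qdp[OF b]])
  have q: "is_qdp N (diff_u \<beta> 0 (G \<alpha> (Suc n)))" by (rule is_qdp_diff_u[OF G_qdp[OF a]])
  have sr: "fsupp N (fourier ?r)" by (rule fsupp_fourier[OF is_qdp_hbar_mul[OF is_qdp_dx[OF q]]])
  show "qcomm etai (fourier (G \<alpha> n)) (zero_mode (fourier (G \<beta> 1))) P h e = fourier ?r P h e"
  proof (cases "finite (msupp P)")
    case False
    then have "fourier ?r P h e = 0" using fsuppD(1)[OF sr] by blast
    then show ?thesis using qcomm_infinite[OF s False] by simp
  next
    case True
    then obtain xs where x: "P = mon xs" using ex_mon by blast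
    have r: "hat (fourier ?r) xs = fps_X * scal (\<i> * of_int (freq xs)) * gh \<alpha> (Suc n) ((\<beta>, 0) # xs)"
      unfolding hat_hbar_mul hat_dx[OF q] hat_diff_u[OF G_qdp[OF a]] gh_def by (simp only: mult.assoc)
    have "br (md (freq xs) (gh \<alpha> n)) (md 0 (gh \<beta> 1)) xs = hat (fourier ?r) xs"
    proof (cases "freq xs = 0")
      case False
      then show ?thesis unfolding r by (rule gh_bracket_1[OF a b])
    next
      case True
      have "br (md 0 (gh \<alpha> n)) (md 0 (gh \<beta> 1)) xs = 0"
        using gh_commute[OF a b] br_Nil_zero_modes by (cases "xs = []") blast+
      then show ?thesis unfolding r True by simp
    qed
    then have "hat (qcomm etai (fourier (G \<alpha> n)) (zero_mode (fourier (G \<beta> 1)))) xs $ h $ e = hat (fourier ?r) xs $ h $ e"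
      unfolding hat_qcomm[OF s] gh_def by simp
    then show ?thesis unfolding hat_nth x[symmetric] using mfact_pos[of P] by simp
  qed
qed

end

section \<open>The string equation\<close>

lemma Fx_vanish:
  assumes "\<And>m. m \<noteq> (\<lambda>_. 0) \<Longrightarrow> g m = 0" "xs \<noteq> []"
  shows "Fx g xs = 0"
proof -
  have z: "{m. g m \<noteq> 0 \<and> mtotal m = length xs} = {}"
  proof -
    have "mtotal m \<noteq> length xs" if "g m \<noteq> 0" for m
    proof -
      have "m = (\<lambda>_. 0)" using assms(1) that by blast
      then show ?thesis using assms(2) by simp
    qed
    then show ?thesis by blast
  qed
  show ?thesis unfolding Fx_def z by simp
qed

text \<open>Total differentiation replaces one variable by another and preserves the number of
  factors. Hence it commutes with D, and with dividing by D - 1 where that is invertible.\<close>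

lemma dxs_weight:
  assumes "finite (msupp m)"
  shows "dxs (\<lambda>m. w (mtotal m) * g m) m = w (mtotal m) * dxs g m"
proof -
  have "mtotal (inc (low v) (dec v m)) = mtotal m" if "m v \<noteq> 0" for v
  proof -
    have f: "finite (msupp (dec v m))" by (rule finite_subset[OF msupp_dec assms])
    have "mtotal (inc (low v) (dec v m)) = mtotal (inc v (dec v m))" unfolding mtotal_inc[OF f] ..
    then show ?thesis unfolding inc_dec[of m v, OF that] .
  qed
  then show ?thesis
    unfolding dxs_def sum_distrib_left by (intro sum.cong refl) simp
qed

lemma mdeg_single: "mdeg (inc v (\<lambda>_. 0)) = snd v"
  by (simp add: mdeg_def msupp_inc)

lemma mtotal_1: "finite (msupp m) \<Longrightarrow> mtotal m = 1 \<Longrightarrow> \<exists>v. m = inc v (\<lambda>_. 0)"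
proof -
  assume f: "finite (msupp m)" and t: "mtotal m = 1"
  obtain xs where x: "m = mon xs" using ex_mon[OF f] by blast
  then have "length xs = 1" using t by simp
  then obtain v where "xs = [v]" by (cases xs) auto
  then show ?thesis using x by (auto simp: mon_Cons)
qed

lemma coeffs_cancel:
  assumes "k \<noteq> 0" "fps_X * scal (\<i> * of_int k) * r = fps_X * scal (\<i> * of_int k) * s"
  shows "r = (s :: coeffs)"
proof -
  have "fps_X * scal (\<i> * of_int k) \<noteq> 0"
  proof
    assume z: "fps_X * scal (\<i> * of_int k) = 0"
    have "(fps_X * scal (\<i> * of_int k)) $ 1 $ 0 = \<i> * of_int k" by (simp add: scal_def)
    then show False using assms(1) unfolding z by simp
  qed
  then show ?thesis using assms(2) by simp
qed

lemma hat_fser_eqI: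
  assumes "\<And>xs. hat F xs = hat F' xs" "\<And>P h e. infinite (msupp P) \<Longrightarrow> F P h e = F' P h e"
  shows "F = F'"
proof (intro ext)
  fix P h e
  show "F P h e = F' P h e"
  proof (cases "finite (msupp P)")
    case True
    then obtain xs where x: "P = mon xs" using ex_mon by blast
    have "hat F xs $ h $ e = hat F' xs $ h $ e" unfolding assms(1) ..
    then show ?thesis unfolding hat_nth x[symmetric] using mfact_pos[of P] by simp
  qed (rule assms(2))
qed

locale string_solutions = recursion_solutions +
  fixes R c :: qdp
  assumes N_pos: "1 \<le> N" and R_qdp: "is_qdp N R" and c_const: "is_const c"
    and H_u1: "var_deriv 1 H = (\<lambda>e h m. half_eta_uu N \<eta> e h m + dx R e h m + c e h m)"
    and G1_deg: "\<And>\<alpha>. \<alpha> \<in> {1..N} \<Longrightarrow> qdp_deg_le N 0 (G \<alpha> 1)"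
begin

lemma one: "1 \<in> {1..N}" using N_pos by simp

definition hq :: lfun where "hq = hat (fourier (half_eta_uu N \<eta>))"

lemma slice_half: "slice N (half_eta_uu N \<eta> e h)" and slice_R: "slice N (R e h)" and slice_c: "slice N (c e h)"
  using is_qdp_half_eta R_qdp is_qdp_const[OF c_const] is_qdp_slice by blast+

lemma Fx_H_u1: "Fx (H e h) ((1, - freq xs) # xs) = Fx (half_eta_uu N \<eta> e h) xs + \<i> * of_int (freq xs) * Fx (R e h) xs + Fx (c e h) xs"
proof -
  have "Fx (H e h) ((1, - freq xs) # xs) = Fx (var_deriv 1 H e h) xs"
    using slice_var_deriv_Fx[OF H_qdp, of 1 e h xs] by simp
  also have "var_deriv 1 H e h = (\<lambda>m. (half_eta_uu N \<eta> e h m + dxs (R e h) m) + c e h m)"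
    unfolding H_u1 dx_dxs ..
  also have "Fx \<dots> xs = Fx (half_eta_uu N \<eta> e h) xs + Fx (dxs (R e h)) xs + Fx (c e h) xs"
    unfolding Fx_add[OF slice_add[OF slice_half slice_dxs[OF slice_R]] slice_c] Fx_add[OF slice_half slice_dxs[OF slice_R]] ..
  finally show ?thesis unfolding Fx_dxs[OF slice_R] .
qed

lemma hh_u1: "hh ((1, - freq xs) # xs) = hq xs + scal (\<i> * of_int (freq xs)) * hat (fourier R) xs + hat (fourier c) xs"
proof (rule coeffs_eqI)
  fix h e
  show "hh ((1, - freq xs) # xs) $ h $ e = (hq xs + scal (\<i> * of_int (freq xs)) * hat (fourier R) xs + hat (fourier c) xs) $ h $ e"
    unfolding hh_def hq_def fps_add_nth scal_nth hat_fourier Fx_H_u1 ..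
qed

lemma hq_single: "hq [x] = 0"
proof (rule coeffs_eqI)
  fix h e
  have z: "{m. quad N \<eta> m \<noteq> 0 \<and> mtotal m = length [x]} = {}" using quad_mtotal by fastforce
  have "Fx (quad N \<eta>) [x] = 0" unfolding Fx_def z by simp
  then show "hq [x] $ h $ e = 0 $ h $ e" unfolding hq_def hat_fourier half_eta_quad by simp
qed

lemma hq_Nil: "hq [] = 0"
proof (rule coeffs_eqI)
  fix h e
  have z: "{m. quad N \<eta> m \<noteq> 0 \<and> mtotal m = length ([] :: mode list)} = {}" using quad_mtotal by fastforce
  have "Fx (quad N \<eta>) [] = 0" unfolding Fx_def z by simp
  then show "hq [] $ h $ e = 0 $ h $ e" unfolding hq_def hat_fourier half_eta_quad by simp
qed

lemma hq_Cons: "\<nu> \<in> {1..N} \<Longrightarrow> (\<lambda>ys. md 0 hq ((\<nu>, l) # ys)) = lin (\<eta> \<nu>) (- l)"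
proof -
  assume n: "\<nu> \<in> {1..N}"
  have "md (- l) (\<lambda>ys. hq ((\<nu>, l) # ys)) = lin (\<eta> \<nu>) (- l)"
  proof (rule md_eq_lin)
    fix xs h e
    have "Fx (quad N \<eta>) ((\<nu>, l) # xs) = (case xs of [(\<mu>, \<kappa>)] \<Rightarrow> if \<mu> \<in> {1..N} then \<eta> \<nu> \<mu> else 0 | _ \<Rightarrow> 0)"
      unfolding Fx_Cons[OF slice_quad jb_quad] atMost_0 by (simp only: sum.insert finite.emptyI empty_iff if_False sum.empty not_False_eq_True power_0 mult_1_left add_0_right du_quad[OF eta_sym n] Fx_linear)
    then show "hq ((\<nu>, l) # xs) $ h $ e = (if e = 0 \<and> h = 0 then (case xs of [(\<mu>, \<kappa>)] \<Rightarrow> if \<mu> \<in> {1..N} then \<eta> \<nu> \<mu> else 0 | _ \<Rightarrow> 0) else 0)"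
      unfolding hq_def hat_fourier half_eta_quad by (simp only: Fx_zero split: if_split) simp
  qed
  then show ?thesis unfolding md_Cons snd_conv by simp
qed

lemma br_hq:
  assumes a: "\<alpha> \<in> {1..N}"
  shows "br (md k (gh \<alpha> n)) (md 0 hq) xs = fps_X * scal (\<i> * of_int k) * md k (gh \<alpha> n) xs"
proof (rule br_quad[where \<eta> = \<eta>])
  show "homog k (md k (gh \<alpha> n))" "perm_inv (md k (gh \<alpha> n))" "homog 0 (md 0 hq)" by (rule homog_md perm_gh)+
  show "md k (gh \<alpha> n) ((\<nu>, l) # xs) = 0" if "\<nu> \<notin> {1..N}" for \<nu> l xs
    unfolding md_def gh_def hat_outside[OF G_qdp[OF a] that] by simp
  show "md 0 hq [] = 0" by (simp add: md_def hq_Nil)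
  show "(\<lambda>ys. md 0 hq ((\<nu>, l) # ys)) = lin (\<eta> \<nu>) (- l)" if "\<nu> \<in> {1..N}" for \<nu> l by (rule hq_Cons[OF that])
  show "md 0 hq ((\<nu>, l) # ys) = 0" if "\<nu> \<notin> {1..N}" for \<nu> l ys
    unfolding md_def hq_def hat_outside[OF is_qdp_half_eta that] by simp
qed (rule etai_eta etai_eta'; assumption)+

text \<open>Differentiate the recursion along \<open>u\<^sup>1\<^sub>0\<close>: up to a total derivative \<open>H\<close> contributes
  \<open>\<eta>(u, u) / 2\<close>, which only translates in \<open>x\<close>, so \<open>\<partial>G\<^sub>n\<^sub>+\<^sub>1 / \<partial>u\<^sup>1\<close> obeys the recursion of \<open>G\<^sub>n\<close>.\<close>

lemma string_step:
  assumes a: "\<alpha> \<in> {1..N}" and xs: "freq xs \<noteq> 0"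
    and IH: "\<And>n' ys. n = Suc n' \<Longrightarrow> ys \<noteq> [] \<Longrightarrow> gh \<alpha> n ((1, 0) # ys) = gh \<alpha> n' ys"
  shows "gh \<alpha> (Suc n) ((1, 0) # xs) = gh \<alpha> n xs"
proof -
  define k where "k = freq xs"
  define d where "d p = md k (\<lambda>ys. gh \<alpha> p ((1, 0) # ys))" for p
  define X where "X = fps_X * scal (\<i> * of_int k)"
  have d: "(\<lambda>ys. md k (gh \<alpha> p) ((1, 0) # ys)) = d p" for p unfolding d_def md_Cons by simp
  have k0: "k \<noteq> 0" using xs k_def by simp
  have "(\<lambda>ys. md 0 hh ((1, 0) # ys)) = (\<lambda>ys. md 0 hq ys + md 0 (hat (fourier c)) ys)"
  proof
    fix ys
    show "md 0 hh ((1, 0) # ys) = md 0 hq ys + md 0 (hat (fourier c)) ys"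
      using hh_u1[of ys] by (cases "freq ys = 0") (simp_all add: md_def)
  qed
  then have "br (md k (gh \<alpha> n)) (\<lambda>ys. md 0 hh ((1, 0) # ys)) xs
    = br (md k (gh \<alpha> n)) (md 0 hq) xs + br (md k (gh \<alpha> n)) (md 0 (hat (fourier c))) xs"
    by (simp only: br_add_right[OF homog_md homog_md])
  also have "br (md k (gh \<alpha> n)) (md 0 (hat (fourier c))) xs = 0"
    unfolding br_swap[of "md k (gh \<alpha> n)" "md 0 (hat (fourier c))"]
    by (subst br_const_left) (simp_all add: md_def hat_const[OF c_const is_qdp_const[OF c_const]])
  finally have 1: "br (md k (gh \<alpha> n)) (\<lambda>ys. md 0 hh ((1, 0) # ys)) xs = X * md k (gh \<alpha> n) xs"
    unfolding br_hq[OF a] X_def by simp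
  have "deg (md k (gh \<alpha> (Suc n))) ((1, 0) # xs) = deg (d (Suc n)) xs + md k (gh \<alpha> (Suc n)) ((1, 0) # xs)"
    using fun_cong[OF deg_Cons[of "md k (gh \<alpha> (Suc n))" "(1, 0)"], of xs] unfolding d .
  \<comment> \<open>Differentiating along u^1 turns D - 1 into D. The extra term of
    \<open>deg_Cons\<close> is exactly the one subtracted in the recursion.\<close>
  then have 2: "X * deg (d (Suc n)) xs = br (d n) (md 0 hh) xs + X * md k (gh \<alpha> n) xs"
    using gh_rec[OF a, of k n "(1, 0) # xs"] unfolding br_Cons d 1 X_def by simp
  have 3: "br (d n) (md 0 hh) xs = X * (deg (md k (gh \<alpha> n)) xs - md k (gh \<alpha> n) xs)"
  proof (cases n)
    case 0
    \<comment> \<open>At n = 0 the derivative of a linear form is constant, so its bracket vanishes;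
      the other side vanishes because D - 1 kills the initial value.\<close>
    have "d 0 ys = 0" if "ys \<noteq> []" for ys
      unfolding d[symmetric] gh_0[OF a] using that by (cases ys) simp_all
    then have "br (d 0) (md 0 hh) xs = 0" by (rule br_const_left)
    then show ?thesis using deg_gh_0[OF a] 0 by simp
  next
    case (Suc n')
    have hd: "homog k (d n)" unfolding d_def by (rule homog_md)
    have "br (\<lambda>ys. d n ys - md k (gh \<alpha> n') ys) (md 0 hh) xs = 0"
    proof (rule br_const_left)
      fix ys :: "mode list" assume "ys \<noteq> []"
      then show "d n ys - md k (gh \<alpha> n') ys = 0" using IH[OF Suc] by (simp add: d_def md_def)
    qed
    then have "br (d n) (md 0 hh) xs = br (md k (gh \<alpha> n')) (md 0 hh) xs"
      unfolding br_diff_left[OF hd homog_md] by simp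
    then show ?thesis using gh_rec[OF a, of k n' xs] unfolding X_def Suc by simp
  qed
  have "X * deg (d (Suc n)) xs = X * deg (md k (gh \<alpha> n)) xs"
    unfolding 2 3 by (simp add: algebra_simps)
  then have 4: "deg (d (Suc n)) xs = deg (md k (gh \<alpha> n)) xs"
    unfolding X_def by (rule coeffs_cancel[OF k0])
  have m: "d (Suc n) xs = gh \<alpha> (Suc n) ((1, 0) # xs)" "md k (gh \<alpha> n) xs = gh \<alpha> n xs"
    by (simp_all add: d_def md_def k_def)
  show ?thesis
  proof (rule coeffs_eqI)
    fix h e
    have "xs \<noteq> []" using xs by auto
    \<comment> \<open>D has positive eigenvalues on nonconstant terms, so equality after applying D
      is equality.\<close>
    then have nz: "of_nat (e + 2 * h + length xs) \<noteq> (0 :: complex)"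
      unfolding of_nat_eq_0_iff by simp
    have "deg (d (Suc n)) xs $ h $ e = deg (md k (gh \<alpha> n)) xs $ h $ e" unfolding 4 ..
    then show "gh \<alpha> (Suc n) ((1, 0) # xs) $ h $ e = gh \<alpha> n xs $ h $ e"
      unfolding deg_nth m using nz by (simp only: mult_cancel_left) simp
  qed
qed

text \<open>Extends \<open>string_step\<close> from nonzero frequencies to all nonconstant
  monomials. The induction needs this stronger form, since the previous step enters a bracket with
  arbitrary further derivatives.\<close>

lemma string_coeff_step:
  assumes a: "\<alpha> \<in> {1..N}"
    and IH: "\<And>n' ys. n = Suc n' \<Longrightarrow> ys \<noteq> [] \<Longrightarrow> gh \<alpha> n ((1, 0) # ys) = gh \<alpha> n' ys"
  shows "(\<forall>e h m. m \<noteq> (\<lambda>_. 0) \<longrightarrow> du 1 0 (G \<alpha> (Suc n) e h) m = G \<alpha> n e h m) \<and>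
    (\<forall>ys. ys \<noteq> [] \<longrightarrow> gh \<alpha> (Suc n) ((1, 0) # ys) = gh \<alpha> n ys)"
proof -
  define g where "g e h = (\<lambda>m. du 1 0 (G \<alpha> (Suc n) e h) m + (- 1) * G \<alpha> n e h m)" for e h
  have sg: "slice N (g e h)" for e h
    unfolding g_def by (intro slice_add slice_scale slice_du slice_G a)
  have Fg: "Fx (g e h) xs = gh \<alpha> (Suc n) ((1, 0) # xs) $ h $ e - gh \<alpha> n xs $ h $ e" for e h xs
    unfolding g_def Fx_add[OF slice_du[OF slice_G[OF a]] slice_scale[OF slice_G[OF a]]] Fx_scale[OF slice_G[OF a]]
      gh_def hat_fourier Fx_Cons_0[OF slice_G[OF a]] by simp
  have gz: "g e h m = 0" if m: "m \<noteq> (\<lambda>_. 0)" for e h m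
  proof (rule Fx_inject_nonzero_freq[OF sg _ m])
    fix xs :: "mode list" assume x: "freq xs \<noteq> 0"
    have "gh \<alpha> (Suc n) ((1, 0) # xs) = gh \<alpha> n xs" by (rule string_step[OF a x IH])
    then show "Fx (g e h) xs = 0" unfolding Fg by simp
  qed
  have "gh \<alpha> (Suc n) ((1, 0) # ys) = gh \<alpha> n ys" if ys: "ys \<noteq> []" for ys
  proof (rule coeffs_eqI)
    fix h e
    have "Fx (g e h) ys = 0" by (rule Fx_vanish[OF gz ys])
    then show "gh \<alpha> (Suc n) ((1, 0) # ys) $ h $ e = gh \<alpha> n ys $ h $ e" unfolding Fg by simp
  qed
  moreover have "du 1 0 (G \<alpha> (Suc n) e h) m = G \<alpha> n e h m" if "m \<noteq> (\<lambda>_. 0)" for e h m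
    using gz[OF that, of e h] unfolding g_def by simp
  ultimately show ?thesis by blast
qed

lemma string_coeff_aux:
  assumes a: "\<alpha> \<in> {1..N}"
  shows "(\<forall>e h m. m \<noteq> (\<lambda>_. 0) \<longrightarrow> du 1 0 (G \<alpha> (Suc n) e h) m = G \<alpha> n e h m) \<and>
    (\<forall>ys. ys \<noteq> [] \<longrightarrow> gh \<alpha> (Suc n) ((1, 0) # ys) = gh \<alpha> n ys)"
proof (induction n)
  case 0
  show ?case by (rule string_coeff_step[OF a]) simp
next
  case (Suc n)
  have "gh \<alpha> (Suc n) ((1, 0) # ys) = gh \<alpha> n' ys" if "Suc n = Suc n'" "ys \<noteq> []" for n' ys
    using Suc that by simp
  then show ?case by (rule string_coeff_step[OF a])
qed

lemma string_coeff:
  "\<alpha> \<in> {1..N} \<Longrightarrow> m \<noteq> (\<lambda>_. 0) \<Longrightarrow> du 1 0 (G \<alpha> (Suc n) e h) m = G \<alpha> n e h m"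
  using string_coeff_aux by blast

end

section \<open>Normalization\<close>

context string_solutions
begin

text \<open>The bracket of \<open>H\<close> with the linear initial value is a mode derivative of
  \<open>H\<close>. Cancelling i hbar k leaves (D - 1) G_1 = variational derivative of
  \<open>H\<close>, away from frequency 0.\<close>

lemma gh_1:
  assumes a: "\<alpha> \<in> {1..N}" and xs: "freq xs \<noteq> 0"
  shows "deg (gh \<alpha> 1) xs - gh \<alpha> 1 xs = hh ((\<alpha>, - freq xs) # xs)"
proof -
  define k where "k = freq xs"
  have "br (md k (gh \<alpha> 0)) (md 0 hh) xs = - br (md 0 hh) (lin (\<eta> \<alpha>) k) xs"
    unfolding gh_0[OF a] by (rule br_swap)
  also have "br (md 0 hh) (lin (\<eta> \<alpha>) k) xs = - (fps_X * scal (\<i> * of_int k) * md 0 hh ((\<alpha>, - k) # xs))"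
    by (rule br_lin[OF homog_md perm_hh a etai_eta[OF _ a] etai_eta'[OF _ a]])
  finally have "fps_X * scal (\<i> * of_int k) * (deg (md k (gh \<alpha> 1)) xs - md k (gh \<alpha> 1) xs)
    = fps_X * scal (\<i> * of_int k) * md 0 hh ((\<alpha>, - k) # xs)"
    using gh_rec[OF a, of k 0 xs] by simp
  then have "deg (md k (gh \<alpha> 1)) xs - md k (gh \<alpha> 1) xs = md 0 hh ((\<alpha>, - k) # xs)"
    by (rule coeffs_cancel[rotated]) (use xs in \<open>simp add: k_def\<close>)
  moreover have "deg (md k (gh \<alpha> 1)) xs = deg (gh \<alpha> 1) xs" "md k (gh \<alpha> 1) xs = gh \<alpha> 1 xs"
    "md 0 hh ((\<alpha>, - k) # xs) = hh ((\<alpha>, - freq xs) # xs)"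
    by (simp_all add: deg_def md_def k_def)
  ultimately show ?thesis by simp
qed

text \<open>The recursion determines \<open>gh \<alpha> 1 [(1, t)]\<close> only for \<open>t \<noteq> 0\<close>; the value at 0 follows since both
  sides are polynomials in \<open>t\<close>.\<close>

lemma string_const_0:
  assumes a: "\<alpha> \<in> {1..N}" and eh: "e \<noteq> 0 \<or> h \<noteq> 0"
  shows "du 1 0 (G \<alpha> 1 e h) (\<lambda>_. 0) = 0"
proof -
  define f where "f t = of_nat (e + 2 * h) * Fx (G \<alpha> 1 e h) [(1, t)] + \<i> * of_int t * Fx (R e h) [(\<alpha>, - t)]" for t
  have l: "linf (\<lambda>t. t)" "linf (\<lambda>t. - t)" using linfI[of 0 1] linfI[of 0 "- 1"] by simp_all
  have "f 0 = 0"
  proof (rule polyf_eq_0_cofinite[where S = "{0}"])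
    show "polyf f"
      unfolding f_def by (intro polyf_add polyf_mult polyf_const polyf_of_int polyf_Fx_hd[OF slice_G[OF a] l(1)] polyf_Fx_hd[OF slice_R l(2)])
    show "f t = 0" if "t \<notin> {0}" for t
    proof -
      \<comment> \<open>Second derivatives of \<open>H\<close> commute, so the mode along \<alpha>
        is governed by the hypothesis on the variational derivative along u^1. The quadratic term
        has no linear part, and only \<open>R\<close> remains.\<close>
      have "hh [(\<alpha>, - t), (1, t)] = hh [(1, t), (\<alpha>, - t)]"
        unfolding hh_def by (rule perm_invD[OF perm_inv_hat]) simp
      also have "\<dots> = scal (- \<i> * of_int t) * hat (fourier R) [(\<alpha>, - t)]"
        using hh_u1[of "[(\<alpha>, - t)]"] hq_single hat_const[OF c_const is_qdp_const[OF c_const]] by simp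
      finally have "deg (gh \<alpha> 1) [(1, t)] - gh \<alpha> 1 [(1, t)] = scal (- \<i> * of_int t) * hat (fourier R) [(\<alpha>, - t)]"
        using gh_1[OF a, of "[(1, t)]"] that by simp
      then have "(deg (gh \<alpha> 1) [(1, t)] - gh \<alpha> 1 [(1, t)]) $ h $ e = (scal (- \<i> * of_int t) * hat (fourier R) [(\<alpha>, - t)]) $ h $ e" by simp
      then show ?thesis
        unfolding fps_sub_nth deg_nth scal_nth gh_def hat_fourier f_def by (simp add: algebra_simps)
    qed
  qed simp
  moreover have "f 0 = of_nat (e + 2 * h) * du 1 0 (G \<alpha> 1 e h) (\<lambda>_. 0)"
    unfolding f_def Fx_Cons_0[OF slice_G[OF a]] Fx_Nil[OF slice_du[OF slice_G[OF a]]] by simp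
  ultimately show ?thesis using eh by (auto simp flip: of_nat_add of_nat_mult simp del: of_nat_add of_nat_mult)
qed

text \<open>Combines \<open>gh_1\<close> at \<alpha> = 1 with the formula for the variational
  derivative of \<open>H\<close> along u^1; the constant \<open>c\<close> is invisible on nonempty
  lists.\<close>

lemma G11:
  assumes m: "m \<noteq> (\<lambda>_. 0)"
  shows "(of_nat (e + 2 * h + mtotal m) - 1) * G 1 1 e h m = half_eta_uu N \<eta> e h m + dxs (R e h) m"
proof -
  define g where "g = (\<lambda>m. (\<lambda>n. of_nat (e + 2 * h + n) - 1) (mtotal m) * G 1 1 e h m)"
  define r where "r = (\<lambda>m. half_eta_uu N \<eta> e h m + dxs (R e h) m)"
  have sg: "slice N g" unfolding g_def by (rule slice_mono[OF slice_G[OF one, of 1 e h]]) simp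
  have sr: "slice N r" unfolding r_def by (intro slice_add slice_half slice_dxs slice_R)
  have Fg: "Fx g xs = (deg (gh 1 1) xs - gh 1 1 xs) $ h $ e" for xs
  proof -
    have "Fx g xs = (of_nat (e + 2 * h + length xs) - 1) * Fx (G 1 1 e h) xs"
      using Fx_weight[OF slice_G[OF one, of 1 e h], of "\<lambda>n. of_nat (e + 2 * h + n) - 1" xs] by (simp only: g_def)
    then show ?thesis unfolding fps_sub_nth deg_nth gh_def hat_fourier by (simp only: left_diff_distrib mult_1_left)
  qed
  have "(\<lambda>m. g m + (- 1) * r m) m = 0"
  proof (rule Fx_inject_nonzero_freq[OF slice_add[OF sg slice_scale[OF sr]] _ m])
    fix xs :: "mode list" assume xs: "xs \<noteq> []" "freq xs \<noteq> 0"
    have "Fx g xs = Fx (H e h) ((1, - freq xs) # xs)"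
      unfolding Fg gh_1[OF one xs(2)] hh_def hat_fourier ..
    also have "\<dots> = Fx r xs + Fx (c e h) xs"
      unfolding Fx_H_u1 r_def Fx_add[OF slice_half slice_dxs[OF slice_R]] Fx_dxs[OF slice_R] ..
    also have "Fx (c e h) xs = 0"
      using hat_const[OF c_const is_qdp_const[OF c_const] xs(1)] hat_fourier[of c xs h e] by (simp del: hat_nth)
    finally show "Fx (\<lambda>m. g m + (- 1) * r m) xs = 0"
      unfolding Fx_add[OF sg slice_scale[OF sr]] Fx_scale[OF sr] by simp
  qed
  then have "g m = r m" by simp
  then show ?thesis unfolding g_def r_def .
qed

text \<open>The combination of \<open>G \<alpha> (n + 1)\<close> with \<open>lcoef\<close> times \<open>G \<mu> n\<close> removes the linear terms of \<open>G \<alpha> 1\<close>;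
  \<open>sconst\<close> is the failure of the string equation in the constant term, its only failure.\<close>

definition lcoef :: "nat \<Rightarrow> nat \<Rightarrow> complex" where
  "lcoef \<alpha> \<mu> = - (\<Sum>\<nu>\<in>{1..N}. G \<alpha> 1 0 0 (dvar \<nu>) * etai \<nu> \<mu>)"

definition sconst :: "nat \<Rightarrow> nat \<Rightarrow> nat \<Rightarrow> nat \<Rightarrow> complex" where
  "sconst \<alpha> n e h = du 1 0 (G \<alpha> (Suc n) e h) (\<lambda>_. 0) - G \<alpha> n e h (\<lambda>_. 0)"

definition normA :: "nat \<Rightarrow> nat \<Rightarrow> nat \<Rightarrow> complex" where
  "normA \<alpha> \<mu> i = (if i = 0 then if \<alpha> = \<mu> then 1 else 0 else if i = 1 then lcoef \<alpha> \<mu> else 0)"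

text \<open>Derivatives annihilate B, so a constant error in the string equation at step n can be
  corrected by adding it to the n-th solution. At n = 0, where B has to vanish, the choice of
  \<open>lcoef\<close> does this instead.\<close>

definition normB :: "nat \<Rightarrow> nat \<Rightarrow> qdp" where
  "normB \<alpha> n = (\<lambda>e h m. if n = 0 \<or> m \<noteq> (\<lambda>_. 0) then 0
     else sconst \<alpha> n e h + (\<Sum>\<mu>\<in>{1..N}. lcoef \<alpha> \<mu> * sconst \<mu> (n - 1) e h))"

definition normG :: "nat \<Rightarrow> nat \<Rightarrow> qdp" where
  "normG \<alpha> n = (\<lambda>e h m. (\<Sum>\<mu>\<in>{1..N}. \<Sum>i\<le>n. normA \<alpha> \<mu> i * G \<mu> (n - i) e h m) + normB \<alpha> n e h m)"

text \<open>The solution multiplied by z.\<close>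

definition prevG :: "nat \<Rightarrow> nat \<Rightarrow> qdp" where
  "prevG \<mu> n = (case n of 0 \<Rightarrow> (\<lambda>e h m. 0) | Suc n' \<Rightarrow> G \<mu> n')"

text \<open>\<open>lcoef\<close> solves this linear system through the inverse matrix; adding it
  times the initial values cancels the linear terms of \<open>G \<alpha> 1\<close>.\<close>

lemma lcoef_eta:
  assumes n: "\<nu> \<in> {1..N}"
  shows "(\<Sum>\<mu>\<in>{1..N}. lcoef \<alpha> \<mu> * \<eta> \<mu> \<nu>) = - G \<alpha> 1 0 0 (dvar \<nu>)"
proof -
  have "(\<Sum>\<mu>\<in>{1..N}. lcoef \<alpha> \<mu> * \<eta> \<mu> \<nu>) = - (\<Sum>\<mu>\<in>{1..N}. \<Sum>\<kappa>\<in>{1..N}. G \<alpha> 1 0 0 (dvar \<kappa>) * (etai \<kappa> \<mu> * \<eta> \<nu> \<mu>))"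
    unfolding lcoef_def sum_negf[symmetric]
    by (intro sum.cong refl) (simp only: eta_sym[OF _ n] mult_minus_left sum_distrib_right mult.assoc)
  also have "\<dots> = - (\<Sum>\<kappa>\<in>{1..N}. G \<alpha> 1 0 0 (dvar \<kappa>) * (\<Sum>\<mu>\<in>{1..N}. etai \<kappa> \<mu> * \<eta> \<nu> \<mu>))"
    unfolding sum_distrib_left by (subst sum.swap) (rule refl)
  also have "(\<Sum>\<kappa>\<in>{1..N}. G \<alpha> 1 0 0 (dvar \<kappa>) * (\<Sum>\<mu>\<in>{1..N}. etai \<kappa> \<mu> * \<eta> \<nu> \<mu>))
    = (\<Sum>\<kappa>\<in>{1..N}. if \<kappa> = \<nu> then G \<alpha> 1 0 0 (dvar \<nu>) else 0)"
  proof (rule sum.cong[OF refl])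
    fix \<kappa> assume k: "\<kappa> \<in> {1..N}"
    show "G \<alpha> 1 0 0 (dvar \<kappa>) * (\<Sum>\<mu>\<in>{1..N}. etai \<kappa> \<mu> * \<eta> \<nu> \<mu>) = (if \<kappa> = \<nu> then G \<alpha> 1 0 0 (dvar \<nu>) else 0)"
      unfolding etai_eta[OF k n] by simp
  qed
  finally show ?thesis using n by simp
qed

lemma is_const_normB: "is_const (normB \<alpha> n)"
  by (simp add: is_const_def normB_def)

lemma normG_eq:
  assumes a: "\<alpha> \<in> {1..N}"
  shows "normG \<alpha> n e h m = G \<alpha> n e h m + (\<Sum>\<mu>\<in>{1..N}. lcoef \<alpha> \<mu> * prevG \<mu> n e h m) + normB \<alpha> n e h m"
proof -
  have "(\<Sum>i\<le>n. normA \<alpha> \<mu> i * G \<mu> (n - i) e h m) = (if \<mu> = \<alpha> then G \<alpha> n e h m else 0) + lcoef \<alpha> \<mu> * prevG \<mu> n e h m" for \<mu>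
  proof (cases n)
    case 0
    then show ?thesis by (simp add: normA_def prevG_def)
  next
    case (Suc n')
    have "(\<Sum>i\<le>n'. normA \<alpha> \<mu> (Suc i) * G \<mu> (n' - i) e h m) = (\<Sum>i\<le>n'. if i = 0 then lcoef \<alpha> \<mu> * G \<mu> n' e h m else 0)"
      by (rule sum.cong) (simp_all add: normA_def)
    also have "\<dots> = lcoef \<alpha> \<mu> * G \<mu> n' e h m" by simp
    finally show ?thesis unfolding Suc sum.atMost_Suc_shift by (simp add: normA_def prevG_def)
  qed
  then show ?thesis unfolding normG_def using a by (simp add: sum.distrib)
qed

lemma slice_prevG: "\<mu> \<in> {1..N} \<Longrightarrow> slice N (prevG \<mu> n e h)"
  by (cases n) (simp_all add: prevG_def slice_G del: atLeastAtMost_iff)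

lemma slice_normB: "slice N (normB \<alpha> n e h)"
  using is_qdp_const[OF is_const_normB] is_qdp_slice by blast

lemma slice_lprevG: "slice N (\<lambda>m. \<Sum>\<mu>\<in>{1..N}. lcoef \<alpha> \<mu> * prevG \<mu> n e h m)"
  by (intro slice_sum slice_scale slice_prevG)

lemma normG_slice_eq:
  "\<alpha> \<in> {1..N} \<Longrightarrow> normG \<alpha> n e h = (\<lambda>m. (G \<alpha> n e h m + (\<Sum>\<mu>\<in>{1..N}. lcoef \<alpha> \<mu> * prevG \<mu> n e h m)) + normB \<alpha> n e h m)"
  using normG_eq by blast

lemma is_qdp_normG: "\<alpha> \<in> {1..N} \<Longrightarrow> is_qdp N (normG \<alpha> n)"
  unfolding is_qdp_slice by (simp only: normG_slice_eq) (intro allI slice_add slice_G slice_lprevG slice_normB)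

lemma hat_normG:
  assumes a: "\<alpha> \<in> {1..N}"
  shows "hat (fourier (normG \<alpha> n)) xs = (gh \<alpha> n xs + (\<Sum>\<mu>\<in>{1..N}. scal (lcoef \<alpha> \<mu>) * hat (fourier (prevG \<mu> n)) xs)) + hat (fourier (normB \<alpha> n)) xs"
proof (rule coeffs_eqI)
  fix h e
  have "Fx (\<lambda>m. \<Sum>\<mu>\<in>{1..N}. lcoef \<alpha> \<mu> * prevG \<mu> n e h m) xs = (\<Sum>\<mu>\<in>{1..N}. Fx (\<lambda>m. lcoef \<alpha> \<mu> * prevG \<mu> n e h m) xs)"
    by (rule Fx_sum[OF slice_scale[OF slice_prevG]])
  also have "\<dots> = (\<Sum>\<mu>\<in>{1..N}. lcoef \<alpha> \<mu> * Fx (prevG \<mu> n e h) xs)"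
    by (intro sum.cong refl Fx_scale[OF slice_prevG])
  finally show "hat (fourier (normG \<alpha> n)) xs $ h $ e = ((gh \<alpha> n xs + (\<Sum>\<mu>\<in>{1..N}. scal (lcoef \<alpha> \<mu>) * hat (fourier (prevG \<mu> n)) xs)) + hat (fourier (normB \<alpha> n)) xs) $ h $ e"
    unfolding fps_add_nth fps_sum_nth scal_nth gh_def hat_fourier normG_slice_eq[OF a]
      Fx_add[OF slice_add[OF slice_G[OF a] slice_lprevG] slice_normB] Fx_add[OF slice_G[OF a] slice_lprevG] by simp
qed

lemma md_add: "md k (\<lambda>xs. F xs + F' xs) = (\<lambda>xs. md k F xs + md k F' xs)"
  and md_sum_scale: "md k (\<lambda>xs. \<Sum>i\<in>I. w i * K i xs) = (\<lambda>xs. \<Sum>i\<in>I. w i * md k (K i) xs)"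
  by (auto simp: md_def)

lemma br_normG:
  assumes a: "\<alpha> \<in> {1..N}"
  shows "br (md k (hat (fourier (normG \<alpha> n)))) (md 0 hh) xs = br (md k (gh \<alpha> n)) (md 0 hh) xs
    + (\<Sum>\<mu>\<in>{1..N}. scal (lcoef \<alpha> \<mu>) * br (md k (hat (fourier (prevG \<mu> n)))) (md 0 hh) xs)"
proof -
  let ?s = "\<lambda>xs. \<Sum>\<mu>\<in>{1..N}. scal (lcoef \<alpha> \<mu>) * md k (hat (fourier (prevG \<mu> n))) xs"
  have hs: "homog k ?s" by (intro homog_sum homog_scale homog_md)
  have "br (md k (hat (fourier (normB \<alpha> n)))) (md 0 hh) xs = 0"
    by (rule br_const_left) (simp add: md_def hat_const[OF is_const_normB is_qdp_const[OF is_const_normB]])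
  moreover have "br ?s (md 0 hh) xs = (\<Sum>\<mu>\<in>{1..N}. scal (lcoef \<alpha> \<mu>) * br (md k (hat (fourier (prevG \<mu> n)))) (md 0 hh) xs)"
    by (simp only: br_sum_left[OF homog_scale[OF homog_md]] br_scale_left[OF homog_md])
  moreover have "hat (fourier (normG \<alpha> n)) = (\<lambda>xs. (gh \<alpha> n xs + (\<Sum>\<mu>\<in>{1..N}. scal (lcoef \<alpha> \<mu>) * hat (fourier (prevG \<mu> n)) xs)) + hat (fourier (normB \<alpha> n)) xs)"
    using hat_normG[OF a] by blast
  ultimately show ?thesis
    by (simp only: md_add md_sum_scale br_add_left[OF homog_add[OF homog_md hs] homog_md] br_add_left[OF homog_md hs] add_0_right)
qed

lemma gh_rec_freq:
  assumes a: "\<alpha> \<in> {1..N}"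
  shows "fps_X * scal (\<i> * of_int (freq xs)) * (deg (gh \<alpha> (Suc n)) xs - gh \<alpha> (Suc n) xs) = br (md (freq xs) (gh \<alpha> n)) (md 0 hh) xs"
  using gh_rec[OF a, of "freq xs" n xs] by (simp add: deg_def md_def)

text \<open>Multiplying a solution by z gives a solution because D - 1 annihilates the initial
  value; this is what makes z-dependent linear combinations admissible.\<close>

lemma prevG_rec:
  assumes a: "\<mu> \<in> {1..N}"
  shows "fps_X * scal (\<i> * of_int (freq xs)) * (deg (hat (fourier (prevG \<mu> (Suc n)))) xs - hat (fourier (prevG \<mu> (Suc n))) xs)
    = br (md (freq xs) (hat (fourier (prevG \<mu> n)))) (md 0 hh) xs"
proof (cases n)
  case 0
  have "deg (gh \<mu> 0) xs - gh \<mu> 0 xs = 0"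
    using deg_gh_0[OF a, of "freq xs" xs] by (simp add: deg_def md_def)
  moreover have "hat (fourier (\<lambda>e h m. 0)) ys = 0" for ys
    by (rule coeffs_eqI) (simp only: hat_fourier Fx_zero fps_zero_nth)
  then have "br (md (freq xs) (hat (fourier (\<lambda>e h m. 0)))) (md 0 hh) xs = 0"
    by (intro br_const_left) (simp add: md_def)
  ultimately show ?thesis unfolding 0 prevG_def nat.case gh_def[symmetric] by simp
next
  case (Suc n')
  then show ?thesis unfolding Suc prevG_def nat.case gh_def[symmetric] by (simp only: gh_rec_freq[OF a])
qed

lemma normG_rec_hat:
  assumes a: "\<alpha> \<in> {1..N}"
  shows "fps_X * (scal (\<i> * of_int (freq xs)) * (deg (hat (fourier (normG \<alpha> (Suc n)))) xs - hat (fourier (normG \<alpha> (Suc n))) xs))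
    = br (md (freq xs) (hat (fourier (normG \<alpha> n)))) (md 0 hh) xs"
proof -
  let ?U = "fps_X * scal (\<i> * of_int (freq xs)) :: coeffs"
  let ?b = "hat (fourier (normB \<alpha> (Suc n)))"
  let ?p = "\<lambda>\<mu>. hat (fourier (prevG \<mu> (Suc n)))"
  have f: "hat (fourier (normG \<alpha> (Suc n))) = (\<lambda>xs. (gh \<alpha> (Suc n) xs + (\<Sum>\<mu>\<in>{1..N}. scal (lcoef \<alpha> \<mu>) * ?p \<mu> xs)) + ?b xs)"
    using hat_normG[OF a] by blast
  \<comment> \<open>A constant lives on the empty list only, where the frequency factor is
    0.\<close>
  have b: "?U * (deg ?b xs - ?b xs) = 0"
  proof (cases "xs = []")
    case False
    then have "?b xs = 0" using hat_const[OF is_const_normB is_qdp_const[OF is_const_normB]] by blast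
    then show ?thesis by (simp add: deg_def)
  qed simp
  have "?U * (deg (hat (fourier (normG \<alpha> (Suc n)))) xs - hat (fourier (normG \<alpha> (Suc n))) xs)
    = ?U * (deg (gh \<alpha> (Suc n)) xs - gh \<alpha> (Suc n) xs) + (\<Sum>\<mu>\<in>{1..N}. scal (lcoef \<alpha> \<mu>) * (?U * (deg (?p \<mu>) xs - ?p \<mu> xs))) + ?U * (deg ?b xs - ?b xs)"
    unfolding f deg_add deg_sum deg_scale
    by (simp add: algebra_simps sum_distrib_left sum_subtractf sum.distrib)
  also have "\<dots> = br (md (freq xs) (hat (fourier (normG \<alpha> n)))) (md 0 hh) xs"
    unfolding b br_normG[OF a] gh_rec_freq[OF a] by (simp add: prevG_rec)
  finally show ?thesis by (simp only: mult.assoc)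
qed

lemma normG_rec:
  assumes a: "\<alpha> \<in> {1..N}"
  shows "fourier (hbar_mul (dx (Dm1 (normG \<alpha> (Suc n))))) = qcomm etai (fourier (normG \<alpha> n)) (zero_mode (fourier H))"
proof (rule hat_fser_eqI)
  have q: "is_qdp N (Dm1 (normG \<alpha> (Suc n)))" by (rule is_qdp_Dm1[OF is_qdp_normG[OF a]])
  have s: "fsupp N (fourier (normG \<alpha> n))" "fsupp N (fourier H)"
    by (rule fsupp_fourier[OF is_qdp_normG[OF a]], rule fsupp_fourier[OF H_qdp])
  show "hat (fourier (hbar_mul (dx (Dm1 (normG \<alpha> (Suc n)))))) xs = hat (qcomm etai (fourier (normG \<alpha> n)) (zero_mode (fourier H))) xs" for xs
    unfolding hat_hbar_mul hat_dx[OF q] hat_Dm1[OF is_qdp_normG[OF a]] hat_qcomm[OF s] normG_rec_hat[OF a] hh_def ..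
  show "fourier (hbar_mul (dx (Dm1 (normG \<alpha> (Suc n))))) P h e = qcomm etai (fourier (normG \<alpha> n)) (zero_mode (fourier H)) P h e"
    if i: "infinite (msupp P)" for P h e
  proof -
    have "fsupp N (fourier (hbar_mul (dx (Dm1 (normG \<alpha> (Suc n))))))"
      by (rule fsupp_fourier[OF is_qdp_hbar_mul[OF is_qdp_dx[OF q]]])
    then have "fourier (hbar_mul (dx (Dm1 (normG \<alpha> (Suc n))))) P h e = 0" using fsuppD(1) i by blast
    then show ?thesis using qcomm_infinite[OF s i] by simp
  qed
qed

lemma recursion_normG: "recursion_solutions N etai \<eta> H normG"
proof (intro recursion_solutions.intro)
  show "normG \<alpha> 0 = (\<lambda>e h m. \<Sum>\<mu>\<in>{1..N}. \<eta> \<alpha> \<mu> * uvar \<mu> e h m)" if "\<alpha> \<in> {1..N}" for \<alpha>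
    unfolding G_init[OF that, symmetric] by (intro ext) (simp add: normG_eq[OF that] prevG_def normB_def)
qed (rule eta_sym eta_inv H_qdp is_qdp_normG normG_rec; assumption)+

lemma du_G_string:
  assumes a: "\<alpha> \<in> {1..N}"
  shows "du 1 0 (G \<alpha> (Suc n) e h) m = G \<alpha> n e h m + (if m = (\<lambda>_. 0) then sconst \<alpha> n e h else 0)"
  using string_coeff[OF a, of m n e h] by (simp add: sconst_def)

lemma du_G_0:
  assumes a: "\<alpha> \<in> {1..N}"
  shows "du 1 0 (G \<alpha> 0 e h) m = (if e = 0 \<and> h = 0 \<and> m = (\<lambda>_. 0) then \<eta> \<alpha> 1 else 0)"
proof -
  have u: "du 1 0 (uvar \<mu> e h) m = (if e = 0 \<and> h = 0 \<and> m = (\<lambda>_. 0) \<and> 1 = \<mu> then 1 else 0)" for \<mu>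
  proof (cases "e = 0 \<and> h = 0")
    case True
    then have "uvar \<mu> e h = ind (dvar \<mu>)" by (simp add: uvar_ind)
    then show ?thesis using True by (simp only: du_dvar) (auto simp: ind_def)
  next
    case False
    then have "uvar \<mu> e h = (\<lambda>m. 0)" by (auto simp: uvar_ind)
    then show ?thesis using False by (simp only: du_zero) auto
  qed
  have "G \<alpha> 0 e h = (\<lambda>m. \<Sum>\<mu>\<in>{1..N}. \<eta> \<alpha> \<mu> * uvar \<mu> e h m)" unfolding G_init[OF a] ..
  then have "du 1 0 (G \<alpha> 0 e h) m = (\<Sum>\<mu>\<in>{1..N}. \<eta> \<alpha> \<mu> * du 1 0 (uvar \<mu> e h) m)"
    by (simp only: du_sum du_scale)
  also have "\<dots> = (\<Sum>\<mu>\<in>{1..N}. if \<mu> = 1 then (if e = 0 \<and> h = 0 \<and> m = (\<lambda>_. 0) then \<eta> \<alpha> 1 else 0) else 0)"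
    by (intro sum.cong refl) (simp only: u, auto)
  finally show ?thesis using one by simp
qed

lemma sconst_0:
  assumes a: "\<alpha> \<in> {1..N}"
  shows "sconst \<alpha> 0 e h = (if e = 0 \<and> h = 0 then G \<alpha> 1 0 0 (dvar 1) else 0)"
proof -
  have "uvar \<mu> e h (\<lambda>_. 0) = 0" for \<mu> by (auto simp: uvar_def fun_eq_iff)
  then have "G \<alpha> 0 e h (\<lambda>_. 0) = 0" unfolding G_init[OF a] by simp
  moreover have "du 1 0 (G \<alpha> 1 0 0) (\<lambda>_. 0) = G \<alpha> 1 0 0 (dvar 1)" by (simp add: du_def dvar_def)
  ultimately show ?thesis using string_const_0[OF a, of e h] by (auto simp: sconst_def)
qed

text \<open>For n >= 1 the constant errors add up to \<open>normB\<close>. At n = 0 the error is the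
  coefficient of u^1 in the part of \<open>G \<alpha> 1\<close> free of eps and hbar, by
  \<open>string_const_0\<close>, and the derivative of the \<open>lcoef\<close> term cancels
  it.\<close>

lemma normG_string:
  assumes a: "\<alpha> \<in> {1..N}"
  shows "diff_u 1 0 (normG \<alpha> (Suc n)) = normG \<alpha> n"
proof (intro ext)
  fix e h :: nat and m :: jmon
  define z where "z = (if m = (\<lambda>_. 0) then (1::complex) else 0)"
  define q where "q \<mu> = (case n of 0 \<Rightarrow> (if e = 0 \<and> h = 0 then \<eta> \<mu> 1 else 0) | Suc n' \<Rightarrow> sconst \<mu> n' e h)" for \<mu>
  have p: "du 1 0 (prevG \<mu> (Suc n) e h) m = prevG \<mu> n e h m + z * q \<mu>" if "\<mu> \<in> {1..N}" for \<mu>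
  proof (cases n)
    case 0
    show ?thesis unfolding prevG_def q_def z_def 0 nat.case du_G_0[OF that] by simp
  next
    case (Suc n')
    show ?thesis unfolding prevG_def q_def z_def Suc nat.case du_G_string[OF that] by simp
  qed
  have "inc (1, 0) m \<noteq> (\<lambda>_. 0)" by (simp add: inc_def fun_eq_iff) blast
  then have b: "du 1 0 (normB \<alpha> (Suc n) e h) m = 0" by (simp add: du_def normB_def)
  have k: "z * sconst \<alpha> n e h + z * (\<Sum>\<mu>\<in>{1..N}. lcoef \<alpha> \<mu> * q \<mu>) = normB \<alpha> n e h m"
  proof (cases n)
    case 0
    have "(\<Sum>\<mu>\<in>{1..N}. lcoef \<alpha> \<mu> * q \<mu>) = (if e = 0 \<and> h = 0 then - G \<alpha> 1 0 0 (dvar 1) else 0)"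
      unfolding q_def 0 using lcoef_eta[OF one, of \<alpha>] by simp
    then show ?thesis unfolding 0 sconst_0[OF a] by (simp add: normB_def)
  next
    case (Suc n')
    then show ?thesis by (simp add: normB_def z_def q_def)
  qed
  have "diff_u 1 0 (normG \<alpha> (Suc n)) e h m
    = du 1 0 (G \<alpha> (Suc n) e h) m + (\<Sum>\<mu>\<in>{1..N}. lcoef \<alpha> \<mu> * du 1 0 (prevG \<mu> (Suc n) e h) m)"
    unfolding diff_u_du normG_slice_eq[OF a] du_add du_sum du_scale b by simp
  also have "\<dots> = G \<alpha> n e h m + z * sconst \<alpha> n e h + ((\<Sum>\<mu>\<in>{1..N}. lcoef \<alpha> \<mu> * prevG \<mu> n e h m) + z * (\<Sum>\<mu>\<in>{1..N}. lcoef \<alpha> \<mu> * q \<mu>))"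
  proof -
    have "(\<Sum>\<mu>\<in>{1..N}. lcoef \<alpha> \<mu> * du 1 0 (prevG \<mu> (Suc n) e h) m) = (\<Sum>\<mu>\<in>{1..N}. lcoef \<alpha> \<mu> * prevG \<mu> n e h m + z * (lcoef \<alpha> \<mu> * q \<mu>))"
      by (intro sum.cong refl) (simp only: p distrib_left mult.left_commute)
    moreover have "du 1 0 (G \<alpha> (Suc n) e h) m = G \<alpha> n e h m + z * sconst \<alpha> n e h"
      unfolding du_G_string[OF a] z_def by simp
    ultimately show ?thesis by (simp only: sum.distrib sum_distrib_left)
  qed
  also have "\<dots> = normG \<alpha> n e h m"
    unfolding normG_eq[OF a] k[symmetric] by (simp only: add_ac)
  finally show "diff_u 1 0 (normG \<alpha> (Suc n)) e h m = normG \<alpha> n e h m" .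
qed

end

section \<open>The functional of the normalized solution G_{1,0}\<close>

context string_solutions
begin

lemma half_eta_nonzero: "half_eta_uu N \<eta> e h m \<noteq> 0 \<Longrightarrow> e = 0 \<and> h = 0 \<and> mtotal m = 2"
  unfolding half_eta_quad using quad_mtotal[of N \<eta> m] by (cases "e = 0 \<and> h = 0") auto

lemma lprev_1:
  assumes a: "\<alpha> \<in> {1..N}"
  shows "(\<Sum>\<mu>\<in>{1..N}. lcoef \<alpha> \<mu> * prevG \<mu> 1 e h m)
    = (if e = 0 \<and> h = 0 then - (\<Sum>\<nu>\<in>{1..N}. G \<alpha> 1 0 0 (dvar \<nu>) * ind (dvar \<nu>) m) else 0)"
proof -
  have "(\<Sum>\<mu>\<in>{1..N}. lcoef \<alpha> \<mu> * prevG \<mu> 1 e h m) = (\<Sum>\<mu>\<in>{1..N}. \<Sum>\<nu>\<in>{1..N}. lcoef \<alpha> \<mu> * \<eta> \<mu> \<nu> * uvar \<nu> e h m)"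
  proof (rule sum.cong[OF refl])
    fix \<mu> assume m: "\<mu> \<in> {1..N}"
    have "prevG \<mu> 1 = G \<mu> 0" by (simp add: prevG_def)
    then show "lcoef \<alpha> \<mu> * prevG \<mu> 1 e h m = (\<Sum>\<nu>\<in>{1..N}. lcoef \<alpha> \<mu> * \<eta> \<mu> \<nu> * uvar \<nu> e h m)"
      by (simp only: G_init[OF m] sum_distrib_left mult.assoc)
  qed
  also have "\<dots> = (\<Sum>\<nu>\<in>{1..N}. (\<Sum>\<mu>\<in>{1..N}. lcoef \<alpha> \<mu> * \<eta> \<mu> \<nu>) * uvar \<nu> e h m)"
    unfolding sum_distrib_right by (rule sum.swap)
  also have "\<dots> = (\<Sum>\<nu>\<in>{1..N}. - (G \<alpha> 1 0 0 (dvar \<nu>) * uvar \<nu> e h m))"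
    by (intro sum.cong refl) (simp only: lcoef_eta mult_minus_left)
  finally show ?thesis unfolding uvar_ind sum_negf by simp
qed

text \<open>Differential degree at most 0 without eps and hbar forbids jets, so the linear part
  involves u^\<nu>_0 only and lies within reach of \<open>lcoef\<close>.\<close>

lemma linear_part:
  assumes m: "finite (msupp m)" "mtotal m = 1"
  shows "G 1 1 0 0 m = (\<Sum>\<nu>\<in>{1..N}. G 1 1 0 0 (dvar \<nu>) * ind (dvar \<nu>) m)"
proof -
  obtain v where v: "m = inc v (\<lambda>_. 0)" using mtotal_1[OF m] by blast
  obtain \<nu> s where vs: "v = (\<nu>, s)" by force
  show ?thesis
  proof (cases "s = 0")
    case True
    have md: "m = dvar \<nu>" unfolding v vs True dvar_def ..
    have i: "ind (dvar \<mu>) m = (if \<mu> = \<nu> then 1 else 0)" for \<mu>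
    proof -
      have "m = dvar \<mu> \<longleftrightarrow> \<mu> = \<nu>" unfolding md using dvar_apply[of \<nu> \<mu> 0] dvar_apply[of \<mu> \<mu> 0] by (cases "\<mu> = \<nu>") force+
      then show ?thesis by (simp add: ind_def)
    qed
    have "G 1 1 0 0 m = 0" if "\<nu> \<notin> {1..N}"
      using slice_index[OF slice_G[OF one, of 1 0 0], of m \<nu> 0] that unfolding md dvar_apply by auto
    moreover have "(\<Sum>\<mu>\<in>{1..N}. G 1 1 0 0 (dvar \<mu>) * ind (dvar \<mu>) m) = (\<Sum>\<mu>\<in>{1..N}. if \<mu> = \<nu> then G 1 1 0 0 m else 0)"
      unfolding i by (intro sum.cong refl) (simp add: md)
    ultimately show ?thesis by (simp del: One_nat_def)
  next
    case False
    have "G 1 1 0 0 m = 0"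
    proof (rule ccontr)
      assume "G 1 1 0 0 m \<noteq> 0"
      then have "int (mdeg m) - int 0 - 2 * int 0 \<le> 0" using G1_deg[OF one] unfolding qdp_deg_le_def by blast
      then show False using False unfolding v mdeg_single vs by simp
    qed
    moreover have "ind (dvar \<mu>) m = 0" for \<mu>
    proof -
      have "m (\<nu>, s) \<noteq> 0" unfolding v vs inc_def by simp
      then have "m \<noteq> dvar \<mu>" using False by (auto simp: dvar_apply)
      then show ?thesis by (simp add: ind_def)
    qed
    ultimately show ?thesis by simp
  qed
qed

text \<open>The inverse of D - 1 applied to \<open>R\<close>. At weight 1, where D - 1 vanishes, the
  value 0 is chosen; it fits because there the normalized solution has no nonconstant terms
  left.\<close>

definition primR :: qdp where
  "primR = (\<lambda>e h m. if e + 2 * h + mtotal m = 1 then 0 else R e h m / (of_nat (e + 2 * h + mtotal m) - 1))"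

lemma is_qdp_primR: "is_qdp N primR"
  unfolding is_qdp_slice
proof (intro allI)
  fix e h
  show "slice N (primR e h)" by (rule slice_mono[OF slice_R[of e h]]) (auto simp: primR_def split: if_splits)
qed

lemma dxs_primR:
  assumes "finite (msupp m)"
  shows "dxs (primR e h) m = (if e + 2 * h + mtotal m = 1 then 0 else dxs (R e h) m / (of_nat (e + 2 * h + mtotal m) - 1))"
proof -
  define w :: "nat \<Rightarrow> complex" where "w n = (if e + 2 * h + n = 1 then 0 else 1 / (of_nat (e + 2 * h + n) - 1))" for n
  have "primR e h = (\<lambda>m. w (mtotal m) * R e h m)" by (simp add: primR_def w_def fun_eq_iff)
  then have "dxs (primR e h) m = w (mtotal m) * dxs (R e h) m" using dxs_weight[OF assms] by simp
  then show ?thesis by (simp add: w_def)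
qed

lemma normG11:
  assumes m: "m \<noteq> (\<lambda>_. 0)"
  shows "normG 1 1 e h m - half_eta_uu N \<eta> e h m = dx primR e h m"
proof (cases "finite (msupp m)")
  case False
  have "normG 1 1 e h m = 0" "half_eta_uu N \<eta> e h m = 0" "dxs (primR e h) m = 0"
    using False is_qdp_normG[OF one, of 1] slice_half[of e h] is_qdp_primR slice_dxs[of N "primR e h"] slice_finite
    unfolding is_qdp_slice by blast+
  then show ?thesis unfolding dx_dxs by simp
next
  case f: True
  define w where "w = e + 2 * h + mtotal m"
  let ?L = "\<Sum>\<nu>\<in>{1..N}. G 1 1 0 0 (dvar \<nu>) * ind (dvar \<nu>) m"
  have n: "normG 1 1 e h m = G 1 1 e h m - (if e = 0 \<and> h = 0 then ?L else 0)"
    unfolding normG_eq[OF one] lprev_1[OF one] using m by (simp add: normB_def)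
  obtain xs where x: "m = mon xs" using ex_mon[OF f] by blast
  then have "xs \<noteq> []" using m by auto
  then have t: "mtotal m \<noteq> 0" using x by simp
  show ?thesis
  proof (cases "w = 1")
    case True
    \<comment> \<open>A nonconstant monomial has total degree at least 1, so weight 1 leaves exactly
      the linear terms without eps and hbar, which the normalization has removed.\<close>
    then have eh: "e = 0" "h = 0" "mtotal m = 1" using t unfolding w_def by auto
    have "half_eta_uu N \<eta> e h m = 0" using half_eta_nonzero[of e h m] eh(3) by auto
    moreover have "dxs (primR e h) m = 0" using dxs_primR[OF f, of e h] True unfolding w_def by simp
    moreover have "normG 1 1 e h m = 0" unfolding n using linear_part[OF f eh(3)] eh(1,2) by (simp del: One_nat_def)
    ultimately show ?thesis unfolding dx_dxs by simp
  next
    case False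
    then have w: "of_nat w - 1 \<noteq> (0 :: complex)" by (metis eq_iff_diff_eq_0 of_nat_1 of_nat_eq_iff)
    have "(if e = 0 \<and> h = 0 then ?L else 0) = 0"
    proof (cases "e = 0 \<and> h = 0")
      case True
      have "ind (dvar \<nu>) m = 0" for \<nu>
      proof -
        have "mtotal (dvar \<nu>) = 1" unfolding dvar_def by (subst mtotal_inc) (simp_all add: msupp_def mtotal_def)
        then have "m \<noteq> dvar \<nu>" using False True unfolding w_def by auto
        then show ?thesis by (simp add: ind_def)
      qed
      then show ?thesis by simp
    qed (rule if_not_P)
    then have n': "normG 1 1 e h m = G 1 1 e h m" unfolding n by simp
    \<comment> \<open>The quadratic term has weight 2, so D - 1 acts on it as the identity.\<close>
    have q: "half_eta_uu N \<eta> e h m = (of_nat w - 1) * half_eta_uu N \<eta> e h m"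
    proof (cases "half_eta_uu N \<eta> e h m = 0")
      case False
      then show ?thesis using half_eta_nonzero[OF False] unfolding w_def by simp
    qed simp
    have "(of_nat w - 1) * G 1 1 e h m = half_eta_uu N \<eta> e h m + dxs (R e h) m"
      using G11[OF m, of e h] unfolding w_def .
    then have "(of_nat w - 1) * (G 1 1 e h m - half_eta_uu N \<eta> e h m) = dxs (R e h) m"
      using q by (simp add: algebra_simps)
    moreover have "dxs (primR e h) m = dxs (R e h) m / (of_nat w - 1)"
      using dxs_primR[OF f, of e h] False unfolding w_def by simp
    ultimately have "dxs (primR e h) m = (of_nat w - 1) * (G 1 1 e h m - half_eta_uu N \<eta> e h m) / (of_nat w - 1)" by simp
    also have "\<dots> = G 1 1 e h m - half_eta_uu N \<eta> e h m" by (rule nonzero_mult_div_cancel_left[OF w])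
    finally show ?thesis unfolding n' dx_dxs ..
  qed
qed

lemma normG11_lf_eq: "lf_eq N (normG 1 1) (half_eta_uu N \<eta>)"
proof -
  define b :: qdp where "b = (\<lambda>e h m. if m = (\<lambda>_. 0) then normG 1 1 e h m - half_eta_uu N \<eta> e h m - dx primR e h m else 0)"
  have "is_const b" by (simp add: is_const_def b_def)
  moreover have "normG 1 1 e h m - half_eta_uu N \<eta> e h m = dx primR e h m + b e h m" for e h m
    using normG11[of m e h] by (simp add: b_def)
  ultimately show ?thesis unfolding lf_eq_def using is_qdp_primR by blast
qed

end

theorem theorem5p1:
  fixes N :: nat and \<eta> etai :: "nat \<Rightarrow> nat \<Rightarrow> complex"
    and H R c :: qdp and G :: "nat \<Rightarrow> nat \<Rightarrow> qdp"
  assumes N: "1 \<le> N"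
    and eta_sym: "\<forall>\<alpha>\<in>{1..N}. \<forall>\<beta>\<in>{1..N}. \<eta> \<alpha> \<beta> = \<eta> \<beta> \<alpha>"
    and eta_inv: "\<forall>\<alpha>\<in>{1..N}. \<forall>\<beta>\<in>{1..N}.
                    (\<Sum>\<mu>\<in>{1..N}. \<eta> \<alpha> \<mu> * etai \<mu> \<beta>) = (if \<alpha> = \<beta> then 1 else 0)"
    and H: "qdp_deg_le N 0 H"
    and a_deg: "\<forall>\<alpha>\<in>{1..N}. \<forall>n. qdp_deg_le N 0 (G \<alpha> n)"
    and a_init: "\<forall>\<alpha>\<in>{1..N}. G \<alpha> 0 = (\<lambda>e h m. \<Sum>\<mu>\<in>{1..N}. \<eta> \<alpha> \<mu> * uvar \<mu> e h m)"
    and a_eq0: "\<forall>\<alpha>\<in>{1..N}. dx (Dm1 (G \<alpha> 0)) = (\<lambda>e h m. 0)"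
    and a_eq: "\<forall>\<alpha>\<in>{1..N}. \<forall>n. fourier (hbar_mul (dx (Dm1 (G \<alpha> (Suc n)))))
                  = qcomm etai (fourier (G \<alpha> n)) (zero_mode (fourier H))"
    and b_R: "qdp_deg_le N (-1) R"
    and b_c: "is_const c"
    and b_eq: "var_deriv 1 H = (\<lambda>e h m. half_eta_uu N \<eta> e h m + dx R e h m + c e h m)"
    and c_eq: "lf_eq N (G 1 2) H"
  shows "\<exists>(A :: nat \<Rightarrow> nat \<Rightarrow> nat \<Rightarrow> complex) (B :: nat \<Rightarrow> nat \<Rightarrow> qdp).
           (\<forall>\<alpha> \<mu>. A \<alpha> \<mu> 0 = (if \<alpha> = \<mu> then 1 else 0)) \<and>
           (\<forall>\<alpha>. B \<alpha> 0 = (\<lambda>e h m. 0)) \<and>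
           (\<forall>\<alpha> n. is_const (B \<alpha> n)) \<and>
           (let G' = (\<lambda>\<alpha> n e h m. (\<Sum>\<mu>\<in>{1..N}. \<Sum>i\<le>n. A \<alpha> \<mu> i * G \<mu> (n - i) e h m) + B \<alpha> n e h m)
            in lf_eq N (G' 1 1) (half_eta_uu N \<eta>) \<and>
               (\<forall>\<alpha>\<in>{1..N}. \<forall>\<beta>\<in>{1..N}. \<forall>p q. \<forall>P h e. P \<noteq> (\<lambda>_. 0) \<longrightarrow>
                   qcomm etai (zero_mode (fourier (G' \<alpha> p))) (zero_mode (fourier (G' \<beta> q))) P h e = 0) \<and>
               (\<forall>\<alpha>\<in>{1..N}. \<forall>\<beta>\<in>{1..N}. \<forall>n.
                   qcomm etai (fourier (G' \<alpha> n)) (zero_mode (fourier (G' \<beta> 1)))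
                     = fourier (hbar_mul (dx (diff_u \<beta> 0 (G' \<alpha> (Suc n)))))) \<and>
               (\<forall>\<alpha>\<in>{1..N}. \<forall>n. diff_u 1 0 (G' \<alpha> (Suc n)) = G' \<alpha> n))"
proof -
  interpret string_solutions N etai \<eta> H G R c
    using assms by unfold_locales (auto simp: qdp_deg_le_def)
  \<comment> \<open>Commutativity and tau symmetry were proved for every solution of the recursion
    with these initial values, hence apply to the normalized one.\<close>
  interpret G': recursion_solutions N etai \<eta> H normG by (rule recursion_normG)
  have e: "(\<lambda>\<alpha> n e h m. (\<Sum>\<mu>\<in>{1..N}. \<Sum>i\<le>n. normA \<alpha> \<mu> i * G \<mu> (n - i) e h m) + normB \<alpha> n e h m) = normG"
    unfolding normG_def ..
  show ?thesis
  proof (intro exI[of _ normA] exI[of _ normB] conjI)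
    show "\<forall>\<alpha> \<mu>. normA \<alpha> \<mu> 0 = (if \<alpha> = \<mu> then 1 else 0)" by (simp add: normA_def)
    show "\<forall>\<alpha>. normB \<alpha> 0 = (\<lambda>e h m. 0)" by (simp add: normB_def)
    show "\<forall>\<alpha> n. is_const (normB \<alpha> n)" by (simp add: is_const_normB)
    show "let G' = (\<lambda>\<alpha> n e h m. (\<Sum>\<mu>\<in>{1..N}. \<Sum>i\<le>n. normA \<alpha> \<mu> i * G \<mu> (n - i) e h m) + normB \<alpha> n e h m)
            in lf_eq N (G' 1 1) (half_eta_uu N \<eta>) \<and>
               (\<forall>\<alpha>\<in>{1..N}. \<forall>\<beta>\<in>{1..N}. \<forall>p q. \<forall>P h e. P \<noteq> (\<lambda>_. 0) \<longrightarrow>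
                   qcomm etai (zero_mode (fourier (G' \<alpha> p))) (zero_mode (fourier (G' \<beta> q))) P h e = 0) \<and>
               (\<forall>\<alpha>\<in>{1..N}. \<forall>\<beta>\<in>{1..N}. \<forall>n.
                   qcomm etai (fourier (G' \<alpha> n)) (zero_mode (fourier (G' \<beta> 1)))
                     = fourier (hbar_mul (dx (diff_u \<beta> 0 (G' \<alpha> (Suc n)))))) \<and>
               (\<forall>\<alpha>\<in>{1..N}. \<forall>n. diff_u 1 0 (G' \<alpha> (Suc n)) = G' \<alpha> n)"
      unfolding e Let_def
      using normG11_lf_eq G'.functionals_commute G'.tau_symmetry normG_string by blast
  qed
qed

end
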